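(* Let $d\ge1$, $\alpha\in(0,1)$, $m=1$ and $M>0$. Then there exists a unique function $u$ on $(0,\infty)\times\mathbb R^d$, with $u\in L^\infty((0,T);L^1(\mathbb R^d))$ for every $T>0$, such that for every $T>0$ and every $\varphi\in C_c^\infty([0,T]\times\mathbb R^d)$ $$\int_0^T\!\!\int_{\mathbb R^d}u(t,x)\,({}^{RL}\partial_t^\alpha\varphi)(T-t,x)\,dx\,dt=\int_0^T\!\!\int_{\mathbb R^d}u(t,x)\,\Delta\varphi(T-t,x)\,dx\,dt+M\,(I_{1-\alpha}\varphi)(T,0).$$ (Uniqueness is up to equality almost everywhere.) Hence there is at most one nonnegative solution $U$ of $$U(z)=\int_z^\infty K(z,\rho)U(\rho)\,d\rho\quad(z>0)\qquad\text{such that}\qquad|\partial B_1|\int_0^\infty U(\rho)\rho^{d-1}\,d\rho=M.$$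
   Context: Notation: $|\partial B_1|$ is the surface measure of the unit sphere of $\mathbb R^d$ (equal to $2$ if $d=1$). In the case $m=1$ one has $b=\alpha/2$, and for $0<z\le\rho$ $$K(z,\rho)=\rho\,Q(z/\rho),\qquad Q(\eta)=\frac1{\Gamma(1-\alpha)}\int_\eta^1(1-\sigma^{1/b})^{-\alpha}\sigma^{1-d}\,d\sigma.$$ Time-fractional operators (acting on the time variable): $I_{1-\alpha}f(t)=\frac1{\Gamma(1-\alpha)}\int_0^t(t-s)^{-\alpha}f(s)\,ds$ and ${}^{RL}\partial_t^\alpha f=\frac{d}{dt}I_{1-\alpha}f$ (Riemann–Liouville derivative). The notation $({}^{RL}\partial_t^\alpha\varphi)(T-t,x)$ means the derivative is computed first and then evaluated at time $T-t$. *)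

theory Defs
  imports "HOL-Analysis.Analysis"
begin

section \<open>Riemann--Liouville operators\<close>

definition frac_integral :: "real \<Rightarrow> (real \<Rightarrow> real) \<Rightarrow> real \<Rightarrow> real" where
  "frac_integral \<beta> f t = 1 / Gamma \<beta> * (LINT s:{0<..<t}|lebesgue. (t - s) powr (\<beta> - 1) * f s)"

definition RL_deriv :: "real \<Rightarrow> (real \<Rightarrow> real) \<Rightarrow> real \<Rightarrow> real" where
  "RL_deriv \<alpha> f = deriv (frac_integral (1 - \<alpha>) f)"


section \<open>Test functions\<close>

text \<open>
  \<open>C\<^sup>k\<close> on a set that need not be open: derivatives are taken within \<open>S\<close>, so they are
  one-sided at boundary points. This is meant for sets on which derivatives within the set are
  unique, such as convex sets with nonempty interior.
\<close>

primrec Ck_on :: "nat \<Rightarrow> 'a::real_normed_vector set \<Rightarrow> ('a \<Rightarrow> real) \<Rightarrow> bool" where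
  "Ck_on 0 S f \<longleftrightarrow> continuous_on S f"
| "Ck_on (Suc k) S f \<longleftrightarrow>
     (\<forall>x\<in>S. f differentiable (at x within S)) \<and>
     (\<forall>v. Ck_on k S (\<lambda>x. frechet_derivative f (at x within S) v))"

text \<open>
  The space \<open>C\<^sub>c\<^sup>\<infinity>([0,T] \<times> \<real>\<^sup>d)\<close>. The support is compact in the closed slab, so nothing is
  required to vanish at the times \<open>0\<close> and \<open>T\<close>. Values at times outside \<open>[0,T]\<close> are irrelevant.
\<close>

definition test_function :: "real \<Rightarrow> (real \<Rightarrow> 'a::euclidean_space \<Rightarrow> real) \<Rightarrow> bool" where
  "test_function T \<phi> \<longleftrightarrow>
     (\<forall>k. Ck_on k ({0..T} \<times> UNIV) (\<lambda>(t, x). \<phi> t x)) \<and>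
     compact (closure {(t, x) \<in> {0..T} \<times> UNIV. \<phi> t x \<noteq> 0})"

definition laplacian :: "('a::euclidean_space \<Rightarrow> real) \<Rightarrow> 'a \<Rightarrow> real" where
  "laplacian f x = (\<Sum>e\<in>Basis. (deriv ^^ 2) (\<lambda>s. f (x + s *\<^sub>R e)) 0)"


section \<open>Weak solutions\<close>

text \<open>
  Membership in \<open>L\<^sup>\<infinity>((0,T); L\<^sup>1)\<close> for a representative: Bochner measurability of
  \<open>t \<mapsto> u(t,\<cdot>)\<close> is expressed as joint Lebesgue measurability.
\<close>

definition Linf_L1 :: "real \<Rightarrow> (real \<Rightarrow> 'a::euclidean_space \<Rightarrow> real) \<Rightarrow> bool" where
  "Linf_L1 T u \<longleftrightarrow>
     (\<lambda>(t, x). u t x) \<in> borel_measurable (lebesgue_on ({0<..<T} \<times> UNIV)) \<and>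
     (\<exists>C. AE t in lebesgue. 0 < t \<and> t < T \<longrightarrow>
        integrable lebesgue (u t) \<and> (LINT x|lebesgue. \<bar>u t x\<bar>) \<le> C)"

definition weak_solution :: "real \<Rightarrow> real \<Rightarrow> (real \<Rightarrow> 'a::euclidean_space \<Rightarrow> real) \<Rightarrow> bool" where
  "weak_solution \<alpha> M u \<longleftrightarrow>
     (\<forall>T>0. Linf_L1 T u) \<and>
     (\<forall>T>0. \<forall>\<phi>. test_function T \<phi> \<longrightarrow>
        (LINT t:{0<..<T}|lebesgue. LINT x|lebesgue. u t x * RL_deriv \<alpha> (\<lambda>s. \<phi> s x) (T - t)) =
        (LINT t:{0<..<T}|lebesgue. LINT x|lebesgue. u t x * laplacian (\<phi> (T - t)) x) +
        M * frac_integral (1 - \<alpha>) (\<lambda>s. \<phi> s 0) T)"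


section \<open>The profile equation\<close>

text \<open>
  Surface measure on the unit sphere, defined through cones as in polar integration:
  \<open>\<sigma>(E) = d \<cdot> |{r x | 0 < r \<le> 1, x \<in> E}|\<close>. For \<open>d = 1\<close> it is the counting measure on \<open>{-1,1}\<close>.
\<close>

definition sphere_measure :: "'a::euclidean_space set \<Rightarrow> real" where
  "sphere_measure E =
     real DIM('a) * measure lebesgue {r *\<^sub>R x | r x. 0 < r \<and> r \<le> 1 \<and> x \<in> E}"

definition Q :: "nat \<Rightarrow> real \<Rightarrow> real \<Rightarrow> real" where
  "Q d \<alpha> \<eta> = (let b = \<alpha> / 2 in
     1 / Gamma (1 - \<alpha>) *
       (LINT \<sigma>:{\<eta><..<1}|lebesgue. (1 - \<sigma> powr (1 / b)) powr (- \<alpha>) * \<sigma> powr (1 - real d)))"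

definition K :: "nat \<Rightarrow> real \<Rightarrow> real \<Rightarrow> real \<Rightarrow> real" where
  "K d \<alpha> z \<rho> = \<rho> * Q d \<alpha> (z / \<rho>)"

text \<open>
  The integrability conditions say that the integrals are finite; they are needed because the
  Bochner integral of a non-integrable function is \<open>0\<close> by convention.
\<close>

definition profile_solution :: "nat \<Rightarrow> real \<Rightarrow> (real \<Rightarrow> real) \<Rightarrow> bool" where
  "profile_solution d \<alpha> U \<longleftrightarrow>
     (\<forall>z>0. set_integrable lebesgue {z<..} (\<lambda>\<rho>. K d \<alpha> z \<rho> * U \<rho>) \<and>
            U z = (LINT \<rho>:{z<..}|lebesgue. K d \<alpha> z \<rho> * U \<rho>))"

definition has_mass :: "'a::euclidean_space itself \<Rightarrow> real \<Rightarrow> (real \<Rightarrow> real) \<Rightarrow> bool" where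
  "has_mass _ M U \<longleftrightarrow>
     set_integrable lebesgue {0<..} (\<lambda>\<rho>. U \<rho> * \<rho> ^ (DIM('a) - 1)) \<and>
     sphere_measure (sphere (0::'a) 1) * (LINT \<rho>:{0<..}|lebesgue. U \<rho> * \<rho> ^ (DIM('a) - 1)) = M"

end

theory Submission
  imports Defs "HOL-Probability.Probability"
begin

text \<open>
  Uniqueness. Testing the difference of two solutions with time-independent cut-offs of products
  of cosines and letting the cut-off grow shows that each spatial cosine transform \<open>g\<close> of the
  difference satisfies the Volterra equation \<open>k * g + \<kappa> (1 * g) = 0\<close> with
  \<open>k(t) = t\<^sup>-\<^sup>\<alpha> / \<Gamma>(1 - \<alpha>)\<close>. As \<open>k\<close> has the convolution inverse
  \<open>t\<^sup>\<alpha>\<^sup>-\<^sup>1 / \<Gamma>(\<alpha>)\<close>, \<open>g\<close> vanishes almost everywhere.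

  Existence. If \<open>p\<^sub>r\<close> is the heat kernel and \<open>\<mu>\<close> the Mittag-Leffler distribution, i.e. the law on
  \<open>[0,\<infinity>)\<close> with moments \<open>k! / \<Gamma>(1 + \<alpha> k)\<close>, then \<open>u(t) = M \<integral> p\<^bsub>t\<^sup>\<alpha> s\<^esub> \<mu>(ds)\<close> is a
  solution. For test functions that do not depend on time this follows from
  \<open>\<integral> p\<^sub>r \<psi> = \<psi>(0) + \<integral>\<^sub>0\<^sup>r \<integral> p\<^sub>q \<Delta>\<psi> dq\<close> and from comparing the laws of \<open>t\<^sup>\<alpha> s\<close> under
  \<open>k(S - t) dt \<mu>(ds)\<close> and \<open>dt \<mu>(ds)\<close> on \<open>t < S\<close>. The general case follows by writing
  \<open>\<phi>(s) = \<phi>(0) + \<integral>\<^sub>0\<^sup>s \<partial>\<^sub>t\<phi>(r) dr\<close> and Fubini's theorem.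

  Profiles. The profile equation is a recursion between the moments of \<open>U\<close> of orders \<open>d + 2j\<close> and
  \<open>d + 2j + 2\<close> (with the weight \<open>d\<rho>/\<rho>\<close>), whose start is the mass. The moments therefore determine
  the symmetric measure \<open>U(\<bar>x\<bar>) \<bar>x\<bar>\<^sup>d\<^sup>-\<^sup>1 dx\<close>, and hence \<open>U\<close>.
\<close>

section \<open>Measures determined by their moments\<close>

text \<open>The two claims are proved independently: uniqueness of profiles is not deduced from that
  of weak solutions, which would first require turning every profile into a weak solution. In cosine
  variables a solution has to be M E_\<alpha>(-\<kappa> t^\<alpha>), where \<kappa> is the squared
  frequency and E_\<alpha>(z) is the sum of z^k / \<Gamma>(1 + \<alpha> k). The heat flow at time r
  turns \<kappa> into exp(-\<kappa> r), so \<mu> must have the Laplace transform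
  E_\<alpha>(-\<kappa>), and this dictates its moments k! / \<Gamma>(1 + \<alpha> k). Neither the
  transform nor a density of \<mu> is computed: the laws to be compared have moments that grow
  slowly enough to determine them. Fourier analysis enters only through characteristic functions on
  the real line. Several space dimensions are handled one coordinate at a time, for which products
  of cosines with arbitrary phases suffice. The datum is a point mass, so u is used only through its
  integrals against test functions. It enters the equation through the value of the test function at
  time 0, because the Riemann-Liouville derivative of a constant is a multiple of k.\<close>

lemma normalized_real_distribution:
  fixes M :: "real measure"
  assumes "finite_borel_measure M" and pos: "measure M UNIV > 0"
  defines "N \<equiv> density M (\<lambda>_. ennreal (1 / measure M UNIV))"
  shows "real_distribution N"
    and "char N t = char M t / measure M UNIV"
    and "\<And>f::real \<Rightarrow> real. f \<in> borel_measurable borel \<Longrightarrow> integrable N f \<longleftrightarrow> integrable M f"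
    and "\<And>f::real \<Rightarrow> real. f \<in> borel_measurable borel \<Longrightarrow>
           integral\<^sup>L N f = integral\<^sup>L M f / measure M UNIV"
    and "M = density N (\<lambda>_. ennreal (measure M UNIV))"
proof -
  interpret M: finite_borel_measure M by fact
  have [measurable_cong, simp]: "sets M = sets borel" by (rule M.M_is_borel)
  have sp [simp]: "space M = UNIV" using sets_eq_imp_space_eq[OF M.M_is_borel] by simp
  have "emeasure N UNIV = 1"
    using pos by (simp add: N_def emeasure_density M.emeasure_eq_measure flip: ennreal_mult')
  then show "real_distribution N"
    by (auto simp: real_distribution_def real_distribution_axioms_def N_def intro!: prob_spaceI)
  show "char N t = char M t / measure M UNIV"
    using pos unfolding char_def N_def
    by (subst integral_density) (auto simp: scaleR_conv_of_real)
  show "integrable N f \<longleftrightarrow> integrable M f" if "f \<in> borel_measurable borel" for f :: "real \<Rightarrow> real"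
    using that pos integrable_mult_left_iff[of M "1 / measure M UNIV" f] unfolding N_def
    by (subst integrable_density) auto
  show "integral\<^sup>L N f = integral\<^sup>L M f / measure M UNIV" if "f \<in> borel_measurable borel" for f :: "real \<Rightarrow> real"
    using that pos unfolding N_def by (subst integral_density) auto
  show "M = density N (\<lambda>_. ennreal (measure M UNIV))"
    using pos unfolding N_def by (subst density_density_eq) (auto simp: density_1 simp flip: ennreal_mult')
qed

text \<open>At 0 the characteristic function is the total mass. Both measures are therefore
  normalised by the same constant, and Levy's theorem applies to the resulting probability
  laws.\<close>

lemma finite_borel_measure_eqI_char:
  fixes M N :: "real measure"
  assumes fin: "finite_borel_measure M" "finite_borel_measure N"
    and eq: "\<And>t. char M t = char N t"
  shows "M = N"
proof -
  interpret M: finite_borel_measure M by fact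
  interpret N: finite_borel_measure N by fact
  have [simp]: "space M = UNIV" "space N = UNIV"
    using sets_eq_imp_space_eq[OF M.M_is_borel] sets_eq_imp_space_eq[OF N.M_is_borel] by simp_all
  have mass: "measure M UNIV = measure N UNIV"
    using eq[of 0] by (simp add: char_def)
  show ?thesis
  proof (cases "measure M UNIV = 0")
    case True
    have "emeasure M A = 0" "emeasure N A = 0" for A
      using True mass emeasure_space[of M A] emeasure_space[of N A]
        measure_nonneg[of M A] measure_nonneg[of N A]
      by (simp_all add: M.emeasure_eq_measure N.emeasure_eq_measure)
    then show ?thesis
      by (intro measure_eqI) (simp_all add: M.M_is_borel N.M_is_borel)
  next
    case False
    then have pos: "measure M UNIV > 0" "measure N UNIV > 0"
      using mass measure_nonneg[of M UNIV] by linarith+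
    note M' = normalized_real_distribution[OF fin(1) pos(1)]
    note N' = normalized_real_distribution[OF fin(2) pos(2)]
    have "density M (\<lambda>_. ennreal (1 / measure M UNIV)) = density N (\<lambda>_. ennreal (1 / measure N UNIV))"
      by (rule Levy_uniqueness[OF M'(1) N'(1)]) (simp add: fun_eq_iff M'(2)[unfolded mass] N'(2) eq mass)
    then show ?thesis
      using M'(5) N'(5) mass by metis
  qed
qed

text \<open>The Taylor remainder is at most twice the absolute value of the last term, computed with
  an absolute moment. At even orders absolute moments are ordinary ones, so the partial sums are
  only taken up to degree 2n.\<close>

lemma (in real_distribution) char_moments_LIMSEQ:
  assumes int: "\<And>k. integrable M (\<lambda>x. x ^ k)"
    and lim: "(\<lambda>n. t ^ (2 * n) / fact (2 * n) * expectation (\<lambda>x. x ^ (2 * n))) \<longlonglongrightarrow> 0"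
  shows "(\<lambda>n. \<Sum>k\<le>2 * n. (\<i> * t) ^ k / fact k * expectation (\<lambda>x. x ^ k)) \<longlonglongrightarrow> char M t"
proof -
  let ?S = "\<lambda>n. \<Sum>k\<le>2 * n. (\<i> * t) ^ k / fact k * expectation (\<lambda>x. x ^ k)"
  let ?b = "\<lambda>n. t ^ (2 * n) / fact (2 * n) * expectation (\<lambda>x. x ^ (2 * n))"
  have "cmod (?S n - char M t) \<le> 2 * ?b n" for n
  proof -
    have "cmod (char M t - ?S n) \<le>
        2 * \<bar>t\<bar> ^ (2 * n) / fact (2 * n) * expectation (\<lambda>x. \<bar>x\<bar> ^ (2 * n))"
      by (rule char_approx1) (rule int)
    also have "\<dots> = 2 * ?b n"
      by (simp add: power_even_abs)
    finally show ?thesis by (simp add: norm_minus_commute)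
  qed
  moreover have "(\<lambda>n. 2 * ?b n) \<longlonglongrightarrow> 0"
    using tendsto_mult_right_zero[OF lim, of 2] by simp
  ultimately have "(\<lambda>n. ?S n - char M t) \<longlonglongrightarrow> 0"
    by (intro tendsto_norm_zero_cancel[of "\<lambda>n. ?S n - char M t"])
      (rule tendsto_sandwich[of "\<lambda>_. 0" _ _ "\<lambda>n. 2 * ?b n"], auto)
  then show ?thesis by (rule LIM_zero_cancel)
qed

text \<open>The growth condition, required for every t, makes the Taylor series at 0 represent the
  characteristic function on the whole line, so that the moments determine it. It is imposed on one
  measure only because the other has the same moments.\<close>

lemma finite_borel_measure_eqI_moments:
  fixes M N :: "real measure"
  assumes fin: "finite_borel_measure M" "finite_borel_measure N"
    and int: "\<And>k. integrable M (\<lambda>x. x ^ k)" "\<And>k. integrable N (\<lambda>x. x ^ k)"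
    and eq: "\<And>k. (\<integral>x. x ^ k \<partial>M) = (\<integral>x. x ^ k \<partial>N)"
    and lim: "\<And>t. (\<lambda>n. t ^ (2 * n) / fact (2 * n) * (\<integral>x. x ^ (2 * n) \<partial>M)) \<longlonglongrightarrow> 0"
  shows "M = N"
proof (rule finite_borel_measure_eqI_char[OF fin])
  fix t
  interpret M: finite_borel_measure M by fact
  interpret N: finite_borel_measure N by fact
  have [simp]: "space M = UNIV" "space N = UNIV"
    using sets_eq_imp_space_eq[OF M.M_is_borel] sets_eq_imp_space_eq[OF N.M_is_borel] by simp_all
  have mass: "measure M UNIV = measure N UNIV"
    using eq[of 0] by simp
  show "char M t = char N t"
  proof (cases "measure M UNIV = 0")
    case True
    have AE: "AE x in L. P x" if "finite_measure L" "space L = UNIV" "measure L UNIV = 0"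
      for L :: "real measure" and P
    proof -
      interpret L: finite_measure L by fact
      have "UNIV \<in> null_sets L"
        using that sets.top[of L] by (auto simp: null_sets_def L.emeasure_eq_measure)
      then show ?thesis by (intro AE_I'[of UNIV]) auto
    qed
    have "char M t = 0" "char N t = 0"
      unfolding char_def
      by (intro integral_eq_zero_AE AE; use True mass M.finite_measure_axioms N.finite_measure_axioms in simp)+
    then show ?thesis by simp
  next
    case False
    then have pos: "measure M UNIV > 0" "measure N UNIV > 0"
      using mass measure_nonneg[of M UNIV] by linarith+
    note M' = normalized_real_distribution[OF fin(1) pos(1)]
    note N' = normalized_real_distribution[OF fin(2) pos(2)]
    let ?M = "density M (\<lambda>_. ennreal (1 / measure M UNIV))"
    let ?N = "density N (\<lambda>_. ennreal (1 / measure N UNIV))"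
    have E: "(\<integral>x. x ^ k \<partial>?M) = (\<integral>x. x ^ k \<partial>M) / measure M UNIV"
      "(\<integral>x. x ^ k \<partial>?N) = (\<integral>x. x ^ k \<partial>?M)" for k
      by (simp_all add: M'(4)[unfolded mass] N'(4) eq mass)
    have I: "integrable ?M (\<lambda>x. x ^ k)" "integrable ?N (\<lambda>x. x ^ k)" for k
      using int by (simp_all add: M'(3) N'(3))
    have L: "(\<lambda>n. t ^ (2 * n) / fact (2 * n) * (\<integral>x. x ^ (2 * n) \<partial>?M)) \<longlonglongrightarrow> 0"
      using tendsto_divide[OF lim[of t] tendsto_const[of "measure M UNIV"]] False
      by (simp add: E(1))
    have "char ?M t = char ?N t"
      using real_distribution.char_moments_LIMSEQ[OF M'(1) I(1) L]
        real_distribution.char_moments_LIMSEQ[OF N'(1) I(2), of t] L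
      by (simp add: E(2) LIMSEQ_unique)
    then show ?thesis
      using False by (simp add: M'(2)[unfolded mass] N'(2) mass)
  qed
qed

section \<open>The Mittag-Leffler distribution\<close>

text \<open>The Frechet-Shohat argument on the half line. Bounded means give tightness by Markov's
  inequality, hence a weakly convergent subsequence. Since x^k is not bounded, it is truncated at
  height R; the error is at most the moment of order k + 1 divided by R, uniformly along the
  sequence, and R is sent to infinity by monotone convergence.\<close>

lemma weak_limit_with_moments:
  fixes M :: "nat \<Rightarrow> real measure" and m :: "nat \<Rightarrow> real"
  assumes rd: "\<And>n. real_distribution (M n)"
    and nonneg: "\<And>n. AE x in M n. 0 \<le> x"
    and int: "\<And>n k. integrable (M n) (\<lambda>x. x ^ k)"
    and lim: "\<And>k. (\<lambda>n. \<integral>x. x ^ k \<partial>M n) \<longlonglongrightarrow> m k"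
  obtains \<mu> where "real_distribution \<mu>" "AE x in \<mu>. 0 \<le> x"
    "\<And>k. integrable \<mu> (\<lambda>x. x ^ k)" "\<And>k. (\<integral>x. x ^ k \<partial>\<mu>) = m k"
proof -
  interpret M: real_distribution "M n" for n by (rule rd)
  have int1: "integrable (M n) (\<lambda>x. x)" for n
    using int[of n 1] by simp
  obtain C where C: "\<And>n. (\<integral>x. x \<partial>M n) \<le> C" "C > 0"
  proof -
    have "Bseq (\<lambda>n. \<integral>x. x \<partial>M n)"
      using lim[of 1] by (intro convergent_imp_Bseq) (auto simp: convergent_def)
    then obtain C where "C > 0" "\<And>n. norm (\<integral>x. x \<partial>M n) \<le> C"
      by (auto elim: BseqE)
    then show ?thesis by (intro that[of C]) (auto simp: abs_le_iff)
  qed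
  have "tight M"
    unfolding tight_def
  proof (intro conjI allI impI rd)
    fix \<epsilon> :: real assume "\<epsilon> > 0"
    \<comment> \<open>Markov's inequality bounds the tail beyond b by C / b, which is \<epsilon> / 2
      for this b.\<close>
    define b where "b = 2 * C / \<epsilon>"
    have b: "b > 0" using C(2) \<open>\<epsilon> > 0\<close> by (simp add: b_def)
    have "measure (M n) {-1<..b} > 1 - \<epsilon>" for n
    proof -
      have "1 - measure (M n) {-1<..b} = measure (M n) (space (M n) - {-1<..b})"
        by (subst M.prob_compl) auto
      also have "\<dots> \<le> measure (M n) {x \<in> space (M n). b \<le> x}"
      proof (rule M.finite_measure_mono_AE)
        show "AE x in M n. x \<in> space (M n) - {-1<..b} \<longrightarrow> x \<in> {x \<in> space (M n). b \<le> x}"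
          using nonneg[of n] by eventually_elim auto
      qed auto
      also have "\<dots> \<le> (\<integral>x. x \<partial>M n) / b"
        by (rule integral_Markov_inequality_measure[where A="{}"])
          (use nonneg[of n] b int1 in auto)
      also have "\<dots> \<le> C / b"
        using C(1)[of n] b by (simp add: divide_right_mono)
      also have "\<dots> < \<epsilon>"
        using C(2) \<open>\<epsilon> > 0\<close> by (simp add: b_def)
      finally show ?thesis by simp
    qed
    then show "\<exists>a b. a < b \<and> (\<forall>n. measure (M n) {a<..b} > 1 - \<epsilon>)"
      using b by (intro exI[of _ "-1"] exI[of _ b]) auto
  qed
  from tight_imp_convergent_subsubsequence[OF this strict_mono_id]
  obtain r \<mu> where r: "strict_mono r" and \<mu>: "real_distribution \<mu>" and wc: "weak_conv_m (M \<circ> r) \<mu>"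
    by auto
  interpret \<mu>: real_distribution \<mu> by (rule \<mu>)
  have wc_int: "(\<lambda>n. integral\<^sup>L (M (r n)) f) \<longlonglongrightarrow> integral\<^sup>L \<mu> f"
    if "\<And>x. isCont f x" "\<And>x. norm (f x) \<le> B" for f :: "real \<Rightarrow> real" and B
    using weak_conv_imp_integral_bdd_continuous_conv[of "M \<circ> r" \<mu> f B] rd \<mu> wc that by simp
  have nonneg\<mu>: "AE x in \<mu>. 0 \<le> x"
  proof -
    \<comment> \<open>A bounded continuous function that is positive exactly on the negative axis,
      so weak convergence can see the mass there.\<close>
    let ?f = "\<lambda>x::real. min 1 (max 0 (- x))"
    have "(\<integral>x. ?f x \<partial>M n) = 0" for n
      by (rule integral_eq_zero_AE) (use nonneg[of n] in eventually_elim, auto)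
    moreover have "(\<lambda>n. integral\<^sup>L (M (r n)) ?f) \<longlonglongrightarrow> integral\<^sup>L \<mu> ?f"
      by (rule wc_int[of _ 1]) (auto intro!: continuous_intros)
    ultimately have "integral\<^sup>L \<mu> ?f = 0"
      by (simp add: LIMSEQ_const_iff)
    then have "AE x in \<mu>. ?f x = 0"
      by (subst (asm) integral_nonneg_eq_0_iff_AE)
        (auto intro!: \<mu>.integrable_const_bound[of _ 1])
    then show ?thesis
      by eventually_elim (auto simp: min_def max_def split: if_splits)
  qed
  \<comment> \<open>The truncation from below makes the function bounded and continuous on the whole
    line; almost everywhere it changes nothing, as the laws live on the half line.\<close>
  define f where "f = (\<lambda>R k x. (min R (max 0 x)) ^ k :: real)"
  have f_cont: "isCont (f R k) x" for R k x
    unfolding f_def by (intro continuous_intros)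
  have f_meas [measurable]: "f R k \<in> borel_measurable borel" for R k
    unfolding f_def by measurable
  have f_bd: "norm (f R k x) \<le> R ^ k" if "R > 0" for R k x
    using that unfolding f_def norm_power by (intro power_mono) auto
  have close: "\<bar>(\<integral>x. f R k x \<partial>M n) - (\<integral>x. x ^ k \<partial>M n)\<bar> \<le> (\<integral>x. x ^ Suc k \<partial>M n) / R"
    if R: "R > 0" for R k n
  proof -
    have fi: "integrable (M n) (f R k)"
      using f_bd[OF R] by (intro M.integrable_const_bound[of _ "R ^ k"]) auto
    have "\<bar>(\<integral>x. f R k x \<partial>M n) - (\<integral>x. x ^ k \<partial>M n)\<bar> = \<bar>\<integral>x. f R k x - x ^ k \<partial>M n\<bar>"
      using fi int by simp
    also have "\<dots> \<le> (\<integral>x. \<bar>f R k x - x ^ k\<bar> \<partial>M n)"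
      by (rule integral_abs_bound)
    also have "\<dots> \<le> (\<integral>x. x ^ Suc k / R \<partial>M n)"
    proof (rule integral_mono_AE)
      show "integrable (M n) (\<lambda>x. \<bar>f R k x - x ^ k\<bar>)"
        using fi int by auto
      show "integrable (M n) (\<lambda>x. x ^ Suc k / R)"
        using int[of n "Suc k"] by (rule integrable_divide_zero)
      show "AE x in M n. \<bar>f R k x - x ^ k\<bar> \<le> x ^ Suc k / R"
        using nonneg[of n]
      proof eventually_elim
        fix x :: real assume x: "0 \<le> x"
        show "\<bar>f R k x - x ^ k\<bar> \<le> x ^ Suc k / R"
        proof (cases "x \<le> R")
          case True
          then show ?thesis using x R by (simp add: f_def)
        next
          case False
          have "\<bar>f R k x - x ^ k\<bar> = x ^ k - R ^ k"
            using False x R power_mono[of R x k] by (simp add: f_def)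
          also have "\<dots> \<le> x ^ k * 1" using R by simp
          also have "\<dots> \<le> x ^ k * (x / R)"
            using False R x by (intro mult_left_mono) auto
          finally show ?thesis by (simp add: mult.commute)
        qed
      qed
    qed
    also have "\<dots> = (\<integral>x. x ^ Suc k \<partial>M n) / R" by (rule integral_divide_zero)
    finally show ?thesis .
  qed
  have lim_r: "(\<lambda>n. \<integral>x. x ^ k \<partial>M (r n)) \<longlonglongrightarrow> m k" for k
    using LIMSEQ_subseq_LIMSEQ[OF lim r] by (simp add: o_def)
  have close\<mu>: "\<bar>(\<integral>x. f R k x \<partial>\<mu>) - m k\<bar> \<le> m (Suc k) / R" if R: "R > 0" for R k
  proof (rule LIMSEQ_le)
    show "(\<lambda>n. \<bar>(\<integral>x. f R k x \<partial>M (r n)) - (\<integral>x. x ^ k \<partial>M (r n))\<bar>) \<longlonglongrightarrow> \<bar>(\<integral>x. f R k x \<partial>\<mu>) - m k\<bar>"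
      by (intro tendsto_intros wc_int[of _ "R ^ k"] lim_r f_cont f_bd R)
    show "(\<lambda>n. (\<integral>x. x ^ Suc k \<partial>M (r n)) / R) \<longlonglongrightarrow> m (Suc k) / R"
      using R by (intro tendsto_intros lim_r) auto
    show "\<exists>N. \<forall>n\<ge>N. \<bar>(\<integral>x. f R k x \<partial>M (r n)) - (\<integral>x. x ^ k \<partial>M (r n))\<bar>
        \<le> (\<integral>x. x ^ Suc k \<partial>M (r n)) / R"
      using close[OF R] by blast
  qed
  have mom: "integrable \<mu> (\<lambda>x. x ^ k) \<and> (\<integral>x. x ^ k \<partial>\<mu>) = m k" for k
  proof -
    have lim_f: "(\<lambda>n. \<integral>x. f (real (Suc n)) k x \<partial>\<mu>) \<longlonglongrightarrow> m k"
    proof (rule LIM_zero_cancel, rule tendsto_rabs_zero_cancel)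
      show "(\<lambda>n. \<bar>(\<integral>x. f (real (Suc n)) k x \<partial>\<mu>) - m k\<bar>) \<longlonglongrightarrow> 0"
      proof (rule tendsto_sandwich[of "\<lambda>_. 0"])
        show "(\<lambda>n. m (Suc k) / real (Suc n)) \<longlonglongrightarrow> 0"
          using tendsto_mult_right_zero[OF LIMSEQ_inverse_real_of_nat, of "m (Suc k)"]
          by (simp add: field_simps)
        show "\<forall>\<^sub>F n in sequentially. \<bar>(\<integral>x. f (real (Suc n)) k x \<partial>\<mu>) - m k\<bar> \<le> m (Suc k) / real (Suc n)"
          using close\<mu> by (intro always_eventually allI) simp
      qed auto
    qed
    have conv: "AE x in \<mu>. (\<lambda>n. f (real (Suc n)) k x) \<longlonglongrightarrow> x ^ k"
      using nonneg\<mu>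
    proof eventually_elim
      fix x :: real assume x: "0 \<le> x"
      have "\<forall>\<^sub>F n in sequentially. f (real (Suc n)) k x = x ^ k"
        using eventually_ge_at_top[of "nat \<lceil>x\<rceil>"]
      proof eventually_elim
        case (elim n)
        then have "x \<le> real (Suc n)" by linarith
        then show ?case using x by (simp add: f_def)
      qed
      then show "(\<lambda>n. f (real (Suc n)) k x) \<longlonglongrightarrow> x ^ k"
        by (rule tendsto_eventually)
    qed
    have mono: "AE x in \<mu>. mono (\<lambda>n. f (real (Suc n)) k x)"
      by (intro AE_I2 monoI) (auto simp: f_def intro!: power_mono)
    have fi: "integrable \<mu> (f (real (Suc n)) k)" for n
      using f_bd[of "real (Suc n)" k]
      by (intro \<mu>.integrable_const_bound[of _ "real (Suc n) ^ k"]) auto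
    show ?thesis
      using integrable_monotone_convergence[OF fi mono conv lim_f]
        integral_monotone_convergence[OF fi mono conv lim_f] by simp
  qed
  show thesis
    by (rule that[OF \<mu> nonneg\<mu>]) (use mom in auto)
qed

text \<open>\<open>h\<close> realises the factor of index j on the unit interval with Lebesgue
  measure: the piece of length \<alpha> carries the atom at 1, and the rest, rescaled to (0,1),
  carries the power 1 / j of a uniform variable. The moment is \<alpha> + (1 - \<alpha>) j / (j +
  k).\<close>

lemma Mittag_Leffler_factor_moment:
  fixes \<alpha> :: real and j k :: nat
  assumes \<alpha>: "0 < \<alpha>" "\<alpha> < 1" and j: "j > 0"
  defines "h \<equiv> \<lambda>\<omega>. if \<omega> \<le> \<alpha> then 1 else ((\<omega> - \<alpha>) / (1 - \<alpha>)) powr (1 / j)"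
  shows "integrable lborel (\<lambda>\<omega>. indicator {0<..<1} \<omega> * h \<omega> ^ k)"
    and "(\<integral>\<omega>. indicator {0<..<1} \<omega> * h \<omega> ^ k \<partial>lborel) = (real j + \<alpha> * real k) / (real j + real k)"
proof -
  define p where "p = k / j"
  have p: "p \<ge> 0" by (simp add: p_def)
  define F where "F = (\<lambda>\<omega>. (1 - \<alpha>) / (1 + p) * ((\<omega> - \<alpha>) / (1 - \<alpha>)) powr (1 + p))"
  have hk: "h \<omega> ^ k = ((\<omega> - \<alpha>) / (1 - \<alpha>)) powr p" if "\<omega> > \<alpha>" for \<omega>
    using that \<alpha> by (simp add: h_def p_def powr_powr flip: powr_realpow)
  have D: "(F has_vector_derivative h \<omega> ^ k) (at \<omega>)" if "\<omega> \<in> {\<alpha><..<1}" for \<omega>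
  proof -
    have "((\<lambda>\<omega>. ((\<omega> - \<alpha>) / (1 - \<alpha>)) powr (1 + p)) has_real_derivative
        (1 + p) * ((\<omega> - \<alpha>) / (1 - \<alpha>)) powr p / (1 - \<alpha>)) (at \<omega>)"
      using that \<alpha> by (auto intro!: derivative_eq_intros)
    from DERIV_cmult[OF this, of "(1 - \<alpha>) / (1 + p)"] show ?thesis
      using that p \<alpha> by (simp add: F_def hk has_real_derivative_iff_has_vector_derivative)
  qed
  have C: "continuous_on {\<alpha>..1} F"
    unfolding F_def using \<alpha> p by (intro continuous_intros continuous_on_powr') auto
  have "((\<lambda>\<omega>. h \<omega> ^ k) has_integral (F 1 - F \<alpha>)) {\<alpha>..1}"
    using fundamental_theorem_of_calculus_interior_strong[of "{}" \<alpha> 1 F "\<lambda>\<omega>. h \<omega> ^ k"] D C \<alpha> by auto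
  moreover have "((\<lambda>\<omega>. h \<omega> ^ k) has_integral (1 * (\<alpha> - 0))) {0..\<alpha>}"
    using \<alpha> has_integral_const_real[of "1::real" 0 \<alpha>]
    by (intro has_integral_eq[of _ "\<lambda>_. 1" "\<lambda>\<omega>. h \<omega> ^ k"]) (auto simp: h_def)
  ultimately have "((\<lambda>\<omega>. h \<omega> ^ k) has_integral (1 * (\<alpha> - 0) + (F 1 - F \<alpha>))) {0..1}"
    using \<alpha> by (intro has_integral_combine[of 0 \<alpha> 1]) auto
  also have "1 * (\<alpha> - 0) + (F 1 - F \<alpha>) = (real j + \<alpha> * real k) / (real j + real k)"
    using j \<alpha> p by (simp add: F_def p_def field_simps)
  finally have I: "((\<lambda>\<omega>. h \<omega> ^ k) has_integral ((real j + \<alpha> * real k) / (real j + real k))) {0<..<1}"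
    by (simp add: has_integral_Icc_iff_Ioo)
  have h_nn: "h \<omega> \<ge> 0" for \<omega> by (simp add: h_def)
  have [measurable]: "h \<in> borel_measurable borel" unfolding h_def by measurable
  have "has_bochner_integral lborel (\<lambda>\<omega>. indicator {0<..<1} \<omega> * h \<omega> ^ k) ((real j + \<alpha> * real k) / (real j + real k))"
    using nn_integral_has_integral_lebesgue[OF _ I] h_nn \<alpha> j
    by (intro has_bochner_integral_nn_integral) auto
  then show "integrable lborel (\<lambda>\<omega>. indicator {0<..<1} \<omega> * h \<omega> ^ k)"
    "(\<integral>\<omega>. indicator {0<..<1} \<omega> * h \<omega> ^ k \<partial>lborel) = (real j + \<alpha> * real k) / (real j + real k)"
    by (auto simp: has_bochner_integral_iff)
qed

text \<open>
  The distribution is the weak limit of the laws of \<open>n\<^sup>1\<^sup>-\<^sup>\<alpha> X\<^sub>1 \<cdots> X\<^sub>n\<close> with independent \<open>X\<^sub>j\<close>, where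
  \<open>X\<^sub>j = 1\<close> with probability \<open>\<alpha>\<close> and \<open>X\<^sub>j\<close> is distributed as \<open>U\<^sup>1\<^sup>/\<^sup>j\<close>, \<open>U\<close> uniform, otherwise: then
  \<open>E X\<^sub>j\<^sup>k = (j + \<alpha> k) / (j + k)\<close>, and Euler's product for \<open>\<Gamma>\<close> gives the limits of the moments.
\<close>

lemma Mittag_Leffler_distribution_exists:
  fixes \<alpha> :: real
  assumes \<alpha>: "0 < \<alpha>" "\<alpha> < 1"
  obtains \<mu> where "real_distribution \<mu>" "AE x in \<mu>. 0 \<le> x"
    "\<And>k. integrable \<mu> (\<lambda>x. x ^ k)" "\<And>k. (\<integral>x. x ^ k \<partial>\<mu>) = fact k / Gamma (1 + \<alpha> * k)"
proof -
  define h where "h = (\<lambda>(j::nat) \<omega>. if \<omega> \<le> \<alpha> then 1 else ((\<omega> - \<alpha>) / (1 - \<alpha>)) powr (1 / j))"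
  define U where "U = density lborel (\<lambda>\<omega>. ennreal (indicator {0<..<1::real} \<omega>))"
  \<comment> \<open>The k-th moment of the product decays like n^(-(1 - \<alpha>) k), which this
    scaling compensates.\<close>
  define c where "c = (\<lambda>n::nat. real n powr (1 - \<alpha>))"
  \<comment> \<open>There are n + 1 factors, as in the Pochhammer symbol of
    \<open>Gamma_series z n\<close>; the ratio of two such series is then exactly a moment of the
    scaled product.\<close>
  define J where "J = (\<lambda>n::nat. {1..Suc n})"
  define X where "X = (\<lambda>n \<omega>. c n * (\<Prod>j\<in>J n. h j (\<omega> j)))"
  define M where "M = (\<lambda>n. distr (Pi\<^sub>M (J n) (\<lambda>_. U)) borel (X n))"
  have [measurable_cong, simp]: "sets U = sets borel" by (simp add: U_def)
  have [measurable]: "h j \<in> borel_measurable borel" for j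
    unfolding h_def by measurable
  have [measurable]: "X n \<in> borel_measurable (Pi\<^sub>M (J n) (\<lambda>_. U))" for n
    unfolding X_def by measurable
  have "emeasure U (space U) = 1"
    by (simp add: U_def emeasure_density)
      (simp add: ennreal_indicator)
  then interpret U: prob_space U by (rule prob_spaceI)
  interpret P: product_prob_space "\<lambda>_. U" UNIV by standard
  have psP: "prob_space (Pi\<^sub>M (J n) (\<lambda>_. U))" for n
    by (rule prob_space_PiM) (rule U.prob_space_axioms)
  have hU: "integrable U (\<lambda>\<omega>. h j \<omega> ^ k)" "(\<integral>\<omega>. h j \<omega> ^ k \<partial>U) = (real j + \<alpha> * real k) / (real j + real k)"
    if "j > 0" for j k
    using Mittag_Leffler_factor_moment[OF \<alpha> that, of k] unfolding U_def h_def
    by (subst integrable_density integral_density; simp)+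
  have h_nn: "h j \<omega> \<ge> 0" for j \<omega> by (simp add: h_def)
  have mom: "integrable (M n) (\<lambda>x. x ^ k)"
    "(\<integral>x. x ^ k \<partial>M n) = c n ^ k * (\<Prod>j\<in>J n. (real j + \<alpha> * real k) / (real j + real k))" for n k
  proof -
    have *: "X n \<omega> ^ k = c n ^ k * (\<Prod>j\<in>J n. h j (\<omega> j) ^ k)" for \<omega>
      by (simp add: X_def power_mult_distrib prod_power_distrib)
    have "integrable (Pi\<^sub>M (J n) (\<lambda>_. U)) (\<lambda>\<omega>. c n ^ k * (\<Prod>j\<in>J n. h j (\<omega> j) ^ k))"
      by (intro integrable_mult_right P.product_integrable_prod hU) (auto simp: J_def)
    then show "integrable (M n) (\<lambda>x. x ^ k)"
      unfolding M_def by (subst integrable_distr_eq) (auto simp: *)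
    show "(\<integral>x. x ^ k \<partial>M n) = c n ^ k * (\<Prod>j\<in>J n. (real j + \<alpha> * real k) / (real j + real k))"
    proof -
      have "(\<integral>x. x ^ k \<partial>M n) = (\<integral>\<omega>. X n \<omega> ^ k \<partial>Pi\<^sub>M (J n) (\<lambda>_. U))"
        unfolding M_def by (subst integral_distr) auto
      also have "\<dots> = c n ^ k * (\<Prod>j\<in>J n. \<integral>\<omega>. h j \<omega> ^ k \<partial>U)"
        unfolding * by (subst integral_mult_right_zero, subst P.product_integral_prod)
          (auto simp: J_def intro!: hU(1))
      also have "(\<Prod>j\<in>J n. \<integral>\<omega>. h j \<omega> ^ k \<partial>U) = (\<Prod>j\<in>J n. (real j + \<alpha> * real k) / (real j + real k))"
      proof (rule prod.cong)
        fix j assume "j \<in> J n"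
        then have "j > 0" by (simp add: J_def)
        then show "(\<integral>\<omega>. h j \<omega> ^ k \<partial>U) = (real j + \<alpha> * real k) / (real j + real k)" by (rule hU(2))
      qed simp
      finally show ?thesis .
    qed
  qed
  have lim: "(\<lambda>n. \<integral>x. x ^ k \<partial>M n) \<longlonglongrightarrow> fact k / Gamma (1 + \<alpha> * k)" for k
  proof -
    have "(\<lambda>n. Gamma_series (1 + real k) n / Gamma_series (1 + \<alpha> * k) n) \<longlonglongrightarrow>
        Gamma (1 + real k) / Gamma (1 + \<alpha> * k)"
      using \<alpha> Gamma_real_pos[of "1 + \<alpha> * k"]
      by (intro tendsto_intros) (simp add: add_pos_nonneg less_imp_neq[symmetric])
    moreover have "\<forall>\<^sub>F n in sequentially.
        Gamma_series (1 + real k) n / Gamma_series (1 + \<alpha> * k) n = (\<integral>x. x ^ k \<partial>M n)"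
      using eventually_gt_at_top[of "0::nat"]
    proof eventually_elim
      case (elim n)
      have poch: "pochhammer (1 + x) (Suc n) = (\<Prod>j\<in>J n. j + x)" for x :: real
        unfolding pochhammer_prod J_def
        by (rule prod.reindex_bij_witness[of _ "\<lambda>j. j - 1" Suc]) auto
      have "c n ^ k = exp ((1 - \<alpha>) * k * ln n)"
        using elim by (simp add: c_def powr_def mult_ac flip: exp_of_nat_mult)
      also have "\<dots> = exp ((1 + real k) * ln n) / exp ((1 + \<alpha> * k) * ln n)"
        by (simp add: algebra_simps flip: exp_diff)
      finally have ck: "c n ^ k = exp ((1 + real k) * ln n) / exp ((1 + \<alpha> * k) * ln n)" .
      have "(\<Prod>j\<in>J n. j + \<alpha> * k) > 0"
        by (rule prod_pos) (use \<alpha> in \<open>auto intro!: add_pos_nonneg simp: J_def\<close>)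
      moreover have "(\<Prod>j\<in>J n. real j + real k) > 0"
        by (rule prod_pos) (auto simp: J_def)
      ultimately show ?case
        by (simp add: Gamma_series_def mom ck prod_dividef poch field_simps del: of_nat_Suc)
    qed
    ultimately show ?thesis
      by (simp add: Gamma_fact add.commute tendsto_cong)
  qed
  have rd: "real_distribution (M n)" for n
    unfolding real_distribution_def real_distribution_axioms_def M_def
    by (auto intro!: prob_space.prob_space_distr psP)
  have nn: "AE x in M n. 0 \<le> x" for n
    unfolding M_def by (subst AE_distr_iff)
      (auto simp: X_def c_def intro!: AE_I2 mult_nonneg_nonneg prod_nonneg h_nn)
  show thesis
    using weak_limit_with_moments[OF rd nn mom(1) lim] that by blast
qed

section \<open>Uniqueness of the profile\<close>

lemma powr_singular_bound:
  fixes \<sigma> a \<alpha> :: real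
  assumes "0 < \<sigma>" "\<sigma> < 1" "a \<ge> 1" "\<alpha> \<ge> 0"
  shows "1 \<le> (1 - \<sigma> powr a) powr (- \<alpha>)" "(1 - \<sigma> powr a) powr (- \<alpha>) \<le> (1 - \<sigma>) powr (- \<alpha>)"
proof -
  have 1: "\<sigma> powr a \<le> \<sigma>"
    using powr_mono'[of 1 a \<sigma>] assms by simp
  show "1 \<le> (1 - \<sigma> powr a) powr (- \<alpha>)"
    using powr_mono2'[of "- \<alpha>" "1 - \<sigma> powr a" 1] assms 1 by simp
  show "(1 - \<sigma> powr a) powr (- \<alpha>) \<le> (1 - \<sigma>) powr (- \<alpha>)"
    using powr_mono2'[of "- \<alpha>" "1 - \<sigma>" "1 - \<sigma> powr a"] assms 1 by simp
qed

lemma powr_singular_integrable: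
  assumes "\<alpha> < 1"
  shows "set_integrable lborel {0<..<1} (\<lambda>\<sigma>::real. (1 - \<sigma>) powr (- \<alpha>))"
proof -
  have "set_integrable lborel {0..1} (\<lambda>t::real. t powr (1 - 1) * (1 - t) powr (1 - \<alpha> - 1))"
    using assms by (intro integrable_Beta) auto
  then have "set_integrable lborel {0<..<1} (\<lambda>t::real. t powr (1 - 1) * (1 - t) powr (1 - \<alpha> - 1))"
    by (rule set_integrable_subset) auto
  then show ?thesis
    by (rule set_integrable_cong[THEN iffD1, rotated -1]) auto
qed

definition profile_weight :: "nat \<Rightarrow> real \<Rightarrow> real \<Rightarrow> real" where
  "profile_weight d \<alpha> \<sigma> =
     1 / Gamma (1 - \<alpha>) * ((1 - \<sigma> powr (2 / \<alpha>)) powr (- \<alpha>) * \<sigma> powr (1 - real d))"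

lemma profile_weight_measurable [measurable]: "profile_weight d \<alpha> \<in> borel_measurable borel"
  unfolding profile_weight_def by measurable

lemma profile_weight_nonneg:
  assumes "0 < \<alpha>" "\<alpha> < 1"
  shows "profile_weight d \<alpha> \<sigma> \<ge> 0"
  using Gamma_real_pos[of "1 - \<alpha>"] assms by (simp add: profile_weight_def)

text \<open>The integrand has a singularity of order \<alpha> < 1 at 1, and the condition \<eta> > 0
  keeps it away from the one at 0. Hence \<open>Q\<close> is a genuine integral and may be computed
  in \<open>ennreal\<close>, where integrals can be exchanged before any finiteness is
  known.\<close>

lemma Q_eq_nn_integral:
  assumes \<alpha>: "0 < \<alpha>" "\<alpha> < 1" and \<eta>: "0 < \<eta>"
  shows "ennreal (Q d \<alpha> \<eta>) =
    (\<integral>\<^sup>+\<sigma>. ennreal (profile_weight d \<alpha> \<sigma>) * indicator {\<eta><..<1} \<sigma> \<partial>lborel)"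
    and "Q d \<alpha> \<eta> \<ge> 0"
proof -
  let ?f = "\<lambda>\<sigma>::real. (1 - \<sigma> powr (2 / \<alpha>)) powr (- \<alpha>) * \<sigma> powr (1 - real d)"
  have \<alpha>2: "2 / \<alpha> \<ge> 1" using \<alpha> by simp
  \<comment> \<open>For d = 0 the power of \<sigma> is at most 1; for d > 0 it is largest at the
    left end \<eta>.\<close>
  define C where "C = max 1 (\<eta> powr (1 - real d))"
  have "set_integrable lborel {0<..<1} (\<lambda>\<sigma>::real. C * (1 - \<sigma>) powr (- \<alpha>))"
    using powr_singular_integrable[OF \<alpha>(2)] by (rule set_integrable_mult_right)
  then have int: "set_integrable lborel {\<eta><..<1} ?f"
    unfolding set_integrable_def
  proof (rule Bochner_Integration.integrable_bound)
    show "AE \<sigma> in lborel. norm (indicator {\<eta><..<1} \<sigma> *\<^sub>R ?f \<sigma>)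
        \<le> norm (indicator {0<..<1} \<sigma> *\<^sub>R (C * (1 - \<sigma>) powr - \<alpha>))"
    proof (intro AE_I2)
      fix \<sigma> :: real
      show "norm (indicator {\<eta><..<1} \<sigma> *\<^sub>R ?f \<sigma>) \<le> norm (indicator {0<..<1} \<sigma> *\<^sub>R (C * (1 - \<sigma>) powr - \<alpha>))"
      proof (cases "\<sigma> \<in> {\<eta><..<1}")
        case True
        have "\<sigma> powr (1 - real d) \<le> C"
        proof (cases "d = 0")
          case True
          then show ?thesis using \<open>\<sigma> \<in> {\<eta><..<1}\<close> \<eta> by (simp add: C_def)
        next
          case False
          then show ?thesis
            using True \<eta> powr_mono2'[of "1 - real d" \<eta> \<sigma>] by (simp add: C_def)
        qed
        then have "?f \<sigma> \<le> (1 - \<sigma>) powr - \<alpha> * C"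
          using True \<eta> \<alpha> powr_singular_bound(2)[of \<sigma> "2 / \<alpha>" \<alpha>] \<alpha>2
          by (intro mult_mono) auto
        then show ?thesis using True \<eta> by (simp add: mult.commute C_def)
      qed simp
    qed
  qed measurable
  have G: "Gamma (1 - \<alpha>) > 0" using \<alpha> by (intro Gamma_real_pos) simp
  have Qeq: "Q d \<alpha> \<eta> = (\<integral>\<sigma>. profile_weight d \<alpha> \<sigma> * indicator {\<eta><..<1} \<sigma> \<partial>lborel)"
    unfolding Q_def Let_def set_lebesgue_integral_def profile_weight_def
    by (subst integral_completion; simp add: mult_ac)
  have "set_integrable lborel {\<eta><..<1} (\<lambda>\<sigma>. 1 / Gamma (1 - \<alpha>) * ?f \<sigma>)"
    using int by (rule set_integrable_mult_right)
  then have "integrable lborel (\<lambda>\<sigma>. profile_weight d \<alpha> \<sigma> * indicator {\<eta><..<1} \<sigma>)"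
    by (simp add: set_integrable_def profile_weight_def mult_ac)
  then show "ennreal (Q d \<alpha> \<eta>) =
      (\<integral>\<^sup>+\<sigma>. ennreal (profile_weight d \<alpha> \<sigma>) * indicator {\<eta><..<1} \<sigma> \<partial>lborel)"
    unfolding Qeq
    by (subst nn_integral_eq_integral[symmetric])
      (auto simp: profile_weight_nonneg[OF \<alpha>] ennreal_mult' ennreal_indicator)
  show "Q d \<alpha> \<eta> \<ge> 0"
    unfolding Qeq by (intro integral_nonneg_AE AE_I2) (simp add: profile_weight_nonneg[OF \<alpha>])
qed

text \<open>The Mellin transform of \<open>Q\<close> at n, that is the integral of \<eta>^(n - 1)
  Q(\<eta>) over (0,1), with the integration in \<eta> already carried out. Its finiteness is left
  open here; where it matters, it is read off from the moment recursion.\<close>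

definition profile_Mellin :: "nat \<Rightarrow> real \<Rightarrow> nat \<Rightarrow> ennreal" where
  "profile_Mellin d \<alpha> n =
     (\<integral>\<^sup>+\<sigma>. ennreal (profile_weight d \<alpha> \<sigma> * \<sigma> ^ n / n) * indicator {0<..<1} \<sigma> \<partial>lborel)"

text \<open>The interval is encoded by a condition on z and a, so that the integrand is visibly
  measurable in both when the endpoint itself becomes a variable of integration.\<close>

lemma nn_integral_power_Ioo:
  assumes "a \<ge> 0"
  shows "(\<integral>\<^sup>+z. ennreal (z ^ n) * (if 0 < z \<and> z < a then 1 else 0) \<partial>lborel) = ennreal (a ^ Suc n / Suc n)"
proof -
  have "((\<lambda>z. z ^ n) has_integral (a ^ Suc n / Suc n - 0 ^ Suc n / Suc n)) {0..a}"
    using assms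
    by (intro fundamental_theorem_of_calculus)
      (auto simp flip: has_real_derivative_iff_has_vector_derivative intro!: derivative_eq_intros simp del: power_Suc)
  then have "((\<lambda>z. z ^ n) has_integral (a ^ Suc n / Suc n)) {0<..<a}"
    by (simp add: has_integral_Icc_iff_Ioo)
  from nn_integral_has_integral_lebesgue'[OF _ this]
  have "(\<integral>\<^sup>+z. ennreal (z ^ n) * indicator {0<..<a} z \<partial>lborel) = ennreal (a ^ Suc n / Suc n)"
    by simp
  also have "(\<integral>\<^sup>+z. ennreal (z ^ n) * indicator {0<..<a} z \<partial>lborel) =
      (\<integral>\<^sup>+z. ennreal (z ^ n) * (if 0 < z \<and> z < a then 1 else 0) \<partial>lborel)"
    by (intro nn_integral_cong) simp
  finally show ?thesis .
qed

lemma K_eq_nn_integral: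
  assumes \<alpha>: "0 < \<alpha>" "\<alpha> < 1" and z: "0 < z" "z < \<rho>"
  shows "ennreal (K d \<alpha> z \<rho>) = ennreal \<rho> *
    (\<integral>\<^sup>+\<sigma>. ennreal (profile_weight d \<alpha> \<sigma>) * indicator {0<..<1} \<sigma> * (if 0 < z \<and> z < \<rho> * \<sigma> then 1 else 0) \<partial>lborel)"
proof -
  have "ennreal (K d \<alpha> z \<rho>) = ennreal \<rho> * ennreal (Q d \<alpha> (z / \<rho>))"
    using z by (simp add: K_def ennreal_mult')
  also have "ennreal (Q d \<alpha> (z / \<rho>)) =
    (\<integral>\<^sup>+\<sigma>. ennreal (profile_weight d \<alpha> \<sigma>) * indicator {0<..<1} \<sigma> * (if 0 < z \<and> z < \<rho> * \<sigma> then 1 else 0) \<partial>lborel)"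
  proof (subst Q_eq_nn_integral[OF \<alpha>])
    have "indicator {z / \<rho><..<1} \<sigma> = (indicator {0<..<1} \<sigma> * (if 0 < z \<and> z < \<rho> * \<sigma> then 1 else 0) :: ennreal)" for \<sigma>
    proof -
      have "z / \<rho> < \<sigma> \<longleftrightarrow> z < \<rho> * \<sigma>" using z by (simp add: field_simps)
      moreover have "0 < \<sigma>" if "z < \<rho> * \<sigma>"
        using that z zero_less_mult_pos[of \<rho> \<sigma>] by linarith
      ultimately show ?thesis using z by (auto simp: indicator_def)
    qed
    then show "(\<integral>\<^sup>+\<sigma>. ennreal (profile_weight d \<alpha> \<sigma>) * indicator {z / \<rho><..<1} \<sigma> \<partial>lborel) =
      (\<integral>\<^sup>+\<sigma>. ennreal (profile_weight d \<alpha> \<sigma>) * indicator {0<..<1} \<sigma> * (if 0 < z \<and> z < \<rho> * \<sigma> then 1 else 0) \<partial>lborel)"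
      by (simp add: mult.assoc)
  qed (use z in simp)
  finally show ?thesis .
qed

text \<open>The profile equation is multiplied by z^(n - 1), and z is integrated first. It runs over
  0 < z < \<rho> \<sigma> and yields (\<rho> \<sigma>)^n / n; together with the factor \<rho> of
  \<open>K\<close> the power of \<rho> becomes n + 1. Everything is nonnegative, so no moment has to
  be finite beforehand.\<close>

lemma profile_moment_recursion:
  fixes W :: "real \<Rightarrow> real"
  assumes \<alpha>: "0 < \<alpha>" "\<alpha> < 1" and W [measurable]: "W \<in> borel_measurable borel"
    and W_nn: "\<And>z. W z \<ge> 0"
    and eq: "AE z in lborel. 0 < z \<longrightarrow>
      ennreal (W z) = (\<integral>\<^sup>+\<rho>. ennreal (K d \<alpha> z \<rho>) * ennreal (W \<rho>) * indicator {z<..} \<rho> \<partial>lborel)"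
    and n: "n > 0"
  shows "(\<integral>\<^sup>+z. ennreal (z ^ (n - 1) * W z) * indicator {0<..} z \<partial>lborel) =
    profile_Mellin d \<alpha> n * (\<integral>\<^sup>+z. ennreal (z ^ (n + 1) * W z) * indicator {0<..} z \<partial>lborel)"
proof -
  let ?p = "\<lambda>\<sigma>. ennreal (profile_weight d \<alpha> \<sigma>) * indicator {0<..<1} \<sigma>"
  have "(\<integral>\<^sup>+z. ennreal (z ^ (n - 1) * W z) * indicator {0<..} z \<partial>lborel) =
    (\<integral>\<^sup>+z. \<integral>\<^sup>+\<rho>. \<integral>\<^sup>+\<sigma>. ennreal (z ^ (n - 1)) * indicator {0<..} z * (ennreal \<rho> * ennreal (W \<rho>) * indicator {0<..} \<rho>) *
        (?p \<sigma> * (if 0 < z \<and> z < \<rho> * \<sigma> then 1 else 0)) \<partial>lborel \<partial>lborel \<partial>lborel)"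
    (is "_ = (\<integral>\<^sup>+z. \<integral>\<^sup>+\<rho>. \<integral>\<^sup>+\<sigma>. ?F z \<rho> \<sigma> \<partial>lborel \<partial>lborel \<partial>lborel)")
  proof (rule nn_integral_cong_AE)
    show "AE z in lborel. ennreal (z ^ (n - 1) * W z) * indicator {0<..} z = (\<integral>\<^sup>+\<rho>. \<integral>\<^sup>+\<sigma>. ?F z \<rho> \<sigma> \<partial>lborel \<partial>lborel)"
      using eq
    proof eventually_elim
      fix z assume eqz: "0 < z \<longrightarrow>
        ennreal (W z) = (\<integral>\<^sup>+\<rho>. ennreal (K d \<alpha> z \<rho>) * ennreal (W \<rho>) * indicator {z<..} \<rho> \<partial>lborel)"
      show "ennreal (z ^ (n - 1) * W z) * indicator {0<..} z = (\<integral>\<^sup>+\<rho>. \<integral>\<^sup>+\<sigma>. ?F z \<rho> \<sigma> \<partial>lborel \<partial>lborel)"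
      proof (cases "z > 0")
        case True
        have "ennreal (W z) = (\<integral>\<^sup>+\<rho>. \<integral>\<^sup>+\<sigma>. (ennreal \<rho> * ennreal (W \<rho>) * indicator {0<..} \<rho>) *
            (?p \<sigma> * (if 0 < z \<and> z < \<rho> * \<sigma> then 1 else 0)) \<partial>lborel \<partial>lborel)"
          unfolding eqz[rule_format, OF True]
        proof (rule nn_integral_cong)
          fix \<rho> :: real
          \<comment> \<open>For \<rho> at most z no \<sigma> in (0,1) satisfies z < \<rho> \<sigma>;
            the restriction \<rho> > z of the equation is thus contained in the inner
            condition.\<close>
          have [simp]: "indicator {0<..<1} \<sigma> * (if 0 < z \<and> z < \<rho> * \<sigma> then 1 else 0) = (0::ennreal)" if "\<not> z < \<rho>" for \<sigma>
          proof -
            have "\<rho> * \<sigma> \<le> z" if "0 < \<sigma>" "\<sigma> < 1"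
            proof (cases "\<rho> \<le> 0")
              case True
              with that have "\<rho> * \<sigma> \<le> 0" by (simp add: mult_nonpos_nonneg)
              with \<open>z > 0\<close> show ?thesis by linarith
            next
              case False
              with that have "\<rho> * \<sigma> \<le> \<rho> * 1" by (intro mult_left_mono) auto
              with \<open>\<not> z < \<rho>\<close> show ?thesis by linarith
            qed
            then show ?thesis by (auto simp: indicator_def)
          qed
          show "ennreal (K d \<alpha> z \<rho>) * ennreal (W \<rho>) * indicator {z<..} \<rho> =
            (\<integral>\<^sup>+\<sigma>. (ennreal \<rho> * ennreal (W \<rho>) * indicator {0<..} \<rho>) * (?p \<sigma> * (if 0 < z \<and> z < \<rho> * \<sigma> then 1 else 0)) \<partial>lborel)"
          proof (cases "z < \<rho>")
            case lt: True
            have "(\<integral>\<^sup>+\<sigma>. (ennreal \<rho> * ennreal (W \<rho>) * indicator {0<..} \<rho>) * (?p \<sigma> * (if 0 < z \<and> z < \<rho> * \<sigma> then 1 else 0)) \<partial>lborel)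
              = (ennreal \<rho> * ennreal (W \<rho>) * indicator {0<..} \<rho>) * (\<integral>\<^sup>+\<sigma>. ?p \<sigma> * (if 0 < z \<and> z < \<rho> * \<sigma> then 1 else 0) \<partial>lborel)"
              by (rule nn_integral_cmult) measurable
            then show ?thesis
              using lt True by (simp add: K_eq_nn_integral[OF \<alpha> True lt] mult_ac)
          next
            case False
            then show ?thesis by (simp add: mult.assoc)
          qed
        qed
        then have "ennreal (z ^ (n - 1) * W z) * indicator {0<..} z =
          ennreal (z ^ (n - 1)) * (\<integral>\<^sup>+\<rho>. \<integral>\<^sup>+\<sigma>. (ennreal \<rho> * ennreal (W \<rho>) * indicator {0<..} \<rho>) *
            (?p \<sigma> * (if 0 < z \<and> z < \<rho> * \<sigma> then 1 else 0)) \<partial>lborel \<partial>lborel)"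
          using True by (simp add: ennreal_mult')
        also have "\<dots> = (\<integral>\<^sup>+\<rho>. ennreal (z ^ (n - 1)) * (\<integral>\<^sup>+\<sigma>. (ennreal \<rho> * ennreal (W \<rho>) * indicator {0<..} \<rho>) *
            (?p \<sigma> * (if 0 < z \<and> z < \<rho> * \<sigma> then 1 else 0)) \<partial>lborel) \<partial>lborel)"
          by (rule nn_integral_cmult[symmetric]) measurable
        also have "\<dots> = (\<integral>\<^sup>+\<rho>. \<integral>\<^sup>+\<sigma>. ?F z \<rho> \<sigma> \<partial>lborel \<partial>lborel)"
        proof (rule nn_integral_cong)
          fix \<rho> :: real
          have "(\<integral>\<^sup>+\<sigma>. ?F z \<rho> \<sigma> \<partial>lborel) = (\<integral>\<^sup>+\<sigma>. ennreal (z ^ (n - 1)) * ((ennreal \<rho> * ennreal (W \<rho>) * indicator {0<..} \<rho>) *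
            (?p \<sigma> * (if 0 < z \<and> z < \<rho> * \<sigma> then 1 else 0))) \<partial>lborel)"
            using True by (intro nn_integral_cong) (simp only: mult.assoc indicator_simps greaterThan_iff mult_1_left)
          also have "\<dots> = ennreal (z ^ (n - 1)) * (\<integral>\<^sup>+\<sigma>. (ennreal \<rho> * ennreal (W \<rho>) * indicator {0<..} \<rho>) *
            (?p \<sigma> * (if 0 < z \<and> z < \<rho> * \<sigma> then 1 else 0)) \<partial>lborel)"
            by (rule nn_integral_cmult) measurable
          finally show "ennreal (z ^ (n - 1)) * (\<integral>\<^sup>+\<sigma>. (ennreal \<rho> * ennreal (W \<rho>) * indicator {0<..} \<rho>) *
            (?p \<sigma> * (if 0 < z \<and> z < \<rho> * \<sigma> then 1 else 0)) \<partial>lborel) = (\<integral>\<^sup>+\<sigma>. ?F z \<rho> \<sigma> \<partial>lborel)"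
            by simp
        qed
        finally show ?thesis .
      qed simp
    qed
  qed
  also have "\<dots> = (\<integral>\<^sup>+\<rho>. \<integral>\<^sup>+z. \<integral>\<^sup>+\<sigma>. ?F z \<rho> \<sigma> \<partial>lborel \<partial>lborel \<partial>lborel)"
    by (rule lborel_pair.Fubini'[symmetric]) measurable
  also have "\<dots> = (\<integral>\<^sup>+\<rho>. \<integral>\<^sup>+\<sigma>. \<integral>\<^sup>+z. ?F z \<rho> \<sigma> \<partial>lborel \<partial>lborel \<partial>lborel)"
    by (intro nn_integral_cong lborel_pair.Fubini'[symmetric]) measurable
  also have "\<dots> = (\<integral>\<^sup>+\<rho>. \<integral>\<^sup>+\<sigma>. (ennreal (\<rho> ^ (n + 1) * W \<rho>) * indicator {0<..} \<rho>) *
      (ennreal (profile_weight d \<alpha> \<sigma> * \<sigma> ^ n / n) * indicator {0<..<1} \<sigma>) \<partial>lborel \<partial>lborel)"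
  proof (intro nn_integral_cong)
    fix \<rho> \<sigma> :: real
    have "(\<integral>\<^sup>+z. ?F z \<rho> \<sigma> \<partial>lborel) = (\<integral>\<^sup>+z. (ennreal \<rho> * ennreal (W \<rho>) * indicator {0<..} \<rho> * ?p \<sigma>) *
        (ennreal (z ^ (n - 1)) * (if 0 < z \<and> z < \<rho> * \<sigma> then 1 else 0)) \<partial>lborel)"
      by (intro nn_integral_cong) (auto simp: indicator_def mult_ac)
    also have "\<dots> = (ennreal \<rho> * ennreal (W \<rho>) * indicator {0<..} \<rho> * ?p \<sigma>) *
        (\<integral>\<^sup>+z. ennreal (z ^ (n - 1)) * (if 0 < z \<and> z < \<rho> * \<sigma> then 1 else 0) \<partial>lborel)"
      by (rule nn_integral_cmult) measurable
    also have "\<dots> = (ennreal (\<rho> ^ (n + 1) * W \<rho>) * indicator {0<..} \<rho>) *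
        (ennreal (profile_weight d \<alpha> \<sigma> * \<sigma> ^ n / n) * indicator {0<..<1} \<sigma>)"
    proof (cases "0 < \<rho> \<and> 0 < \<sigma> \<and> \<sigma> < 1")
      case True
      then show ?thesis
        using n W_nn profile_weight_nonneg[OF \<alpha>, of d \<sigma>]
        by (simp add: nn_integral_power_Ioo ennreal_mult'[symmetric] power_mult_distrib field_simps)
    qed (auto simp: indicator_def)
    finally show "(\<integral>\<^sup>+z. ?F z \<rho> \<sigma> \<partial>lborel) = (ennreal (\<rho> ^ (n + 1) * W \<rho>) * indicator {0<..} \<rho>) *
        (ennreal (profile_weight d \<alpha> \<sigma> * \<sigma> ^ n / n) * indicator {0<..<1} \<sigma>)" .
  qed
  also have "\<dots> = (\<integral>\<^sup>+\<rho>. ennreal (\<rho> ^ (n + 1) * W \<rho>) * indicator {0<..} \<rho> * profile_Mellin d \<alpha> n \<partial>lborel)"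
    unfolding profile_Mellin_def by (intro nn_integral_cong nn_integral_cmult) measurable
  also have "\<dots> = (\<integral>\<^sup>+z. ennreal (z ^ (n + 1) * W z) * indicator {0<..} z \<partial>lborel) * profile_Mellin d \<alpha> n"
    by (rule nn_integral_multc) measurable
  finally show ?thesis by (simp add: mult.commute)
qed

text \<open>
  Since \<open>N\<close> is arbitrary, the moment recursion makes the moments grow slowly enough for the
  Taylor series of the characteristic function to converge everywhere.
\<close>

lemma profile_Mellin_lower_bound:
  assumes \<alpha>: "0 < \<alpha>" "\<alpha> < 1" and d: "d > 0"
  shows "\<exists>k0. \<forall>k\<ge>k0. profile_Mellin d \<alpha> (d + 2 * k) \<ge> ennreal (N / (real (2 * k + 1) * real (2 * k + 2)))"
proof -
  define a where "a = 2 / \<alpha>"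
  have a: "a \<ge> 1" using \<alpha> by (simp add: a_def)
  have G: "Gamma (1 - \<alpha>) > 0" using \<alpha> by (intro Gamma_real_pos) simp
  \<comment> \<open>The blow-up of the weight at 1 is what allows every N: its singular factor is at
    least N' beyond \<delta>. In N' the 2 pays for keeping only half of the integral of the power, d
    for d + 2k \<le> d (2k + 1), and the Gamma value for the prefactor.\<close>
  define N' where "N' = max 1 (2 * N * d * Gamma (1 - \<alpha>))"
  define \<delta> where "\<delta> = (1 - N' powr (- 1 / \<alpha>)) powr (1 / a)"
  have N': "N' \<ge> 1" by (simp add: N'_def)
  have x: "0 \<le> 1 - N' powr (- 1 / \<alpha>)" "1 - N' powr (- 1 / \<alpha>) < 1"
    using N' \<alpha> powr_mono[of "- 1 / \<alpha>" 0 N'] by auto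
  have \<delta>: "0 \<le> \<delta>" "\<delta> < 1"
    using x a powr_less_mono2[of "1 / a" "1 - N' powr (- 1 / \<alpha>)" 1] by (auto simp: \<delta>_def)
  have big: "(1 - \<sigma> powr a) powr (- \<alpha>) \<ge> N'" if "\<delta> < \<sigma>" "\<sigma> < 1" for \<sigma>
  proof -
    have "\<delta> powr a \<le> \<sigma> powr a" using that \<delta> a by (intro powr_mono2) auto
    moreover have "\<delta> powr a = 1 - N' powr (- 1 / \<alpha>)"
      using x a by (simp add: \<delta>_def powr_powr)
    moreover have "\<sigma> powr a < 1"
      using that \<delta> a powr_less_mono2[of a \<sigma> 1] by simp
    ultimately have "(N' powr (- 1 / \<alpha>)) powr (- \<alpha>) \<le> (1 - \<sigma> powr a) powr (- \<alpha>)"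
      using \<alpha> by (intro powr_mono2') auto
    then show ?thesis using \<alpha> N' by (simp add: powr_powr)
  qed
  have "(\<lambda>k. \<delta> ^ (2 * k + 2)) \<longlonglongrightarrow> 0"
  proof -
    have "(\<lambda>n. \<delta> ^ n) \<longlonglongrightarrow> 0" using \<delta> by (intro LIMSEQ_power_zero) auto
    then have "((\<lambda>n. \<delta> ^ n) \<circ> (\<lambda>k. 2 * k + 2)) \<longlonglongrightarrow> 0"
      by (rule LIMSEQ_subseq_LIMSEQ) (auto intro: strict_monoI)
    then show ?thesis by (simp add: o_def)
  qed
  then have "\<forall>\<^sub>F k in sequentially. \<delta> ^ (2 * k + 2) < 1 / 2"
    by (rule order_tendstoD) simp
  then obtain k0 where k0: "\<And>k. k \<ge> k0 \<Longrightarrow> \<delta> ^ (2 * k + 2) < 1 / 2"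
    by (auto simp: eventually_sequentially)
  have "profile_Mellin d \<alpha> (d + 2 * k) \<ge> ennreal (N / (real (2 * k + 1) * real (2 * k + 2)))"
    if k: "k \<ge> k0" for k
  proof -
    define c where "c = N' / (Gamma (1 - \<alpha>) * (d + 2 * k))"
    have c: "c \<ge> 0" using N' G by (simp add: c_def)
    have "((\<lambda>\<sigma>. c * \<sigma> ^ (2 * k + 1)) has_integral
        (c * 1 ^ (2 * k + 2) / real (2 * k + 2) - c * \<delta> ^ (2 * k + 2) / real (2 * k + 2))) {\<delta>..1}"
      using \<delta>
      by (intro fundamental_theorem_of_calculus)
        (auto simp flip: has_real_derivative_iff_has_vector_derivative
          intro!: derivative_eq_intros simp del: power_Suc)
    then have I: "((\<lambda>\<sigma>. c * \<sigma> ^ (2 * k + 1)) has_integral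
        (c * (1 - \<delta> ^ (2 * k + 2)) / real (2 * k + 2))) {\<delta><..<1}"
      by (simp add: has_integral_Icc_iff_Ioo right_diff_distrib diff_divide_distrib)
    have d2k: "(real d + 2 * real k) \<le> d * (2 * real k + 1)"
      using d mult_right_mono[of 1 "real d" "2 * real k"] by (simp add: algebra_simps)
    have "N / (real (2 * k + 1) * real (2 * k + 2)) \<le> c * (1 / 2) / real (2 * k + 2)"
    proof -
      have "2 * N * d * Gamma (1 - \<alpha>) \<le> N'" by (simp add: N'_def)
      then have "2 * N * d \<le> N' / Gamma (1 - \<alpha>)"
        using G by (simp add: field_simps)
      moreover have "N' / Gamma (1 - \<alpha>) / (d * (2 * real k + 1)) \<le> N' / Gamma (1 - \<alpha>) / (real d + 2 * real k)"
        using d2k N' G d by (intro divide_left_mono) (auto intro!: mult_pos_pos add_pos_nonneg)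
      ultimately have "2 * N * d / (d * (2 * real k + 1)) \<le> N' / Gamma (1 - \<alpha>) / (real d + 2 * real k)"
        using d by (smt (verit, best) divide_right_mono mult_nonneg_nonneg of_nat_0_le_iff)
      then have "2 * N / (2 * real k + 1) \<le> c"
        using d by (simp add: c_def)
      then have "N / (2 * real k + 1) \<le> c * (1 / 2)" by (simp add: mult.commute)
      then have "N / (2 * real k + 1) / real (2 * k + 2) \<le> c * (1 / 2) / real (2 * k + 2)"
        by (rule divide_right_mono) simp
      then show ?thesis by (simp add: mult_ac add_ac)
    qed
    also have "\<dots> \<le> c * (1 - \<delta> ^ (2 * k + 2)) / real (2 * k + 2)"
      using k0[OF k] c by (intro divide_right_mono mult_left_mono) auto
    finally have "ennreal (N / (real (2 * k + 1) * real (2 * k + 2))) \<le>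
        ennreal (c * (1 - \<delta> ^ (2 * k + 2)) / real (2 * k + 2))"
      by (rule ennreal_leI)
    also have "\<dots> = (\<integral>\<^sup>+\<sigma>. ennreal (c * \<sigma> ^ (2 * k + 1)) * indicator {\<delta><..<1} \<sigma> \<partial>lborel)"
      using \<delta> c by (intro nn_integral_has_integral_lebesgue'[symmetric] I) auto
    also have "\<dots> \<le> profile_Mellin d \<alpha> (d + 2 * k)"
      unfolding profile_Mellin_def
    proof (rule nn_integral_mono)
      fix \<sigma> :: real
      show "ennreal (c * \<sigma> ^ (2 * k + 1)) * indicator {\<delta><..<1} \<sigma> \<le>
        ennreal (profile_weight d \<alpha> \<sigma> * \<sigma> ^ (d + 2 * k) / real (d + 2 * k)) * indicator {0<..<1} \<sigma>"
      proof (cases "\<sigma> \<in> {\<delta><..<1}")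
        case True
        then have \<sigma>: "0 < \<sigma>" "\<sigma> < 1" using \<delta> by auto
        \<comment> \<open>The dimension cancels from the exponent, which makes the comparison with
          the factorial of 2k possible.\<close>
        have "\<sigma> powr (1 - real d) * \<sigma> ^ (d + 2 * k) = \<sigma> ^ (2 * k + 1)"
          using \<sigma> by (simp add: powr_realpow[symmetric] powr_add[symmetric] del: power_Suc)
        then have "profile_weight d \<alpha> \<sigma> * \<sigma> ^ (d + 2 * k) / real (d + 2 * k) =
          (1 - \<sigma> powr a) powr (- \<alpha>) / (Gamma (1 - \<alpha>) * (d + 2 * k)) * \<sigma> ^ (2 * k + 1)"
          by (simp add: profile_weight_def a_def field_simps)
        also have "\<dots> \<ge> c * \<sigma> ^ (2 * k + 1)"
          unfolding c_def using big[of \<sigma>] True \<sigma> G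
          by (intro mult_right_mono divide_right_mono) auto
        finally show ?thesis using \<sigma> True by (simp add: ennreal_leI)
      qed simp
    qed
    finally show ?thesis .
  qed
  then show ?thesis by blast
qed

text \<open>The product (2k + 1)(2k + 2) is the quotient of the factorials of 2k + 2 and 2k. As N is
  arbitrary, the quotients of consecutive terms become small for every t, and the ratio test
  applies.\<close>

lemma scaled_moments_tendsto_0:
  fixes m :: "nat \<Rightarrow> real"
  assumes nn: "\<And>k. m k \<ge> 0"
    and step: "\<And>N. N > 0 \<Longrightarrow> \<exists>k0. \<forall>k\<ge>k0. m (Suc k) * N \<le> (real (2 * k + 1) * real (2 * k + 2)) * m k"
  shows "(\<lambda>k. t ^ (2 * k) / fact (2 * k) * m k) \<longlonglongrightarrow> 0"
proof -
  let ?a = "\<lambda>k. t ^ (2 * k) / fact (2 * k) * m k"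
  \<comment> \<open>With this N consecutive terms shrink at least by the factor 1/2; the summand 1
    keeps N positive when t = 0.\<close>
  obtain k0 where k0: "\<And>k. k \<ge> k0 \<Longrightarrow> m (Suc k) * (2 * t\<^sup>2 + 1) \<le> (real (2 * k + 1) * real (2 * k + 2)) * m k"
    using step[of "2 * t\<^sup>2 + 1"] by (auto simp: add_nonneg_pos)
  have nna: "?a k \<ge> 0" for k using nn[of k] by simp
  have half: "norm (?a (Suc k)) \<le> 1 / 2 * norm (?a k)" if "k \<ge> k0" for k
  proof -
    let ?b = "real (2 * k + 1) * real (2 * k + 2)"
    have "2 * t\<^sup>2 * m (Suc k) \<le> ?b * m k"
      using k0[OF that] nn[of "Suc k"] by (simp add: algebra_simps)
    then have "t\<^sup>2 * m (Suc k) / ?b \<le> 1 / 2 * m k"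
      by (subst pos_divide_le_eq) (auto simp: mult_ac)
    then have "t ^ (2 * k) / fact (2 * k) * (t\<^sup>2 * m (Suc k) / ?b) \<le> t ^ (2 * k) / fact (2 * k) * (1 / 2 * m k)"
      by (intro mult_left_mono) auto
    moreover have "?a (Suc k) = t ^ (2 * k) / fact (2 * k) * (t\<^sup>2 * m (Suc k) / ?b)"
      by (simp add: power2_eq_square field_simps)
    ultimately have "?a (Suc k) \<le> 1 / 2 * ?a k" by simp
    then show ?thesis using nna[of k] nna[of "Suc k"] by (simp only: real_norm_def abs_of_nonneg)
  qed
  have "summable ?a"
    by (rule summable_ratio_test[of "1/2" k0]) (use half in auto)
  then show ?thesis by (rule summable_LIMSEQ_zero)
qed

section \<open>From moments on the half line to a measure on the line\<close>

lemma nn_integral_even: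
  fixes f :: "real \<Rightarrow> ennreal"
  assumes [measurable]: "f \<in> borel_measurable borel" and even: "\<And>x. f (- x) = f x"
  shows "(\<integral>\<^sup>+x. f x \<partial>lborel) = 2 * (\<integral>\<^sup>+x. f x * indicator {0<..} x \<partial>lborel)"
proof -
  have "(\<integral>\<^sup>+x. f x \<partial>lborel) = (\<integral>\<^sup>+x. f x * indicator {0<..} x + f x * indicator {..<0} x \<partial>lborel)"
    using AE_lborel_singleton[of "0::real"]
    by (intro nn_integral_cong_AE) (auto elim!: eventually_mono simp: indicator_def)
  also have "\<dots> = (\<integral>\<^sup>+x. f x * indicator {0<..} x \<partial>lborel) + (\<integral>\<^sup>+x. f x * indicator {..<0} x \<partial>lborel)"
    by (rule nn_integral_add) measurable
  also have "(\<integral>\<^sup>+x. f x * indicator {..<0} x \<partial>lborel) = (\<integral>\<^sup>+x. f x * indicator {0<..} x \<partial>lborel)"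
    by (subst nn_integral_real_affine[of _ "-1" 0]) (auto simp: even indicator_def intro!: nn_integral_cong)
  finally show ?thesis by (simp add: mult_2)
qed

text \<open>The recursion advances in steps of two and reaches only every other moment on the half
  line. Reflecting the measure makes precisely these its even moments, while its odd moments vanish
  by symmetry, so the full moment sequence is known.\<close>

lemma symmetric_moments:
  fixes W :: "real \<Rightarrow> real" and r :: "nat \<Rightarrow> real"
  assumes [measurable]: "W \<in> borel_measurable borel" and nn: "\<And>x. W x \<ge> 0"
    and r: "\<And>k. (\<integral>\<^sup>+z. ennreal (z ^ (e + 2 * k) * W z) * indicator {0<..} z \<partial>lborel) = ennreal (r k)"
      "\<And>k. r k \<ge> 0"
  defines "N \<equiv> density lborel (\<lambda>x. ennreal (\<bar>x\<bar> ^ e * W \<bar>x\<bar>))"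
  shows "finite_borel_measure N" "integrable N (\<lambda>x. x ^ j)"
    "(\<integral>x. x ^ (2 * k) \<partial>N) = 2 * r k" "odd j \<Longrightarrow> (\<integral>x. x ^ j \<partial>N) = 0"
proof -
  let ?g = "\<lambda>x. \<bar>x\<bar> ^ e * W \<bar>x\<bar>"
  have ev: "(\<integral>\<^sup>+x. ennreal (?g x * x ^ (2 * k)) \<partial>lborel) = ennreal (2 * r k)" for k
  proof -
    have "(\<integral>\<^sup>+x. ennreal (?g x * x ^ (2 * k)) \<partial>lborel) =
        2 * (\<integral>\<^sup>+x. ennreal (?g x * x ^ (2 * k)) * indicator {0<..} x \<partial>lborel)"
      by (rule nn_integral_even) auto
    also have "(\<integral>\<^sup>+x. ennreal (?g x * x ^ (2 * k)) * indicator {0<..} x \<partial>lborel) =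
        (\<integral>\<^sup>+x. ennreal (x ^ (e + 2 * k) * W x) * indicator {0<..} x \<partial>lborel)"
      by (intro nn_integral_cong) (auto simp: indicator_def power_add mult_ac)
    finally show ?thesis using r by (simp add: ennreal_mult)
  qed
  have hb: "has_bochner_integral lborel (\<lambda>x. ?g x * x ^ (2 * k)) (2 * r k)" for k
    using ev[of k] r nn by (intro has_bochner_integral_nn_integral) (auto intro!: AE_I2)
  show int: "integrable N (\<lambda>x. x ^ j)" for j
  proof -
    have "integrable lborel (\<lambda>x. ?g x * x ^ j)"
    proof (rule Bochner_Integration.integrable_bound)
      show "integrable lborel (\<lambda>x. ?g x * x ^ (2 * 0) + ?g x * x ^ (2 * j))"
        by (intro Bochner_Integration.integrable_add integrable.intros[OF hb])
      \<comment> \<open>Integrability of the odd powers is reduced to that of the even ones.\<close>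
      have "\<bar>x\<bar> ^ j \<le> 1 + x ^ (2 * j)" for x :: real
      proof -
        have "0 \<le> (\<bar>x\<bar> ^ j - 1)\<^sup>2" by simp
        also have "\<dots> = x ^ (2 * j) - 2 * \<bar>x\<bar> ^ j + 1"
          by (simp add: power2_diff power_mult[symmetric] mult.commute[of j] power_even_abs)
        finally show ?thesis using zero_le_power[OF abs_ge_zero, of x j] by linarith
      qed
      then have "?g x * \<bar>x\<bar> ^ j \<le> ?g x * (1 + x ^ (2 * j))" for x
        using nn by (intro mult_left_mono) auto
      then show "AE x in lborel. norm (?g x * x ^ j) \<le> norm (?g x * x ^ (2 * 0) + ?g x * x ^ (2 * j))"
        using nn by (intro AE_I2) (simp add: abs_mult power_abs distrib_left)
    qed measurable
    then show ?thesis
      unfolding N_def using nn by (subst integrable_density) auto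
  qed
  show "(\<integral>x. x ^ (2 * k) \<partial>N) = 2 * r k"
    unfolding N_def using nn hb[of k] by (subst integral_density) (auto simp: has_bochner_integral_iff)
  show "(\<integral>x. x ^ j \<partial>N) = 0" if "odd j"
  proof -
    have "(\<integral>x. x ^ j \<partial>N) = (\<integral>x. ?g x * x ^ j \<partial>lborel)"
      unfolding N_def using nn by (subst integral_density) auto
    moreover have "(\<integral>x. ?g x * x ^ j \<partial>lborel) = - (\<integral>x. ?g x * x ^ j \<partial>lborel)"
      using that by (subst lborel_integral_real_affine[of "-1" _ 0]) auto
    ultimately show ?thesis by linarith
  qed
  have "emeasure N UNIV = ennreal (2 * r 0)"
    using ev[of 0] by (simp add: N_def emeasure_density)
  then show "finite_borel_measure N"
    by (auto simp: finite_borel_measure_def finite_borel_measure_axioms_def N_def intro!: finite_measureI)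
qed

text \<open>The equation returns U at every z > 0 from the Borel version W alone, so that equality
  almost everywhere can later be raised to equality everywhere. Measurability of U is extracted from
  the mass condition by dividing by the power of \<rho> on the positive axis.\<close>

lemma profile_borel_representative:
  fixes U :: "real \<Rightarrow> real"
  assumes \<alpha>: "0 < \<alpha>" "\<alpha> < 1" and d: "d > 0"
    and nn: "\<And>z. z > 0 \<Longrightarrow> U z \<ge> 0"
    and sol: "profile_solution d \<alpha> U"
    and int: "set_integrable lebesgue {0<..} (\<lambda>\<rho>. U \<rho> * \<rho> ^ (d - 1))"
    and m: "(LINT \<rho>:{0<..}|lebesgue. U \<rho> * \<rho> ^ (d - 1)) = m"
  obtains W where "W \<in> borel_measurable borel" "\<And>z. W z \<ge> 0" "AE z in lborel. 0 < z \<longrightarrow> U z = W z"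
    "\<And>z. z > 0 \<Longrightarrow> ennreal (U z) =
       (\<integral>\<^sup>+\<rho>. ennreal (K d \<alpha> z \<rho>) * ennreal (W \<rho>) * indicator {z<..} \<rho> \<partial>lborel)"
    "(\<integral>\<^sup>+z. ennreal (z ^ (d - 1) * W z) * indicator {0<..} z \<partial>lborel) = ennreal m"
proof -
  have [measurable]: "(\<lambda>\<rho>. indicator {0<..} \<rho> * (U \<rho> * \<rho> ^ (d - 1))) \<in> borel_measurable lebesgue"
    using borel_measurable_integrable[OF int[unfolded set_integrable_def]] by simp
  have "(\<lambda>\<rho>. indicator {0<..} \<rho> * (U \<rho> * \<rho> ^ (d - 1)) / \<rho> ^ (d - 1)) \<in> borel_measurable lebesgue"
    by (rule borel_measurable_divide, measurable) (simp add: measurable_completion)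
  then have "(\<lambda>\<rho>. indicator {0<..} \<rho> * U \<rho>) \<in> borel_measurable lebesgue"
    by (rule measurable_cong[THEN iffD1, rotated]) (auto simp: indicator_def)
  from completion_ex_borel_measurable_real[OF this]
  obtain W0 where W0: "W0 \<in> borel_measurable lborel" "AE z in lborel. indicator {0<..} z * U z = W0 z"
    by auto
  define W where "W = (\<lambda>z. max 0 (W0 z))"
  have W [measurable]: "W \<in> borel_measurable borel"
    using W0(1) by (auto simp: W_def)
  have W_nn: "W z \<ge> 0" for z by (simp add: W_def)
  have UW: "AE z in lborel. 0 < z \<longrightarrow> U z = W z"
    using W0(2)
  proof eventually_elim
    fix z assume "indicator {0<..} z * U z = W0 z"
    then show "0 < z \<longrightarrow> U z = W z"
      using nn[of z] by (cases "z > 0") (auto simp: W_def)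
  qed
  have eq: "ennreal (U z) =
       (\<integral>\<^sup>+\<rho>. ennreal (K d \<alpha> z \<rho>) * ennreal (W \<rho>) * indicator {z<..} \<rho> \<partial>lborel)" if z: "z > 0" for z
  proof -
    have i: "set_integrable lebesgue {z<..} (\<lambda>\<rho>. K d \<alpha> z \<rho> * U \<rho>)"
      and U: "U z = (LINT \<rho>:{z<..}|lebesgue. K d \<alpha> z \<rho> * U \<rho>)"
      using sol z unfolding profile_solution_def by auto
    have K_nn: "K d \<alpha> z \<rho> \<ge> 0" if "\<rho> > z" for \<rho>
      using Q_eq_nn_integral(2)[OF \<alpha>, of "z / \<rho>" d] that z by (simp add: K_def)
    have "ennreal (U z) = (\<integral>\<^sup>+\<rho>. ennreal (indicator {z<..} \<rho> * (K d \<alpha> z \<rho> * U \<rho>)) \<partial>lebesgue)"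
      unfolding U set_lebesgue_integral_def
      using i[unfolded set_integrable_def] K_nn nn z
      by (subst nn_integral_eq_integral[symmetric]) (auto simp: indicator_def intro!: AE_I2)
    also have "\<dots> = (\<integral>\<^sup>+\<rho>. ennreal (indicator {z<..} \<rho> * (K d \<alpha> z \<rho> * U \<rho>)) \<partial>lborel)"
      by (rule nn_integral_completion)
    also have "\<dots> = (\<integral>\<^sup>+\<rho>. ennreal (K d \<alpha> z \<rho>) * ennreal (W \<rho>) * indicator {z<..} \<rho> \<partial>lborel)"
      by (rule nn_integral_cong_AE, use UW in eventually_elim)
        (use z K_nn in \<open>auto simp: indicator_def ennreal_mult'\<close>)
    finally show ?thesis .
  qed
  have "(\<integral>\<^sup>+z. ennreal (z ^ (d - 1) * W z) * indicator {0<..} z \<partial>lborel) =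
      (\<integral>\<^sup>+z. ennreal (indicator {0<..} z * (U z * z ^ (d - 1))) \<partial>lborel)"
    by (rule nn_integral_cong_AE, use UW in eventually_elim) (auto simp: indicator_def mult_ac)
  also have "\<dots> = (\<integral>\<^sup>+z. ennreal (indicator {0<..} z * (U z * z ^ (d - 1))) \<partial>lebesgue)"
    by (rule nn_integral_completion[symmetric])
  also have "\<dots> = ennreal m"
    unfolding m[symmetric] set_lebesgue_integral_def
    using int[unfolded set_integrable_def] nn
    by (subst nn_integral_eq_integral) (auto simp: indicator_def intro!: AE_I2)
  finally show thesis
    using that[OF W W_nn UW eq] by simp
qed

text \<open>Cancelling \<open>profile_Mellin\<close> in \<open>ennreal\<close> requires it to be
  neither 0 nor infinite. Both facts follow from the recursion itself: a product that is positive
  and finite has nonzero factors, and therefore finite ones. Started at the mass m > 0, positivity,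
  finiteness and equality of the two moment sequences propagate together.\<close>

lemma profile_moments_determined:
  fixes W V :: "real \<Rightarrow> real"
  assumes \<alpha>: "0 < \<alpha>" "\<alpha> < 1" and d: "d > 0" and m: "m > 0"
    and meas: "W \<in> borel_measurable borel" "V \<in> borel_measurable borel"
    and nn: "\<And>z. W z \<ge> 0" "\<And>z. V z \<ge> 0"
    and eqW: "AE z in lborel. 0 < z \<longrightarrow>
      ennreal (W z) = (\<integral>\<^sup>+\<rho>. ennreal (K d \<alpha> z \<rho>) * ennreal (W \<rho>) * indicator {z<..} \<rho> \<partial>lborel)"
    and eqV: "AE z in lborel. 0 < z \<longrightarrow>
      ennreal (V z) = (\<integral>\<^sup>+\<rho>. ennreal (K d \<alpha> z \<rho>) * ennreal (V \<rho>) * indicator {z<..} \<rho> \<partial>lborel)"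
    and mW: "(\<integral>\<^sup>+z. ennreal (z ^ (d - 1) * W z) * indicator {0<..} z \<partial>lborel) = ennreal m"
    and mV: "(\<integral>\<^sup>+z. ennreal (z ^ (d - 1) * V z) * indicator {0<..} z \<partial>lborel) = ennreal m"
  obtains r where "\<And>k. r k \<ge> 0"
    "\<And>k. (\<integral>\<^sup>+z. ennreal (z ^ (d - 1 + 2 * k) * W z) * indicator {0<..} z \<partial>lborel) = ennreal (r k)"
    "\<And>k. (\<integral>\<^sup>+z. ennreal (z ^ (d - 1 + 2 * k) * V z) * indicator {0<..} z \<partial>lborel) = ennreal (r k)"
    "\<And>t. (\<lambda>k. t ^ (2 * k) / fact (2 * k) * r k) \<longlonglongrightarrow> 0"
proof -
  define A where "A = (\<lambda>W k. \<integral>\<^sup>+z. ennreal (z ^ (d - 1 + 2 * k) * W z) * indicator {0<..} z \<partial>lborel)"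
  let ?P = "\<lambda>k. profile_Mellin d \<alpha> (d + 2 * k)"
  have rec: "A W k = ?P k * A W (Suc k)" "A V k = ?P k * A V (Suc k)" for k
  proof -
    have e: "d + 2 * k - 1 = d - 1 + 2 * k" "d + 2 * k + 1 = d - 1 + 2 * Suc k" using d by simp_all
    show "A W k = ?P k * A W (Suc k)" "A V k = ?P k * A V (Suc k)"
      using profile_moment_recursion[OF \<alpha> meas(1) nn(1) eqW, of "d + 2 * k"]
        profile_moment_recursion[OF \<alpha> meas(2) nn(2) eqV, of "d + 2 * k"] d
      unfolding A_def e by simp_all
  qed
  have A: "A W k = A V k \<and> 0 < A W k \<and> A W k < \<infinity>" for k
  proof (induction k)
    case 0
    then show ?case using mW mV m by (simp add: A_def)
  next
    case (Suc k)
    have P: "?P k \<noteq> 0" "A W (Suc k) \<noteq> 0" "A V (Suc k) \<noteq> 0"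
      using Suc rec[of k] by auto
    moreover have "?P k \<noteq> \<top>"
      using Suc rec(1)[of k] P by (auto simp: ennreal_top_mult)
    moreover have "A W (Suc k) \<noteq> \<top>"
      using Suc rec(1)[of k] P by (auto simp: ennreal_mult_top)
    moreover have "A W (Suc k) = A V (Suc k)"
      using Suc rec[of k] P \<open>?P k \<noteq> \<top>\<close> by (metis ennreal_mult_cancel_left)
    ultimately show ?case
      by (simp add: zero_less_iff_neq_zero less_top)
  qed
  define r where "r = (\<lambda>k. enn2real (A W k))"
  have r: "A W k = ennreal (r k)" for k
    using A[of k] unfolding r_def by (intro ennreal_enn2real[symmetric]) auto
  have r_nn: "r k \<ge> 0" for k by (simp add: r_def)
  have "\<exists>k0. \<forall>k\<ge>k0. r (Suc k) * N \<le> (real (2 * k + 1) * real (2 * k + 2)) * r k" if N: "N > 0" for N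
  proof -
    obtain k0 where k0: "\<And>k. k \<ge> k0 \<Longrightarrow> ?P k \<ge> ennreal (N / (real (2 * k + 1) * real (2 * k + 2)))"
      using profile_Mellin_lower_bound[OF \<alpha> d] by blast
    have "r (Suc k) * N \<le> (real (2 * k + 1) * real (2 * k + 2)) * r k" if k: "k \<ge> k0" for k
    proof -
      let ?b = "real (2 * k + 1) * real (2 * k + 2)"
      have "ennreal (N / ?b * r (Suc k)) \<le> ennreal (r k)"
      proof -
        have "ennreal (N / ?b * r (Suc k)) = ennreal (N / ?b) * ennreal (r (Suc k))"
          using N r_nn by (intro ennreal_mult) auto
        also have "\<dots> \<le> ?P k * ennreal (r (Suc k))"
          by (intro mult_right_mono k0 k) simp
        also have "\<dots> = ennreal (r k)" using rec(1)[of k] by (simp add: r)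
        finally show ?thesis .
      qed
      then have "N / ?b * r (Suc k) \<le> r k"
        using r_nn by simp
      then show ?thesis
        by (subst (asm) times_divide_eq_left, subst (asm) pos_divide_le_eq) (auto simp: mult_ac)
    qed
    then show ?thesis by blast
  qed
  note lim = scaled_moments_tendsto_0[OF r_nn this]
  have rV: "A V k = ennreal (r k)" for k
    using r[of k] A[of k] by simp
  show thesis
    by (rule that[OF r_nn r[unfolded A_def] rV[unfolded A_def] lim])
qed

lemma profile_solution_unique:
  fixes U V :: "real \<Rightarrow> real"
  assumes \<alpha>: "0 < \<alpha>" "\<alpha> < 1" and d: "d > 0" and m: "m > 0"
    and U: "\<And>z. z > 0 \<Longrightarrow> U z \<ge> 0" "profile_solution d \<alpha> U"
      "set_integrable lebesgue {0<..} (\<lambda>\<rho>. U \<rho> * \<rho> ^ (d - 1))"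
      "(LINT \<rho>:{0<..}|lebesgue. U \<rho> * \<rho> ^ (d - 1)) = m"
    and V: "\<And>z. z > 0 \<Longrightarrow> V z \<ge> 0" "profile_solution d \<alpha> V"
      "set_integrable lebesgue {0<..} (\<lambda>\<rho>. V \<rho> * \<rho> ^ (d - 1))"
      "(LINT \<rho>:{0<..}|lebesgue. V \<rho> * \<rho> ^ (d - 1)) = m"
    and z: "z > 0"
  shows "U z = V z"
proof -
  obtain U' where U': "U' \<in> borel_measurable borel" "\<And>z. U' z \<ge> 0" "AE z in lborel. 0 < z \<longrightarrow> U z = U' z"
    "\<And>z. z > 0 \<Longrightarrow> ennreal (U z) =
       (\<integral>\<^sup>+\<rho>. ennreal (K d \<alpha> z \<rho>) * ennreal (U' \<rho>) * indicator {z<..} \<rho> \<partial>lborel)"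
    "(\<integral>\<^sup>+z. ennreal (z ^ (d - 1) * U' z) * indicator {0<..} z \<partial>lborel) = ennreal m"
    using profile_borel_representative[OF \<alpha> d U] by blast
  obtain V' where V': "V' \<in> borel_measurable borel" "\<And>z. V' z \<ge> 0" "AE z in lborel. 0 < z \<longrightarrow> V z = V' z"
    "\<And>z. z > 0 \<Longrightarrow> ennreal (V z) =
       (\<integral>\<^sup>+\<rho>. ennreal (K d \<alpha> z \<rho>) * ennreal (V' \<rho>) * indicator {z<..} \<rho> \<partial>lborel)"
    "(\<integral>\<^sup>+z. ennreal (z ^ (d - 1) * V' z) * indicator {0<..} z \<partial>lborel) = ennreal m"
    using profile_borel_representative[OF \<alpha> d V] by blast
  note [measurable] = U'(1) V'(1)
  have eqU: "AE z in lborel. 0 < z \<longrightarrow>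
      ennreal (U' z) = (\<integral>\<^sup>+\<rho>. ennreal (K d \<alpha> z \<rho>) * ennreal (U' \<rho>) * indicator {z<..} \<rho> \<partial>lborel)"
    using U'(3) by eventually_elim (metis U'(4))
  have eqV: "AE z in lborel. 0 < z \<longrightarrow>
      ennreal (V' z) = (\<integral>\<^sup>+\<rho>. ennreal (K d \<alpha> z \<rho>) * ennreal (V' \<rho>) * indicator {z<..} \<rho> \<partial>lborel)"
    using V'(3) by eventually_elim (metis V'(4))
  obtain r where r: "\<And>k. r k \<ge> 0"
    "\<And>k. (\<integral>\<^sup>+z. ennreal (z ^ (d - 1 + 2 * k) * U' z) * indicator {0<..} z \<partial>lborel) = ennreal (r k)"
    "\<And>k. (\<integral>\<^sup>+z. ennreal (z ^ (d - 1 + 2 * k) * V' z) * indicator {0<..} z \<partial>lborel) = ennreal (r k)"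
    "\<And>t. (\<lambda>k. t ^ (2 * k) / fact (2 * k) * r k) \<longlonglongrightarrow> 0"
    by (rule profile_moments_determined[OF \<alpha> d m U'(1) V'(1) U'(2) V'(2) eqU eqV U'(5) V'(5)]) (rule that)
  let ?N = "\<lambda>W. density lborel (\<lambda>x. ennreal (\<bar>x\<bar> ^ (d - 1) * W \<bar>x\<bar>))"
  note SU = symmetric_moments[OF U'(1,2) r(2) r(1)]
  note SV = symmetric_moments[OF V'(1,2) r(3) r(1)]
  have "?N U' = ?N V'"
  proof (rule finite_borel_measure_eqI_moments)
    show "(\<integral>x. x ^ k \<partial>?N U') = (\<integral>x. x ^ k \<partial>?N V')" for k
    proof (cases "even k")
      case True
      then obtain b where "k = 2 * b" by (elim evenE)
      then show ?thesis by (simp only: SU(3) SV(3))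
    next
      case False
      then show ?thesis by (simp only: SU(4)[OF False] SV(4)[OF False])
    qed
    show "(\<lambda>n. t ^ (2 * n) / fact (2 * n) * (\<integral>x. x ^ (2 * n) \<partial>?N U')) \<longlonglongrightarrow> 0" for t
      using tendsto_mult_right_zero[OF r(4)[of t], of 2] unfolding SU(3) by (simp add: mult_ac)
  qed (rule SU(1,2) SV(1,2))+
  moreover have "(\<lambda>x. ennreal (\<bar>x\<bar> ^ (d - 1) * W \<bar>x\<bar>)) \<in> borel_measurable lborel"
    if "W \<in> borel_measurable borel" for W :: "real \<Rightarrow> real"
    using that by measurable
  ultimately have "AE x in lborel. ennreal (\<bar>x\<bar> ^ (d - 1) * U' \<bar>x\<bar>) = ennreal (\<bar>x\<bar> ^ (d - 1) * V' \<bar>x\<bar>)"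
    by (intro sigma_finite_measure.density_unique[OF sigma_finite_lborel]) (simp_all add: U'(1) V'(1))
  then have UV: "AE x in lborel. 0 < x \<longrightarrow> U' x = V' x"
    by eventually_elim (use U'(2) V'(2) in \<open>auto simp: ennreal_inj\<close>)
  \<comment> \<open>At each single z both values are integrals of the Borel versions, which agree
    almost everywhere.\<close>
  have "ennreal (U z) = ennreal (V z)"
    unfolding U'(4)[OF z] V'(4)[OF z]
    by (rule nn_integral_cong_AE, use UV in eventually_elim) (use z in \<open>auto simp: indicator_def\<close>)
  then show ?thesis using U(1)[OF z] V(1)[OF z] by simp
qed

section \<open>Convolution with fractional kernels\<close>

text \<open>The Riemann-Liouville kernel extended by 0, so that causal convolutions are integrals
  over the whole line. The parameter 1 - \<alpha> gives k, \<alpha> its convolution inverse, and 1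
  the Heaviside function, whose convolution is the primitive from 0 when the other factor lives on
  the positive axis.\<close>

definition frac_kernel :: "real \<Rightarrow> real \<Rightarrow> real" where
  "frac_kernel \<beta> t = (if t > 0 then t powr (\<beta> - 1) / Gamma \<beta> else 0)"

lemma frac_kernel_measurable [measurable]: "frac_kernel \<beta> \<in> borel_measurable borel"
  unfolding frac_kernel_def by measurable

lemma frac_kernel_nonneg: "\<beta> > 0 \<Longrightarrow> frac_kernel \<beta> t \<ge> 0"
  using Gamma_real_pos[of \<beta>] by (simp add: frac_kernel_def)

lemma frac_kernel_1: "frac_kernel 1 t = indicator {0<..} t"
  by (simp add: frac_kernel_def)

text \<open>The semigroup law of fractional integration: the substitution s = t \<sigma> produces
  the Beta integral, whose value cancels the two Gamma factors.\<close>

lemma frac_kernel_convolution: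
  assumes a: "a > 0" and b: "b > 0"
  shows "has_bochner_integral lborel (\<lambda>s. frac_kernel a (t - s) * frac_kernel b s) (frac_kernel (a + b) t)"
proof (cases "t > 0")
  case False
  then have "(\<lambda>s. frac_kernel a (t - s) * frac_kernel b s) = (\<lambda>_. 0)"
    by (auto simp: frac_kernel_def fun_eq_iff)
  then show ?thesis
    using False has_bochner_integral_zero[of lborel] by (simp only:) (simp add: frac_kernel_def)
next
  case t: True
  have Ga: "Gamma a > 0" "Gamma b > 0" "Gamma (a + b) > 0"
    using a b by (simp_all add: Gamma_real_pos)
  let ?B = "\<lambda>\<sigma>::real. \<sigma> powr (b - 1) * (1 - \<sigma>) powr (a - 1)"
  have "(?B has_integral Beta b a) {0<..<1}"
    using has_integral_Beta_real[OF b a] by (simp add: has_integral_Icc_iff_Ioo)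
  from nn_integral_has_integral_lebesgue[OF _ this]
  have nn: "(\<integral>\<^sup>+\<sigma>. ennreal (indicator {0<..<1} \<sigma> * ?B \<sigma>) \<partial>lborel) = ennreal (Beta b a)"
    by simp
  have "has_bochner_integral lborel (\<lambda>\<sigma>. indicator {0<..<1} \<sigma> * ?B \<sigma>) (Beta b a)"
    using Ga by (intro has_bochner_integral_nn_integral nn) (auto simp: Beta_def add.commute)
  then have H: "has_bochner_integral lborel
      (\<lambda>\<sigma>. t powr (a + b - 2) / (Gamma a * Gamma b) * (indicator {0<..<1} \<sigma> * ?B \<sigma>))
      (t powr (a + b - 2) / (Gamma a * Gamma b) * Beta b a)"
    by (rule has_bochner_integral_mult_right)
  have "has_bochner_integral lborel (\<lambda>\<sigma>. frac_kernel a (t - (0 + t * \<sigma>)) * frac_kernel b (0 + t * \<sigma>))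
      (frac_kernel (a + b) t /\<^sub>R \<bar>t\<bar>)"
  proof (rule has_bochner_integral_cong[THEN iffD1, OF refl _ _ H])
    fix \<sigma> :: real
    show "t powr (a + b - 2) / (Gamma a * Gamma b) * (indicator {0<..<1} \<sigma> * ?B \<sigma>) =
      frac_kernel a (t - (0 + t * \<sigma>)) * frac_kernel b (0 + t * \<sigma>)"
    proof (cases "0 < \<sigma> \<and> \<sigma> < 1")
      case True
      have "t - t * \<sigma> = t * (1 - \<sigma>)" by (simp add: algebra_simps)
      moreover have "t powr (a + b - 2) = t powr (a - 1) * t powr (b - 1)"
        by (simp add: powr_add[symmetric])
      ultimately show ?thesis
        using True t by (simp add: frac_kernel_def powr_mult)
    next
      case False
      then have "\<sigma> \<le> 0 \<or> t * (1 - \<sigma>) \<le> 0" using t by (auto simp: mult_le_0_iff)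
      then have "t * \<sigma> \<le> 0 \<or> t - t * \<sigma> \<le> 0" using t by (auto simp: algebra_simps mult_le_0_iff)
      then show ?thesis using False by (auto simp: frac_kernel_def)
    qed
    have "t powr (a + b - 1) = t powr (a + b - 2) * t"
      using t powr_add[of t "a + b - 2" 1] by (simp add: algebra_simps)
    then show "t powr (a + b - 2) / (Gamma a * Gamma b) * Beta b a = frac_kernel (a + b) t /\<^sub>R \<bar>t\<bar>"
      using t Ga by (simp add: frac_kernel_def Beta_def field_simps)
  qed
  then show ?thesis
    using t by (subst lborel_has_bochner_integral_real_affine_iff[of t _ _ 0]) auto
qed

lemma frac_kernel_primitive:
  assumes "a > 0"
  shows "has_bochner_integral lborel (\<lambda>s. indicator {0<..} s * frac_kernel a (t - s)) (frac_kernel (a + 1) t)"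
  using frac_kernel_convolution[of a 1 t] assms by (simp add: frac_kernel_1 mult.commute)

text \<open>For an integer q > 1 / \<alpha>, q steps of size \<alpha> add at least 1 to the
  argument, so the Gamma value dominates the factorial of n div q, whereas the power grows only
  geometrically in n div q.\<close>

lemma power_over_Gamma_tendsto_0:
  fixes x \<alpha> c :: real
  assumes \<alpha>: "\<alpha> > 0" and c: "c \<ge> 1"
  shows "(\<lambda>n. x ^ n / Gamma (c + \<alpha> * n)) \<longlonglongrightarrow> 0"
proof -
  obtain q :: nat where q: "1 / \<alpha> < q" using reals_Archimedean2 by blast
  then have q0: "q > 0" using \<alpha> by (metis gr0I less_asym of_nat_0 zero_less_divide_1_iff)
  have q1: "1 \<le> \<alpha> * q" using q \<alpha> by (simp add: field_simps)
  define X where "X = max 1 \<bar>x\<bar>"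
  have X: "X \<ge> 1" "\<bar>x\<bar> \<le> X" by (auto simp: X_def)
  let ?g = "\<lambda>n. X ^ q * ((X ^ q) ^ (n div q) / fact (n div q))"
  have bound: "norm (x ^ n / Gamma (c + \<alpha> * n)) \<le> ?g n" if n: "n \<ge> q" for n
  proof -
    let ?j = "n div q"
    \<comment> \<open>Gamma increases only beyond its minimum, which lies below 2; with this bound
      both arguments compared are at least 2.\<close>
    have j: "?j \<ge> 1" using n q0 by (simp add: Suc_leI div_greater_zero_iff)
    have "real ?j * 1 \<le> real ?j * (\<alpha> * q)" using q1 by (intro mult_left_mono) auto
    also have "\<dots> = \<alpha> * real (?j * q)" by simp
    also have "\<dots> \<le> \<alpha> * real n" using \<alpha> by (intro mult_left_mono of_nat_mono) auto
    finally have jn: "1 + real ?j \<le> c + \<alpha> * n" using c by simp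
    have "fact ?j = Gamma (1 + real ?j)" by (simp add: Gamma_fact)
    also have "\<dots> \<le> Gamma (c + \<alpha> * n)"
      using Gamma_real_strict_mono[of "1 + real ?j" "c + \<alpha> * n"] j jn
      by (cases "1 + real ?j = c + \<alpha> * n") auto
    finally have G: "fact ?j \<le> Gamma (c + \<alpha> * n)" .
    have "\<bar>x\<bar> ^ n \<le> X ^ n" using X by (intro power_mono) auto
    also have "\<dots> \<le> X ^ (q * (?j + 1))"
      using X dividend_less_times_div[OF q0, of n] by (intro power_increasing) (auto simp: algebra_simps)
    finally have "\<bar>x\<bar> ^ n \<le> X ^ q * (X ^ q) ^ ?j"
      by (simp add: power_add power_mult)
    then have "\<bar>x\<bar> ^ n / Gamma (c + \<alpha> * n) \<le> X ^ q * (X ^ q) ^ ?j / fact ?j"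
      using G X by (intro frac_le) auto
    then show ?thesis
      using G order.strict_trans2[OF fact_gt_zero G] by (simp add: power_abs)
  qed
  have "(\<lambda>j. (X ^ q) ^ j / fact j) \<longlonglongrightarrow> 0"
    using summable_LIMSEQ_zero[OF summable_exp[of "X ^ q"]] by (simp add: divide_inverse mult.commute)
  moreover have "filterlim (\<lambda>n. n div q) at_top sequentially"
    unfolding filterlim_at_top eventually_sequentially
  proof
    fix Z
    show "\<exists>N. \<forall>n\<ge>N. Z \<le> n div q"
      using q0 by (intro exI[of _ "Z * q"]) (auto simp: less_eq_div_iff_mult_less_eq)
  qed
  ultimately have "(\<lambda>n. (X ^ q) ^ (n div q) / fact (n div q)) \<longlonglongrightarrow> 0"
    by (rule filterlim_compose)
  from tendsto_mult_right_zero[OF this, of "X ^ q"] have "?g \<longlonglongrightarrow> 0" .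
  then show ?thesis
    by (rule Lim_null_comparison[rotated])
      (use bound in \<open>auto simp: eventually_sequentially\<close>)
qed

lemma frac_kernel_bounded_integrable:
  assumes a: "a > 0" and [measurable]: "g \<in> borel_measurable borel"
    and g: "AE t in lborel. \<bar>g t\<bar> \<le> C * indicator {0<..} t"
  shows "integrable lborel (\<lambda>s. frac_kernel a (t - s) * g s)"
proof (rule Bochner_Integration.integrable_bound)
  show "integrable lborel (\<lambda>s. C * (indicator {0<..} s * frac_kernel a (t - s)))"
    by (intro integrable_mult_right integrable.intros[OF frac_kernel_primitive[OF a]])
  show "AE s in lborel. norm (frac_kernel a (t - s) * g s) \<le> norm (C * (indicator {0<..} s * frac_kernel a (t - s)))"
    using g
  proof eventually_elim
    fix s assume "\<bar>g s\<bar> \<le> C * indicator {0<..} s"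
    then have "\<bar>g s\<bar> * frac_kernel a (t - s) \<le> \<bar>C * indicator {0<..} s\<bar> * frac_kernel a (t - s)"
      using frac_kernel_nonneg[OF a, of "t - s"] by (intro mult_right_mono) auto
    then show "norm (frac_kernel a (t - s) * g s) \<le> norm (C * (indicator {0<..} s * frac_kernel a (t - s)))"
      using frac_kernel_nonneg[OF a, of "t - s"] by (simp add: abs_mult mult_ac)
  qed
qed measurable

lemma frac_kernel_convolution_assoc:
  assumes a: "a > 0" and b: "b > 0" and [measurable]: "g \<in> borel_measurable borel"
    and g: "AE t in lborel. \<bar>g t\<bar> \<le> C * indicator {0<..} t"
  shows "(\<integral>t. frac_kernel a (S - t) * (\<integral>s. frac_kernel b (t - s) * g s \<partial>lborel) \<partial>lborel) =
    (\<integral>s. frac_kernel (a + b) (S - s) * g s \<partial>lborel)"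
proof -
  have conv: "has_bochner_integral lborel (\<lambda>t. frac_kernel a (S - t) * frac_kernel b (t - s)) (frac_kernel (a + b) (S - s))" for s
  proof -
    have "has_bochner_integral lborel (\<lambda>t. frac_kernel a (S - s - (- s + 1 * t)) * frac_kernel b (- s + 1 * t))
      (frac_kernel (a + b) (S - s) /\<^sub>R \<bar>1\<bar>)"
      using frac_kernel_convolution[OF a b, of "S - s"]
      by (subst lborel_has_bochner_integral_real_affine_iff[symmetric]) simp_all
    then show ?thesis by (simp add: algebra_simps)
  qed
  have ki: "(\<integral>t. frac_kernel a (S - t) * frac_kernel b (t - s) \<partial>lborel) = frac_kernel (a + b) (S - s)"
    and kint: "integrable lborel (\<lambda>t. frac_kernel a (S - t) * frac_kernel b (t - s))" for s
    using conv[of s] by (auto simp: has_bochner_integral_iff)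
  have nn: "frac_kernel a x \<ge> 0" "frac_kernel b x \<ge> 0" for x
    using frac_kernel_nonneg a b by auto
  have "integrable (lborel \<Otimes>\<^sub>M lborel) (\<lambda>(s, t). frac_kernel a (S - t) * (frac_kernel b (t - s) * g s))"
  proof (rule lborel_pair.Fubini_integrable)
    have "integrable lborel (\<lambda>s. frac_kernel (a + b) (S - s) * \<bar>g s\<bar>)"
      using g a b by (intro frac_kernel_bounded_integrable) auto
    moreover have "(\<integral>t. norm (frac_kernel a (S - t) * (frac_kernel b (t - s) * g s)) \<partial>lborel) =
        frac_kernel (a + b) (S - s) * \<bar>g s\<bar>" for s
    proof -
      have "(\<integral>t. norm (frac_kernel a (S - t) * (frac_kernel b (t - s) * g s)) \<partial>lborel) =
          (\<integral>t. frac_kernel a (S - t) * frac_kernel b (t - s) * \<bar>g s\<bar> \<partial>lborel)"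
        by (intro Bochner_Integration.integral_cong) (simp_all add: abs_mult nn)
      then show ?thesis using ki by simp
    qed
    ultimately show "integrable lborel (\<lambda>s. \<integral>t. norm (case (s, t) of (s, t) \<Rightarrow>
        frac_kernel a (S - t) * (frac_kernel b (t - s) * g s)) \<partial>lborel)"
      by simp
    show "AE s in lborel. integrable lborel (\<lambda>t. case (s, t) of (s, t) \<Rightarrow>
        frac_kernel a (S - t) * (frac_kernel b (t - s) * g s))"
      using kint by (intro AE_I2) (simp add: mult.assoc[symmetric])
  qed measurable
  then have "(\<integral>t. \<integral>s. frac_kernel a (S - t) * (frac_kernel b (t - s) * g s) \<partial>lborel \<partial>lborel) =
      (\<integral>s. \<integral>t. frac_kernel a (S - t) * (frac_kernel b (t - s) * g s) \<partial>lborel \<partial>lborel)"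
    by (rule lborel_pair.Fubini_integral)
  also have "\<dots> = (\<integral>s. frac_kernel (a + b) (S - s) * g s \<partial>lborel)"
    by (simp add: mult.assoc[symmetric] ki)
  finally show ?thesis by simp
qed

text \<open>Convolving with \<open>frac_kernel \<alpha>\<close> turns the first term into the
  primitive G of g, so G = -\<kappa> (\<open>frac_kernel \<alpha>\<close> * G). Iterating this
  bounds G by C \<kappa>^n times a kernel of order 2 + \<alpha> n, which tends to 0. The statement
  is about the primitive because it is defined at every point, while g is controlled almost
  everywhere only.\<close>

lemma fractional_Volterra_unique:
  fixes g :: "real \<Rightarrow> real"
  assumes \<alpha>: "0 < \<alpha>" "\<alpha> < 1" and \<kappa>: "\<kappa> \<ge> 0" and [measurable]: "g \<in> borel_measurable borel"
    and g: "AE t in lborel. \<bar>g t\<bar> \<le> C * indicator {0<..} t" and C: "C \<ge> 0"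
    and eq: "\<And>S. S \<le> T \<Longrightarrow>
      (\<integral>t. frac_kernel (1 - \<alpha>) (S - t) * g t \<partial>lborel) + \<kappa> * (\<integral>t. frac_kernel 1 (S - t) * g t \<partial>lborel) = 0"
    and S: "S \<le> T"
  shows "(\<integral>t. frac_kernel 1 (S - t) * g t \<partial>lborel) = 0"
proof -
  define G where "G = (\<lambda>S. \<integral>t. frac_kernel 1 (S - t) * g t \<partial>lborel)"
  have G_meas [measurable]: "G \<in> borel_measurable borel" unfolding G_def by measurable
  have GG: "G S = - \<kappa> * (\<integral>t. frac_kernel \<alpha> (S - t) * G t \<partial>lborel)" if "S \<le> T" for S
  proof -
    have "G S = (\<integral>t. frac_kernel \<alpha> (S - t) * (\<integral>s. frac_kernel (1 - \<alpha>) (t - s) * g s \<partial>lborel) \<partial>lborel)"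
      unfolding G_def using \<alpha> by (subst frac_kernel_convolution_assoc[OF _ _ _ g]) auto
    also have "\<dots> = (\<integral>t. frac_kernel \<alpha> (S - t) * (- \<kappa> * G t) \<partial>lborel)"
    proof (intro Bochner_Integration.integral_cong refl)
      fix t
      show "frac_kernel \<alpha> (S - t) * (\<integral>s. frac_kernel (1 - \<alpha>) (t - s) * g s \<partial>lborel) =
        frac_kernel \<alpha> (S - t) * (- \<kappa> * G t)"
      proof (cases "t < S")
        case True
        then show ?thesis using eq[of t] that by (simp add: G_def add_eq_0_iff)
      qed (simp add: frac_kernel_def)
    qed
    also have "\<dots> = (\<integral>t. - \<kappa> * (frac_kernel \<alpha> (S - t) * G t) \<partial>lborel)"
      by (simp add: mult_ac)
    finally show ?thesis by simp
  qed
  \<comment> \<open>The kernel of order 2 is S for S > 0 and 0 otherwise, so the start n = 0 says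
    that G grows at most linearly and vanishes up to time 0. Each iteration raises the order by
    \<alpha>.\<close>
  have bound: "\<bar>G S\<bar> \<le> C * \<kappa> ^ n * frac_kernel (2 + \<alpha> * n) S" if "S \<le> T" for n S
    using that
  proof (induction n arbitrary: S)
    case 0
    have "\<bar>G S\<bar> \<le> (\<integral>t. \<bar>frac_kernel 1 (S - t) * g t\<bar> \<partial>lborel)"
      unfolding G_def by (rule integral_abs_bound)
    also have "\<dots> \<le> (\<integral>t. C * (indicator {0<..} t * frac_kernel 1 (S - t)) \<partial>lborel)"
    proof (rule integral_mono_AE)
      show "integrable lborel (\<lambda>t. \<bar>frac_kernel 1 (S - t) * g t\<bar>)"
        by (intro integrable_abs frac_kernel_bounded_integrable[OF _ _ g]) auto
      show "integrable lborel (\<lambda>t. C * (indicator {0<..} t * frac_kernel 1 (S - t)))"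
        by (intro integrable_mult_right integrable.intros[OF frac_kernel_primitive]) simp
      show "AE t in lborel. \<bar>frac_kernel 1 (S - t) * g t\<bar> \<le> C * (indicator {0<..} t * frac_kernel 1 (S - t))"
        using g
      proof eventually_elim
        fix t assume "\<bar>g t\<bar> \<le> C * indicator {0<..} t"
        from mult_right_mono[OF this, of "frac_kernel 1 (S - t)"]
        show "\<bar>frac_kernel 1 (S - t) * g t\<bar> \<le> C * (indicator {0<..} t * frac_kernel 1 (S - t))"
          by (simp add: abs_mult frac_kernel_nonneg mult_ac)
      qed
    qed
    also have "\<dots> = C * frac_kernel 2 S"
      using frac_kernel_primitive[of 1 S] by (simp add: has_bochner_integral_iff)
    finally show ?case by simp
  next
    case (Suc n)
    have nn: "frac_kernel \<alpha> x \<ge> 0" for x using \<alpha> by (intro frac_kernel_nonneg)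
    let ?b = "C * \<kappa> ^ n"
    have hb: "has_bochner_integral lborel (\<lambda>t. ?b * (frac_kernel \<alpha> (S - t) * frac_kernel (2 + \<alpha> * n) t))
      (?b * frac_kernel (\<alpha> + (2 + \<alpha> * n)) S)"
      using \<alpha> by (intro has_bochner_integral_mult_right frac_kernel_convolution) (auto intro: add_pos_nonneg)
    have le: "\<bar>frac_kernel \<alpha> (S - t) * G t\<bar> \<le> ?b * (frac_kernel \<alpha> (S - t) * frac_kernel (2 + \<alpha> * n) t)" for t
    proof (cases "t < S")
      case True
      then have "\<bar>G t\<bar> \<le> ?b * frac_kernel (2 + \<alpha> * n) t" using Suc by simp
      from mult_left_mono[OF this nn[of "S - t"]] show ?thesis
        by (simp add: abs_mult nn mult_ac)
    qed (simp add: frac_kernel_def)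
    have "\<bar>G S\<bar> = \<kappa> * \<bar>\<integral>t. frac_kernel \<alpha> (S - t) * G t \<partial>lborel\<bar>"
      using GG[OF Suc.prems] \<kappa> by (simp add: abs_mult)
    also have "\<dots> \<le> \<kappa> * (\<integral>t. ?b * (frac_kernel \<alpha> (S - t) * frac_kernel (2 + \<alpha> * n) t) \<partial>lborel)"
    proof (intro mult_left_mono \<kappa>)
      have "\<bar>\<integral>t. frac_kernel \<alpha> (S - t) * G t \<partial>lborel\<bar> \<le> (\<integral>t. \<bar>frac_kernel \<alpha> (S - t) * G t\<bar> \<partial>lborel)"
        by (rule integral_abs_bound)
      also have "\<dots> \<le> (\<integral>t. ?b * (frac_kernel \<alpha> (S - t) * frac_kernel (2 + \<alpha> * n) t) \<partial>lborel)"
      proof (rule integral_mono)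
        show "integrable lborel (\<lambda>t. \<bar>frac_kernel \<alpha> (S - t) * G t\<bar>)"
          by (rule Bochner_Integration.integrable_bound[OF integrable.intros[OF hb]])
            (use le in \<open>auto intro!: AE_I2 order_trans[OF le abs_ge_self]\<close>)
      qed (use le integrable.intros[OF hb] in auto)
      finally show "\<bar>\<integral>t. frac_kernel \<alpha> (S - t) * G t \<partial>lborel\<bar> \<le>
        (\<integral>t. ?b * (frac_kernel \<alpha> (S - t) * frac_kernel (2 + \<alpha> * n) t) \<partial>lborel)" .
    qed
    also have "\<dots> = \<kappa> * (?b * frac_kernel (\<alpha> + (2 + \<alpha> * n)) S)"
      by (subst has_bochner_integral_integral_eq[OF hb]) (rule refl)
    also have "\<dots> = C * \<kappa> ^ Suc n * frac_kernel (2 + \<alpha> * Suc n) S"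
      by (simp add: algebra_simps)
    finally show ?case .
  qed
  have "G S = 0"
  proof (cases "S > 0")
    case False
    then show ?thesis using bound[OF S, of 0] by (simp add: frac_kernel_def)
  next
    case True
    have eq: "C * \<kappa> ^ n * frac_kernel (2 + \<alpha> * n) S = C * S * ((\<kappa> * S powr \<alpha>) ^ n / Gamma (2 + \<alpha> * n))" for n
    proof -
      have "S powr (2 + \<alpha> * n - 1) = S * (S powr \<alpha>) ^ n"
        using True powr_add[of S 1 "\<alpha> * n"] by (simp add: powr_powr[symmetric] powr_realpow)
      then show ?thesis using True by (simp add: frac_kernel_def power_mult_distrib)
    qed
    have "(\<lambda>n. C * S * ((\<kappa> * S powr \<alpha>) ^ n / Gamma (2 + \<alpha> * n))) \<longlonglongrightarrow> C * S * 0"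
      using \<alpha> by (intro tendsto_intros power_over_Gamma_tendsto_0) auto
    moreover have "\<bar>G S\<bar> \<le> C * S * ((\<kappa> * S powr \<alpha>) ^ n / Gamma (2 + \<alpha> * n))" for n
      using bound[OF S, of n] unfolding eq .
    ultimately have "\<bar>G S\<bar> \<le> C * S * 0"
      by (intro LIMSEQ_le_const) auto
    then show ?thesis by simp
  qed
  then show ?thesis by (simp add: G_def)
qed

section \<open>Test functions\<close>

definition exp_bump :: "real poly \<Rightarrow> real \<Rightarrow> real" where
  "exp_bump p x = (if x > 0 then poly p (1 / x) * exp (- (1 / x)) else 0)"

lemma poly_times_exp_minus_tendsto_0:
  fixes p :: "real poly"
  shows "((\<lambda>y. poly p y * exp (- y)) \<longlongrightarrow> 0) at_top"
proof -
  have "((\<lambda>y. \<Sum>i\<le>degree p. coeff p i * (y ^ i / exp y)) \<longlongrightarrow> (\<Sum>i\<le>degree p. coeff p i * 0)) at_top"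
    by (intro tendsto_intros tendsto_power_div_exp_0)
  moreover have "(\<lambda>y. \<Sum>i\<le>degree p. coeff p i * (y ^ i / exp y)) = (\<lambda>y. poly p y * exp (- y))"
    by (simp add: fun_eq_iff poly_altdef sum_distrib_right exp_minus divide_inverse mult.assoc)
  ultimately show ?thesis by simp
qed

text \<open>With y = 1 / x the derivative in x is -y^2 times that in y, and p(y) exp(-y) goes to y^2
  (p - p')(y) exp(-y). The family is thus closed under differentiation, and this single formula
  yields derivatives of all orders. At 0 the difference quotient from the right is again of this
  form, with y p(y), and tends to 0.\<close>

lemma exp_bump_has_derivative:
  "(exp_bump p has_real_derivative exp_bump ([:0, 0, 1:] * (p - pderiv p)) x) (at x)"
proof -
  let ?q = "[:0, 0, 1:] * (p - pderiv p)"
  consider "x > 0" | "x < 0" | "x = 0" by linarith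
  then show ?thesis
  proof cases
    case 1
    have "((\<lambda>x. poly p (1 / x) * exp (- (1 / x))) has_real_derivative poly ?q (1 / x) * exp (- (1 / x))) (at x)"
      using 1 by (auto intro!: derivative_eq_intros poly_DERIV[THEN DERIV_chain2] simp: field_simps power2_eq_square)
    then have "((\<lambda>x. poly p (1 / x) * exp (- (1 / x))) has_real_derivative exp_bump ?q x) (at x)"
      using 1 by (simp add: exp_bump_def)
    then show ?thesis
      by (rule has_field_derivative_transform_within_open[of _ _ _ "{0<..}"])
        (use 1 in \<open>auto simp: exp_bump_def\<close>)
  next
    case 2
    have "((\<lambda>x. 0) has_real_derivative exp_bump ?q x) (at x)"
      using 2 by (simp add: exp_bump_def)
    then show ?thesis
      by (rule has_field_derivative_transform_within_open[of _ _ _ "{..<0}"])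
        (use 2 in \<open>auto simp: exp_bump_def\<close>)
  next
    case 3
    have "((\<lambda>h. exp_bump p h / h) \<longlongrightarrow> 0) (at 0)"
    proof (rule filterlim_split_at)
      have "((\<lambda>h. 0::real) \<longlongrightarrow> 0) (at_left 0)" by simp
      then show "((\<lambda>h. exp_bump p h / h) \<longlongrightarrow> 0) (at_left 0)"
        by (rule tendsto_cong[THEN iffD1, rotated])
          (auto simp: exp_bump_def eventually_at_filter)
      have "((\<lambda>h::real. poly (pCons 0 p) (1 / h) * exp (- (1 / h))) \<longlongrightarrow> 0) (at_right 0)"
        using filterlim_compose[OF poly_times_exp_minus_tendsto_0[of "pCons 0 p"] filterlim_inverse_at_top_right]
        by (simp add: inverse_eq_divide)
      then show "((\<lambda>h. exp_bump p h / h) \<longlongrightarrow> 0) (at_right 0)"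
        by (rule tendsto_cong[THEN iffD1, rotated])
          (auto simp: exp_bump_def eventually_at_filter field_simps)
    qed
    then show ?thesis
      using 3 by (simp add: has_field_derivative_iff exp_bump_def)
  qed
qed

lemma exp_bump_pos: "x > 0 \<Longrightarrow> exp_bump 1 x > 0"
  by (simp add: exp_bump_def)

text \<open>The bump is the product of two one-sided ones, positive for x < 1 and for x > -1,
  normalised at 0. Its explicit form is part of the conclusion because smoothness of all orders is
  derived from the closed family \<open>exp_bump\<close>; the two derivatives and their bounds serve
  the Laplacian.\<close>

lemma compactly_supported_bump:
  obtains h h' h'' :: "real \<Rightarrow> real" and B p q where
    "h = (\<lambda>x. B * (exp_bump p (1 - x) * exp_bump q (1 + x)))" "h 0 = 1"
    "\<And>x. (h has_real_derivative h' x) (at x)" "\<And>x. (h' has_real_derivative h'' x) (at x)"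
    "\<And>x. \<bar>x\<bar> > 1 \<Longrightarrow> h x = 0"
    "\<exists>C. \<forall>x. \<bar>h x\<bar> \<le> C \<and> \<bar>h' x\<bar> \<le> C \<and> \<bar>h'' x\<bar> \<le> C" "continuous_on UNIV h''"
proof -
  define B where "B = 1 / (exp_bump 1 1 * exp_bump 1 1)"
  define q :: "real poly" where "q = [:0, 0, 1:] * (1 - pderiv 1)"
  define r where "r = [:0, 0, 1:] * (q - pderiv q)"
  let ?e = exp_bump
  define h where "h = (\<lambda>x. B * (?e 1 (1 - x) * ?e 1 (1 + x)))"
  define h' where "h' = (\<lambda>x. B * (?e 1 (1 - x) * ?e q (1 + x) - ?e q (1 - x) * ?e 1 (1 + x)))"
  define h'' where "h'' = (\<lambda>x. B * (?e 1 (1 - x) * ?e r (1 + x) - 2 * ?e q (1 - x) * ?e q (1 + x)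
      + ?e r (1 - x) * ?e 1 (1 + x)))"
  have d1 [derivative_intros]: "((\<lambda>x. ?e 1 (g x)) has_real_derivative ?e q (g x) * g') (at x)"
    if "(g has_real_derivative g') (at x)" for g g' x
    using DERIV_chain2[OF exp_bump_has_derivative that, of 1] by (simp add: q_def)
  have d2 [derivative_intros]: "((\<lambda>x. ?e q (g x)) has_real_derivative ?e r (g x) * g') (at x)"
    if "(g has_real_derivative g') (at x)" for g g' x
    using DERIV_chain2[OF exp_bump_has_derivative that, of q] by (simp add: r_def)
  have cont [continuous_intros]: "continuous_on A (\<lambda>x. ?e p (g x))" if "continuous_on A g" for A p and g :: "real \<Rightarrow> real"
    using continuous_on_compose2[OF _ that, of UNIV "?e p"] exp_bump_has_derivative
    by (meson DERIV_isCont UNIV_I continuous_at_imp_continuous_on subset_UNIV)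
  have D: "(h has_real_derivative h' x) (at x)" "(h' has_real_derivative h'' x) (at x)" for x
    unfolding h_def h'_def h''_def
    by (auto intro!: derivative_eq_intros simp: algebra_simps)
  have zero: "h x = 0" "h' x = 0" "h'' x = 0" if "\<bar>x\<bar> > 1" for x
    using that by (auto simp: h_def h'_def h''_def exp_bump_def abs_if split: if_splits)
  have c: "continuous_on A h" "continuous_on A h'" "continuous_on A h''" for A
    unfolding h_def h'_def h''_def by (intro continuous_intros)+
  have bd: "\<exists>C. \<forall>x. \<bar>f x\<bar> \<le> C" if "continuous_on {-1..1} f" "\<And>x. \<bar>x\<bar> > 1 \<Longrightarrow> f x = 0" for f :: "real \<Rightarrow> real"
  proof -
    have "bounded (f ` {-1..1})"
      using that(1) by (intro compact_imp_bounded compact_continuous_image) auto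
    then obtain C where "\<forall>y\<in>f ` {-1..1}. norm y \<le> C"
      unfolding bounded_iff by blast
    then have C: "\<bar>f x\<bar> \<le> C" if "x \<in> {-1..1}" for x
      using that by auto
    have "\<bar>f x\<bar> \<le> max C 0" for x
      using C[of x] that(2)[of x] by (cases "\<bar>x\<bar> > 1") (auto simp: abs_if split: if_splits)
    then show ?thesis by blast
  qed
  obtain C1 C2 C3 where C: "\<And>x. \<bar>h x\<bar> \<le> C1" "\<And>x. \<bar>h' x\<bar> \<le> C2" "\<And>x. \<bar>h'' x\<bar> \<le> C3"
    using bd[OF c(1) zero(1)] bd[OF c(2) zero(2)] bd[OF c(3) zero(3)] by metis
  have "\<bar>h x\<bar> \<le> max C1 (max C2 C3) \<and> \<bar>h' x\<bar> \<le> max C1 (max C2 C3) \<and> \<bar>h'' x\<bar> \<le> max C1 (max C2 C3)" for x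
    using C[of x] by (auto simp: le_max_iff_disj)
  moreover have "h 0 = 1"
    using exp_bump_pos[of 1] by (simp add: h_def B_def)
  ultimately show thesis
    using that[OF h_def _ D zero(1) _ c(3)] by blast
qed

section \<open>Differential calculus within a set\<close>

definition unique_derivatives :: "'a::real_normed_vector set \<Rightarrow> bool" where
  "unique_derivatives S \<longleftrightarrow> (\<forall>p\<in>S. \<forall>(f :: 'a \<Rightarrow> real) f'.
     (f has_derivative f') (at p within S) \<longrightarrow> frechet_derivative f (at p within S) = f')"

text \<open>\<open>frechet_derivative\<close> within a set is an arbitrary choice where several
  linear maps qualify. It is unique once every basis direction admits arbitrarily short steps inside
  the set. Spatial steps are free, and a time step can always be directed towards the middle of
  [0,T].\<close>

lemma unique_derivatives_slab:
  assumes "T > (0::real)"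
  shows "unique_derivatives ({0..T} \<times> (UNIV :: 'a::euclidean_space set))"
  unfolding unique_derivatives_def
proof (intro ballI allI impI)
  fix p :: "real \<times> 'a" and f :: "real \<times> 'a \<Rightarrow> real" and f'
  let ?S = "{0..T} \<times> (UNIV :: 'a set)"
  assume p: "p \<in> ?S" and f: "(f has_derivative f') (at p within ?S)"
  have "(f has_derivative frechet_derivative f (at p within ?S)) (at p within ?S)"
    using f frechet_derivative_works differentiableI by blast
  then show "frechet_derivative f (at p within ?S) = f'"
  proof (rule frechet_derivative_unique_within[OF _ f])
    fix i :: "real \<times> 'a" and e :: real
    assume i: "i \<in> Basis" and e: "e > 0"
    show "\<exists>d. 0 < \<bar>d\<bar> \<and> \<bar>d\<bar> < e \<and> p + d *\<^sub>R i \<in> ?S"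
    proof (cases "fst i = 0")
      case True
      then show ?thesis using p e by (intro exI[of _ "e / 2"]) (auto simp: mem_Times_iff)
    next
      case False
      then have i1: "fst i = 1" using i by (auto simp: Basis_prod_def)
      define d where "d = min e T / 2"
      have d: "0 < d" "d < e" "d \<le> T / 2" using e assms by (auto simp: d_def)
      show ?thesis
      proof (cases "fst p \<le> T / 2")
        case True
        then show ?thesis using p d i1 by (intro exI[of _ d]) (auto simp: mem_Times_iff)
      next
        case False
        then show ?thesis using p d i1 by (intro exI[of _ "- d"]) (auto simp: mem_Times_iff)
      qed
    qed
  qed
qed

text \<open>Invariance under equality on S is an assumption here because it is itself proved by
  induction with this rule; \<open>Ck_on_intro\<close> is the version with the assumption
  discharged.\<close>

lemma Ck_on_SucI:
  assumes "unique_derivatives S"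
    and "\<And>p. p \<in> S \<Longrightarrow> (f has_derivative D p) (at p within S)"
    and "\<And>v. Ck_on k S (\<lambda>p. D p v)"
    and cong: "\<And>f g. (\<And>p. p \<in> S \<Longrightarrow> f p = g p) \<Longrightarrow> Ck_on k S f \<Longrightarrow> Ck_on k S g"
  shows "Ck_on (Suc k) S f"
proof -
  have "frechet_derivative f (at p within S) = D p" if "p \<in> S" for p
    using assms(1,2) that unfolding unique_derivatives_def by blast
  then have "Ck_on k S (\<lambda>p. frechet_derivative f (at p within S) v)" for v
    by (intro cong[OF _ assms(3)[of v]]) simp
  then show ?thesis using assms(2) by (auto simp: differentiable_def)
qed

lemma Ck_on_cong:
  assumes "unique_derivatives S" and eq: "\<And>p. p \<in> S \<Longrightarrow> f p = g p" and "Ck_on k S f"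
  shows "Ck_on k S g"
  using eq \<open>Ck_on k S f\<close>
proof (induction k arbitrary: f g)
  case 0
  then show ?case using continuous_on_cong[of S S f g] by simp
next
  case (Suc k)
  show ?case
  proof (rule Ck_on_SucI[OF assms(1), where D = "\<lambda>p. frechet_derivative f (at p within S)"])
    fix p assume p: "p \<in> S"
    have "(f has_derivative frechet_derivative f (at p within S)) (at p within S)"
      using Suc.prems(2) p frechet_derivative_works by auto
    then show "(g has_derivative frechet_derivative f (at p within S)) (at p within S)"
      by (rule has_derivative_transform_within[of _ _ _ _ 1]) (use p Suc.prems(1) in auto)
  qed (use Suc in auto)
qed

lemmas Ck_on_intro = Ck_on_SucI[OF _ _ _ Ck_on_cong]

lemma Ck_on_SucD: "Ck_on (Suc k) S f \<Longrightarrow> Ck_on k S f"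
proof (induction k arbitrary: f)
  case 0
  then show ?case by (auto simp: continuous_on_eq_continuous_within differentiable_imp_continuous_within)
next
  case (Suc k)
  have "(\<forall>x\<in>S. f differentiable at x within S) \<and>
      (\<forall>v. Ck_on (Suc k) S (\<lambda>x. frechet_derivative f (at x within S) v))"
    using Suc.prems by (rule Ck_on.simps(2)[of "Suc k" S f, THEN iffD1])
  then have 1: "\<forall>x\<in>S. f differentiable at x within S"
    and 2: "\<And>v. Ck_on (Suc k) S (\<lambda>x. frechet_derivative f (at x within S) v)"
    by blast+
  show ?case
    using 1 Suc.IH[OF 2] by simp
qed

lemma Ck_on_derivative:
  assumes "Ck_on (Suc k) S f" "p \<in> S"
  shows "(f has_derivative frechet_derivative f (at p within S)) (at p within S)"
  using assms frechet_derivative_works by auto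

lemma Ck_on_const:
  assumes "unique_derivatives S"
  shows "Ck_on k S (\<lambda>_. c)"
proof (induction k arbitrary: c)
  case (Suc k)
  show ?case
    by (rule Ck_on_intro[OF assms _ _ assms, where D = "\<lambda>_ _. 0"]) (use Suc in auto)
qed simp

lemma Ck_on_add:
  assumes "unique_derivatives S" "Ck_on k S f" "Ck_on k S g"
  shows "Ck_on k S (\<lambda>p. f p + g p)"
  using assms(2,3)
proof (induction k arbitrary: f g)
  case 0
  then show ?case by (auto intro: continuous_on_add)
next
  case (Suc k)
  show ?case
  proof (rule Ck_on_intro[OF assms(1) _ _ assms(1)])
    show "((\<lambda>p. f p + g p) has_derivative
        (\<lambda>v. frechet_derivative f (at p within S) v + frechet_derivative g (at p within S) v)) (at p within S)"
      if "p \<in> S" for p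
      by (intro has_derivative_add Ck_on_derivative[OF Suc.prems(1) that] Ck_on_derivative[OF Suc.prems(2) that])
  qed (use Suc in auto)
qed

lemma Ck_on_mult:
  assumes "unique_derivatives S" "Ck_on k S f" "Ck_on k S g"
  shows "Ck_on k S (\<lambda>p. f p * g p)"
  using assms(2,3)
proof (induction k arbitrary: f g)
  case 0
  then show ?case by (auto intro: continuous_on_mult)
next
  case (Suc k)
  show ?case
  proof (rule Ck_on_intro[OF assms(1) _ _ assms(1)])
    show "((\<lambda>p. f p * g p) has_derivative
        (\<lambda>v. f p * frechet_derivative g (at p within S) v + frechet_derivative f (at p within S) v * g p)) (at p within S)"
      if "p \<in> S" for p
      by (intro has_derivative_mult Ck_on_derivative[OF Suc.prems(1) that] Ck_on_derivative[OF Suc.prems(2) that])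
    show "Ck_on k S (\<lambda>p. f p * frechet_derivative g (at p within S) v + frechet_derivative f (at p within S) v * g p)" for v
      using Suc.prems by (intro Ck_on_add[OF assms(1)] Suc.IH Ck_on_SucD[OF Suc.prems(1)] Ck_on_SucD[OF Suc.prems(2)]) auto
  qed
qed

lemma Ck_on_prod:
  assumes "unique_derivatives S" "finite I" "\<And>i. i \<in> I \<Longrightarrow> Ck_on k S (f i)"
  shows "Ck_on k S (\<lambda>p. \<Prod>i\<in>I. f i p)"
  using assms(2,3)
  by (induction I rule: finite_induct) (auto intro!: Ck_on_const Ck_on_mult assms(1))

text \<open>The induction on k needs derivatives to be functions of the same kind, hence a family F
  closed under differentiation. It is applied to the bumps and to the linear combinations of sine
  and cosine.\<close>

lemma Ck_on_affine_compose:
  fixes F :: "(real \<Rightarrow> real) set" and l :: "'a::real_normed_vector \<Rightarrow> real"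
  assumes "unique_derivatives S" and l: "bounded_linear l"
    and F: "\<And>f. f \<in> F \<Longrightarrow> \<exists>f'\<in>F. \<forall>x. (f has_real_derivative f' x) (at x)" and "f \<in> F"
  shows "Ck_on k S (\<lambda>p. f (c + l p))"
  using \<open>f \<in> F\<close>
proof (induction k arbitrary: f)
  case 0
  then obtain f' where "\<And>x. (f has_real_derivative f' x) (at x)" using F by blast
  then have "continuous_on UNIV f"
    by (meson DERIV_isCont continuous_at_imp_continuous_on)
  moreover have "continuous_on S (\<lambda>p. c + l p)"
    by (intro continuous_intros linear_continuous_on l)
  ultimately show ?case by (auto intro: continuous_on_compose2)
next
  case (Suc k)
  then obtain f' where f': "f' \<in> F" "\<And>x. (f has_real_derivative f' x) (at x)" using F by blast
  show ?case
  proof (rule Ck_on_intro[OF assms(1) _ _ assms(1)])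
    fix p assume "p \<in> S"
    have "((\<lambda>p. c + l p) has_derivative l) (at p within S)"
      by (auto intro!: derivative_eq_intros bounded_linear.has_derivative[OF l])
    from has_derivative_compose[OF this, OF f'(2)[unfolded has_field_derivative_def]]
    show "((\<lambda>p. f (c + l p)) has_derivative (\<lambda>v. f' (c + l p) * l v)) (at p within S)" .
  next
    show "Ck_on k S (\<lambda>p. f' (c + l p) * l v)" for v
      by (intro Ck_on_mult assms(1) Suc.IH f'(1) Ck_on_const)
  qed
qed

section \<open>Products over the coordinates as test functions\<close>

lemma laplacian_product:
  fixes f :: "'a::euclidean_space \<Rightarrow> real \<Rightarrow> real"
  assumes f: "\<And>e y. (f e has_real_derivative f' e y) (at y)"
    and f': "\<And>e y. (f' e has_real_derivative f'' e y) (at y)"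
  shows "laplacian (\<lambda>x. \<Prod>e\<in>Basis. f e (x \<bullet> e)) x =
    (\<Sum>e\<in>Basis. f'' e (x \<bullet> e) * (\<Prod>e'\<in>Basis - {e}. f e' (x \<bullet> e')))"
  unfolding laplacian_def
proof (rule sum.cong[OF refl])
  fix e :: 'a assume e: "e \<in> Basis"
  define P where "P = (\<Prod>e'\<in>Basis - {e}. f e' (x \<bullet> e'))"
  have split: "(\<Prod>e'\<in>Basis. f e' ((x + s *\<^sub>R e) \<bullet> e')) = f e (x \<bullet> e + s) * P" for s
  proof -
    have "(\<Prod>e'\<in>Basis. f e' ((x + s *\<^sub>R e) \<bullet> e')) =
        f e ((x + s *\<^sub>R e) \<bullet> e) * (\<Prod>e'\<in>Basis - {e}. f e' ((x + s *\<^sub>R e) \<bullet> e'))"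
      using e by (intro prod.remove) auto
    also have "(\<Prod>e'\<in>Basis - {e}. f e' ((x + s *\<^sub>R e) \<bullet> e')) = P"
      unfolding P_def using e by (intro prod.cong) (auto simp: inner_add_left inner_Basis)
    finally show ?thesis using e by (simp add: inner_add_left)
  qed
  have d1: "((\<lambda>s. f e (x \<bullet> e + s) * P) has_real_derivative f' e (x \<bullet> e + s) * P) (at s)" for s
  proof -
    have "((\<lambda>s. f e (x \<bullet> e + s)) has_real_derivative f' e (x \<bullet> e + s) * 1) (at s)"
      by (rule DERIV_chain2[OF f]) (auto intro!: derivative_eq_intros)
    then show ?thesis by (intro DERIV_cmult_right) simp
  qed
  have d2: "((\<lambda>s. f' e (x \<bullet> e + s) * P) has_real_derivative f'' e (x \<bullet> e + s) * P) (at s)" for s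
  proof -
    have "((\<lambda>s. f' e (x \<bullet> e + s)) has_real_derivative f'' e (x \<bullet> e + s) * 1) (at s)"
      by (rule DERIV_chain2[OF f']) (auto intro!: derivative_eq_intros)
    then show ?thesis by (intro DERIV_cmult_right) simp
  qed
  have "deriv (\<lambda>s. f e (x \<bullet> e + s) * P) = (\<lambda>s. f' e (x \<bullet> e + s) * P)"
    using d1 by (auto intro!: DERIV_imp_deriv)
  then show "(deriv ^^ 2) (\<lambda>s. \<Prod>e'\<in>Basis. f e' ((x + s *\<^sub>R e) \<bullet> e')) 0 = f'' e (x \<bullet> e) * P"
    unfolding split using DERIV_imp_deriv[OF d2[of 0]] by (simp add: numeral_2_eq_2)
qed

lemma test_function_product:
  fixes c \<xi> :: "'a::euclidean_space \<Rightarrow> real"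
  assumes T: "T > 0" and R: "R > 0" and h: "h = (\<lambda>x. B * (exp_bump p (1 - x) * exp_bump q (1 + x)))"
    and supp: "\<And>x. \<bar>x\<bar> > 1 \<Longrightarrow> h x = 0"
  shows "test_function T (\<lambda>_ (x::'a). \<Prod>e\<in>Basis. h ((x \<bullet> e) / R) * cos (c e + \<xi> e * (x \<bullet> e)))"
  unfolding test_function_def
proof (intro conjI allI)
  fix k
  let ?S = "{0..T} \<times> (UNIV :: 'a set)"
  note uniq = unique_derivatives_slab[OF T, where 'a = 'a]
  have bump: "Ck_on k ?S (\<lambda>z. exp_bump p (1 + a * (snd z \<bullet> e)))" for p a and e :: 'a
    by (rule Ck_on_affine_compose[OF uniq _, where F = "range exp_bump"])
      (auto intro!: bounded_linear_intros exp_bump_has_derivative)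
  have cos: "Ck_on k ?S (\<lambda>z. cos (c e + \<xi> e * (snd z \<bullet> e)))" for e
  proof (rule Ck_on_affine_compose[OF uniq _, where F = "{\<lambda>x. a * cos x + b * sin x | a b. True}"])
    show "cos \<in> {\<lambda>x::real. a * cos x + b * sin x | a b. True}"
      by (rule CollectI, rule exI[of _ 1], rule exI[of _ 0]) simp
    show "\<exists>f'\<in>{\<lambda>x::real. a * cos x + b * sin x | a b. True}. \<forall>x. (f has_real_derivative f' x) (at x)"
      if "f \<in> {\<lambda>x::real. a * cos x + b * sin x | a b. True}" for f
    proof -
      from that obtain a b where f: "f = (\<lambda>x. a * cos x + b * sin x)" by blast
      show ?thesis
      proof (rule bexI[of _ "\<lambda>x. b * cos x + (- a) * sin x"])
        show "(\<lambda>x. b * cos x + (- a) * sin x) \<in> {\<lambda>x. a * cos x + b * sin x | a b. True}"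
          by (rule CollectI, rule exI[of _ b], rule exI[of _ "- a"]) simp
      qed (auto simp: f intro!: derivative_eq_intros)
    qed
  qed (auto intro!: bounded_linear_intros)
  have "Ck_on k ?S (\<lambda>z. \<Prod>e\<in>Basis.
      B * (exp_bump p (1 + (- 1 / R) * (snd z \<bullet> e)) * exp_bump q (1 + (1 / R) * (snd z \<bullet> e))) *
      cos (c e + \<xi> e * (snd z \<bullet> e)))"
    by (intro Ck_on_prod uniq Ck_on_mult Ck_on_const bump cos) auto
  then show "Ck_on k ?S (\<lambda>(t, x). \<Prod>e\<in>Basis. h ((x \<bullet> e) / R) * cos (c e + \<xi> e * (x \<bullet> e)))"
    by (simp add: h case_prod_unfold)
next
  let ?b = "cball 0 (real DIM('a) * R) :: 'a set"
  let ?A = "{(t, x) \<in> {0..T} \<times> UNIV. (\<Prod>e\<in>Basis. h ((x \<bullet> e) / R) * cos (c e + \<xi> e * (x \<bullet> e))) \<noteq> 0}"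
  have "?A \<subseteq> {0..T} \<times> ?b"
  proof clarsimp
    fix x :: 'a
    assume nz: "\<forall>e\<in>Basis. h ((x \<bullet> e) / R) \<noteq> 0 \<and> cos (c e + \<xi> e * (x \<bullet> e)) \<noteq> 0"
    have "\<bar>x \<bullet> e\<bar> \<le> R" if "e \<in> Basis" for e
    proof -
      have "\<bar>(x \<bullet> e) / R\<bar> \<le> 1" using nz supp[of "(x \<bullet> e) / R"] that by fastforce
      then show ?thesis using R by (simp add: abs_divide)
    qed
    then have "(\<Sum>e\<in>Basis. \<bar>x \<bullet> e\<bar>) \<le> (\<Sum>e\<in>(Basis :: 'a set). R)"
      by (intro sum_mono) auto
    then show "norm x \<le> real DIM('a) * R"
      using norm_le_l1[of x] by simp
  qed
  moreover have "bounded ({0..T} \<times> ?b)" by (intro bounded_Times) auto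
  ultimately show "compact (closure ?A)"
    by (simp add: compact_closure bounded_subset)
qed

text \<open>The test functions are \<open>\<Prod>\<^sub>e h(x\<^sub>e / n) cos (c\<^sub>e + \<xi>\<^sub>e x\<^sub>e)\<close> with a fixed bump \<open>h\<close>, \<open>h 0 = 1\<close>.\<close>

lemma trigonometric_test_functions:
  fixes c \<xi> :: "'a::euclidean_space \<Rightarrow> real"
  defines "w \<equiv> \<lambda>x. \<Prod>e\<in>Basis. cos (c e + \<xi> e * (x \<bullet> e))"
  obtains \<psi> :: "nat \<Rightarrow> 'a \<Rightarrow> real" and L :: "nat \<Rightarrow> 'a \<Rightarrow> real" and C :: real where
    "\<And>n T. T > 0 \<Longrightarrow> test_function T (\<lambda>_. \<psi> n)" "\<And>n. laplacian (\<psi> n) = L n"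
    "\<And>n. \<psi> n \<in> borel_measurable borel" "\<And>n. L n \<in> borel_measurable borel"
    "\<And>n x. \<bar>\<psi> n x\<bar> \<le> C" "\<And>n x. \<bar>L n x\<bar> \<le> C"
    "\<And>x. (\<lambda>n. \<psi> n x) \<longlonglongrightarrow> w x" "\<And>x. (\<lambda>n. L n x) \<longlonglongrightarrow> - (\<Sum>e\<in>Basis. (\<xi> e)\<^sup>2) * w x"
proof -
  obtain h h' h'' :: "real \<Rightarrow> real" and B p q where
    h: "h = (\<lambda>x. B * (exp_bump p (1 - x) * exp_bump q (1 + x)))" "h 0 = 1"
    and Dh: "\<And>x. (h has_real_derivative h' x) (at x)" "\<And>x. (h' has_real_derivative h'' x) (at x)"
    and supp: "\<And>x. \<bar>x\<bar> > 1 \<Longrightarrow> h x = 0"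
    and bd: "\<exists>C. \<forall>x. \<bar>h x\<bar> \<le> C \<and> \<bar>h' x\<bar> \<le> C \<and> \<bar>h'' x\<bar> \<le> C" and ch'': "continuous_on UNIV h''"
    by (rule compactly_supported_bump) (rule that)
  obtain C where C: "\<And>x. \<bar>h x\<bar> \<le> C" "\<And>x. \<bar>h' x\<bar> \<le> C" "\<And>x. \<bar>h'' x\<bar> \<le> C" using bd by blast
  have C0: "C \<ge> 0" using C(1)[of 0] by simp
  have isc: "isCont h x" "isCont h' x" "isCont h'' x" for x
    using DERIV_isCont[OF Dh(1)] DERIV_isCont[OF Dh(2)] ch''
    by (auto simp: continuous_on_eq_continuous_at)
  have [measurable]: "h \<in> borel_measurable borel" "h' \<in> borel_measurable borel" "h'' \<in> borel_measurable borel"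
    using isc by (auto intro!: borel_measurable_continuous_onI continuous_at_imp_continuous_on)
  \<comment> \<open>Scales n + 1 are at least 1, so the factors 1 / R that come with derivatives of
    h only improve the uniform bounds.\<close>
  define R where "R = (\<lambda>n. real (Suc n))"
  have R: "R n \<ge> 1" for n by (simp add: R_def)
  define f where "f = (\<lambda>n e y. h (y / R n) * cos (c e + \<xi> e * y))"
  define f' where "f' = (\<lambda>n e y. h' (y / R n) / R n * cos (c e + \<xi> e * y) - \<xi> e * (h (y / R n) * sin (c e + \<xi> e * y)))"
  define f'' where "f'' = (\<lambda>n e y. (h'' (y / R n) / (R n)\<^sup>2 - (\<xi> e)\<^sup>2 * h (y / R n)) * cos (c e + \<xi> e * y)
      - 2 * \<xi> e * (h' (y / R n) / R n * sin (c e + \<xi> e * y)))"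
  have R0: "R n \<noteq> 0" for n using R[of n] by linarith
  have dh: "((\<lambda>y. h (y / R n)) has_real_derivative h' (y / R n) / R n) (at y)"
    "((\<lambda>y. h' (y / R n)) has_real_derivative h'' (y / R n) / R n) (at y)" for n y
  proof -
    have r: "((\<lambda>y. y / R n) has_real_derivative 1 / R n) (at y)"
      using R0[of n] by (auto intro!: derivative_eq_intros)
    show "((\<lambda>y. h (y / R n)) has_real_derivative h' (y / R n) / R n) (at y)"
      "((\<lambda>y. h' (y / R n)) has_real_derivative h'' (y / R n) / R n) (at y)"
      using DERIV_chain2[OF Dh(1) r] DERIV_chain2[OF Dh(2) r] by simp_all
  qed
  have D: "(f n e has_real_derivative f' n e y) (at y)" "(f' n e has_real_derivative f'' n e y) (at y)" for n e y
    unfolding f_def f'_def f''_def using R0[of n]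
    by (auto intro!: derivative_eq_intros dh simp: field_simps power2_eq_square)
  define \<psi> where "\<psi> = (\<lambda>n (x::'a). \<Prod>e\<in>Basis. f n e (x \<bullet> e))"
  define L where "L = (\<lambda>n (x::'a). \<Sum>e\<in>Basis. f'' n e (x \<bullet> e) * (\<Prod>e'\<in>Basis - {e}. f n e' (x \<bullet> e')))"
  have lapl: "laplacian (\<psi> n) = L n" for n
    unfolding \<psi>_def L_def using laplacian_product[of "f n" "f' n" "f'' n", OF D] by (intro ext) simp
  have tf: "test_function T (\<lambda>_. \<psi> n)" if "T > 0" for n T
    using test_function_product[OF that _ h(1) supp, of "R n" c \<xi>] R[of n] unfolding \<psi>_def f_def by simp
  have bf: "\<bar>f n e y\<bar> \<le> C" for n e y
    using mult_mono[OF C(1) abs_cos_le_one C0] by (simp add: f_def abs_mult)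
  have bf'': "\<bar>f'' n e y\<bar> \<le> (C + (\<xi> e)\<^sup>2 * C) + 2 * \<bar>\<xi> e\<bar> * C" for n e y
  proof -
    have "\<bar>h'' (y / R n) / (R n)\<^sup>2\<bar> \<le> C / 1"
      unfolding abs_divide using C(3) R[of n] C0 by (intro frac_le) (auto simp: power2_eq_square mult_ge1_I)
    moreover have "\<bar>(\<xi> e)\<^sup>2 * h (y / R n)\<bar> \<le> (\<xi> e)\<^sup>2 * C"
      using C(1) by (simp add: abs_mult mult_left_mono)
    ultimately have 1: "\<bar>h'' (y / R n) / (R n)\<^sup>2 - (\<xi> e)\<^sup>2 * h (y / R n)\<bar> \<le> C + (\<xi> e)\<^sup>2 * C"
      by linarith
    have "\<bar>h' (y / R n) / R n\<bar> \<le> C / 1"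
      unfolding abs_divide using C(2) R[of n] C0 by (intro frac_le) auto
    then have "\<bar>h' (y / R n) / R n\<bar> * \<bar>sin (c e + \<xi> e * y)\<bar> \<le> C * 1"
      using C0 by (intro mult_mono) auto
    then have "2 * \<bar>\<xi> e\<bar> * (\<bar>h' (y / R n) / R n\<bar> * \<bar>sin (c e + \<xi> e * y)\<bar>) \<le> 2 * \<bar>\<xi> e\<bar> * (C * 1)"
      by (rule mult_left_mono) simp
    then have 2: "\<bar>2 * \<xi> e * (h' (y / R n) / R n * sin (c e + \<xi> e * y))\<bar> \<le> 2 * \<bar>\<xi> e\<bar> * C"
      by (simp only: abs_mult abs_numeral mult_1_right)
    have "\<bar>h'' (y / R n) / (R n)\<^sup>2 - (\<xi> e)\<^sup>2 * h (y / R n)\<bar> * \<bar>cos (c e + \<xi> e * y)\<bar> \<le> (C + (\<xi> e)\<^sup>2 * C) * 1"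
      using 1 C0 by (intro mult_mono) auto
    then have "\<bar>(h'' (y / R n) / (R n)\<^sup>2 - (\<xi> e)\<^sup>2 * h (y / R n)) * cos (c e + \<xi> e * y)\<bar> \<le> C + (\<xi> e)\<^sup>2 * C"
      by (simp only: abs_mult mult_1_right)
    then show ?thesis unfolding f''_def using 2 by linarith
  qed
  have b\<psi>: "\<bar>\<psi> n x\<bar> \<le> (\<Prod>e\<in>(Basis::'a set). C)" for n x
    unfolding \<psi>_def abs_prod by (intro prod_mono) (auto simp: bf)
  have bL: "\<bar>L n x\<bar> \<le> (\<Sum>e\<in>Basis. ((C + (\<xi> e)\<^sup>2 * C) + 2 * \<bar>\<xi> e\<bar> * C) * (\<Prod>e'\<in>Basis - {e}. C))" for n x
    unfolding L_def
  proof (rule order_trans[OF sum_abs], rule sum_mono)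
    fix e :: 'a
    have "\<bar>\<Prod>e'\<in>Basis - {e}. f n e' (x \<bullet> e')\<bar> \<le> (\<Prod>e'\<in>Basis - {e}. C)"
      unfolding abs_prod by (intro prod_mono) (auto simp: bf)
    then show "\<bar>f'' n e (x \<bullet> e) * (\<Prod>e'\<in>Basis - {e}. f n e' (x \<bullet> e'))\<bar> \<le>
      ((C + (\<xi> e)\<^sup>2 * C) + 2 * \<bar>\<xi> e\<bar> * C) * (\<Prod>e'\<in>Basis - {e}. C)"
      unfolding abs_mult using bf'' C0 by (intro mult_mono) auto
  qed
  have lim0: "(\<lambda>n. y / R n) \<longlonglongrightarrow> 0" for y
    unfolding R_def using tendsto_mult_right_zero[OF LIMSEQ_inverse_real_of_nat, of y]
    by (simp add: divide_inverse)
  have limh: "(\<lambda>n. h (y / R n)) \<longlonglongrightarrow> 1" "(\<lambda>n. h' (y / R n)) \<longlonglongrightarrow> h' 0" "(\<lambda>n. h'' (y / R n)) \<longlonglongrightarrow> h'' 0" for y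
    using isCont_tendsto_compose[OF isc(1) lim0[of y]] isCont_tendsto_compose[OF isc(2) lim0[of y]]
      isCont_tendsto_compose[OF isc(3) lim0[of y]] h(2) by simp_all
  have limR: "(\<lambda>n. a n / R n) \<longlonglongrightarrow> 0" if "a \<longlonglongrightarrow> b" for a b
    using tendsto_mult[OF that lim0[of 1]] by simp
  have limf: "(\<lambda>n. f n e y) \<longlonglongrightarrow> cos (c e + \<xi> e * y)" for e y
    unfolding f_def using tendsto_mult[OF limh(1) tendsto_const, of y "cos (c e + \<xi> e * y)"] by simp
  \<comment> \<open>Every derivative of h carries a factor 1 / R, so in the limit only the second
    derivative of the cosine survives.\<close>
  have limf'': "(\<lambda>n. f'' n e y) \<longlonglongrightarrow> - (\<xi> e)\<^sup>2 * cos (c e + \<xi> e * y)" for e y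
  proof -
    have "(\<lambda>n. h'' (y / R n) / (R n)\<^sup>2) \<longlonglongrightarrow> 0"
      using limR[OF limR[OF limh(3)[of y]]] by (simp add: power2_eq_square)
    then have "(\<lambda>n. f'' n e y) \<longlonglongrightarrow> (0 - (\<xi> e)\<^sup>2 * 1) * cos (c e + \<xi> e * y) - 2 * \<xi> e * (0 * sin (c e + \<xi> e * y))"
      unfolding f''_def by (intro tendsto_intros limh(1) limR[OF limh(2)])
    then show ?thesis by simp
  qed
  have lim\<psi>: "(\<lambda>n. \<psi> n x) \<longlonglongrightarrow> w x" for x
    unfolding \<psi>_def w_def by (intro tendsto_intros limf)
  have limL: "(\<lambda>n. L n x) \<longlonglongrightarrow> - (\<Sum>e\<in>Basis. (\<xi> e)\<^sup>2) * w x" for x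
  proof -
    have "(\<lambda>n. L n x) \<longlonglongrightarrow> (\<Sum>e\<in>Basis. - (\<xi> e)\<^sup>2 * cos (c e + \<xi> e * (x \<bullet> e)) *
        (\<Prod>e'\<in>Basis - {e}. cos (c e' + \<xi> e' * (x \<bullet> e'))))"
      unfolding L_def by (intro tendsto_intros limf limf'')
    also have "(\<Sum>e\<in>Basis. - (\<xi> e)\<^sup>2 * cos (c e + \<xi> e * (x \<bullet> e)) *
        (\<Prod>e'\<in>Basis - {e}. cos (c e' + \<xi> e' * (x \<bullet> e')))) = (\<Sum>e\<in>Basis. - (\<xi> e)\<^sup>2 * w x)"
      unfolding w_def by (intro sum.cong refl) (subst prod.remove[of Basis], auto)
    finally show ?thesis by (simp add: sum_distrib_right sum_negf)
  qed
  have [measurable]: "\<psi> n \<in> borel_measurable borel" "L n \<in> borel_measurable borel" for n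
    unfolding \<psi>_def L_def f_def f''_def by measurable
  define C' where "C' = max (\<Prod>e\<in>(Basis::'a set). C) (\<Sum>e\<in>(Basis::'a set). ((C + (\<xi> e)\<^sup>2 * C) + 2 * \<bar>\<xi> e\<bar> * C) * (\<Prod>e'\<in>Basis - {e}. C))"
  show thesis
  proof (rule that[of \<psi> L C'])
    show "\<bar>\<psi> n x\<bar> \<le> C'" "\<bar>L n x\<bar> \<le> C'" for n x
      using b\<psi>[of n x] bL[of n x] unfolding C'_def by linarith+
  qed (use tf lapl lim\<psi> limL in auto)
qed

section \<open>Uniqueness of weak solutions\<close>

lemma integrable_mult_bounded:
  fixes f g :: "'a \<Rightarrow> real"
  assumes f: "integrable M f" and [measurable]: "g \<in> borel_measurable M" and g: "\<And>x. \<bar>g x\<bar> \<le> C"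
  shows "integrable M (\<lambda>x. f x * g x)"
proof (rule Bochner_Integration.integrable_bound)
  show "integrable M (\<lambda>x. \<bar>f x\<bar> * C)" using f by auto
  have "\<bar>f x\<bar> * \<bar>g x\<bar> \<le> \<bar>\<bar>f x\<bar> * C\<bar>" for x
    using mult_left_mono[OF g, of "\<bar>f x\<bar>" x] by simp
  then show "AE x in M. norm (f x * g x) \<le> norm (\<bar>f x\<bar> * C)"
    by (intro AE_I2) (simp add: abs_mult)
qed (use f in measurable)

lemma finite_borel_measure_distr_density:
  fixes f :: "'a \<Rightarrow> real"
  assumes f: "integrable M f" and nn: "\<And>x. f x \<ge> 0" and [measurable]: "X \<in> borel_measurable M"
  defines "N \<equiv> distr (density M (\<lambda>x. ennreal (f x))) borel X"
  shows "finite_borel_measure N"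
    and "\<And>B. B \<in> sets borel \<Longrightarrow> emeasure N B = ennreal (\<integral>x. f x * indicator B (X x) \<partial>M)"
    and "char N t = Complex (\<integral>x. f x * cos (t * X x) \<partial>M) (\<integral>x. f x * sin (t * X x) \<partial>M)"
proof -
  have [measurable]: "f \<in> borel_measurable M" using f by auto
  show em: "emeasure N B = ennreal (\<integral>x. f x * indicator B (X x) \<partial>M)" if [measurable]: "B \<in> sets borel" for B
  proof -
    have "emeasure N B = (\<integral>\<^sup>+x. ennreal (f x) * indicator (X -` B \<inter> space M) x \<partial>M)"
      unfolding N_def by (subst emeasure_distr) (auto simp: emeasure_density)
    also have "\<dots> = (\<integral>\<^sup>+x. ennreal (f x * indicator B (X x)) \<partial>M)"
      by (intro nn_integral_cong) (auto simp: indicator_def)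
    also have "\<dots> = ennreal (\<integral>x. f x * indicator B (X x) \<partial>M)"
      using nn by (intro nn_integral_eq_integral Bochner_Integration.integrable_bound[OF f])
        (auto simp: indicator_def)
    finally show ?thesis .
  qed
  have "emeasure N (space N) < \<infinity>"
    using em[of UNIV] by (simp add: N_def)
  then show "finite_borel_measure N"
    by (auto simp: finite_borel_measure_def finite_borel_measure_axioms_def N_def intro!: finite_measureI)
  have int: "integrable M (\<lambda>x. f x * cos (t * X x))" "integrable M (\<lambda>x. f x * sin (t * X x))"
    by (rule Bochner_Integration.integrable_bound[OF f]; simp add: abs_mult mult_left_le)+
  have "char N t = (\<integral>x. f x *\<^sub>R iexp (t * X x) \<partial>M)"
    unfolding char_def N_def using nn by (subst integral_distr, simp, simp, subst integral_density) auto
  also have "\<dots> = (\<integral>x. complex_of_real (f x * cos (t * X x)) + \<i> * complex_of_real (f x * sin (t * X x)) \<partial>M)"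
    by (intro Bochner_Integration.integral_cong refl) (simp only: cis_conv_exp[symmetric], simp add: complex_eq_iff)
  also have "\<dots> = complex_of_real (\<integral>x. f x * cos (t * X x) \<partial>M) + \<i> * complex_of_real (\<integral>x. f x * sin (t * X x) \<partial>M)"
    using int by (subst Bochner_Integration.integral_add) (auto simp del: of_real_mult)
  finally show "char N t = Complex (\<integral>x. f x * cos (t * X x) \<partial>M) (\<integral>x. f x * sin (t * X x) \<partial>M)"
    by (simp add: complex_eq_iff)
qed

text \<open>The positive and the negative part of f, pushed forward by X, are finite measures on the
  line with equal characteristic functions, hence equal. The imaginary part needs sines, which are
  cosines with phase -pi / 2; this is why a phase c is part of the hypothesis.\<close>

lemma integral_indicator_eq_0_if_cosine_transform_eq_0:
  fixes f :: "'a \<Rightarrow> real"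
  assumes f: "integrable M f" and X [measurable]: "X \<in> borel_measurable M"
    and 0: "\<And>c t. (\<integral>x. f x * cos (c + t * X x) \<partial>M) = 0" and B [measurable]: "B \<in> sets borel"
  shows "(\<integral>x. f x * indicator B (X x) \<partial>M) = 0"
proof -
  have [measurable]: "f \<in> borel_measurable M" using f by auto
  let ?p = "\<lambda>x. max 0 (f x)" and ?n = "\<lambda>x. max 0 (- f x)"
  have split: "?p x = f x + ?n x" for x by auto
  have p: "integrable M ?p" and n: "integrable M ?n"
    using f by (auto intro!: Bochner_Integration.integrable_bound[OF f])
  note P = finite_borel_measure_distr_density[OF p _ X] and N = finite_borel_measure_distr_density[OF n _ X]
  let ?P = "distr (density M (\<lambda>x. ennreal (?p x))) borel X"
  let ?N = "distr (density M (\<lambda>x. ennreal (?n x))) borel X"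
  have pn: "(\<integral>x. ?p x * g x \<partial>M) = (\<integral>x. f x * g x \<partial>M) + (\<integral>x. ?n x * g x \<partial>M)"
    if "g \<in> borel_measurable M" and g: "\<And>x. \<bar>g x\<bar> \<le> 1" for g
  proof -
    have "integrable M (\<lambda>x. f x * g x)" "integrable M (\<lambda>x. ?n x * g x)"
      by (rule integrable_mult_bounded[OF f that(1) g], rule integrable_mult_bounded[OF n that(1) g])
    then show ?thesis
      by (subst Bochner_Integration.integral_add[symmetric]) (auto simp: split distrib_right intro!: Bochner_Integration.integral_cong)
  qed
  have "?P = ?N"
  proof (rule finite_borel_measure_eqI_char)
    fix t
    have "(\<integral>x. f x * cos (t * X x) \<partial>M) = 0" using 0[of 0 t] by simp
    moreover have "(\<integral>x. f x * sin (t * X x) \<partial>M) = 0"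
    proof -
      have "sin (t * X x) = cos (- (pi / 2) + t * X x)" for x
        by (simp add: cos_diff)
      then show ?thesis by (simp only: 0)
    qed
    ultimately show "char ?P t = char ?N t"
      by (subst P(3), simp, subst N(3), simp) (simp add: pn)
  qed (use P(1) N(1) in auto)
  then have "ennreal (\<integral>x. ?p x * indicator B (X x) \<partial>M) = ennreal (\<integral>x. ?n x * indicator B (X x) \<partial>M)"
    using P(2)[OF _ B] N(2)[OF _ B] by simp
  then have "(\<integral>x. ?p x * indicator B (X x) \<partial>M) = (\<integral>x. ?n x * indicator B (X x) \<partial>M)"
    by (subst (asm) ennreal_inj) (auto intro!: integral_nonneg_AE)
  then show ?thesis by (subst (asm) pn) auto
qed

lemma borel_measurable_fst_snd [measurable]:
  "(\<lambda>p :: 'a::second_countable_topology \<times> 'b::second_countable_topology. fst p) \<in> borel_measurable borel"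
  "(\<lambda>p :: 'a::second_countable_topology \<times> 'b::second_countable_topology. snd p) \<in> borel_measurable borel"
  by (intro borel_measurable_continuous_onI continuous_intros)+

lemma mem_box_real_prod:
  fixes a b p :: "real \<times> 'a::euclidean_space"
  shows "p \<in> box a b \<longleftrightarrow> fst a < fst p \<and> fst p < fst b \<and> snd p \<in> box (snd a) (snd b)"
  by (auto simp: mem_box Basis_prod_def inner_prod_def ball_Un)

lemma AE_lborel_fst_neq:
  "AE p in (lborel :: (real \<times> 'a::euclidean_space) measure). fst p \<noteq> s"
  unfolding lborel_prod[symmetric]
  by (rule lborel_pair.AE_pair_measure) (measurable, use AE_lborel_singleton[of s] in auto)

text \<open>The cosine in one coordinate after the other is exchanged for the indicator of an
  arbitrary Borel set by the one-dimensional result, with the remaining factors absorbed into the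
  integrable function. Once all are exchanged, integrals over boxes vanish, and boxes form a
  generator of the Borel sets that is stable under intersection.\<close>

lemma AE_eq_0_if_spatial_cosine_transforms_eq_0:
  fixes f :: "real \<times> 'a::euclidean_space \<Rightarrow> real"
  assumes f: "integrable lborel f" and supp: "\<And>p. fst p \<le> 0 \<Longrightarrow> f p = 0"
    and 0: "\<And>s c \<xi>. s > 0 \<Longrightarrow> (\<integral>p. f p * indicator {..<s} (fst p) * (\<Prod>e\<in>Basis. cos (c e + \<xi> e * (snd p \<bullet> e))) \<partial>lborel) = 0"
  shows "AE p in lborel. f p = 0"
proof -
  have [measurable]: "f \<in> borel_measurable borel" using f by auto
  have bd: "integrable lborel (\<lambda>p. f p * g p)"
    if [measurable]: "g \<in> borel_measurable borel" and g: "\<And>p. \<bar>g p\<bar> \<le> 1" for g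
    by (rule integrable_mult_bounded[OF f _ g]) simp
  have abs_prod_le_1: "\<bar>\<Prod>e\<in>J. g e\<bar> \<le> 1" if "\<And>e. \<bar>g e\<bar> \<le> 1" for J :: "'a set" and g :: "'a \<Rightarrow> real"
    unfolding abs_prod using that by (intro prod_le_1) auto
  \<comment> \<open>J collects the coordinates that already carry indicators. Phases and frequencies
    stay arbitrary in the induction, since the values at the new coordinate vary.\<close>
  have 1: "(\<integral>p. f p * (indicator {..<s} (fst p) * (\<Prod>e\<in>J. indicator (B e) (snd p \<bullet> e)) *
      (\<Prod>e\<in>Basis - J. cos (c e + \<xi> e * (snd p \<bullet> e)))) \<partial>lborel) = 0"
    if "finite J" "J \<subseteq> Basis" "\<And>e. B e \<in> sets borel" for J s c \<xi> and B :: "'a \<Rightarrow> real set"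
    using that
  proof (induction J arbitrary: c \<xi> rule: finite_induct)
    case empty
    show ?case
    proof (cases "s > 0")
      case True
      then show ?thesis using 0[OF True, of c \<xi>] by (simp add: mult.assoc)
    next
      case False
      have "f p * (indicator {..<s} (fst p) * (\<Prod>e\<in>Basis. cos (c e + \<xi> e * (snd p \<bullet> e)))) = 0" for p
        using False supp[of p] by (cases "fst p \<le> 0") (auto simp: indicator_def)
      then show ?thesis
        by (simp only: prod.empty mult_1_right Diff_empty Bochner_Integration.integral_zero)
    qed
  next
    case (insert b J)
    have [measurable]: "B e \<in> sets borel" for e by fact
    have bB: "b \<in> Basis" using insert by auto
    have Bs: "Basis - J = insert b (Basis - insert b J)" using insert bB by auto
    let ?g = "\<lambda>p. indicator {..<s} (fst p) * (\<Prod>e\<in>J. indicator (B e) (snd p \<bullet> e)) *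
      (\<Prod>e\<in>Basis - insert b J. cos (c e + \<xi> e * (snd p \<bullet> e)))"
    have gb: "\<bar>?g p\<bar> \<le> 1" for p
      unfolding abs_mult
      by (intro mult_le_one abs_prod_le_1 mult_nonneg_nonneg abs_ge_zero) (auto simp: indicator_def)
    have "(\<integral>p. (f p * ?g p) * indicator (B b) (snd p \<bullet> b) \<partial>lborel) = 0"
    proof (rule integral_indicator_eq_0_if_cosine_transform_eq_0)
      show "integrable lborel (\<lambda>p. f p * ?g p)"
        by (rule bd[OF _ gb]) measurable
      fix d t
      have eqp: "(\<Prod>e\<in>Basis - J. cos ((c(b := d)) e + (\<xi>(b := t)) e * (snd p \<bullet> e))) =
          cos (d + t * (snd p \<bullet> b)) * (\<Prod>e\<in>Basis - insert b J. cos (c e + \<xi> e * (snd p \<bullet> e)))" for p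
        unfolding Bs by (subst prod.insert) (auto intro!: prod.cong)
      have "(\<integral>p. f p * (indicator {..<s} (fst p) * (\<Prod>e\<in>J. indicator (B e) (snd p \<bullet> e)) *
          (cos (d + t * (snd p \<bullet> b)) * (\<Prod>e\<in>Basis - insert b J. cos (c e + \<xi> e * (snd p \<bullet> e))))) \<partial>lborel) = 0"
        using insert.IH[of "c(b := d)" "\<xi>(b := t)", unfolded eqp] insert.prems by simp
      then show "(\<integral>p. (f p * ?g p) * cos (d + t * (snd p \<bullet> b)) \<partial>lborel) = 0"
        by (simp only: mult_ac)
    qed measurable
    also have "(\<lambda>p. (f p * ?g p) * indicator (B b) (snd p \<bullet> b)) = (\<lambda>p. f p * (indicator {..<s} (fst p) *
      (\<Prod>e\<in>insert b J. indicator (B e) (snd p \<bullet> e)) * (\<Prod>e\<in>Basis - insert b J. cos (c e + \<xi> e * (snd p \<bullet> e)))))"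
      by (intro ext, subst prod.insert[OF insert.hyps]) (simp only: mult_ac)
    finally show ?case .
  qed
  have 2: "(\<integral>p. f p * (indicator {..<s} (fst p) * indicator (box a b) (snd p)) \<partial>lborel) = 0" for s and a b :: 'a
  proof -
    have "indicator (box a b) x = (\<Prod>e\<in>Basis. indicator {a \<bullet> e<..<b \<bullet> e} (x \<bullet> e) :: real)" for x
    proof (cases "x \<in> box a b")
      case True
      then show ?thesis by (auto simp: mem_box)
    next
      case False
      then obtain e where "e \<in> Basis" "x \<bullet> e \<notin> {a \<bullet> e<..<b \<bullet> e}" by (auto simp: mem_box)
      then have "(\<Prod>e\<in>Basis. indicator {a \<bullet> e<..<b \<bullet> e} (x \<bullet> e) :: real) = 0"
        by (intro prod_zero bexI[of _ e]) auto
      then show ?thesis using False by simp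
    qed
    then show ?thesis
      using 1[of Basis "\<lambda>e. {a \<bullet> e<..<b \<bullet> e}" s] by simp
  qed
  have box: "(\<integral>p. f p * indicator (box a b) p \<partial>lborel) = 0" for a b :: "real \<times> 'a"
  proof (cases "fst a < fst b")
    case False
    then have "box a b = {}" using mem_box_real_prod[of _ a b] by fastforce
    then show ?thesis by simp
  next
    case True
    let ?i = "\<lambda>s p. indicator {..<s} (fst p) * indicator (box (snd a) (snd b)) (snd p) :: real"
    have int: "integrable lborel (\<lambda>p. f p * ?i s p)" for s
      by (rule bd) (auto simp: indicator_def)
    \<comment> \<open>Only times before s are available, so a box is the difference of two such
      sets, up to the null set of times equal to its left end.\<close>
    have "(\<integral>p. f p * indicator (box a b) p \<partial>lborel) = (\<integral>p. f p * ?i (fst b) p - f p * ?i (fst a) p \<partial>lborel)"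
    proof (rule integral_cong_AE)
      show "AE p in lborel. f p * indicator (box a b) p = f p * ?i (fst b) p - f p * ?i (fst a) p"
        using AE_lborel_fst_neq[of "fst a"]
      proof eventually_elim
        fix p :: "real \<times> 'a" assume "fst p \<noteq> fst a"
        moreover have "p \<in> box a b \<longleftrightarrow> fst a < fst p \<and> fst p < fst b \<and> snd p \<in> box (snd a) (snd b)"
          by (rule mem_box_real_prod)
        ultimately show "f p * indicator (box a b) p = f p * ?i (fst b) p - f p * ?i (fst a) p"
          using True by (auto simp: indicator_def)
      qed
    qed measurable
    also have "\<dots> = 0"
      using int by (subst Bochner_Integration.integral_diff) (auto simp: 2)
    finally show ?thesis .
  qed
  have borel: "(\<integral>p. f p * indicator A p \<partial>lborel) = 0" if "A \<in> sets borel" for A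
  proof -
    have A: "A \<in> sigma_sets UNIV (range (\<lambda>(a, b). box a b))"
      using that by (simp add: borel_eq_box)
    have stab: "Int_stable (range (\<lambda>(a, b). box a b :: (real \<times> 'a) set))"
    proof (rule Int_stableI)
      fix A B assume "A \<in> range (\<lambda>(a, b). box a b :: (real \<times> 'a) set)" "B \<in> range (\<lambda>(a, b). box a b :: (real \<times> 'a) set)"
      then obtain a b c d where AB: "A = box a b" "B = box c d" by auto
      show "A \<inter> B \<in> range (\<lambda>(a, b). box a b)"
        unfolding AB box_Int_box by (rule range_eqI, rule case_prod_conv[symmetric])
    qed
    have pw: "range (\<lambda>(a, b). box a b :: (real \<times> 'a) set) \<subseteq> Pow UNIV" by simp
    have sb: "B \<in> sets borel" if "B \<in> sigma_sets UNIV (range (\<lambda>(a, b). box a b))" for B :: "(real \<times> 'a) set"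
      using that by (simp add: borel_eq_box)
    have total: "(\<integral>p. f p \<partial>lborel) = 0"
    proof -
      have "(\<lambda>n. \<integral>p. f p * indicator {..<real n} (fst p) \<partial>lborel) \<longlonglongrightarrow> (\<integral>p. f p \<partial>lborel)"
      proof (rule integral_dominated_convergence[where w = "\<lambda>p. \<bar>f p\<bar>"])
        show "AE p in lborel. (\<lambda>n. f p * indicator {..<real n} (fst p)) \<longlonglongrightarrow> f p"
        proof (rule AE_I2)
          fix p :: "real \<times> 'a"
          obtain N where "fst p < real N" using reals_Archimedean2 by blast
          then have "\<forall>\<^sub>F n in sequentially. f p * indicator {..<real n} (fst p) = f p"
            by (intro eventually_sequentiallyI[of N]) (auto simp: indicator_def)
          then show "(\<lambda>n. f p * indicator {..<real n} (fst p)) \<longlonglongrightarrow> f p"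
            by (rule tendsto_eventually)
        qed
      qed (use f in \<open>auto simp: indicator_def\<close>)
      moreover have "(\<integral>p. f p * indicator {..<real n} (fst p) \<partial>lborel) = 0" for n
        using 1[of "{}" "\<lambda>_. {}" "real n" "\<lambda>_. 0" "\<lambda>_. 0"] by simp
      ultimately show ?thesis by (simp add: LIMSEQ_const_iff)
    qed
    show ?thesis
      using stab pw A
    proof (induction A rule: sigma_sets_induct_disjoint)
      case (basic A)
      then show ?case using box by auto
    next
      case empty
      show ?case by simp
    next
      case (compl A)
      have [measurable]: "A \<in> sets borel" using sb compl by auto
      have "(\<integral>p. f p * indicator (UNIV - A) p \<partial>lborel) = (\<integral>p. f p - f p * indicator A p \<partial>lborel)"
        by (intro Bochner_Integration.integral_cong) (auto simp: indicator_def)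
      also have "\<dots> = 0"
        using f total compl by (subst Bochner_Integration.integral_diff) (auto intro!: bd simp: indicator_def)
      finally show ?case .
    next
      case (union A)
      have [measurable]: "A i \<in> sets borel" for i using sb union by auto
      have "(\<integral>p\<in>(\<Union>i. A i). f p \<partial>lborel) = (\<Sum>i. (\<integral>p\<in>(A i). f p \<partial>lborel))"
      proof (rule lebesgue_integral_countable_add)
        show "set_integrable lborel (\<Union>i. A i) f"
          unfolding set_integrable_def using bd[of "indicator (\<Union>i. A i)"]
          by (simp add: mult.commute indicator_def)
        show "A i \<inter> A j = {}" if "i \<noteq> j" for i j
          using union(1) that by (auto simp: disjoint_family_on_def)
      qed auto
      then show ?case
        using union by (simp add: set_lebesgue_integral_def mult.commute)
    qed
  qed
  show ?thesis
  proof (rule density_unique_real)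
    show "(\<integral>p\<in>A. f p \<partial>lborel) = (\<integral>p\<in>A. 0 \<partial>lborel)" if "A \<in> sets lborel" for A
      using borel[of A] that by (simp add: set_lebesgue_integral_def mult.commute)
  qed (use f in auto)
qed

section \<open>Borel representatives and their time slices\<close>

lemma lebesgue_integral_AE_borel:
  fixes f g :: "'a::euclidean_space \<Rightarrow> real"
  assumes g: "g \<in> borel_measurable borel" and ae: "AE x in lborel. f x = g x"
  shows "integral\<^sup>L lebesgue f = integral\<^sup>L lborel g" "integrable lebesgue f \<longleftrightarrow> integrable lborel g"
proof -
  have g': "g \<in> borel_measurable lebesgue" using g by (intro measurable_completion) simp
  have ae': "AE x in lebesgue. f x = g x" using ae by (rule AE_completion)
  \<comment> \<open>Completeness of \<open>lebesgue\<close> makes f measurable because it agrees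
    almost everywhere with a measurable function.\<close>
  have f': "f \<in> borel_measurable lebesgue"
    by (rule borel_measurable_AE[OF g']) (use ae' in auto)
  have "integral\<^sup>L lebesgue f = integral\<^sup>L lebesgue g"
    by (rule integral_cong_AE[OF f' g' ae'])
  also have "\<dots> = integral\<^sup>L lborel g"
    using g by (intro integral_completion) simp
  finally show "integral\<^sup>L lebesgue f = integral\<^sup>L lborel g" .
  have "integrable lebesgue f \<longleftrightarrow> integrable lebesgue g"
    by (rule integrable_cong_AE[OF f' g' ae'])
  also have "\<dots> \<longleftrightarrow> integrable lborel g"
    using g by (intro integrable_completion) simp
  finally show "integrable lebesgue f \<longleftrightarrow> integrable lborel g" .
qed

text \<open>The Borel counterpart of \<open>Linf_L1\<close>. The indicator in the bound forces
  almost all slices at times t \<le> 0 to vanish, as convolutions over the whole line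
  require.\<close>

definition L1_slices :: "real \<Rightarrow> (real \<times> 'a::euclidean_space \<Rightarrow> real) \<Rightarrow> bool" where
  "L1_slices C w \<longleftrightarrow> w \<in> borel_measurable borel \<and> C \<ge> 0 \<and>
     (AE t in lborel. integrable lborel (\<lambda>x. w (t, x)) \<and> (\<integral>x. \<bar>w (t, x)\<bar> \<partial>lborel) \<le> C * indicator {0<..} t)"

definition slice :: "(real \<times> 'a::euclidean_space \<Rightarrow> real) \<Rightarrow> ('a \<Rightarrow> real) \<Rightarrow> real \<Rightarrow> real" where
  "slice w g t = (\<integral>x. w (t, x) * g x \<partial>lborel)"

lemma slice_measurable [measurable]:
  fixes w :: "real \<times> 'a::euclidean_space \<Rightarrow> real"
  assumes w: "w \<in> borel_measurable borel" and [measurable]: "g \<in> borel_measurable borel"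
  shows "slice w g \<in> borel_measurable borel"
proof -
  have [measurable]: "w \<in> borel_measurable (borel \<Otimes>\<^sub>M borel)" using w by (simp add: borel_prod)
  show ?thesis unfolding slice_def by measurable
qed

lemma slice_abs_le:
  fixes w :: "real \<times> 'a::euclidean_space \<Rightarrow> real"
  assumes w: "integrable lborel (\<lambda>x. w (t, x))" and [measurable]: "g \<in> borel_measurable borel" and g: "\<And>x. \<bar>g x\<bar> \<le> B"
  shows "integrable lborel (\<lambda>x. w (t, x) * g x)"
    and "(\<integral>x. \<bar>w (t, x) * g x\<bar> \<partial>lborel) \<le> (\<integral>x. \<bar>w (t, x)\<bar> \<partial>lborel) * B"
    and "\<bar>slice w g t\<bar> \<le> (\<integral>x. \<bar>w (t, x)\<bar> \<partial>lborel) * B"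
proof -
  show int: "integrable lborel (\<lambda>x. w (t, x) * g x)"
    by (rule integrable_mult_bounded[OF w _ g]) simp
  have "(\<integral>x. \<bar>w (t, x) * g x\<bar> \<partial>lborel) \<le> (\<integral>x. \<bar>w (t, x)\<bar> * B \<partial>lborel)"
    using w by (intro integral_mono integrable_abs int integrable_mult_left)
      (auto simp: abs_mult intro!: mult_left_mono g)
  then show *: "(\<integral>x. \<bar>w (t, x) * g x\<bar> \<partial>lborel) \<le> (\<integral>x. \<bar>w (t, x)\<bar> \<partial>lborel) * B" by simp
  show "\<bar>slice w g t\<bar> \<le> (\<integral>x. \<bar>w (t, x)\<bar> \<partial>lborel) * B"
    unfolding slice_def by (rule order_trans[OF integral_abs_bound *])
qed

lemma slice_bound:
  assumes w: "L1_slices C w" and g: "g \<in> borel_measurable borel" "\<And>x. \<bar>g x\<bar> \<le> B"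
  shows "AE t in lborel. integrable lborel (\<lambda>x. w (t, x) * g x) \<and> \<bar>slice w g t\<bar> \<le> C * B * indicator {0<..} t"
proof -
  have B: "B \<ge> 0" using g(2)[of undefined] by simp
  from w have "AE t in lborel. integrable lborel (\<lambda>x. w (t, x)) \<and> (\<integral>x. \<bar>w (t, x)\<bar> \<partial>lborel) \<le> C * indicator {0<..} t"
    by (simp add: L1_slices_def)
  then show ?thesis
  proof eventually_elim
    case (elim t)
    have "(\<integral>x. \<bar>w (t, x)\<bar> \<partial>lborel) * B \<le> C * indicator {0<..} t * B"
      using elim B by (intro mult_right_mono) auto
    then show ?case
      using slice_abs_le(1,3)[of w t g B] elim g by (auto simp: mult_ac intro: order_trans)
  qed
qed

lemma L1_slices_integrable:
  assumes w: "L1_slices C w" and supp: "\<And>t x. t > T \<Longrightarrow> w (t, x) = 0"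
  shows "integrable lborel w"
proof -
  have [measurable]: "w \<in> borel_measurable (borel \<Otimes>\<^sub>M borel)" using w by (simp add: L1_slices_def borel_prod)
  have ae: "AE t in lborel. integrable lborel (\<lambda>x. w (t, x)) \<and> (\<integral>x. \<bar>w (t, x)\<bar> \<partial>lborel) \<le> C * indicator {0<..} t"
    using w by (simp add: L1_slices_def)
  have "integrable (lborel \<Otimes>\<^sub>M lborel) w"
  proof (rule lborel_pair.Fubini_integrable)
    show "integrable lborel (\<lambda>t. \<integral>x. norm (w (t, x)) \<partial>lborel)"
    proof (rule Bochner_Integration.integrable_bound)
      show "integrable lborel (\<lambda>t. C * indicator {0..T} t)"
        by (intro integrable_mult_right integrable_real_indicator) (auto simp: emeasure_lborel_Icc_eq)
      show "AE t in lborel. norm (\<integral>x. norm (w (t, x)) \<partial>lborel) \<le> norm (C * indicator {0..T} t)"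
        using ae
      proof eventually_elim
        case (elim t)
        have "0 \<le> (\<integral>x. \<bar>w (t, x)\<bar> \<partial>lborel)" by simp
        moreover have "(\<integral>x. \<bar>w (t, x)\<bar> \<partial>lborel) = 0" if "t > T" using supp[OF that] by simp
        moreover have "C * indicator {0<..} t \<le> \<bar>C * indicator {0..T} t\<bar>" if "\<not> t > T"
          using that by (auto simp: indicator_def)
        ultimately show ?case using elim by (cases "t > T") auto
      qed
    qed measurable
    show "AE t in lborel. integrable lborel (\<lambda>x. w (t, x))"
      using ae by eventually_elim simp
  qed measurable
  then show ?thesis by (simp add: lborel_prod)
qed

text \<open>A constant is not annihilated by the Riemann-Liouville derivative; it yields the kernel
  k. For this reason test functions of space alone already lead to the Volterra equation.\<close>

lemma RL_deriv_const:
  assumes \<alpha>: "0 < \<alpha>" "\<alpha> < 1" and s: "s > 0"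
  shows "RL_deriv \<alpha> (\<lambda>_. c) s = c * frac_kernel (1 - \<alpha>) s"
proof -
  have G: "Gamma (1 - \<alpha>) > 0" using \<alpha> by (intro Gamma_real_pos) simp
  have G2: "Gamma (2 - \<alpha>) = (1 - \<alpha>) * Gamma (1 - \<alpha>)"
  proof -
    have "1 - \<alpha> \<notin> \<int>\<^sub>\<le>\<^sub>0" using \<alpha> by (auto elim!: nonpos_Ints_cases)
    from Gamma_plus1[OF this] show ?thesis by (simp add: add_ac)
  qed
  have eq: "frac_integral (1 - \<alpha>) (\<lambda>_. c) t = c * frac_kernel (2 - \<alpha>) t" if "t > 0" for t
  proof -
    have "frac_integral (1 - \<alpha>) (\<lambda>_. c) t =
        1 / Gamma (1 - \<alpha>) * (\<integral>s. indicator {0<..<t} s * ((t - s) powr (- \<alpha>) * c) \<partial>lborel)"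
      unfolding frac_integral_def set_lebesgue_integral_def by (subst integral_completion) auto
    also have "\<dots> = (\<integral>s. c * (indicator {0<..} s * frac_kernel (1 - \<alpha>) (t - s)) \<partial>lborel)"
      unfolding integral_mult_right_zero[symmetric]
      by (intro Bochner_Integration.integral_cong) (auto simp: frac_kernel_def indicator_def)
    also have "\<dots> = c * frac_kernel (2 - \<alpha>) t"
      using frac_kernel_primitive[of "1 - \<alpha>" t] \<alpha> by (simp add: has_bochner_integral_iff)
    finally show ?thesis .
  qed
  have "((\<lambda>t. c * (t powr (1 - \<alpha>) / Gamma (2 - \<alpha>))) has_real_derivative c * frac_kernel (1 - \<alpha>) s) (at s)"
  proof -
    have "((\<lambda>t. c * (t powr (1 - \<alpha>) / Gamma (2 - \<alpha>))) has_real_derivative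
        c * ((1 - \<alpha>) * s powr (1 - \<alpha> - 1) / Gamma (2 - \<alpha>))) (at s)"
      by (intro DERIV_cmult DERIV_cdivide has_real_derivative_powr s)
    also have "c * ((1 - \<alpha>) * s powr (1 - \<alpha> - 1) / Gamma (2 - \<alpha>)) = c * frac_kernel (1 - \<alpha>) s"
      using s \<alpha> by (simp add: frac_kernel_def G2)
    finally show ?thesis .
  qed
  then have "(frac_integral (1 - \<alpha>) (\<lambda>_. c) has_real_derivative c * frac_kernel (1 - \<alpha>) s) (at s)"
    by (rule has_field_derivative_transform_within_open[of _ _ _ "{0<..}"])
      (use s eq in \<open>auto simp: frac_kernel_def\<close>)
  then show ?thesis unfolding RL_deriv_def by (rule DERIV_imp_deriv)
qed

text \<open>The hypothesis concerns each bounded time interval separately. Exhausting the positive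
  times by (0,n) produces one measurable function, hence one Borel function w for all T, and
  Fubini's theorem for null sets gives agreement on almost every time slice.\<close>

lemma Linf_L1_representative:
  fixes v :: "real \<Rightarrow> 'a::euclidean_space \<Rightarrow> real"
  assumes v: "\<And>T. T > 0 \<Longrightarrow> Linf_L1 T v"
  obtains w where "w \<in> borel_measurable borel" "AE p in lborel. 0 < fst p \<longrightarrow> v (fst p) (snd p) = w p"
    "AE t in lborel. 0 < t \<longrightarrow> (AE x in lborel. v t x = w (t, x))"
    "\<And>T. T > 0 \<Longrightarrow> \<exists>C. L1_slices C (\<lambda>p. indicator {0<..<T} (fst p) * w p)"
proof -
  define F where "F = (\<lambda>p. if fst p > 0 then v (fst p) (snd p) else 0)"
  have Fn: "(\<lambda>p. indicator ({0<..<real n} \<times> UNIV) p * v (fst p) (snd p)) \<in> borel_measurable lebesgue" for n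
  proof (cases "n = 0")
    case False
    then have "(\<lambda>(t, x). v t x) \<in> borel_measurable (lebesgue_on ({0<..<real n} \<times> UNIV))"
      using v[of "real n"] by (simp add: Linf_L1_def)
    moreover have "{0<..<real n} \<times> (UNIV :: 'a set) \<in> sets borel"
      by (intro borel_open open_Times) auto
    ultimately show ?thesis
      by (subst (asm) borel_measurable_restrict_space_iff) (auto simp: case_prod_unfold)
  qed simp
  have "F \<in> borel_measurable lebesgue"
  proof (rule borel_measurable_LIMSEQ_real[OF _ Fn])
    fix p :: "real \<times> 'a"
    obtain N where N: "fst p < real N" using reals_Archimedean2 by blast
    have "\<forall>\<^sub>F n in sequentially. indicator ({0<..<real n} \<times> UNIV) p * v (fst p) (snd p) = F p"
      by (rule eventually_sequentiallyI[of N]) (use N in \<open>auto simp: F_def indicator_def mem_Times_iff\<close>)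
    then show "(\<lambda>n. indicator ({0<..<real n} \<times> UNIV) p * v (fst p) (snd p)) \<longlonglongrightarrow> F p"
      by (rule tendsto_eventually)
  qed
  from completion_ex_borel_measurable_real[OF this]
  obtain w where w: "w \<in> borel_measurable borel" and Fw: "AE p in lborel. F p = w p" by auto
  have 1: "AE p in lborel. 0 < fst p \<longrightarrow> v (fst p) (snd p) = w p"
    using Fw by eventually_elim (auto simp: F_def)
  have "AE p in lborel \<Otimes>\<^sub>M lborel. F p = w p" using Fw by (subst lborel_prod)
  from lborel_pair.AE_pair[OF this]
  have 2: "AE t in lborel. 0 < t \<longrightarrow> (AE x in lborel. v t x = w (t, x))"
    by eventually_elim (auto simp: F_def)
  have [measurable]: "w \<in> borel_measurable (borel \<Otimes>\<^sub>M borel)" using w by (simp add: borel_prod)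
  have "\<exists>C. L1_slices C (\<lambda>p. indicator {0<..<T} (fst p) * w p)" if T: "T > 0" for T
  proof -
    obtain C where C: "AE t in lebesgue. 0 < t \<and> t < T \<longrightarrow>
        integrable lebesgue (v t) \<and> (LINT x|lebesgue. \<bar>v t x\<bar>) \<le> C"
      using v[OF T] by (auto simp: Linf_L1_def)
    then have "AE t in lborel. 0 < t \<and> t < T \<longrightarrow>
        integrable lebesgue (v t) \<and> (LINT x|lebesgue. \<bar>v t x\<bar>) \<le> C"
      by (simp add: AE_completion_iff)
    then have "AE t in lborel. integrable lborel (\<lambda>x. indicator {0<..<T} t * w (t, x)) \<and>
        (\<integral>x. \<bar>indicator {0<..<T} t * w (t, x)\<bar> \<partial>lborel) \<le> max C 0 * indicator {0<..} t"
      using 2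
    proof eventually_elim
      case (elim t)
      show ?case
      proof (cases "0 < t \<and> t < T")
        case True
        then have ae: "AE x in lborel. v t x = w (t, x)" using elim by simp
        then have ae': "AE x in lborel. \<bar>v t x\<bar> = \<bar>w (t, x)\<bar>" by eventually_elim simp
        have "integrable lborel (\<lambda>x. w (t, x))"
          using lebesgue_integral_AE_borel(2)[OF _ ae] elim True by simp
        moreover have "(\<integral>x. \<bar>w (t, x)\<bar> \<partial>lborel) \<le> C"
          using lebesgue_integral_AE_borel(1)[OF _ ae'] elim True by simp
        ultimately show ?thesis using True by simp
      qed auto
    qed
    moreover have "(\<lambda>p. indicator {0<..<T} (fst p) * w p) \<in> borel_measurable borel"
      using w by measurable
    ultimately show ?thesis by (intro exI[of _ "max C 0"]) (simp add: L1_slices_def)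
  qed
  then show thesis using that[OF w 1 2] by blast
qed

text \<open>Since the weak formulation reads test functions at T - t, a function of space alone
  turns its left side into a convolution with \<open>frac_kernel (1 - \<alpha>)\<close> evaluated at
  T. The Riemann-Liouville derivative then factors out of the spatial integral.\<close>

lemma weak_solution_slices:
  fixes v :: "real \<Rightarrow> 'a::euclidean_space \<Rightarrow> real"
  assumes \<alpha>: "0 < \<alpha>" "\<alpha> < 1" and sol: "weak_solution \<alpha> M v" and T: "T > 0"
    and w [measurable]: "w \<in> borel_measurable borel"
    and vw: "AE t in lborel. 0 < t \<longrightarrow> (AE x in lborel. v t x = w (t, x))"
    and \<psi>: "test_function T (\<lambda>_. \<psi>)" and [measurable]: "\<psi> \<in> borel_measurable borel" "laplacian \<psi> \<in> borel_measurable borel"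
  shows "(\<integral>t. frac_kernel (1 - \<alpha>) (T - t) * (indicator {0<..<T} t * slice w \<psi> t) \<partial>lborel) =
    (\<integral>t. indicator {0<..<T} t * slice w (laplacian \<psi>) t \<partial>lborel) + M * frac_integral (1 - \<alpha>) (\<lambda>_. \<psi> 0) T"
proof -
  have [measurable]: "w \<in> borel_measurable (borel \<Otimes>\<^sub>M borel)" using w by (simp add: borel_prod)
  have inner: "AE t in lborel. 0 < t \<longrightarrow> (\<forall>g\<in>borel_measurable borel. (LINT x|lebesgue. v t x * g x) = slice w g t)"
    using vw
  proof eventually_elim
    case (elim t)
    show ?case
    proof (intro impI ballI)
      fix g :: "'a \<Rightarrow> real" assume t: "0 < t" and [measurable]: "g \<in> borel_measurable borel"
      from elim t have "AE x in lborel. v t x = w (t, x)" by simp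
      then have "AE x in lborel. v t x * g x = w (t, x) * g x" by eventually_elim simp
      then show "(LINT x|lebesgue. v t x * g x) = slice w g t"
        unfolding slice_def by (intro lebesgue_integral_AE_borel(1)) auto
    qed
  qed
  have "(LINT t:{0<..<T}|lebesgue. LINT x|lebesgue. v t x * RL_deriv \<alpha> (\<lambda>s. \<psi> x) (T - t)) =
      (\<integral>t. frac_kernel (1 - \<alpha>) (T - t) * (indicator {0<..<T} t * slice w \<psi> t) \<partial>lborel)"
    unfolding set_lebesgue_integral_def
  proof (rule lebesgue_integral_AE_borel(1))
    show "AE t in lborel. indicator {0<..<T} t *\<^sub>R (LINT x|lebesgue. v t x * RL_deriv \<alpha> (\<lambda>s. \<psi> x) (T - t)) =
      frac_kernel (1 - \<alpha>) (T - t) * (indicator {0<..<T} t * slice w \<psi> t)"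
      using inner
    proof eventually_elim
      case (elim t)
      show ?case
      proof (cases "t \<in> {0<..<T}")
        case True
        then have "(LINT x|lebesgue. v t x * RL_deriv \<alpha> (\<lambda>s. \<psi> x) (T - t)) =
            (LINT x|lebesgue. v t x * \<psi> x * frac_kernel (1 - \<alpha>) (T - t))"
          by (simp add: RL_deriv_const[OF \<alpha>] mult.assoc)
        also have "\<dots> = (LINT x|lebesgue. v t x * \<psi> x) * frac_kernel (1 - \<alpha>) (T - t)" by simp
        also have "(LINT x|lebesgue. v t x * \<psi> x) = slice w \<psi> t" using elim True by simp
        finally show ?thesis using True by simp
      qed simp
    qed
  qed measurable
  moreover have "(LINT t:{0<..<T}|lebesgue. LINT x|lebesgue. v t x * laplacian \<psi> x) =
      (\<integral>t. indicator {0<..<T} t * slice w (laplacian \<psi>) t \<partial>lborel)"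
    unfolding set_lebesgue_integral_def
    by (rule lebesgue_integral_AE_borel(1), measurable, use inner in eventually_elim) (auto simp: indicator_def)
  moreover have "(LINT t:{0<..<T}|lebesgue. LINT x|lebesgue. v t x * RL_deriv \<alpha> (\<lambda>s. \<psi> x) (T - t)) =
        (LINT t:{0<..<T}|lebesgue. LINT x|lebesgue. v t x * laplacian \<psi> x) +
        M * frac_integral (1 - \<alpha>) (\<lambda>s. \<psi> 0) T"
    using sol T \<psi> unfolding weak_solution_def by blast
  ultimately show ?thesis by simp
qed

text \<open>The final time S of the test functions becomes the variable of the Volterra equation;
  the terms with M have cancelled in \<open>eq\<close>. The cut-off is removed by dominated
  convergence, first in space and then in time, and the Laplacians of the cut-off products tend to
  minus the squared frequency times the product of cosines.\<close>

lemma weak_solution_difference_trigonometric: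
  fixes c \<xi> :: "'a::euclidean_space \<Rightarrow> real" and w1 w2 :: "real \<times> 'a \<Rightarrow> real"
  assumes \<alpha>: "0 < \<alpha>" "\<alpha> < 1" and T: "T > 0"
    and w: "L1_slices C (\<lambda>p. indicator {0<..<T} (fst p) * (w1 p - w2 p))"
      "L1_slices C1 (\<lambda>p. indicator {0<..<T} (fst p) * w1 p)" "L1_slices C2 (\<lambda>p. indicator {0<..<T} (fst p) * w2 p)"
    and meas [measurable]: "w1 \<in> borel_measurable borel" "w2 \<in> borel_measurable borel"
    and eq: "\<And>S \<psi> L. 0 < S \<Longrightarrow> S \<le> T \<Longrightarrow> test_function S (\<lambda>_. \<psi>) \<Longrightarrow> \<psi> \<in> borel_measurable borel \<Longrightarrow>
      laplacian \<psi> \<in> borel_measurable borel \<Longrightarrow>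
      (\<integral>t. frac_kernel (1 - \<alpha>) (S - t) * (indicator {0<..<S} t * slice w1 \<psi> t) \<partial>lborel) -
      (\<integral>t. indicator {0<..<S} t * slice w1 (laplacian \<psi>) t \<partial>lborel) =
      (\<integral>t. frac_kernel (1 - \<alpha>) (S - t) * (indicator {0<..<S} t * slice w2 \<psi> t) \<partial>lborel) -
      (\<integral>t. indicator {0<..<S} t * slice w2 (laplacian \<psi>) t \<partial>lborel)"
  defines "W \<equiv> \<lambda>p. indicator {0<..<T} (fst p) * (w1 p - w2 p)"
    and "g \<equiv> \<lambda>x. \<Prod>e\<in>Basis. cos (c e + \<xi> e * (x \<bullet> e))"
  assumes S: "S \<le> T"
  shows "(\<integral>t. frac_kernel (1 - \<alpha>) (S - t) * slice W g t \<partial>lborel) +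
    (\<Sum>e\<in>Basis. (\<xi> e)\<^sup>2) * (\<integral>t. frac_kernel 1 (S - t) * slice W g t \<partial>lborel) = 0"
proof (cases "S > 0")
  case False
  have "slice W g t = 0" if "t < S" for t
    using that False by (simp add: slice_def W_def)
  then have z: "frac_kernel \<beta> (S - t) * slice W g t = 0" for \<beta> t
    by (cases "t < S") (auto simp: frac_kernel_def)
  show ?thesis by (simp only: z Bochner_Integration.integral_zero mult_zero_right add_0_left)
next
  case S0: True
  let ?\<Lambda> = "\<Sum>e\<in>Basis. (\<xi> e)\<^sup>2"
  obtain \<psi> L :: "nat \<Rightarrow> 'a \<Rightarrow> real" and B where
    tf: "\<And>n T. T > 0 \<Longrightarrow> test_function T (\<lambda>_. \<psi> n)" and lapl: "\<And>n. laplacian (\<psi> n) = L n"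
    and m [measurable]: "\<And>n. \<psi> n \<in> borel_measurable borel" "\<And>n. L n \<in> borel_measurable borel"
    and bd: "\<And>n x. \<bar>\<psi> n x\<bar> \<le> B" "\<And>n x. \<bar>L n x\<bar> \<le> B"
    and lim': "\<And>x. (\<lambda>n. \<psi> n x) \<longlonglongrightarrow> (\<Prod>e\<in>Basis. cos (c e + \<xi> e * (x \<bullet> e)))"
      "\<And>x. (\<lambda>n. L n x) \<longlonglongrightarrow> - ?\<Lambda> * (\<Prod>e\<in>Basis. cos (c e + \<xi> e * (x \<bullet> e)))"
    by (rule trigonometric_test_functions[of c \<xi>]) (rule that)
  have lim: "(\<lambda>n. \<psi> n x) \<longlonglongrightarrow> g x" "(\<lambda>n. L n x) \<longlonglongrightarrow> - ?\<Lambda> * g x" for x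
    using lim' by (simp_all only: g_def)
  have W: "L1_slices C W" using w(1) by (simp add: W_def)
  have [measurable]: "W \<in> borel_measurable borel" using W by (simp add: L1_slices_def)
  have [measurable]: "g \<in> borel_measurable borel" unfolding g_def by measurable
  have diff: "AE t in lborel. \<forall>n. slice W (f n) t = indicator {0<..<T} t * slice w1 (f n) t - indicator {0<..<T} t * slice w2 (f n) t"
    if fm: "\<And>n. f n \<in> borel_measurable borel" "\<And>n x. \<bar>f n x\<bar> \<le> B" for f :: "nat \<Rightarrow> 'a \<Rightarrow> real"
    unfolding AE_all_countable
  proof
    fix n
    show "AE t in lborel. slice W (f n) t = indicator {0<..<T} t * slice w1 (f n) t - indicator {0<..<T} t * slice w2 (f n) t"
      using slice_bound[OF w(2) fm(1)[of n] fm(2)[of n]] slice_bound[OF w(3) fm(1)[of n] fm(2)[of n]]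
    proof eventually_elim
      case (elim t)
      then show ?case
        by (cases "t \<in> {0<..<T}") (auto simp: slice_def W_def left_diff_distrib)
    qed
  qed
  have split: "(\<integral>t. frac_kernel \<beta> (S - t) * slice W (f n) t \<partial>lborel) =
      (\<integral>t. frac_kernel \<beta> (S - t) * (indicator {0<..<S} t * slice w1 (f n) t) \<partial>lborel) -
      (\<integral>t. frac_kernel \<beta> (S - t) * (indicator {0<..<S} t * slice w2 (f n) t) \<partial>lborel)"
    if \<beta>: "\<beta> > 0" and fm [measurable]: "\<And>n. f n \<in> borel_measurable borel" "\<And>n x. \<bar>f n x\<bar> \<le> B"
    for f :: "nat \<Rightarrow> 'a \<Rightarrow> real" and n \<beta>
  proof -
    have i: "integrable lborel (\<lambda>t. frac_kernel \<beta> (S - t) * (indicator {0<..<S} t * slice u (f n) t))"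
      if "L1_slices C' (\<lambda>p. indicator {0<..<T} (fst p) * u p)" and [measurable]: "u \<in> borel_measurable borel" for C' u
    proof (rule frac_kernel_bounded_integrable[OF \<beta>])
      show "AE t in lborel. \<bar>indicator {0<..<S} t * slice u (f n) t\<bar> \<le> C' * B * indicator {0<..} t"
        using slice_bound[OF that(1) fm(1)[of n] fm(2)[of n]]
      proof eventually_elim
        case (elim t)
        have "\<bar>indicator {0<..<S} t * slice u (f n) t\<bar> \<le> \<bar>slice (\<lambda>p. indicator {0<..<T} (fst p) * u p) (f n) t\<bar>"
          using S by (auto simp: indicator_def slice_def)
        then show ?case using elim by linarith
      qed
    qed measurable
    have dfm: "AE t in lborel. \<forall>n. slice W (f n) t = indicator {0<..<T} t * slice w1 (f n) t - indicator {0<..<T} t * slice w2 (f n) t"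
      by (rule diff[OF fm])
    have "(\<integral>t. frac_kernel \<beta> (S - t) * slice W (f n) t \<partial>lborel) =
      (\<integral>t. frac_kernel \<beta> (S - t) * (indicator {0<..<S} t * slice w1 (f n) t) -
        frac_kernel \<beta> (S - t) * (indicator {0<..<S} t * slice w2 (f n) t) \<partial>lborel)"
    proof (rule integral_cong_AE)
      show "AE t in lborel. frac_kernel \<beta> (S - t) * slice W (f n) t =
        frac_kernel \<beta> (S - t) * (indicator {0<..<S} t * slice w1 (f n) t) -
        frac_kernel \<beta> (S - t) * (indicator {0<..<S} t * slice w2 (f n) t)"
        using dfm
      proof eventually_elim
        case (elim t)
        then show ?case
        proof (cases "t < S")
          case True
          \<comment> \<open>W is cut off once at T. The kernel vanishes for t \<ge> S, and below S
            the cut-offs at S and T agree.\<close>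
          then have "indicator {0<..<T} t = (indicator {0<..<S} t :: real)" using S by (auto simp: indicator_def)
          then show ?thesis using elim by (simp add: right_diff_distrib)
        qed (simp add: frac_kernel_def)
      qed
    qed measurable
    also have "\<dots> = (\<integral>t. frac_kernel \<beta> (S - t) * (indicator {0<..<S} t * slice w1 (f n) t) \<partial>lborel) -
      (\<integral>t. frac_kernel \<beta> (S - t) * (indicator {0<..<S} t * slice w2 (f n) t) \<partial>lborel)"
      by (intro Bochner_Integration.integral_diff i[OF w(2) meas(1)] i[OF w(3) meas(2)])
    finally show ?thesis .
  qed
  have one: "(\<integral>t. frac_kernel 1 (S - t) * (indicator {0<..<S} t * h t) \<partial>lborel) = (\<integral>t. indicator {0<..<S} t * h t \<partial>lborel)" for h
    by (intro Bochner_Integration.integral_cong) (auto simp: frac_kernel_1 indicator_def)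
  have eqn: "(\<integral>t. frac_kernel (1 - \<alpha>) (S - t) * slice W (\<psi> n) t \<partial>lborel) =
      (\<integral>t. frac_kernel 1 (S - t) * slice W (L n) t \<partial>lborel)" for n
    using eq[OF S0 S tf[OF S0] m(1), of n] split[where f = \<psi> and \<beta> = "1 - \<alpha>" and n = n, OF _ m(1) bd(1)]
      split[where f = L and \<beta> = 1 and n = n, OF _ m(2) bd(2)] \<alpha>
    by (simp add: one lapl)
  have limit: "(\<lambda>n. \<integral>t. frac_kernel \<beta> (S - t) * slice W (f n) t \<partial>lborel) \<longlonglongrightarrow>
      (\<integral>t. frac_kernel \<beta> (S - t) * slice W h t \<partial>lborel)"
    if \<beta>: "\<beta> > 0" and fm [measurable]: "\<And>n. f n \<in> borel_measurable borel" "\<And>n x. \<bar>f n x\<bar> \<le> B"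
      and h [measurable]: "h \<in> borel_measurable borel" and fh: "\<And>x. (\<lambda>n. f n x) \<longlonglongrightarrow> h x"
    for f :: "nat \<Rightarrow> 'a \<Rightarrow> real" and h \<beta>
  proof (rule integral_dominated_convergence[where w = "\<lambda>t. C * B * (indicator {0<..} t * frac_kernel \<beta> (S - t))"])
    show "integrable lborel (\<lambda>t. C * B * (indicator {0<..} t * frac_kernel \<beta> (S - t)))"
      by (intro integrable_mult_right integrable.intros[OF frac_kernel_primitive[OF \<beta>]])
    show "AE t in lborel. norm (frac_kernel \<beta> (S - t) * slice W (f n) t)
        \<le> C * B * (indicator {0<..} t * frac_kernel \<beta> (S - t))" for n
      using slice_bound[OF W fm(1)[of n] fm(2)[of n]]
    proof eventually_elim
      case (elim t)
      then have "\<bar>slice W (f n) t\<bar> * frac_kernel \<beta> (S - t) \<le> C * B * indicator {0<..} t * frac_kernel \<beta> (S - t)"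
        using frac_kernel_nonneg[OF \<beta>] by (intro mult_right_mono) auto
      then show ?case using frac_kernel_nonneg[OF \<beta>, of "S - t"] by (simp add: abs_mult mult_ac)
    qed
    show "AE t in lborel. (\<lambda>n. frac_kernel \<beta> (S - t) * slice W (f n) t) \<longlonglongrightarrow> frac_kernel \<beta> (S - t) * slice W h t"
      using W[unfolded L1_slices_def, THEN conjunct2, THEN conjunct2]
    proof eventually_elim
      case (elim t)
      have [measurable]: "(\<lambda>x. W (t, x)) \<in> borel_measurable borel" using elim by auto
      have "(\<lambda>n. slice W (f n) t) \<longlonglongrightarrow> slice W h t"
        unfolding slice_def
      proof (rule integral_dominated_convergence[where w = "\<lambda>x. \<bar>W (t, x)\<bar> * B"])
        show "integrable lborel (\<lambda>x. \<bar>W (t, x)\<bar> * B)" using elim by auto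
        show "AE x in lborel. norm (W (t, x) * f n x) \<le> \<bar>W (t, x)\<bar> * B" for n
          using fm(2) by (intro AE_I2) (auto simp: abs_mult intro!: mult_left_mono)
        show "AE x in lborel. (\<lambda>n. W (t, x) * f n x) \<longlonglongrightarrow> W (t, x) * h x"
          by (intro AE_I2 tendsto_intros fh)
      qed measurable
      then show ?case by (intro tendsto_intros)
    qed
  qed measurable
  have l1: "(\<lambda>n. \<integral>t. frac_kernel (1 - \<alpha>) (S - t) * slice W (\<psi> n) t \<partial>lborel) \<longlonglongrightarrow>
      (\<integral>t. frac_kernel (1 - \<alpha>) (S - t) * slice W g t \<partial>lborel)"
    using \<alpha> by (intro limit bd(1) lim(1)) auto
  have l2: "(\<lambda>n. \<integral>t. frac_kernel 1 (S - t) * slice W (L n) t \<partial>lborel) \<longlonglongrightarrow>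
      (\<integral>t. frac_kernel 1 (S - t) * slice W (\<lambda>x. - ?\<Lambda> * g x) t \<partial>lborel)"
    by (intro limit bd(2) lim(2)) auto
  have "slice W (\<lambda>x. - ?\<Lambda> * g x) t = - ?\<Lambda> * slice W g t" for t
  proof -
    have "slice W (\<lambda>x. - ?\<Lambda> * g x) t = (\<integral>x. - ?\<Lambda> * (W (t, x) * g x) \<partial>lborel)"
      unfolding slice_def by (intro Bochner_Integration.integral_cong) auto
    then show ?thesis unfolding slice_def integral_mult_right_zero .
  qed
  then have "(\<integral>t. frac_kernel 1 (S - t) * slice W (\<lambda>x. - ?\<Lambda> * g x) t \<partial>lborel) =
      (\<integral>t. - ?\<Lambda> * (frac_kernel 1 (S - t) * slice W g t) \<partial>lborel)"
    by (intro Bochner_Integration.integral_cong) auto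
  also have "\<dots> = - ?\<Lambda> * (\<integral>t. frac_kernel 1 (S - t) * slice W g t \<partial>lborel)"
    by (rule integral_mult_right_zero)
  finally show ?thesis
    using LIMSEQ_unique[OF l1 l2[folded eqn]] by simp
qed

lemma weak_solution_unique:
  fixes u v :: "real \<Rightarrow> 'a::euclidean_space \<Rightarrow> real"
  assumes \<alpha>: "0 < \<alpha>" "\<alpha> < 1" and u: "weak_solution \<alpha> M u" and v: "weak_solution \<alpha> M v"
  shows "AE (t, x) in lebesgue. 0 < t \<longrightarrow> v t x = u t x"
proof -
  have Lu: "\<And>T. T > 0 \<Longrightarrow> Linf_L1 T u" and Lv: "\<And>T. T > 0 \<Longrightarrow> Linf_L1 T v"
    using u v unfolding weak_solution_def by blast+
  obtain w1 where w1 [measurable]: "w1 \<in> borel_measurable borel" and ae1: "AE p in lborel. 0 < fst p \<longrightarrow> u (fst p) (snd p) = w1 p"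
    and sl1: "AE t in lborel. 0 < t \<longrightarrow> (AE x in lborel. u t x = w1 (t, x))"
    and b1: "\<And>T. T > 0 \<Longrightarrow> \<exists>C. L1_slices C (\<lambda>p. indicator {0<..<T} (fst p) * w1 p)"
    by (rule Linf_L1_representative[of u], erule Lu) (rule that)
  obtain w2 where w2 [measurable]: "w2 \<in> borel_measurable borel" and ae2: "AE p in lborel. 0 < fst p \<longrightarrow> v (fst p) (snd p) = w2 p"
    and sl2: "AE t in lborel. 0 < t \<longrightarrow> (AE x in lborel. v t x = w2 (t, x))"
    and b2: "\<And>T. T > 0 \<Longrightarrow> \<exists>C. L1_slices C (\<lambda>p. indicator {0<..<T} (fst p) * w2 p)"
    by (rule Linf_L1_representative[of v], erule Lv) (rule that)
  have "AE p in lborel. indicator {0<..<real (Suc n)} (fst p) * (w1 p - w2 p) = 0" for n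
  proof -
    \<comment> \<open>The solutions are integrable only over bounded time intervals; countably many
      of them are enough for a statement almost everywhere.\<close>
    define T where "T = real (Suc n)"
    have T: "T > 0" by (simp add: T_def)
    obtain C1 C2 where C1: "L1_slices C1 (\<lambda>p. indicator {0<..<T} (fst p) * w1 p)"
      and C2: "L1_slices C2 (\<lambda>p. indicator {0<..<T} (fst p) * w2 p)"
      using b1[OF T] b2[OF T] by blast
    define W where "W = (\<lambda>p. indicator {0<..<T} (fst p) * (w1 p - w2 p))"
    have [measurable]: "W \<in> borel_measurable borel" unfolding W_def by measurable
    have "AE t in lborel. integrable lborel (\<lambda>x. W (t, x)) \<and> (\<integral>x. \<bar>W (t, x)\<bar> \<partial>lborel) \<le> (C1 + C2) * indicator {0<..} t"
      using C1[unfolded L1_slices_def, THEN conjunct2, THEN conjunct2] C2[unfolded L1_slices_def, THEN conjunct2, THEN conjunct2]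
    proof eventually_elim
      case (elim t)
      let ?a = "\<lambda>x. indicator {0<..<T} t * w1 (t, x)" and ?b = "\<lambda>x. indicator {0<..<T} t * w2 (t, x)"
      have e: "integrable lborel ?a" "integrable lborel ?b"
        "(\<integral>x. \<bar>?a x\<bar> \<partial>lborel) \<le> C1 * indicator {0<..} t" "(\<integral>x. \<bar>?b x\<bar> \<partial>lborel) \<le> C2 * indicator {0<..} t"
        using elim by simp_all
      have W: "W (t, x) = ?a x - ?b x" for x by (simp add: W_def right_diff_distrib)
      have "(\<integral>x. \<bar>W (t, x)\<bar> \<partial>lborel) \<le> (\<integral>x. \<bar>?a x\<bar> + \<bar>?b x\<bar> \<partial>lborel)"
        unfolding W by (intro integral_mono Bochner_Integration.integrable_add integrable_abs Bochner_Integration.integrable_diff e) simp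
      also have "\<dots> = (\<integral>x. \<bar>?a x\<bar> \<partial>lborel) + (\<integral>x. \<bar>?b x\<bar> \<partial>lborel)"
        by (intro Bochner_Integration.integral_add integrable_abs e)
      finally have "(\<integral>x. \<bar>W (t, x)\<bar> \<partial>lborel) \<le> (C1 + C2) * indicator {0<..} t"
        using e by (simp add: distrib_right)
      moreover have "integrable lborel (\<lambda>x. W (t, x))"
        unfolding W by (intro Bochner_Integration.integrable_diff e)
      ultimately show ?case by simp
    qed
    then have W: "L1_slices (C1 + C2) W"
      using C1 C2 by (simp add: L1_slices_def)
    have intW: "integrable lborel W"
      by (rule L1_slices_integrable[OF W, of T]) (simp add: W_def)
    have "AE p in lborel. W p = 0"
    proof (rule AE_eq_0_if_spatial_cosine_transforms_eq_0[OF intW])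
      show "W p = 0" if "fst p \<le> 0" for p using that by (simp add: W_def)
      fix s c and \<xi> :: "'a \<Rightarrow> real" assume s: "s > (0::real)"
      define g where "g = (\<lambda>x. \<Prod>e\<in>Basis. cos (c e + \<xi> e * (x \<bullet> e)))"
      have g_meas [measurable]: "g \<in> borel_measurable borel" unfolding g_def by measurable
      have g_bd: "\<bar>g x\<bar> \<le> 1" for x
        unfolding g_def abs_prod by (intro prod_le_1) auto
      have eqS: "(\<integral>t. frac_kernel (1 - \<alpha>) (S - t) * slice W g t \<partial>lborel) +
        (\<Sum>e\<in>Basis. (\<xi> e)\<^sup>2) * (\<integral>t. frac_kernel 1 (S - t) * slice W g t \<partial>lborel) = 0" if "S \<le> T" for S
        unfolding g_def W_def
      proof (rule weak_solution_difference_trigonometric[OF \<alpha> T _ C1 C2 w1 w2 _ that])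
        show "L1_slices (C1 + C2) (\<lambda>p. indicator {0<..<T} (fst p) * (w1 p - w2 p))"
          using W by (simp add: W_def)
        fix S and \<psi> :: "'a \<Rightarrow> real" assume S: "0 < S" and tf: "test_function S (\<lambda>_. \<psi>)"
          and m: "\<psi> \<in> borel_measurable borel" "laplacian \<psi> \<in> borel_measurable borel"
        show "(\<integral>t. frac_kernel (1 - \<alpha>) (S - t) * (indicator {0<..<S} t * slice w1 \<psi> t) \<partial>lborel) -
          (\<integral>t. indicator {0<..<S} t * slice w1 (laplacian \<psi>) t \<partial>lborel) =
          (\<integral>t. frac_kernel (1 - \<alpha>) (S - t) * (indicator {0<..<S} t * slice w2 \<psi> t) \<partial>lborel) -
          (\<integral>t. indicator {0<..<S} t * slice w2 (laplacian \<psi>) t \<partial>lborel)"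
          using weak_solution_slices[OF \<alpha> u S w1 sl1 tf m] weak_solution_slices[OF \<alpha> v S w2 sl2 tf m] by simp
      qed
      have bound: "AE t in lborel. \<bar>slice W g t\<bar> \<le> (C1 + C2) * indicator {0<..} t"
        using slice_bound[OF W g_meas g_bd] by eventually_elim simp
      have C0: "C1 + C2 \<ge> 0" using W by (simp add: L1_slices_def)
      \<comment> \<open>The Volterra equation is available up to T only. As W vanishes from T on,
        integrating up to the minimum of s and T covers every s.\<close>
      have zero: "(\<integral>t. frac_kernel 1 (min s T - t) * slice W g t \<partial>lborel) = 0"
        by (rule fractional_Volterra_unique[OF \<alpha> _ _ bound C0 eqS]) (auto intro: sum_nonneg)
      have "(\<integral>p. W p * (indicator {..<s} (fst p) * g (snd p)) \<partial>lborel) =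
          (\<integral>p. W p * (indicator {..<s} (fst p) * g (snd p)) \<partial>(lborel \<Otimes>\<^sub>M lborel))"
        by (subst lborel_prod) (rule refl)
      also have "\<dots> = (\<integral>t. \<integral>x. W (t, x) * (indicator {..<s} t * g x) \<partial>lborel \<partial>lborel)"
      proof (subst lborel_pair.integral_fst'[symmetric])
        have "\<bar>indicator {..<s} (fst p) * g (snd p)\<bar> \<le> 1" for p
          using g_bd[of "snd p"] by (auto simp: indicator_def)
        then have "integrable lborel (\<lambda>p. W p * (indicator {..<s} (fst p) * g (snd p)))"
          by (intro integrable_mult_bounded[OF intW, where C = 1]) auto
        then show "integrable (lborel \<Otimes>\<^sub>M lborel) (\<lambda>p. W p * (indicator {..<s} (fst p) * g (snd p)))"
          by (subst lborel_prod)
      qed simp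
      also have "\<dots> = (\<integral>t. frac_kernel 1 (min s T - t) * slice W g t \<partial>lborel)"
      proof (intro Bochner_Integration.integral_cong refl)
        fix t
        have "(\<integral>x. W (t, x) * (indicator {..<s} t * g x) \<partial>lborel) = (\<integral>x. indicator {..<s} t * (W (t, x) * g x) \<partial>lborel)"
          by (simp only: mult_ac)
        also have "\<dots> = indicator {..<s} t * slice W g t"
          unfolding slice_def by (rule integral_mult_right_zero)
        also have "\<dots> = frac_kernel 1 (min s T - t) * slice W g t"
        proof (cases "t < T")
          case True
          then show ?thesis by (auto simp: frac_kernel_1 indicator_def)
        next
          case False
          then have "slice W g t = 0" by (simp add: slice_def W_def)
          then show ?thesis by simp
        qed
        finally show "(\<integral>x. W (t, x) * (indicator {..<s} t * g x) \<partial>lborel) = frac_kernel 1 (min s T - t) * slice W g t" .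
      qed
      also have "\<dots> = 0" by (rule zero)
      finally show "(\<integral>p. W p * indicator {..<s} (fst p) * (\<Prod>e\<in>Basis. cos (c e + \<xi> e * (snd p \<bullet> e))) \<partial>lborel) = 0"
        by (simp only: mult.assoc g_def)
    qed
    then show ?thesis by (simp only: W_def T_def)
  qed
  then have "AE p in lborel. \<forall>n. indicator {0<..<real (Suc n)} (fst p) * (w1 p - w2 p) = 0"
    by (simp only: AE_all_countable) blast
  then have "AE p in lborel. 0 < fst p \<longrightarrow> v (fst p) (snd p) = u (fst p) (snd p)"
    using ae1 ae2
  proof eventually_elim
    case (elim p)
    show ?case
    proof
      assume p: "0 < fst p"
      obtain n where "fst p < real n" using reals_Archimedean2 by blast
      then have "indicator {0<..<real (Suc n)} (fst p) = (1 :: real)" using p by simp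
      then have "w1 p = w2 p" using elim(1)[rule_format, of n] by simp
      then show "v (fst p) (snd p) = u (fst p) (snd p)" using elim p by simp
    qed
  qed
  then show ?thesis
    by (auto simp: case_prod_unfold intro: AE_completion)
qed

section \<open>Scale mixtures by the Mittag-Leffler distribution\<close>

lemma sigma_finite_real_distribution: "real_distribution \<mu> \<Longrightarrow> sigma_finite_measure \<mu>"
  by (simp add: real_distribution_def prob_space_def finite_measure_def)

lemma integral_distr_density:
  fixes f g :: "'a \<Rightarrow> real" and h :: "real \<Rightarrow> real"
  assumes [measurable]: "f \<in> borel_measurable M" "X \<in> borel_measurable M" "h \<in> borel_measurable borel"
    and nn: "\<And>x. f x \<ge> 0"
  shows "(\<integral>y. h y \<partial>distr (density M (\<lambda>x. ennreal (f x))) borel X) = (\<integral>x. f x * h (X x) \<partial>M)"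
    and "integrable (distr (density M (\<lambda>x. ennreal (f x))) borel X) h \<longleftrightarrow> integrable M (\<lambda>x. f x * h (X x))"
  using nn by (simp_all add: integral_distr integral_density integrable_distr_eq integrable_density)

locale Mittag_Leffler =
  fixes \<alpha> :: real and \<mu> :: "real measure"
  assumes \<alpha>: "0 < \<alpha>" "\<alpha> < 1" and rd: "real_distribution \<mu>"
    and nonneg: "AE x in \<mu>. 0 \<le> x"
    and int_mom: "\<And>k. integrable \<mu> (\<lambda>x. x ^ k)"
    and mom: "\<And>k. (\<integral>x. x ^ k \<partial>\<mu>) = fact k / Gamma (1 + \<alpha> * k)"
begin

sublocale \<mu>: real_distribution \<mu> by (rule rd)

sublocale P: pair_sigma_finite lborel \<mu>
  by (simp add: pair_sigma_finite_def sigma_finite_real_distribution[OF rd] sigma_finite_lborel)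

lemma sets_pair [measurable_cong]: "sets (lborel \<Otimes>\<^sub>M \<mu>) = sets (borel \<Otimes>\<^sub>M borel)"
  by (intro sets_pair_measure_cong) auto

definition weight :: "real \<Rightarrow> real \<Rightarrow> real \<Rightarrow> real" where
  "weight \<beta> S t = indicator {0<..} t * frac_kernel \<beta> (S - t)"

lemma weight_measurable [measurable]: "weight \<beta> S \<in> borel_measurable borel"
  unfolding weight_def by measurable

lemma weight_nonneg: "\<beta> > 0 \<Longrightarrow> weight \<beta> S t \<ge> 0"
  by (simp add: weight_def frac_kernel_nonneg)

lemma weight_integral:
  assumes "\<beta> > 0"
  shows "integrable lborel (weight \<beta> S)" "(\<integral>t. weight \<beta> S t \<partial>lborel) = frac_kernel (\<beta> + 1) S"
  using frac_kernel_primitive[OF assms, of S] unfolding weight_def[abs_def]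
  by (auto simp: has_bochner_integral_iff)

text \<open>The power t^(\<alpha> k) is \<Gamma>(1 + \<alpha> k) times the kernel of order 1 +
  \<alpha> k, so this is an instance of the semigroup law. The Gamma factor later cancels against
  the one in the moments of \<mu>.\<close>

lemma weight_power:
  assumes \<beta>: "\<beta> > 0"
  shows "has_bochner_integral lborel (\<lambda>t. weight \<beta> S t * (t powr \<alpha>) ^ k)
    (Gamma (1 + \<alpha> * k) * frac_kernel (\<beta> + (1 + \<alpha> * k)) S)"
proof -
  have p: "1 + \<alpha> * k > 0" using \<alpha> by (intro add_pos_nonneg) auto
  have "has_bochner_integral lborel (\<lambda>t. Gamma (1 + \<alpha> * k) * (frac_kernel \<beta> (S - t) * frac_kernel (1 + \<alpha> * k) t))
      (Gamma (1 + \<alpha> * k) * frac_kernel (\<beta> + (1 + \<alpha> * k)) S)"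
    by (intro has_bochner_integral_mult_right frac_kernel_convolution \<beta> p)
  moreover have "Gamma (1 + \<alpha> * k) * (frac_kernel \<beta> (S - t) * frac_kernel (1 + \<alpha> * k) t) =
      weight \<beta> S t * (t powr \<alpha>) ^ k" for t
    using Gamma_real_pos[OF p]
    by (simp add: weight_def frac_kernel_def powr_powr powr_realpow[symmetric] powr_gt_zero)
  ultimately show ?thesis by simp
qed

text \<open>The law of the clock t^\<alpha> s at which the heat flow is read, when t has the density
  \<open>weight \<beta> S\<close> and s the law \<mu>. The parameter 1 - \<alpha> belongs to the
  Riemann-Liouville side of the equation, the parameter 1 to the Laplacian side. The total mass is
  not normalised.\<close>

definition mixture :: "real \<Rightarrow> real \<Rightarrow> real measure" where
  "mixture \<beta> S = distr (density (lborel \<Otimes>\<^sub>M \<mu>) (\<lambda>p. ennreal (weight \<beta> S (fst p)))) borel (\<lambda>p. fst p powr \<alpha> * snd p)"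

lemma weight_pair_integrable:
  assumes \<beta>: "\<beta> > 0" and g [measurable]: "case_prod g \<in> borel_measurable (borel \<Otimes>\<^sub>M borel)"
    and bd: "\<And>t s. t > 0 \<Longrightarrow> s \<ge> 0 \<Longrightarrow> \<bar>g t s\<bar> \<le> B"
  shows "integrable (lborel \<Otimes>\<^sub>M \<mu>) (\<lambda>p. weight \<beta> S (fst p) * g (fst p) (snd p))"
proof -
  have B: "B \<ge> 0" using bd[of 1 0] by simp
  have gt: "g t \<in> borel_measurable borel" for t using g by simp
  have gi: "integrable \<mu> (g t)" if "t > 0" for t
    by (rule \<mu>.integrable_const_bound[of _ B]) (use nonneg bd[OF that] gt in \<open>auto elim!: eventually_mono\<close>)
  have "integrable (lborel \<Otimes>\<^sub>M \<mu>) (\<lambda>(t, s). weight \<beta> S t * g t s)"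
  proof (rule P.Fubini_integrable)
    show "integrable lborel (\<lambda>t. \<integral>s. norm (case (t, s) of (t, s) \<Rightarrow> weight \<beta> S t * g t s) \<partial>\<mu>)"
    proof (rule Bochner_Integration.integrable_bound)
      show "integrable lborel (\<lambda>t. weight \<beta> S t * B)"
        using weight_integral(1)[OF \<beta>] by simp
      have "\<bar>\<integral>s. \<bar>weight \<beta> S t * g t s\<bar> \<partial>\<mu>\<bar> \<le> weight \<beta> S t * B" for t
      proof (cases "t > 0")
        case True
        have "(\<integral>s. \<bar>g t s\<bar> \<partial>\<mu>) \<le> (\<integral>s. B \<partial>\<mu>)"
          by (rule integral_mono_AE) (use gi[OF True] nonneg bd[OF True] in \<open>auto elim!: eventually_mono\<close>)
        then have "(\<integral>s. \<bar>g t s\<bar> \<partial>\<mu>) \<le> B" by (simp add: \<mu>.prob_space[unfolded \<mu>.space_eq_univ])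
        then have "weight \<beta> S t * (\<integral>s. \<bar>g t s\<bar> \<partial>\<mu>) \<le> weight \<beta> S t * B"
          by (intro mult_left_mono weight_nonneg[OF \<beta>])
        moreover have "(\<integral>s. \<bar>weight \<beta> S t * g t s\<bar> \<partial>\<mu>) = weight \<beta> S t * (\<integral>s. \<bar>g t s\<bar> \<partial>\<mu>)"
          by (simp add: abs_mult weight_nonneg[OF \<beta>])
        moreover have "0 \<le> weight \<beta> S t * (\<integral>s. \<bar>g t s\<bar> \<partial>\<mu>)"
          by (intro mult_nonneg_nonneg weight_nonneg[OF \<beta>] Bochner_Integration.integral_nonneg) auto
        ultimately show ?thesis by linarith
      qed (simp add: weight_def)
      then show "AE t in lborel. norm (\<integral>s. norm (case (t, s) of (t, s) \<Rightarrow> weight \<beta> S t * g t s) \<partial>\<mu>)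
          \<le> norm (weight \<beta> S t * B)"
        using weight_nonneg[OF \<beta>] B by (intro AE_I2) simp
    qed measurable
    show "AE t in lborel. integrable \<mu> (\<lambda>s. case (t, s) of (t, s) \<Rightarrow> weight \<beta> S t * g t s)"
      using gi by (intro AE_I2) (auto simp: weight_def indicator_def)
  qed measurable
  then show ?thesis by (simp add: case_prod_unfold)
qed

lemma mixture_finite:
  assumes \<beta>: "\<beta> > 0"
  shows "finite_borel_measure (mixture \<beta> S)"
  unfolding mixture_def
proof (rule finite_borel_measure_distr_density)
  show "integrable (lborel \<Otimes>\<^sub>M \<mu>) (\<lambda>p. weight \<beta> S (fst p))"
    using weight_pair_integrable[OF \<beta>, of "\<lambda>_ _. 1" 1 S] by simp
qed (use weight_nonneg[OF \<beta>] in auto)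

lemma mixture_integral:
  assumes \<beta>: "\<beta> > 0" and [measurable]: "h \<in> borel_measurable borel" and bd: "\<And>x. x \<ge> 0 \<Longrightarrow> \<bar>h x\<bar> \<le> B"
  shows "(\<integral>y. h y \<partial>mixture \<beta> S) = (\<integral>t. weight \<beta> S t * (\<integral>s. h (t powr \<alpha> * s) \<partial>\<mu>) \<partial>lborel)"
    and "integrable (mixture \<beta> S) h"
proof -
  have i: "integrable (lborel \<Otimes>\<^sub>M \<mu>) (\<lambda>p. weight \<beta> S (fst p) * h (fst p powr \<alpha> * snd p))"
    by (rule weight_pair_integrable[OF \<beta>, where g = "\<lambda>t s. h (t powr \<alpha> * s)" and B = B]) (auto intro!: bd)
  then show "integrable (mixture \<beta> S) h"
    unfolding mixture_def by (subst integral_distr_density(2)) (auto simp: weight_nonneg[OF \<beta>])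
  have "(\<integral>y. h y \<partial>mixture \<beta> S) = (\<integral>p. weight \<beta> S (fst p) * h (fst p powr \<alpha> * snd p) \<partial>(lborel \<Otimes>\<^sub>M \<mu>))"
    unfolding mixture_def by (subst integral_distr_density(1)) (auto simp: weight_nonneg[OF \<beta>])
  also have "\<dots> = (\<integral>t. \<integral>s. weight \<beta> S t * h (t powr \<alpha> * s) \<partial>\<mu> \<partial>lborel)"
    using P.integral_fst'[OF i] by simp
  finally show "(\<integral>y. h y \<partial>mixture \<beta> S) = (\<integral>t. weight \<beta> S t * (\<integral>s. h (t powr \<alpha> * s) \<partial>\<mu>) \<partial>lborel)"
    by simp
qed

lemma mixture_moments:
  assumes \<beta>: "\<beta> > 0"
  shows "integrable (mixture \<beta> S) (\<lambda>x. x ^ k)" "(\<integral>x. x ^ k \<partial>mixture \<beta> S) = fact k * frac_kernel (\<beta> + 1 + \<alpha> * k) S"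
proof -
  note wp = weight_power[OF \<beta>, of S k, unfolded has_bochner_integral_iff]
  have p: "1 + \<alpha> * k > 0" using \<alpha> by (intro add_pos_nonneg) auto
  have e: "weight \<beta> S t * (t powr \<alpha> * s) ^ k = (weight \<beta> S t * (t powr \<alpha>) ^ k) * s ^ k" for t s
    by (simp add: power_mult_distrib)
  have "integrable (lborel \<Otimes>\<^sub>M \<mu>) (\<lambda>(t, s). weight \<beta> S t * (t powr \<alpha> * s) ^ k)"
  proof (rule P.Fubini_integrable)
    have "(\<integral>s. norm (case (t, s) of (t, s) \<Rightarrow> weight \<beta> S t * (t powr \<alpha> * s) ^ k) \<partial>\<mu>) =
        (weight \<beta> S t * (t powr \<alpha>) ^ k) * (\<integral>s. \<bar>s ^ k\<bar> \<partial>\<mu>)" for t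
      unfolding prod.case e by (simp add: abs_mult weight_nonneg[OF \<beta>])
    then show "integrable lborel (\<lambda>t. \<integral>s. norm (case (t, s) of (t, s) \<Rightarrow> weight \<beta> S t * (t powr \<alpha> * s) ^ k) \<partial>\<mu>)"
      using wp by simp
    show "AE t in lborel. integrable \<mu> (\<lambda>s. case (t, s) of (t, s) \<Rightarrow> weight \<beta> S t * (t powr \<alpha> * s) ^ k)"
      unfolding prod.case e using int_mom by (intro AE_I2 integrable_mult_right)
  qed measurable
  then have i: "integrable (lborel \<Otimes>\<^sub>M \<mu>) (\<lambda>p. weight \<beta> S (fst p) * (fst p powr \<alpha> * snd p) ^ k)"
    by (simp add: case_prod_unfold)
  then show "integrable (mixture \<beta> S) (\<lambda>x. x ^ k)"
    unfolding mixture_def by (subst integral_distr_density(2)) (auto simp: weight_nonneg[OF \<beta>])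
  have "(\<integral>x. x ^ k \<partial>mixture \<beta> S) = (\<integral>p. weight \<beta> S (fst p) * (fst p powr \<alpha> * snd p) ^ k \<partial>(lborel \<Otimes>\<^sub>M \<mu>))"
    unfolding mixture_def by (subst integral_distr_density(1)) (auto simp: weight_nonneg[OF \<beta>])
  also have "\<dots> = (\<integral>t. \<integral>s. (weight \<beta> S t * (t powr \<alpha>) ^ k) * s ^ k \<partial>\<mu> \<partial>lborel)"
    using P.integral_fst'[OF i] by (simp add: e)
  also have "\<dots> = (\<integral>t. weight \<beta> S t * (t powr \<alpha>) ^ k \<partial>lborel) * (\<integral>s. s ^ k \<partial>\<mu>)"
    by simp
  also have "\<dots> = fact k * frac_kernel (\<beta> + 1 + \<alpha> * k) S"
    using wp Gamma_real_pos[OF p] by (simp add: mom add.assoc)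
  finally show "(\<integral>x. x ^ k \<partial>mixture \<beta> S) = fact k * frac_kernel (\<beta> + 1 + \<alpha> * k) S" .
qed

lemma mixture_nonneg:
  assumes \<beta>: "\<beta> > 0"
  shows "AE x in mixture \<beta> S. 0 \<le> x"
proof -
  interpret finite_borel_measure "mixture \<beta> S" by (rule mixture_finite[OF \<beta>])
  have z: "(\<integral>s. indicator {..<0} (t powr \<alpha> * s) \<partial>\<mu>) = (0::real)" for t
    by (rule integral_eq_zero_AE, use nonneg in eventually_elim) (auto simp: indicator_def mult_less_0_iff not_less)
  have "(\<integral>y. indicator {..<0} y \<partial>mixture \<beta> S) = (\<integral>t. weight \<beta> S t * (\<integral>s. indicator {..<0} (t powr \<alpha> * s) \<partial>\<mu>) \<partial>lborel)"
    by (rule mixture_integral(1)[OF \<beta>, where B = 1]) (auto simp: indicator_def)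
  then have "measure (mixture \<beta> S) {..<0} = 0"
    using sets_eq_imp_space_eq[OF M_is_borel] by (simp add: z M_is_borel)
  then have "{..<0} \<in> null_sets (mixture \<beta> S)"
    by (simp add: null_sets_def M_is_borel emeasure_eq_measure)
  from AE_not_in[OF this] show ?thesis by eventually_elim auto
qed

lemma tail_measurable:
  assumes S: "S > 0"
  shows "(\<lambda>r. measure (mixture (1 - \<alpha>) S) {r<..}) \<in> borel_measurable borel"
proof -
  let ?A = "mixture (1 - \<alpha>) S"
  interpret A: finite_borel_measure ?A by (rule mixture_finite) (use \<alpha> in simp)
  have spA: "space ?A = UNIV" using sets_eq_imp_space_eq[OF A.M_is_borel] by simp
  have "measure ?A {r<..} = measure ?A UNIV - cdf ?A r" for r
    using A.finite_measure_compl[of "{..r}"]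
    by (simp add: cdf_def spA Compl_eq_Diff_UNIV[symmetric] A.M_is_borel Compl_atMost)
  moreover have "cdf ?A \<in> borel_measurable borel"
    by (intro borel_measurable_mono monoI A.cdf_nondecreasing)
  ultimately show ?thesis by simp
qed

text \<open>This identity carries the time-fractional equation; both sides have the same moments.\<close>

lemma mixture_1_eq_tail:
  assumes S: "S > 0"
  defines "A \<equiv> mixture (1 - \<alpha>) S"
  shows "mixture 1 S = density lborel (\<lambda>r. ennreal (measure A {r<..}) * indicator {0<..} r)" (is "_ = ?C")
proof (rule finite_borel_measure_eqI_moments)
  have \<beta>: "1 - \<alpha> > 0" using \<alpha> by simp
  interpret A: finite_borel_measure A unfolding A_def by (rule mixture_finite[OF \<beta>])
  have spA: "space A = UNIV" using sets_eq_imp_space_eq[OF A.M_is_borel] by simp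
  note [measurable_cong] = A.M_is_borel
  have ns: "AE x in A. 0 \<le> x" unfolding A_def by (rule mixture_nonneg[OF \<beta>])
  interpret LA: pair_sigma_finite lborel A
    by (simp add: pair_sigma_finite_def sigma_finite_lborel A.sigma_finite_measure_axioms)
  have [measurable]: "(\<lambda>r. measure A {r<..}) \<in> borel_measurable borel"
    unfolding A_def by (rule tail_measurable[OF S])
  \<comment> \<open>By Tonelli's theorem the k-th moment of the tail function of A is the moment of
    A of order k + 1, divided by k + 1.\<close>
  have nn: "(\<integral>\<^sup>+r. ennreal (r ^ k) * (ennreal (measure A {r<..}) * indicator {0<..} r) \<partial>lborel) =
      ennreal (fact k * frac_kernel (2 + \<alpha> * k) S)" for k
  proof -
    have "(\<integral>\<^sup>+r. ennreal (r ^ k) * (ennreal (measure A {r<..}) * indicator {0<..} r) \<partial>lborel) =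
        (\<integral>\<^sup>+r. \<integral>\<^sup>+x. ennreal (r ^ k) * (if 0 < r \<and> r < x then 1 else 0) \<partial>A \<partial>lborel)"
    proof (rule nn_integral_cong)
      fix r :: real
      have "(\<integral>\<^sup>+x. ennreal (r ^ k) * (if 0 < r \<and> r < x then 1 else 0) \<partial>A) =
          (\<integral>\<^sup>+x. (ennreal (r ^ k) * indicator {0<..} r) * indicator {r<..} x \<partial>A)"
        by (intro nn_integral_cong) (auto simp: indicator_def)
      also have "\<dots> = (ennreal (r ^ k) * indicator {0<..} r) * emeasure A {r<..}"
        by (subst nn_integral_cmult_indicator) (auto simp: A.M_is_borel)
      finally show "ennreal (r ^ k) * (ennreal (measure A {r<..}) * indicator {0<..} r) =
          (\<integral>\<^sup>+x. ennreal (r ^ k) * (if 0 < r \<and> r < x then 1 else 0) \<partial>A)"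
        by (simp add: A.emeasure_eq_measure mult_ac)
    qed
    also have "\<dots> = (\<integral>\<^sup>+x. \<integral>\<^sup>+r. ennreal (r ^ k) * (if 0 < r \<and> r < x then 1 else 0) \<partial>lborel \<partial>A)"
      by (rule LA.Fubini'[symmetric]) measurable
    also have "\<dots> = (\<integral>\<^sup>+x. ennreal (x ^ Suc k / Suc k) \<partial>A)"
      by (rule nn_integral_cong_AE, use ns in eventually_elim) (rule nn_integral_power_Ioo)
    also have "\<dots> = ennreal (\<integral>x. x ^ Suc k / Suc k \<partial>A)"
    proof (rule nn_integral_eq_integral)
      show "integrable A (\<lambda>x. x ^ Suc k / Suc k)"
        using mixture_moments(1)[OF \<beta>, of S "Suc k"] unfolding A_def by (rule integrable_divide_zero)
      show "AE x in A. 0 \<le> x ^ Suc k / Suc k" using ns by eventually_elim simp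
    qed
    also have "(\<integral>x. x ^ Suc k / Suc k \<partial>A) = (\<integral>x. x ^ Suc k \<partial>A) / Suc k"
      by (rule integral_divide_zero)
    \<comment> \<open>The coincidence behind the identity: the moment of order k + 1 at parameter 1
      - \<alpha> has the kernel order (1 - \<alpha>) + 1 + \<alpha> (k + 1) = 2 + \<alpha> k, which
      is that of the moment of order k at parameter 1.\<close>
    also have "\<dots> = fact k * frac_kernel (2 + \<alpha> * k) S"
      unfolding A_def mixture_moments(2)[OF \<beta>] by (simp add: algebra_simps add_divide_distrib[symmetric]) (simp add: field_simps)
    finally show ?thesis .
  qed
  have hb: "has_bochner_integral lborel (\<lambda>r. (measure A {r<..} * indicator {0<..} r) * r ^ k)
      (fact k * frac_kernel (2 + \<alpha> * k) S)" for k
  proof (rule has_bochner_integral_nn_integral)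
    show "(\<integral>\<^sup>+r. ennreal ((measure A {r<..} * indicator {0<..} r) * r ^ k) \<partial>lborel) = ennreal (fact k * frac_kernel (2 + \<alpha> * k) S)"
      unfolding nn[symmetric] by (intro nn_integral_cong) (auto simp: indicator_def ennreal_mult' mult.commute)
    show "0 \<le> fact k * frac_kernel (2 + \<alpha> * k) S"
      using \<alpha> by (intro mult_nonneg_nonneg frac_kernel_nonneg add_pos_nonneg) auto
  qed (auto simp: indicator_def intro!: AE_I2)
  have C: "?C = density lborel (\<lambda>r. ennreal (measure A {r<..} * indicator {0<..} r))"
    by (intro density_cong) (auto simp: indicator_def)
  show Ci: "integrable ?C (\<lambda>x. x ^ k)" for k
    unfolding C using hb[of k] by (subst integrable_density) (auto simp: has_bochner_integral_iff)
  have Cm: "(\<integral>x. x ^ k \<partial>?C) = fact k * frac_kernel (2 + \<alpha> * k) S" for k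
    unfolding C using hb[of k] by (subst integral_density) (auto simp: has_bochner_integral_iff)
  show "(\<integral>x. x ^ k \<partial>mixture 1 S) = (\<integral>x. x ^ k \<partial>?C)" for k
    unfolding Cm using mixture_moments(2)[of 1 S k] by simp
  show "finite_borel_measure (mixture 1 S)" by (rule mixture_finite) simp
  show "integrable (mixture 1 S) (\<lambda>x. x ^ k)" for k by (rule mixture_moments(1)) simp
  have "emeasure ?C UNIV < \<infinity>"
    using nn[of 0] by (simp add: emeasure_density)
  then show "finite_borel_measure ?C"
    by (auto simp: finite_borel_measure_def finite_borel_measure_axioms_def intro!: finite_measureI)
  fix t :: real
  have "t ^ (2 * n) / fact (2 * n) * (\<integral>x. x ^ (2 * n) \<partial>mixture 1 S) = S * ((t * S powr \<alpha>) ^ (2 * n) / Gamma (2 + \<alpha> * (2 * n)))" for n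
  proof -
    have p: "S powr (2 + \<alpha> * real m - 1) = S * (S powr \<alpha>) ^ m" for m
    proof -
      have "S powr (\<alpha> * real m) = (S powr \<alpha>) ^ m"
        using S by (simp add: powr_powr[symmetric] powr_realpow)
      then show ?thesis using S powr_add[of S 1 "\<alpha> * real m"] by simp
    qed
    have "(\<integral>x. x ^ (2 * n) \<partial>mixture 1 S) = fact (2 * n) * (S * (S powr \<alpha>) ^ (2 * n) / Gamma (2 + \<alpha> * real (2 * n)))"
      using S mixture_moments(2)[of 1 S "2 * n"] by (simp only: frac_kernel_def p if_True one_add_one)
    then show ?thesis by (simp add: power_mult_distrib)
  qed
  moreover have "(\<lambda>n. S * ((t * S powr \<alpha>) ^ (2 * n) / Gamma (2 + \<alpha> * real (2 * n)))) \<longlonglongrightarrow> 0"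
  proof -
    have "(\<lambda>n. (t * S powr \<alpha>) ^ n / Gamma (2 + \<alpha> * n)) \<longlonglongrightarrow> 0"
      using \<alpha> by (intro power_over_Gamma_tendsto_0) auto
    from LIMSEQ_subseq_LIMSEQ[OF this, of "\<lambda>n. 2 * n"]
    have "(\<lambda>n. (t * S powr \<alpha>) ^ (2 * n) / Gamma (2 + \<alpha> * real (2 * n))) \<longlonglongrightarrow> 0"
      by (simp add: strict_mono_def o_def)
    from tendsto_mult_right_zero[OF this, of S] show ?thesis .
  qed
  ultimately show "(\<lambda>n. t ^ (2 * n) / fact (2 * n) * (\<integral>x. x ^ (2 * n) \<partial>mixture 1 S)) \<longlonglongrightarrow> 0"
    by (simp only:)
qed

text \<open>An atom of \<mu> at 0 would survive the scaling by t^\<alpha> and give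
  \<open>mixture 1 1\<close> an atom there, but that measure has a density by
  \<open>mixture_1_eq_tail\<close>. The heat kernel at time 0 is a point mass, so it is the absence
  of this atom that makes the solution a function.\<close>

lemma no_atom_at_0: "AE s in \<mu>. 0 < s"
proof -
  have G2: "Gamma (2::real) \<noteq> 0" using Gamma_real_pos[of "2::real"] by (metis less_irrefl zero_less_numeral)
  interpret B: finite_borel_measure "mixture 1 1" by (rule mixture_finite) simp
  have "emeasure (mixture 1 1) {0} = 0"
    unfolding mixture_1_eq_tail[OF zero_less_one]
  proof -
    have "ennreal (measure (mixture (1 - \<alpha>) 1) {r<..}) * indicator {0<..} r * indicator {0} r = 0" for r
      by (simp add: indicator_def)
    then show "emeasure (density lborel (\<lambda>r. ennreal (measure (mixture (1 - \<alpha>) 1) {r<..}) * indicator {0<..} r)) {0} = 0"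
      using tail_measurable[OF zero_less_one] by (subst emeasure_density) simp_all
  qed
  then have "measure (mixture 1 1) {0} = 0" by (simp add: measure_def)
  moreover have "(\<integral>y. indicator {0} y \<partial>mixture 1 1) = measure (mixture 1 1) {0}"
    using sets_eq_imp_space_eq[OF B.M_is_borel] by (simp add: B.M_is_borel)
  moreover have "(\<integral>y. indicator {0} y \<partial>mixture 1 1) = (\<integral>t. weight 1 1 t * (\<integral>s. indicator {0} (t powr \<alpha> * s) \<partial>\<mu>) \<partial>lborel)"
    by (rule mixture_integral(1)[where B = 1]) (auto simp: indicator_def)
  moreover have "weight 1 1 t * (\<integral>s. indicator {0} (t powr \<alpha> * s) \<partial>\<mu>) = measure \<mu> {0} * weight 1 1 t" for t
  proof (cases "t > 0")
    case True
    then have "(\<integral>s. indicator {0} (t powr \<alpha> * s) \<partial>\<mu>) = (\<integral>s. indicator {0::real} s \<partial>\<mu>)"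
      by (intro Bochner_Integration.integral_cong) (auto simp: indicator_def)
    also have "\<dots> = measure \<mu> {0}" by simp
    finally show ?thesis by (simp only: mult.commute)
  qed (simp add: weight_def)
  ultimately have "measure \<mu> {0} = 0"
    using weight_integral(2)[of 1 1] G2 by (simp add: frac_kernel_def)
  then have "{0} \<in> null_sets \<mu>" by (simp add: null_sets_def \<mu>.emeasure_eq_measure)
  from AE_not_in[OF this] nonneg show ?thesis by eventually_elim auto
qed

text \<open>Integrating g = g(0) + (integral of g') against A =
  \<open>mixture (1 - \<alpha>) S\<close> and exchanging integrals gives g(0) times the mass of A
  plus the integral of g' against the tail of A, and this tail is the density of
  \<open>mixture 1 S\<close>. Applied to the heat flow of \<psi>, it transfers the heat equation in
  r to the fractional equation in t.\<close>

lemma mixture_FTC: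
  assumes S: "S > 0" and g [measurable]: "g \<in> borel_measurable borel" "g' \<in> borel_measurable borel"
    and bd: "\<And>x. x \<ge> 0 \<Longrightarrow> \<bar>g x\<bar> \<le> C" "\<And>x. x \<ge> 0 \<Longrightarrow> \<bar>g' x\<bar> \<le> C"
    and ftc: "\<And>x. x \<ge> 0 \<Longrightarrow> g x = g 0 + (\<integral>r. indicator {0<..<x} r * g' r \<partial>lborel)"
  shows "(\<integral>t. weight (1 - \<alpha>) S t * (\<integral>s. g (t powr \<alpha> * s) \<partial>\<mu>) \<partial>lborel) =
    (\<integral>t. weight 1 S t * (\<integral>s. g' (t powr \<alpha> * s) \<partial>\<mu>) \<partial>lborel) + g 0 * frac_kernel (2 - \<alpha>) S"
proof -
  have \<beta>: "1 - \<alpha> > 0" using \<alpha> by simp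
  let ?A = "mixture (1 - \<alpha>) S"
  interpret A: finite_borel_measure ?A by (rule mixture_finite[OF \<beta>])
  have spA: "space ?A = UNIV" using sets_eq_imp_space_eq[OF A.M_is_borel] by simp
  note [measurable_cong] = A.M_is_borel
  have ns: "AE x in ?A. 0 \<le> x" by (rule mixture_nonneg[OF \<beta>])
  interpret LA: pair_sigma_finite lborel ?A
    by (simp add: pair_sigma_finite_def sigma_finite_lborel A.sigma_finite_measure_axioms)
  interpret AL: pair_sigma_finite ?A lborel
    by (simp add: pair_sigma_finite_def sigma_finite_lborel A.sigma_finite_measure_axioms)
  have C0: "C \<ge> 0" using bd(1)[of 0] by simp
  let ?i = "\<lambda>r x. (if 0 < r \<and> r < x then 1 else 0 :: real)"
  have i1: "(\<integral>r. ?i r x \<partial>lborel) = x" "integrable lborel (\<lambda>r. ?i r x)" if "x \<ge> 0" for x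
  proof -
    have e: "?i r x = indicator {0<..<x} r" for r by (simp add: indicator_def)
    show "(\<integral>r. ?i r x \<partial>lborel) = x" "integrable lborel (\<lambda>r. ?i r x)"
      using that unfolding e by auto
  qed
  have tail: "(\<integral>x. ?i r x \<partial>?A) = measure ?A {r<..} * indicator {0<..} r" for r
  proof -
    have "?i r x = indicator {0<..} r * indicator {r<..} x" for x by (simp add: indicator_def)
    then show ?thesis by (simp add: spA A.M_is_borel)
  qed
  have int: "integrable (?A \<Otimes>\<^sub>M lborel) (\<lambda>(x, r). ?i r x * g' r)"
  proof (rule AL.Fubini_integrable)
    have ir: "integrable lborel (\<lambda>r. ?i r x * g' r)" if "x \<ge> 0" for x
    proof (rule Bochner_Integration.integrable_bound)
      show "integrable lborel (\<lambda>r. C * ?i r x)" using i1(2)[OF that] by simp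
      show "AE r in lborel. norm (?i r x * g' r) \<le> norm (C * ?i r x)"
        using bd(2) C0 by (intro AE_I2) auto
    qed measurable
    show "AE x in ?A. integrable lborel (\<lambda>r. case (x, r) of (x, r) \<Rightarrow> ?i r x * g' r)"
      using ns by eventually_elim (use ir in simp)
    show "integrable ?A (\<lambda>x. \<integral>r. norm (case (x, r) of (x, r) \<Rightarrow> ?i r x * g' r) \<partial>lborel)"
    proof (rule Bochner_Integration.integrable_bound)
      show "integrable ?A (\<lambda>x. C * x ^ 1)"
        by (intro integrable_mult_right mixture_moments(1)[OF \<beta>])
      show "AE x in ?A. norm (\<integral>r. norm (case (x, r) of (x, r) \<Rightarrow> ?i r x * g' r) \<partial>lborel) \<le> norm (C * x ^ 1)"
        using ns
      proof eventually_elim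
        case (elim x)
        have "(\<integral>r. \<bar>?i r x * g' r\<bar> \<partial>lborel) \<le> (\<integral>r. C * ?i r x \<partial>lborel)"
        proof (rule integral_mono)
          show "\<bar>?i r x * g' r\<bar> \<le> C * ?i r x" for r using bd(2) C0 by auto
        qed (use i1(2)[OF elim] ir[OF elim] in \<open>simp_all del: abs_mult add: integrable_abs\<close>)
        then have "(\<integral>r. \<bar>?i r x * g' r\<bar> \<partial>lborel) \<le> C * x" using i1(1)[OF elim] by simp
        moreover have "0 \<le> (\<integral>r. \<bar>?i r x * g' r\<bar> \<partial>lborel)" by (rule Bochner_Integration.integral_nonneg) simp
        ultimately show ?case using C0 elim by simp
      qed
    qed measurable
  qed measurable
  have "(\<integral>y. g y \<partial>?A) = (\<integral>x. g 0 + (\<integral>r. ?i r x * g' r \<partial>lborel) \<partial>?A)"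
  proof (rule integral_cong_AE)
    show "AE x in ?A. g x = g 0 + (\<integral>r. ?i r x * g' r \<partial>lborel)"
      using ns
    proof eventually_elim
      case (elim x)
      have "(\<integral>r. indicator {0<..<x} r * g' r \<partial>lborel) = (\<integral>r. ?i r x * g' r \<partial>lborel)"
        by (intro Bochner_Integration.integral_cong) (auto simp: indicator_def)
      then show ?case using ftc[OF elim] by simp
    qed
  qed measurable
  also have "\<dots> = g 0 * measure ?A UNIV + (\<integral>x. \<integral>r. ?i r x * g' r \<partial>lborel \<partial>?A)"
  proof (subst Bochner_Integration.integral_add)
    show "integrable ?A (\<lambda>x. \<integral>r. ?i r x * g' r \<partial>lborel)"
      using AL.integrable_fst'[OF int] by simp
  qed (simp_all add: spA)
  also have "(\<integral>x. \<integral>r. ?i r x * g' r \<partial>lborel \<partial>?A) = (\<integral>r. \<integral>x. ?i r x * g' r \<partial>?A \<partial>lborel)"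
    using AL.Fubini_integral[OF int] by simp
  also have "\<dots> = (\<integral>r. (measure ?A {r<..} * indicator {0<..} r) * g' r \<partial>lborel)"
    by (simp add: tail)
  also have "\<dots> = (\<integral>r. g' r \<partial>mixture 1 S)"
  proof -
    have [measurable]: "(\<lambda>r. measure ?A {r<..}) \<in> borel_measurable borel" by (rule tail_measurable[OF S])
    have "density lborel (\<lambda>r. ennreal (measure ?A {r<..}) * indicator {0<..} r) =
        density lborel (\<lambda>r. ennreal (measure ?A {r<..} * indicator {0<..} r))"
      by (intro density_cong) (auto simp: indicator_def)
    then show ?thesis
      unfolding mixture_1_eq_tail[OF S] by (simp add: integral_density)
  qed
  also have "measure ?A UNIV = frac_kernel (2 - \<alpha>) S"
    using mixture_moments(2)[OF \<beta>, of S 0] by (simp add: spA)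
  finally show ?thesis
    using mixture_integral(1)[OF \<beta> g(1) bd(1), of S] mixture_integral(1)[OF zero_less_one g(2) bd(2), of S] by simp
qed

end

section \<open>The heat semigroup\<close>

lemma gaussian_integrable:
  fixes a :: real
  assumes a: "a > 0"
  shows "integrable lborel (\<lambda>x::'a::euclidean_space. exp (- a * (norm x)\<^sup>2))"
proof -
  have "integrable lborel (\<lambda>x::real. exp (- a * x\<^sup>2))"
  proof -
    have "integrable lborel (\<lambda>x. sqrt (pi / a) * normal_density 0 (1 / sqrt (2 * a)) x)"
      using a by (intro integrable_mult_right integrable_normal_density) simp
    moreover have "sqrt (pi / a) * normal_density 0 (1 / sqrt (2 * a)) x = exp (- a * x\<^sup>2)" for x
      using a by (simp add: normal_density_def power_divide real_sqrt_mult[symmetric] real_sqrt_divide[symmetric])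
    ultimately show ?thesis by simp
  qed
  then have fin: "(\<integral>\<^sup>+(x::real). ennreal (exp (- a * x\<^sup>2)) \<partial>lborel) < \<infinity>"
    by (simp add: nn_integral_eq_integral)
  have sq: "exp (- a * (norm x)\<^sup>2) = (\<Prod>b\<in>Basis. exp (- a * (x \<bullet> b)\<^sup>2))" for x :: 'a
    unfolding exp_sum[OF finite_Basis, symmetric] power2_norm_eq_inner
    by (subst euclidean_inner) (simp add: sum_distrib_left power2_eq_square)
  have "(\<integral>\<^sup>+(x::'a). ennreal (exp (- a * (norm x)\<^sup>2)) \<partial>lborel) =
      (\<integral>\<^sup>+(x::'a). (\<Prod>b\<in>Basis. ennreal (exp (- a * (x \<bullet> b)\<^sup>2))) \<partial>lborel)"
    by (intro nn_integral_cong) (simp only: sq, subst prod_ennreal, auto)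
  also have "\<dots> = (\<Prod>b\<in>(Basis::'a set). (\<integral>\<^sup>+x. ennreal (exp (- a * x\<^sup>2)) \<partial>lborel))"
    by (rule nn_integral_lborel_prod) auto
  also have "\<dots> < \<infinity>"
    using fin by (simp add: power_less_top_ennreal)
  finally show ?thesis
    by (intro integrableI_bounded) auto
qed

text \<open>The heat kernel at time 1. It is normalised by its own integral, so the constant never
  has to be evaluated.\<close>

definition gauss :: "'a::euclidean_space \<Rightarrow> real" where
  "gauss x = exp (- (1 / 4) * (norm x)\<^sup>2) / (\<integral>(y::'a). exp (- (1 / 4) * (norm y)\<^sup>2) \<partial>lborel)"

lemma gauss_normalizer_pos: "(\<integral>(y::'a::euclidean_space). exp (- (1 / 4) * (norm y)\<^sup>2) \<partial>lborel) > 0"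
proof -
  have i: "integrable lborel (\<lambda>x::'a. exp (- (1 / 4) * (norm x)\<^sup>2))"
    by (rule gaussian_integrable) simp
  have "(\<integral>(y::'a). exp (- (1 / 4) * (norm y)\<^sup>2) \<partial>lborel) \<noteq> 0"
  proof
    assume "(\<integral>(y::'a). exp (- (1 / 4) * (norm y)\<^sup>2) \<partial>lborel) = 0"
    then have "AE y in (lborel :: 'a measure). exp (- (1 / 4) * (norm y)\<^sup>2) = 0"
      by (subst (asm) integral_nonneg_eq_0_iff_AE[OF i]) auto
    then have "AE y in (lborel :: 'a measure). False" by simp
    then have "emeasure (lborel :: 'a measure) UNIV = 0"
      by (subst (asm) AE_iff_measurable[of UNIV]) auto
    then show False by simp
  qed
  moreover have "(\<integral>(y::'a). exp (- (1 / 4) * (norm y)\<^sup>2) \<partial>lborel) \<ge> 0"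
    by (rule Bochner_Integration.integral_nonneg) simp
  ultimately show ?thesis by linarith
qed

lemma gauss_nonneg: "gauss x \<ge> 0"
  unfolding gauss_def using gauss_normalizer_pos[where 'a = 'a] by (intro divide_nonneg_pos) auto

lemma gauss_measurable [measurable]: "gauss \<in> borel_measurable borel"
  unfolding gauss_def by measurable

lemma gauss_integrable: "integrable lborel (gauss :: 'a::euclidean_space \<Rightarrow> real)"
  unfolding gauss_def using gaussian_integrable[of "1/4", where 'a = 'a] by (intro integrable_divide_zero) simp

lemma gauss_integral: "(\<integral>(x::'a::euclidean_space). gauss x \<partial>lborel) = 1"
  unfolding gauss_def using gauss_normalizer_pos[where 'a = 'a] by simp

lemma gauss_moment_integrable:
  assumes e: "e \<in> Basis"
  shows "integrable lborel (\<lambda>x::'a::euclidean_space. \<bar>x \<bullet> e\<bar> * gauss x)"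
proof (rule Bochner_Integration.integrable_bound)
  let ?Z = "\<integral>(y::'a). exp (- (1 / 4) * (norm y)\<^sup>2) \<partial>lborel"
  show "integrable lborel (\<lambda>x::'a. 8 * exp (- (1 / 8) * (norm x)\<^sup>2) / ?Z)"
    by (intro integrable_divide_zero integrable_mult_right gaussian_integrable) simp
  \<comment> \<open>Half of the Gaussian decay is spent on absorbing the linear factor, by |x| \<le>
    8 exp(|x|^2 / 8).\<close>
  have "\<bar>x \<bullet> e\<bar> * exp (- (1 / 4) * (norm x)\<^sup>2) \<le> 8 * exp (- (1 / 8) * (norm x)\<^sup>2)" for x :: 'a
  proof -
    have "\<bar>x \<bullet> e\<bar> \<le> norm x" using Basis_le_norm[OF e] by simp
    also have "norm x \<le> 8 * (1 + (norm x)\<^sup>2 / 8)"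
    proof -
      have "0 \<le> (norm x - 1) * (norm x - 1)" by simp
      then have "2 * norm x \<le> norm x * norm x + 1" by (simp add: algebra_simps)
      moreover have "8 * (1 + (norm x)\<^sup>2 / 8) = 8 + norm x * norm x" by (simp add: power2_eq_square)
      moreover have "0 \<le> norm x * norm x" by simp
      ultimately show ?thesis using norm_ge_zero[of x] by linarith
    qed
    also have "\<dots> \<le> 8 * exp ((norm x)\<^sup>2 / 8)"
      by (intro mult_left_mono exp_ge_add_one_self) simp
    finally have "\<bar>x \<bullet> e\<bar> * exp (- (1 / 4) * (norm x)\<^sup>2) \<le> 8 * exp ((norm x)\<^sup>2 / 8) * exp (- (1 / 4) * (norm x)\<^sup>2)"
      by (intro mult_right_mono) auto
    also have "\<dots> = 8 * exp (- (1 / 8) * (norm x)\<^sup>2)"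
      by (simp add: mult_exp_exp)
    finally show ?thesis .
  qed
  then show "AE x in (lborel :: 'a measure). norm (\<bar>x \<bullet> e\<bar> * gauss x) \<le> norm (8 * exp (- (1 / 8) * (norm x)\<^sup>2) / ?Z)"
    using gauss_normalizer_pos[where 'a = 'a] gauss_nonneg
    by (intro AE_I2) (simp add: gauss_def divide_right_mono)
qed measurable

text \<open>Averaging D over unit segments in the direction e does not change its integral, by
  translation invariance. The averages are F(z + e) - F(z), and these integrate to 0, again by
  translation invariance, without boundary terms.\<close>

lemma integral_partial_derivative_eq_0:
  fixes F D :: "'a::euclidean_space \<Rightarrow> real"
  assumes F: "integrable lborel F" and D: "integrable lborel D" and cont: "continuous_on UNIV D"
    and deriv: "\<And>z. ((\<lambda>h. F (z + h *\<^sub>R e)) has_real_derivative D z) (at 0)"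
  shows "(\<integral>z. D z \<partial>lborel) = 0"
proof -
  have [measurable]: "F \<in> borel_measurable borel" "D \<in> borel_measurable borel" using F D by auto
  have shift: "(\<integral>z. f (v + z) \<partial>lborel) = (\<integral>z. f z \<partial>lborel)" "integrable lborel (\<lambda>z. f (v + z)) \<longleftrightarrow> integrable lborel f"
    if [measurable]: "f \<in> borel_measurable borel" for f :: "'a \<Rightarrow> real" and v
  proof -
    have "(\<integral>z. f z \<partial>lborel) = (\<integral>z. f z \<partial>distr lborel borel ((+) v))" by (simp add: lborel_distr_plus)
    then show "(\<integral>z. f (v + z) \<partial>lborel) = (\<integral>z. f z \<partial>lborel)" by (simp add: integral_distr)
    have "integrable lborel f \<longleftrightarrow> integrable (distr lborel borel ((+) v)) f" by (simp add: lborel_distr_plus)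
    then show "integrable lborel (\<lambda>z. f (v + z)) \<longleftrightarrow> integrable lborel f" by (simp add: integrable_distr_eq)
  qed
  have D': "((\<lambda>h. F (z + h *\<^sub>R e)) has_real_derivative D (z + h *\<^sub>R e)) (at h)" for z h
  proof -
    have "((\<lambda>k. F ((z + h *\<^sub>R e) + k *\<^sub>R e)) has_real_derivative D (z + h *\<^sub>R e)) (at 0)" by (rule deriv)
    then have "((\<lambda>k. F (z + (k + h) *\<^sub>R e)) has_real_derivative D (z + h *\<^sub>R e)) (at 0)"
      by (simp add: scaleR_left_distrib add_ac)
    then show ?thesis using DERIV_shift[of "\<lambda>h. F (z + h *\<^sub>R e)" "D (z + h *\<^sub>R e)" 0 h] by simp
  qed
  have line: "(\<integral>h. indicator {0..1} h * D (z + h *\<^sub>R e) \<partial>lborel) = F (z + e) - F z" for z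
  proof -
    have "(\<integral>h. D (z + h *\<^sub>R e) * indicator {0..1} h \<partial>lborel) = F (z + 1 *\<^sub>R e) - F (z + 0 *\<^sub>R e)"
    proof (rule integral_FTC_Icc_real)
      show "isCont (\<lambda>h. D (z + h *\<^sub>R e)) h" for h
        using continuous_on_compose2[OF cont, of UNIV "\<lambda>h. z + h *\<^sub>R e"]
        by (simp add: continuous_on_eq_continuous_at continuous_intros)
    qed (use D' in auto)
    then show ?thesis by (simp add: mult.commute)
  qed
  have "integrable (lborel \<Otimes>\<^sub>M lborel) (\<lambda>(h, z). indicator {0..1::real} h * D (z + h *\<^sub>R e))"
  proof (rule lborel_pair.Fubini_integrable)
    have "(\<integral>z. norm (case (h, z) of (h, z) \<Rightarrow> indicator {0..1::real} h * D (z + h *\<^sub>R e)) \<partial>lborel) =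
        indicator {0..1} h * (\<integral>z. \<bar>D z\<bar> \<partial>lborel)" for h
      using shift(1)[of "\<lambda>z. \<bar>D z\<bar>" "h *\<^sub>R e"] by (simp add: abs_mult add.commute)
    then show "integrable lborel (\<lambda>h. \<integral>z. norm (case (h, z) of (h, z) \<Rightarrow> indicator {0..1::real} h * D (z + h *\<^sub>R e)) \<partial>lborel)"
      by simp
    show "AE h in lborel. integrable lborel (\<lambda>z. case (h, z) of (h, z) \<Rightarrow> indicator {0..1::real} h * D (z + h *\<^sub>R e))"
    proof (rule AE_I2)
      fix h :: real
      show "integrable lborel (\<lambda>z. case (h, z) of (h, z) \<Rightarrow> indicator {0..1::real} h * D (z + h *\<^sub>R e))"
        using shift(2)[of D "h *\<^sub>R e"] D by (simp add: add.commute)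
    qed
  qed measurable
  then have "(\<integral>z. \<integral>h. indicator {0..1::real} h * D (z + h *\<^sub>R e) \<partial>lborel \<partial>lborel) =
      (\<integral>h. \<integral>z. indicator {0..1::real} h * D (z + h *\<^sub>R e) \<partial>lborel \<partial>lborel)"
    by (rule lborel_pair.Fubini_integral)
  also have "\<dots> = (\<integral>h. indicator {0..1::real} h * (\<integral>z. D z \<partial>lborel) \<partial>lborel)"
  proof -
    have "(\<integral>z. D (z + h *\<^sub>R e) \<partial>lborel) = (\<integral>z. D z \<partial>lborel)" for h
      using shift(1)[of D "h *\<^sub>R e"] by (simp add: add.commute)
    then show ?thesis by simp
  qed
  also have "\<dots> = (\<integral>z. D z \<partial>lborel)" by simp
  finally have "(\<integral>z. D z \<partial>lborel) = (\<integral>z. F (z + e) - F z \<partial>lborel)" by (simp add: line)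
  also have "\<dots> = 0"
    using F shift[of F e] by (simp add: add.commute)
  finally show ?thesis .
qed

text \<open>L stands for the Laplacian of \<psi> and is a separate argument so that it can vary with
  time in step with \<psi>. A total first derivative is demanded because \<open>heat_FTC\<close>
  differentiates along rays; of second order only the pure partial derivatives occur. One bound B
  for everything keeps families of such functions under uniform control.\<close>

definition C2_bounded :: "real \<Rightarrow> ('a::euclidean_space \<Rightarrow> real) \<Rightarrow> ('a \<Rightarrow> real) \<Rightarrow> bool" where
  "C2_bounded B \<psi> L \<longleftrightarrow> continuous_on UNIV \<psi> \<and> (\<forall>x. \<bar>\<psi> x\<bar> \<le> B) \<and> (\<exists>\<psi>1 \<psi>2.
     (\<forall>x. (\<psi> has_derivative (\<lambda>v. \<Sum>e\<in>Basis. (v \<bullet> e) * \<psi>1 e x)) (at x)) \<and>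
     (\<forall>e\<in>Basis. (\<forall>x. ((\<lambda>h. \<psi>1 e (x + h *\<^sub>R e)) has_real_derivative \<psi>2 e x) (at 0)) \<and>
        continuous_on UNIV (\<psi>1 e) \<and> continuous_on UNIV (\<psi>2 e) \<and> (\<forall>x. \<bar>\<psi>1 e x\<bar> \<le> B \<and> \<bar>\<psi>2 e x\<bar> \<le> B)) \<and>
     (\<forall>x. L x = (\<Sum>e\<in>Basis. \<psi>2 e x)) \<and> (\<forall>x. \<bar>L x\<bar> \<le> B))"

lemma C2_boundedI:
  assumes "continuous_on UNIV \<psi>" "\<And>x. \<bar>\<psi> x\<bar> \<le> B"
    and "\<And>x. (\<psi> has_derivative (\<lambda>v. \<Sum>e\<in>Basis. (v \<bullet> e) * \<psi>' e x)) (at x)"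
    and "\<And>x e. e \<in> Basis \<Longrightarrow> ((\<lambda>h. \<psi>' e (x + h *\<^sub>R e)) has_real_derivative \<psi>'' e x) (at 0)"
    and "\<And>e. e \<in> Basis \<Longrightarrow> continuous_on UNIV (\<psi>' e)" "\<And>e. e \<in> Basis \<Longrightarrow> continuous_on UNIV (\<psi>'' e)"
    and "\<And>x e. e \<in> Basis \<Longrightarrow> \<bar>\<psi>' e x\<bar> \<le> B" "\<And>x e. e \<in> Basis \<Longrightarrow> \<bar>\<psi>'' e x\<bar> \<le> B"
    and "\<And>x. L x = (\<Sum>e\<in>Basis. \<psi>'' e x)" "\<And>x. \<bar>L x\<bar> \<le> B"
  shows "C2_bounded B \<psi> L"
  unfolding C2_bounded_def
  by (rule conjI, rule assms, rule conjI, rule allI, rule assms, rule exI[of _ \<psi>'], rule exI[of _ \<psi>''])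
    (intro conjI ballI allI assms; assumption)

lemma C2_boundedD:
  assumes C2: "C2_bounded B \<psi> L"
  shows "continuous_on UNIV \<psi>" "\<bar>\<psi> x\<bar> \<le> B" "continuous_on UNIV L" "\<bar>L x\<bar> \<le> B"
proof -
  obtain \<psi>1 \<psi>2 where "\<And>x. (\<psi> has_derivative (\<lambda>v. \<Sum>e\<in>Basis. (v \<bullet> e) * \<psi>1 e x)) (at x)"
    and "\<And>e x. e \<in> Basis \<Longrightarrow> ((\<lambda>h. \<psi>1 e (x + h *\<^sub>R e)) has_real_derivative \<psi>2 e x) (at 0)"
    and "\<And>e. e \<in> Basis \<Longrightarrow> continuous_on UNIV (\<psi>1 e)" and c2: "\<And>e. e \<in> Basis \<Longrightarrow> continuous_on UNIV (\<psi>2 e)"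
    and "\<And>e x. e \<in> Basis \<Longrightarrow> \<bar>\<psi>1 e x\<bar> \<le> B" and "\<And>e x. e \<in> Basis \<Longrightarrow> \<bar>\<psi>2 e x\<bar> \<le> B"
    and L: "\<And>x. L x = (\<Sum>e\<in>Basis. \<psi>2 e x)" and bL: "\<And>x. \<bar>L x\<bar> \<le> B"
    and "continuous_on UNIV \<psi>" and "\<And>x. \<bar>\<psi> x\<bar> \<le> B"
    using C2 unfolding C2_bounded_def by blast
  then show "continuous_on UNIV \<psi>" "\<bar>\<psi> x\<bar> \<le> B" "\<bar>L x\<bar> \<le> B" by auto
  show "continuous_on UNIV L" unfolding L by (intro continuous_intros c2)
qed

lemma C2_bounded_zero: "B \<ge> 0 \<Longrightarrow> C2_bounded B (\<lambda>_. 0) (\<lambda>_. 0)"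
  unfolding C2_bounded_def by (intro conjI exI[of _ "\<lambda>_ _. 0"]) auto

text \<open>The heat flow of \<psi> evaluated at the origin only, which is where the initial mass
  sits. Scaling the argument instead of the kernel makes r = 0 a regular point.\<close>

definition heat :: "('a::euclidean_space \<Rightarrow> real) \<Rightarrow> real \<Rightarrow> real" where
  "heat \<psi> r = (\<integral>z. gauss z * \<psi> (sqrt r *\<^sub>R z) \<partial>lborel)"

lemma gauss_mult_integrable:
  assumes [measurable]: "\<psi> \<in> borel_measurable borel" and "\<And>x. \<bar>\<psi> x\<bar> \<le> B"
  shows "integrable lborel (\<lambda>z::'a::euclidean_space. gauss z * \<psi> (q *\<^sub>R z))"
  by (rule integrable_mult_bounded[OF gauss_integrable]) (use assms in auto)

lemma heat_bounded:
  fixes \<psi> :: "'a::euclidean_space \<Rightarrow> real"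
  assumes [measurable]: "\<psi> \<in> borel_measurable borel" and bd: "\<And>x. \<bar>\<psi> x\<bar> \<le> B"
  shows "\<bar>heat \<psi> r\<bar> \<le> B"
proof -
  have "\<bar>heat \<psi> r\<bar> \<le> (\<integral>z. \<bar>gauss z * \<psi> (sqrt r *\<^sub>R z)\<bar> \<partial>lborel)"
    unfolding heat_def by (rule integral_abs_bound)
  also have "\<dots> \<le> (\<integral>(z::'a). gauss z * B \<partial>lborel)"
    by (intro integral_mono integrable_abs integrable_mult_left gauss_integrable gauss_mult_integrable[of \<psi> B] assms)
      (auto simp: abs_mult gauss_nonneg intro!: mult_left_mono bd)
  also have "\<dots> = B" by (simp add: gauss_integral)
  finally show ?thesis .
qed

lemma heat_0: "heat \<psi> 0 = \<psi> 0"
  by (simp add: heat_def gauss_integral)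

lemma heat_continuous:
  fixes \<psi> :: "'a::euclidean_space \<Rightarrow> real"
  assumes cont: "continuous_on UNIV \<psi>" and bd: "\<And>x. \<bar>\<psi> x\<bar> \<le> B"
  shows "continuous_on UNIV (heat \<psi>)"
  unfolding continuous_on_sequentially
proof (intro ballI allI impI, elim conjE)
  have [measurable]: "\<psi> \<in> borel_measurable borel" using cont by (rule borel_measurable_continuous_onI)
  fix r and x :: "nat \<Rightarrow> real" assume x: "x \<longlonglongrightarrow> r"
  show "(heat \<psi> \<circ> x) \<longlonglongrightarrow> heat \<psi> r"
    unfolding heat_def o_def
  proof (rule integral_dominated_convergence[where w = "\<lambda>z. gauss z * B"])
    show "integrable lborel (\<lambda>z::'a. gauss z * B)" by (intro integrable_mult_left gauss_integrable)
    show "AE z in lborel. (\<lambda>n. gauss z * \<psi> (sqrt (x n) *\<^sub>R z)) \<longlonglongrightarrow> gauss z * \<psi> (sqrt r *\<^sub>R z)"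
      by (intro AE_I2 tendsto_intros continuous_on_tendsto_compose[OF cont] x) auto
    show "AE z in lborel. norm (gauss z * \<psi> (sqrt (x n) *\<^sub>R z)) \<le> gauss z * B" for n
      by (intro AE_I2) (auto simp: abs_mult gauss_nonneg intro!: mult_left_mono bd)
  qed measurable
qed

lemma gauss_has_derivative:
  assumes e: "e \<in> Basis"
  shows "((\<lambda>h. gauss (z + h *\<^sub>R e)) has_real_derivative - (1 / 2) * (z \<bullet> e) * gauss z) (at 0)"
proof -
  have n: "(norm (z + h *\<^sub>R e))\<^sup>2 = (norm z)\<^sup>2 + 2 * (z \<bullet> e) * h + h\<^sup>2" for h
    using e dot_norm[of z "h *\<^sub>R e"] by (simp add: power_mult_distrib field_simps)
  define Z where "Z = (\<integral>y. exp (- (1 / 4) * (norm (y::'a))\<^sup>2) \<partial>lborel)"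
  show ?thesis
    unfolding gauss_def n Z_def[symmetric]
    by (rule DERIV_cdivide[THEN DERIV_cong]) (auto intro!: derivative_eq_intros)
qed

text \<open>With q = sqrt r the increment of \<psi> along the ray through z is the integral of z .
  grad \<psi>(q z) over q, which avoids the singular derivative of the square root at 0. As the
  derivative of \<open>gauss\<close> in direction e is -(z . e) / 2 times \<open>gauss\<close>,
  integration by parts replaces z . grad \<psi> by 2 q times the Laplacian, and 2 q dq is
  dr.\<close>

lemma heat_FTC:
  fixes \<psi> L :: "'a::euclidean_space \<Rightarrow> real"
  assumes C2: "C2_bounded B \<psi> L" and x: "x \<ge> 0"
  shows "heat \<psi> x = \<psi> 0 + (\<integral>r. indicator {0<..<x} r * heat L r \<partial>lborel)"
proof -
  obtain \<psi>1 \<psi>2 where D\<psi>: "\<And>x. (\<psi> has_derivative (\<lambda>v. \<Sum>e\<in>Basis. (v \<bullet> e) * \<psi>1 e x)) (at x)"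
    and D1: "\<And>e x. e \<in> Basis \<Longrightarrow> ((\<lambda>h. \<psi>1 e (x + h *\<^sub>R e)) has_real_derivative \<psi>2 e x) (at 0)"
    and c1: "\<And>e. e \<in> Basis \<Longrightarrow> continuous_on UNIV (\<psi>1 e)" and c2: "\<And>e. e \<in> Basis \<Longrightarrow> continuous_on UNIV (\<psi>2 e)"
    and b1: "\<And>e x. e \<in> Basis \<Longrightarrow> \<bar>\<psi>1 e x\<bar> \<le> B" and b2: "\<And>e x. e \<in> Basis \<Longrightarrow> \<bar>\<psi>2 e x\<bar> \<le> B"
    and L: "\<And>x. L x = (\<Sum>e\<in>Basis. \<psi>2 e x)" and bL: "\<And>x. \<bar>L x\<bar> \<le> B"
    and c\<psi>: "continuous_on UNIV \<psi>" and b\<psi>: "\<And>x. \<bar>\<psi> x\<bar> \<le> B"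
    using C2 unfolding C2_bounded_def by blast
  have cL: "continuous_on UNIV L" unfolding L by (intro continuous_intros c2)
  have m1 [measurable]: "\<psi>1 e \<in> borel_measurable borel" and m2 [measurable]: "\<psi>2 e \<in> borel_measurable borel" if "e \<in> Basis" for e
    using c1[OF that] c2[OF that] by (auto intro: borel_measurable_continuous_onI)
  have [measurable]: "\<psi> \<in> borel_measurable borel" "L \<in> borel_measurable borel"
    using c\<psi> cL by (auto intro: borel_measurable_continuous_onI)
  let ?Q = "sqrt x"
  let ?d = "\<lambda>q z. \<Sum>e\<in>Basis. (z \<bullet> e) * \<psi>1 e (q *\<^sub>R z)"
  have int1: "integrable lborel (\<lambda>z. (z \<bullet> e) * gauss z * \<psi>1 e (q *\<^sub>R z))" if e: "e \<in> Basis" for e q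
  proof (rule integrable_mult_bounded[where C = B])
    show "integrable lborel (\<lambda>z::'a. (z \<bullet> e) * gauss z)"
      by (rule Bochner_Integration.integrable_bound[OF gauss_moment_integrable[OF e]])
        (auto simp: abs_mult gauss_nonneg)
  qed (use b1[OF e] m1[OF e] in auto)
  have ibp: "(\<integral>z. (z \<bullet> e) * gauss z * \<psi>1 e (q *\<^sub>R z) \<partial>lborel) = 2 * q * (\<integral>z. gauss z * \<psi>2 e (q *\<^sub>R z) \<partial>lborel)"
    if e: "e \<in> Basis" for e q
  proof -
    have i2: "integrable lborel (\<lambda>z. gauss z * \<psi>2 e (q *\<^sub>R z))"
      by (rule gauss_mult_integrable[OF m2[OF e] b2[OF e]])
    have "(\<integral>z. - (1 / 2) * ((z \<bullet> e) * gauss z * \<psi>1 e (q *\<^sub>R z)) + q * (gauss z * \<psi>2 e (q *\<^sub>R z)) \<partial>lborel) = 0"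
    proof (rule integral_partial_derivative_eq_0[where e = e])
      show "integrable lborel (\<lambda>z. gauss z * \<psi>1 e (q *\<^sub>R z))"
        by (rule gauss_mult_integrable[OF m1[OF e] b1[OF e]])
      show "integrable lborel (\<lambda>z. - (1 / 2) * ((z \<bullet> e) * gauss z * \<psi>1 e (q *\<^sub>R z)) + q * (gauss z * \<psi>2 e (q *\<^sub>R z)))"
        by (intro Bochner_Integration.integrable_add integrable_mult_right int1[OF e] i2)
      show "continuous_on UNIV (\<lambda>z. - (1 / 2) * ((z \<bullet> e) * gauss z * \<psi>1 e (q *\<^sub>R z)) + q * (gauss z * \<psi>2 e (q *\<^sub>R z)))"
        unfolding gauss_def using gauss_normalizer_pos[where 'a = 'a]
        by (intro continuous_intros continuous_on_compose2[OF c1[OF e]] continuous_on_compose2[OF c2[OF e]]) auto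
      fix z
      have "((\<lambda>h. \<psi>1 e (q *\<^sub>R z + h *\<^sub>R e)) \<circ> (\<lambda>h. q * h) has_real_derivative \<psi>2 e (q *\<^sub>R z) * q) (at 0)"
        by (rule DERIV_chain) (use D1[OF e, of "q *\<^sub>R z"] in \<open>auto intro!: derivative_eq_intros\<close>)
      then have "((\<lambda>h. \<psi>1 e (q *\<^sub>R (z + h *\<^sub>R e))) has_real_derivative \<psi>2 e (q *\<^sub>R z) * q) (at 0)"
        by (simp add: o_def scaleR_add_right)
      from DERIV_mult[OF gauss_has_derivative[OF e, of z] this]
      show "((\<lambda>h. gauss (z + h *\<^sub>R e) * \<psi>1 e (q *\<^sub>R (z + h *\<^sub>R e))) has_real_derivative
          - (1 / 2) * ((z \<bullet> e) * gauss z * \<psi>1 e (q *\<^sub>R z)) + q * (gauss z * \<psi>2 e (q *\<^sub>R z))) (at 0)"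
        by (simp add: mult_ac)
    qed
    then show ?thesis
      using int1[OF e, of q] i2 by (simp add: Bochner_Integration.integral_add)
  qed
  have inner: "(\<integral>z. gauss z * ?d q z \<partial>lborel) = 2 * q * heat L (q\<^sup>2)" if "q \<ge> 0" for q
  proof -
    have "(\<integral>z. gauss z * ?d q z \<partial>lborel) = (\<integral>z. (\<Sum>e\<in>Basis. (z \<bullet> e) * gauss z * \<psi>1 e (q *\<^sub>R z)) \<partial>lborel)"
      by (simp add: sum_distrib_left mult_ac)
    also have "\<dots> = (\<Sum>e\<in>Basis. 2 * q * (\<integral>z. gauss z * \<psi>2 e (q *\<^sub>R z) \<partial>lborel))"
      by (subst Bochner_Integration.integral_sum) (auto simp: int1 ibp)
    also have "\<dots> = 2 * q * (\<integral>z. (\<Sum>e\<in>Basis. gauss z * \<psi>2 e (q *\<^sub>R z)) \<partial>lborel)"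
    proof -
      have "(\<integral>z. (\<Sum>e\<in>Basis. gauss z * \<psi>2 e (q *\<^sub>R z)) \<partial>lborel) = (\<Sum>e\<in>Basis. \<integral>z. gauss z * \<psi>2 e (q *\<^sub>R z) \<partial>lborel)"
        by (rule Bochner_Integration.integral_sum) (rule gauss_mult_integrable[OF m2 b2])
      then show ?thesis by (simp only: sum_distrib_left)
    qed
    also have "(\<integral>z. (\<Sum>e\<in>Basis. gauss z * \<psi>2 e (q *\<^sub>R z)) \<partial>lborel) = heat L (q\<^sup>2)"
      using that by (simp add: heat_def L sum_distrib_left)
    finally show ?thesis .
  qed
  have ray: "(\<integral>q. indicator {0..?Q} q * ?d q z \<partial>lborel) = \<psi> (?Q *\<^sub>R z) - \<psi> 0" for z
  proof -
    have "(\<integral>q. ?d q z * indicator {0..?Q} q \<partial>lborel) = \<psi> (?Q *\<^sub>R z) - \<psi> (0 *\<^sub>R z)"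
    proof (rule integral_FTC_Icc_real)
      fix q
      have "((\<lambda>q. \<psi> (q *\<^sub>R z)) has_derivative (\<lambda>k. \<Sum>e\<in>Basis. ((k *\<^sub>R z) \<bullet> e) * \<psi>1 e (q *\<^sub>R z))) (at q)"
        by (rule has_derivative_compose[OF _ D\<psi>]) (auto intro!: derivative_eq_intros)
      then show "((\<lambda>q. \<psi> (q *\<^sub>R z)) has_real_derivative ?d q z) (at q)"
        unfolding has_field_derivative_def by (rule has_derivative_eq_rhs) (simp add: fun_eq_iff sum_distrib_right sum_distrib_left mult_ac)
      have "continuous_on UNIV (\<lambda>q. ?d q z)"
        by (intro continuous_intros continuous_on_compose2[OF c1]) auto
      then show "isCont (\<lambda>q. ?d q z) q" by (simp add: continuous_on_eq_continuous_at)
    qed (use x in auto)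
    then show ?thesis by (simp add: mult.commute)
  qed
  have "integrable (lborel \<Otimes>\<^sub>M lborel) (\<lambda>(q, z). indicator {0..?Q} q * (gauss z * ?d q z))"
  proof (rule lborel_pair.Fubini_integrable)
    have bnd: "\<bar>gauss z * ?d q z\<bar> \<le> B * (\<Sum>e\<in>Basis. \<bar>z \<bullet> e\<bar> * gauss z)" for q z
    proof -
      have "\<bar>?d q z\<bar> \<le> (\<Sum>e\<in>Basis. \<bar>z \<bullet> e\<bar> * B)"
        by (rule order_trans[OF sum_abs], rule sum_mono) (auto simp: abs_mult intro!: mult_left_mono b1)
      then have "gauss z * \<bar>?d q z\<bar> \<le> gauss z * (\<Sum>e\<in>Basis. \<bar>z \<bullet> e\<bar> * B)"
        by (rule mult_left_mono) (rule gauss_nonneg)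
      also have "\<dots> = B * (\<Sum>e\<in>Basis. \<bar>z \<bullet> e\<bar> * gauss z)" by (simp add: sum_distrib_left mult_ac)
      finally show ?thesis by (simp add: abs_mult gauss_nonneg)
    qed
    have bi: "integrable lborel (\<lambda>z::'a. B * (\<Sum>e\<in>Basis. \<bar>z \<bullet> e\<bar> * gauss z))"
      by (intro integrable_mult_right Bochner_Integration.integrable_sum gauss_moment_integrable)
    have gi: "integrable lborel (\<lambda>z. gauss z * ?d q z)" for q
      by (rule Bochner_Integration.integrable_bound[OF bi])
        (auto intro!: AE_I2 order_trans[OF bnd abs_ge_self])
    show "AE q in lborel. integrable lborel (\<lambda>z. case (q, z) of (q, z) \<Rightarrow> indicator {0..?Q} q * (gauss z * ?d q z))"
      using gi by (intro AE_I2) simp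
    show "integrable lborel (\<lambda>q. \<integral>z. norm (case (q, z) of (q, z) \<Rightarrow> indicator {0..?Q} q * (gauss z * ?d q z)) \<partial>lborel)"
    proof (rule Bochner_Integration.integrable_bound)
      let ?K = "\<integral>(z::'a). B * (\<Sum>e\<in>Basis. \<bar>z \<bullet> e\<bar> * gauss z) \<partial>lborel"
      show "integrable lborel (\<lambda>q. indicator {0..?Q} q * ?K)"
        by (intro integrable_mult_left integrable_real_indicator) (auto simp: emeasure_lborel_Icc_eq)
      have le: "(\<integral>z. \<bar>gauss z * ?d q z\<bar> \<partial>lborel) \<le> ?K" for q
        by (intro integral_mono integrable_abs gi bi bnd)
      have nn: "0 \<le> (\<integral>z. \<bar>gauss z * ?d q z\<bar> \<partial>lborel)" for q
        by (rule Bochner_Integration.integral_nonneg) simp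
      show "AE q in lborel. norm (\<integral>z. norm (case (q, z) of (q, z) \<Rightarrow> indicator {0..?Q} q * (gauss z * ?d q z)) \<partial>lborel)
          \<le> norm (indicator {0..?Q} q * ?K)"
      proof (rule AE_I2)
        fix q
        show "norm (\<integral>z. norm (case (q, z) of (q, z) \<Rightarrow> indicator {0..?Q} q * (gauss z * ?d q z)) \<partial>lborel)
          \<le> norm (indicator {0..?Q} q * ?K)"
          using le[of q] nn[of q] by (cases "q \<in> {0..?Q}") simp_all
      qed
    qed measurable
  qed measurable
  then have f1: "(\<integral>z. \<integral>q. indicator {0..?Q} q * (gauss z * ?d q z) \<partial>lborel \<partial>lborel) =
      (\<integral>q. \<integral>z. indicator {0..?Q} q * (gauss z * ?d q z) \<partial>lborel \<partial>lborel)"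
    by (rule lborel_pair.Fubini_integral)
  have f2: "(\<integral>q. indicator {0..?Q} q * (gauss z * ?d q z) \<partial>lborel) = gauss z * (\<psi> (?Q *\<^sub>R z) - \<psi> 0)" for z
  proof -
    have "(\<integral>q. indicator {0..?Q} q * (gauss z * ?d q z) \<partial>lborel) = (\<integral>q. gauss z * (indicator {0..?Q} q * ?d q z) \<partial>lborel)"
      by (simp only: mult_ac)
    then show ?thesis by (simp only: integral_mult_right_zero ray)
  qed
  have f3: "(\<integral>z. indicator {0..?Q} q * (gauss z * ?d q z) \<partial>lborel) = indicator {0..?Q} q * (2 * q * heat L (q\<^sup>2))" for q
    using inner[of q] by (cases "q \<in> {0..?Q}") simp_all
  have f4: "(\<integral>z. gauss z * (\<psi> (?Q *\<^sub>R z) - \<psi> 0) \<partial>lborel) = heat \<psi> x - \<psi> 0"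
  proof -
    have "(\<integral>z. gauss z * (\<psi> (?Q *\<^sub>R z) - \<psi> 0) \<partial>lborel) = (\<integral>z. gauss z * \<psi> (?Q *\<^sub>R z) - gauss z * \<psi> 0 \<partial>lborel)"
      by (simp add: right_diff_distrib)
    also have "\<dots> = heat \<psi> x - \<psi> 0"
      using gauss_mult_integrable[of \<psi> B ?Q] b\<psi> gauss_integrable
      by (subst Bochner_Integration.integral_diff) (auto simp: heat_def gauss_integral)
    finally show ?thesis .
  qed
  have main: "heat \<psi> x - \<psi> 0 = (\<integral>q. indicator {0..?Q} q * (2 * q * heat L (q\<^sup>2)) \<partial>lborel)"
    using f1 unfolding f2 f3 f4 .
  have ch: "continuous_on UNIV (heat L)" by (rule heat_continuous[OF cL bL])
  have "(\<integral>q. heat L (q\<^sup>2) * (2 * q) * indicator {0..?Q} q \<partial>lborel) = (\<integral>r. heat L r * indicator {0\<^sup>2..?Q\<^sup>2} r \<partial>lborel)"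
    by (rule integral_substitution(2)[symmetric, where g = "\<lambda>q. q\<^sup>2" and g' = "\<lambda>q. 2 * q"])
      (use x in \<open>auto intro!: derivative_eq_intros continuous_intros borel_integrable_atLeastAtMost'
        continuous_on_subset[OF ch]\<close>)
  also have "\<dots> = (\<integral>r. indicator {0<..<x} r * heat L r \<partial>lborel)"
  proof (rule integral_cong_AE)
    have [measurable]: "heat L \<in> borel_measurable borel" by (rule borel_measurable_continuous_onI[OF ch])
    show "(\<lambda>r. heat L r * indicator {0\<^sup>2..?Q\<^sup>2} r) \<in> borel_measurable lborel"
      "(\<lambda>r. indicator {0<..<x} r * heat L r) \<in> borel_measurable lborel"
      by measurable
    show "AE r in lborel. heat L r * indicator {0\<^sup>2..?Q\<^sup>2} r = indicator {0<..<x} r * heat L r"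
      using AE_lborel_singleton[of 0] AE_lborel_singleton[of x]
      by eventually_elim (use x in \<open>auto simp: indicator_def\<close>)
  qed
  finally show ?thesis using main by (simp add: mult_ac)
qed

section \<open>Riemann--Liouville derivatives of primitives\<close>

lemma frac_integral_eq_convolution:
  assumes [measurable]: "f \<in> borel_measurable borel" and f: "\<And>s. 0 < s \<Longrightarrow> s < t \<Longrightarrow> \<phi> s = f s"
  shows "frac_integral \<beta> \<phi> t = (\<integral>s. frac_kernel \<beta> (t - s) * (indicator {0<..} s * f s) \<partial>lborel)"
proof -
  have "(LINT s:{0<..<t}|lebesgue. (t - s) powr (\<beta> - 1) * \<phi> s) =
      (\<integral>s. indicator {0<..<t} s * ((t - s) powr (\<beta> - 1) * f s) \<partial>lborel)"
    unfolding set_lebesgue_integral_def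
    by (rule lebesgue_integral_AE_borel(1)) (auto simp: indicator_def f intro!: AE_I2)
  then have "frac_integral \<beta> \<phi> t = (\<integral>s. 1 / Gamma \<beta> * (indicator {0<..<t} s * ((t - s) powr (\<beta> - 1) * f s)) \<partial>lborel)"
    unfolding frac_integral_def by simp
  also have "\<dots> = (\<integral>s. frac_kernel \<beta> (t - s) * (indicator {0<..} s * f s) \<partial>lborel)"
    by (intro Bochner_Integration.integral_cong) (auto simp: frac_kernel_def indicator_def)
  finally show ?thesis .
qed

lemma frac_kernel_convolution_shift:
  fixes g :: "real \<Rightarrow> real"
  assumes [measurable]: "g \<in> borel_measurable borel"
  shows "(\<integral>r. frac_kernel \<beta> (s - r) * g r \<partial>lborel) = (\<integral>r. frac_kernel \<beta> r * g (s - r) \<partial>lborel)"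
  using lborel_integral_real_affine[of "-1" "\<lambda>r. frac_kernel \<beta> (s - r) * g r" s] by simp

text \<open>After the reflection of the variable the singular kernel stays fixed and only g moves,
  so the kernel restricted to r < T, times C, is a majorant as soon as the approaching points lie
  below T. Since g may jump at 0, the single point r = s is excluded as a null set.\<close>

lemma frac_kernel_convolution_isCont:
  fixes g :: "real \<Rightarrow> real"
  assumes \<beta>: "\<beta> > 0" and [measurable]: "g \<in> borel_measurable borel"
    and bd: "\<And>r. \<bar>g r\<bar> \<le> C * indicator {0<..} r" and cont: "\<And>r. 0 < r \<Longrightarrow> r < T \<Longrightarrow> isCont g r"
    and s: "0 < s" "s < T"
  shows "isCont (\<lambda>s. \<integral>r. frac_kernel \<beta> (s - r) * g r \<partial>lborel) s"
  unfolding continuous_at_sequentially frac_kernel_convolution_shift[OF assms(2)] o_def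
proof (intro allI impI)
  have C: "C \<ge> 0" using bd[of 1] by simp
  fix x assume x: "x \<longlonglongrightarrow> s"
  then have "\<forall>\<^sub>F n in sequentially. x n < T" using s by (intro order_tendstoD)
  then obtain N where N: "\<And>n. n \<ge> N \<Longrightarrow> x n < T" by (auto simp: eventually_sequentially)
  have "(\<lambda>n. \<integral>r. frac_kernel \<beta> r * g (x (n + N) - r) \<partial>lborel) \<longlonglongrightarrow> (\<integral>r. frac_kernel \<beta> r * g (s - r) \<partial>lborel)"
  proof (rule integral_dominated_convergence[where w = "\<lambda>r. C * (frac_kernel \<beta> r * indicator {0<..} (T - r))"])
    have "integrable lborel (\<lambda>r. frac_kernel \<beta> r * indicator {0<..} (T - r))"
      using frac_kernel_convolution[of 1 \<beta> T] \<beta> by (simp add: frac_kernel_1 mult.commute has_bochner_integral_iff)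
    then show "integrable lborel (\<lambda>r. C * (frac_kernel \<beta> r * indicator {0<..} (T - r)))"
      by (rule integrable_mult_right)
    show "AE r in lborel. norm (frac_kernel \<beta> r * g (x (n + N) - r)) \<le> C * (frac_kernel \<beta> r * indicator {0<..} (T - r))" for n
    proof (rule AE_I2)
      fix r
      have "\<bar>g (x (n + N) - r)\<bar> \<le> C * indicator {0<..} (T - r)"
        using bd[of "x (n + N) - r"] N[of "n + N"] C by (cases "r < x (n + N)") auto
      from mult_left_mono[OF this frac_kernel_nonneg[OF \<beta>, of r]]
      show "norm (frac_kernel \<beta> r * g (x (n + N) - r)) \<le> C * (frac_kernel \<beta> r * indicator {0<..} (T - r))"
        by (simp add: abs_mult frac_kernel_nonneg[OF \<beta>] mult_ac)
    qed
    show "AE r in lborel. (\<lambda>n. frac_kernel \<beta> r * g (x (n + N) - r)) \<longlonglongrightarrow> frac_kernel \<beta> r * g (s - r)"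
      using AE_lborel_singleton[of s]
    proof eventually_elim
      fix r :: real assume r: "r \<noteq> s"
      show "(\<lambda>n. frac_kernel \<beta> r * g (x (n + N) - r)) \<longlonglongrightarrow> frac_kernel \<beta> r * g (s - r)"
      proof (cases "r > 0")
        case False
        then show ?thesis by (simp add: frac_kernel_def)
      next
        case True
        have lim: "(\<lambda>n. x (n + N) - r) \<longlonglongrightarrow> s - r"
          by (intro tendsto_intros LIMSEQ_ignore_initial_segment x)
        show ?thesis
        proof (cases "r < s")
          case rs: True
          then show ?thesis
            using s True by (intro tendsto_intros isCont_tendsto_compose[OF cont lim]) auto
        next
          case False
          then have "s - r < 0" using r by simp
          with lim have "\<forall>\<^sub>F n in sequentially. x (n + N) - r < 0" by (rule order_tendstoD)
          then have "\<forall>\<^sub>F n in sequentially. frac_kernel \<beta> r * g (x (n + N) - r) = frac_kernel \<beta> r * g (s - r)"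
          proof eventually_elim
            case (elim n)
            then show ?case using bd[of "x (n + N) - r"] bd[of "s - r"] \<open>s - r < 0\<close> by simp
          qed
          then show ?thesis by (rule tendsto_eventually)
        qed
      qed
    qed
  qed measurable
  then show "(\<lambda>n. \<integral>r. frac_kernel \<beta> r * g (x n - r) \<partial>lborel) \<longlonglongrightarrow> (\<integral>r. frac_kernel \<beta> r * g (s - r) \<partial>lborel)"
    by (rule LIMSEQ_offset)
qed

text \<open>By the semigroup law the fractional integral of c + 1 * g is the primitive of c k + k *
  g with k = \<open>frac_kernel (1 - \<alpha>)\<close>. That function is continuous on (0,T), so the
  fundamental theorem of calculus recovers it as the derivative. The term c k is the contribution of
  the value at time 0.\<close>

lemma RL_deriv_eq:
  fixes \<phi> g :: "real \<Rightarrow> real"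
  assumes \<alpha>: "0 < \<alpha>" "\<alpha> < 1" and [measurable]: "g \<in> borel_measurable borel"
    and bd: "\<And>r. \<bar>g r\<bar> \<le> C * indicator {0<..} r" and cont: "\<And>r. 0 < r \<Longrightarrow> r < T \<Longrightarrow> isCont g r"
    and \<phi>: "\<And>s. 0 < s \<Longrightarrow> s \<le> T \<Longrightarrow> \<phi> s = c + (\<integral>r. frac_kernel 1 (s - r) * g r \<partial>lborel)"
  shows "0 < s \<Longrightarrow> s \<le> T \<Longrightarrow> frac_integral (1 - \<alpha>) \<phi> s =
      c * frac_kernel (2 - \<alpha>) s + (\<integral>r. frac_kernel (2 - \<alpha>) (s - r) * g r \<partial>lborel)"
    and "0 < s \<Longrightarrow> s < T \<Longrightarrow> RL_deriv \<alpha> \<phi> s =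
      c * frac_kernel (1 - \<alpha>) s + (\<integral>r. frac_kernel (1 - \<alpha>) (s - r) * g r \<partial>lborel)"
proof -
  have \<beta>: "1 - \<alpha> > 0" using \<alpha> by simp
  have C: "C \<ge> 0" using bd[of 1] by simp
  have bd': "AE r in lborel. \<bar>g r\<bar> \<le> C * indicator {0<..} r" using bd by (intro AE_I2)
  let ?f = "\<lambda>s. c + (\<integral>r. frac_kernel 1 (s - r) * g r \<partial>lborel)"
  have i1: "integrable lborel (\<lambda>r. frac_kernel a (s - r) * g r)" if "a > 0" for a s
    by (rule frac_kernel_bounded_integrable[OF that _ bd']) measurable
  show I: "frac_integral (1 - \<alpha>) \<phi> s =
      c * frac_kernel (2 - \<alpha>) s + (\<integral>r. frac_kernel (2 - \<alpha>) (s - r) * g r \<partial>lborel)" if s: "0 < s" "s \<le> T" for s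
  proof -
    let ?G = "\<lambda>s. \<integral>r. frac_kernel 1 (s - r) * g r \<partial>lborel"
    have G0: "?G t = 0" if "t \<le> 0" for t
    proof -
      have "frac_kernel 1 (t - r) * g r = 0" for r
        using bd[of r] that by (cases "r > 0") (auto simp: frac_kernel_1)
      then show ?thesis by (simp only: Bochner_Integration.integral_zero)
    qed
    have "frac_integral (1 - \<alpha>) \<phi> s = (\<integral>t. frac_kernel (1 - \<alpha>) (s - t) * (indicator {0<..} t * ?f t) \<partial>lborel)"
      by (rule frac_integral_eq_convolution) (use \<phi> s in auto)
    also have "\<dots> = (\<integral>t. c * (indicator {0<..} t * frac_kernel (1 - \<alpha>) (s - t)) + frac_kernel (1 - \<alpha>) (s - t) * ?G t \<partial>lborel)"
      using G0 by (intro Bochner_Integration.integral_cong) (auto simp: indicator_def algebra_simps)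
    also have "\<dots> = c * (\<integral>t. indicator {0<..} t * frac_kernel (1 - \<alpha>) (s - t) \<partial>lborel) + (\<integral>t. frac_kernel (1 - \<alpha>) (s - t) * ?G t \<partial>lborel)"
    proof (subst Bochner_Integration.integral_add)
      have Gb: "\<bar>?G t\<bar> \<le> C * t" if "t > 0" for t
      proof -
        have "\<bar>?G t\<bar> \<le> (\<integral>r. \<bar>frac_kernel 1 (t - r) * g r\<bar> \<partial>lborel)" by (rule integral_abs_bound)
        also have "\<dots> \<le> (\<integral>r. C * (indicator {0<..} r * frac_kernel 1 (t - r)) \<partial>lborel)"
        proof (intro integral_mono integrable_abs i1 integrable_mult_right integrable.intros[OF frac_kernel_primitive])
          show "\<bar>frac_kernel 1 (t - r) * g r\<bar> \<le> C * (indicator {0<..} r * frac_kernel 1 (t - r))" for r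
            using mult_left_mono[OF bd[of r], of "frac_kernel 1 (t - r)"] by (simp add: abs_mult frac_kernel_nonneg mult_ac)
        qed auto
        also have "\<dots> = C * t"
          using that frac_kernel_primitive[of 1 t] Gamma_fact[of 1, where 'a = real] by (simp add: has_bochner_integral_iff frac_kernel_def)
        finally show ?thesis .
      qed
      \<comment> \<open>The primitive of g is only known to grow at most linearly. Cutting it off at
        s makes it bounded and changes nothing, because the kernel vanishes beyond s.\<close>
      have "integrable lborel (\<lambda>t. frac_kernel (1 - \<alpha>) (s - t) * (indicator {..s} t * ?G t))"
      proof (rule frac_kernel_bounded_integrable[OF \<beta>])
        show "AE t in lborel. \<bar>indicator {..s} t * ?G t\<bar> \<le> C * s * indicator {0<..} t"
        proof (rule AE_I2)
          fix t
          show "\<bar>indicator {..s} t * ?G t\<bar> \<le> C * s * indicator {0<..} t"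
          proof (cases "0 < t \<and> t \<le> s")
            case True
            then have "\<bar>?G t\<bar> \<le> C * s" using Gb[of t] C mult_left_mono[of t s C] by linarith
            then show ?thesis using True by simp
          next
            case False
            then show ?thesis using G0[of t] C s by (cases "t \<le> 0") (auto simp: indicator_def)
          qed
        qed
      qed measurable
      moreover have "frac_kernel (1 - \<alpha>) (s - t) * (indicator {..s} t * ?G t) = frac_kernel (1 - \<alpha>) (s - t) * ?G t" for t
        by (cases "t \<le> s") (auto simp: frac_kernel_def)
      ultimately show "integrable lborel (\<lambda>t. frac_kernel (1 - \<alpha>) (s - t) * ?G t)" by simp
      show "integrable lborel (\<lambda>t. c * (indicator {0<..} t * frac_kernel (1 - \<alpha>) (s - t)))"
        by (intro integrable_mult_right integrable.intros[OF frac_kernel_primitive[OF \<beta>]])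
    qed simp
    also have "(\<integral>t. frac_kernel (1 - \<alpha>) (s - t) * ?G t \<partial>lborel) = (\<integral>r. frac_kernel (2 - \<alpha>) (s - r) * g r \<partial>lborel)"
      using frac_kernel_convolution_assoc[OF \<beta> zero_less_one _ bd', of s] by simp
    also have "(\<integral>t. indicator {0<..} t * frac_kernel (1 - \<alpha>) (s - t) \<partial>lborel) = frac_kernel (2 - \<alpha>) s"
      using frac_kernel_primitive[OF \<beta>, of s] by (simp add: has_bochner_integral_iff)
    finally show ?thesis .
  qed
  let ?q = "\<lambda>s. c * frac_kernel (1 - \<alpha>) s + (\<integral>r. frac_kernel (1 - \<alpha>) (s - r) * g r \<partial>lborel)"
  show "RL_deriv \<alpha> \<phi> s = ?q s" if s: "0 < s" "s < T" for s
  proof -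
    let ?h = "\<lambda>s. \<integral>r. frac_kernel (1 - \<alpha>) (s - r) * g r \<partial>lborel"
    have G0: "Gamma (1 - \<alpha>) \<noteq> 0" using Gamma_real_pos[OF \<beta>] by (metis less_irrefl)
    have qc: "isCont ?q t" if "0 < t" "t < T" for t
    proof -
      have c: "isCont (\<lambda>t. t powr (1 - \<alpha> - 1) / Gamma (1 - \<alpha>)) t"
        using that G0 by (intro continuous_intros) auto
      have ev: "\<forall>\<^sub>F y in nhds t. y powr (1 - \<alpha> - 1) / Gamma (1 - \<alpha>) = frac_kernel (1 - \<alpha>) y"
        by (rule eventually_mono[OF eventually_nhds_in_open[of "{0<..}" t]]) (use that in \<open>auto simp: frac_kernel_def\<close>)
      have "isCont (frac_kernel (1 - \<alpha>)) t"
        by (rule isCont_cong[THEN iffD1, OF ev c])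
      then show ?thesis
        using frac_kernel_convolution_isCont[OF \<beta> _ bd cont that] by (intro continuous_intros) auto
    qed
    have prim: "(\<integral>t. frac_kernel 1 (x - t) * (indicator {0<..} t * ?q t) \<partial>lborel) =
        c * frac_kernel (2 - \<alpha>) x + (\<integral>r. frac_kernel (2 - \<alpha>) (x - r) * g r \<partial>lborel)"
      and qi: "integrable lborel (\<lambda>t. frac_kernel 1 (x - t) * (indicator {0<..} t * ?q t))" for x
    proof -
      have h0: "?h t = 0" if "t \<le> 0" for t
      proof -
        have "frac_kernel (1 - \<alpha>) (t - r) * g r = 0" for r
          using bd[of r] that by (cases "r > 0") (auto simp: frac_kernel_def)
        then show ?thesis by (simp only: Bochner_Integration.integral_zero)
      qed
      have e: "frac_kernel 1 (x - t) * (indicator {0<..} t * ?q t) =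
          c * (frac_kernel 1 (x - t) * frac_kernel (1 - \<alpha>) t) + frac_kernel 1 (x - t) * ?h t" for t
        using h0[of t] by (cases "t > 0") (auto simp: algebra_simps frac_kernel_def[of "1 - \<alpha>"])
      have a: "has_bochner_integral lborel (\<lambda>t. frac_kernel 1 (x - t) * frac_kernel (1 - \<alpha>) t) (frac_kernel (2 - \<alpha>) x)"
        using frac_kernel_convolution[OF zero_less_one \<beta>, of x] by simp
      have hb: "\<bar>?h t\<bar> \<le> C * frac_kernel (2 - \<alpha>) t" for t
      proof -
        have "\<bar>?h t\<bar> \<le> (\<integral>r. \<bar>frac_kernel (1 - \<alpha>) (t - r) * g r\<bar> \<partial>lborel)" by (rule integral_abs_bound)
        also have "\<dots> \<le> (\<integral>r. C * (indicator {0<..} r * frac_kernel (1 - \<alpha>) (t - r)) \<partial>lborel)"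
        proof (intro integral_mono integrable_abs i1 integrable_mult_right integrable.intros[OF frac_kernel_primitive] \<beta>)
          show "\<bar>frac_kernel (1 - \<alpha>) (t - r) * g r\<bar> \<le> C * (indicator {0<..} r * frac_kernel (1 - \<alpha>) (t - r))" for r
            using mult_left_mono[OF bd[of r], of "frac_kernel (1 - \<alpha>) (t - r)"] frac_kernel_nonneg[OF \<beta>]
            by (simp add: abs_mult mult_ac)
        qed
        also have "\<dots> = C * frac_kernel (2 - \<alpha>) t"
          using frac_kernel_primitive[OF \<beta>, of t] by (simp add: has_bochner_integral_iff)
        finally show ?thesis .
      qed
      have b: "integrable lborel (\<lambda>t. frac_kernel 1 (x - t) * ?h t)"
      proof (rule Bochner_Integration.integrable_bound)
        show "integrable lborel (\<lambda>t. C * (frac_kernel 1 (x - t) * frac_kernel (2 - \<alpha>) t))"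
          using frac_kernel_convolution[of 1 "2 - \<alpha>" x] \<alpha> by (intro integrable_mult_right) (simp add: has_bochner_integral_iff)
        show "AE t in lborel. norm (frac_kernel 1 (x - t) * ?h t) \<le> norm (C * (frac_kernel 1 (x - t) * frac_kernel (2 - \<alpha>) t))"
        proof (rule AE_I2)
          fix t
          have "frac_kernel 1 (x - t) * \<bar>?h t\<bar> \<le> frac_kernel 1 (x - t) * (C * frac_kernel (2 - \<alpha>) t)"
            by (intro mult_left_mono hb frac_kernel_nonneg) simp
          also have "\<dots> \<le> \<bar>C * (frac_kernel 1 (x - t) * frac_kernel (2 - \<alpha>) t)\<bar>"
            by (simp add: mult_ac)
          finally show "norm (frac_kernel 1 (x - t) * ?h t) \<le> norm (C * (frac_kernel 1 (x - t) * frac_kernel (2 - \<alpha>) t))"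
            by (simp add: abs_mult frac_kernel_nonneg)
        qed
      qed measurable
      show "integrable lborel (\<lambda>t. frac_kernel 1 (x - t) * (indicator {0<..} t * ?q t))"
        unfolding e by (intro Bochner_Integration.integrable_add integrable_mult_right b integrable.intros[OF a])
      have "(\<integral>t. frac_kernel 1 (x - t) * (indicator {0<..} t * ?q t) \<partial>lborel) =
          (\<integral>t. c * (frac_kernel 1 (x - t) * frac_kernel (1 - \<alpha>) t) \<partial>lborel) + (\<integral>t. frac_kernel 1 (x - t) * ?h t \<partial>lborel)"
        unfolding e by (intro Bochner_Integration.integral_add integrable_mult_right b integrable.intros[OF a])
      also have "(\<integral>t. c * (frac_kernel 1 (x - t) * frac_kernel (1 - \<alpha>) t) \<partial>lborel) = c * frac_kernel (2 - \<alpha>) x"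
        using a by (simp add: has_bochner_integral_iff)
      also have "(\<integral>t. frac_kernel 1 (x - t) * ?h t \<partial>lborel) = (\<integral>r. frac_kernel (2 - \<alpha>) (x - r) * g r \<partial>lborel)"
        using frac_kernel_convolution_assoc[OF zero_less_one \<beta> _ bd', of x] by simp
      finally show "(\<integral>t. frac_kernel 1 (x - t) * (indicator {0<..} t * ?q t) \<partial>lborel) =
        c * frac_kernel (2 - \<alpha>) x + (\<integral>r. frac_kernel (2 - \<alpha>) (x - r) * g r \<partial>lborel)" .
    qed
    \<comment> \<open>A compact interval around s inside (0,T), away from the singularity of the
      kernel at 0 and from the end T, where g is not controlled.\<close>
    define a where "a = s / 2"
    define b where "b = (s + T) / 2"
    have ab: "0 < a" "a < s" "s < b" "b < T" using s by (auto simp: a_def b_def)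
    have "continuous_on {a..b} ?q"
      using qc ab by (intro continuous_at_imp_continuous_on) auto
    then have "((\<lambda>x. integral {a..x} ?q) has_real_derivative ?q s) (at s within {a..b})"
      using ab by (intro integral_has_real_derivative) auto
    then have d: "((\<lambda>x. integral {a..x} ?q + frac_integral (1 - \<alpha>) \<phi> a) has_real_derivative ?q s) (at s)"
      using ab by (subst (asm) at_within_Icc_at) (auto intro!: derivative_eq_intros)
    have "frac_integral (1 - \<alpha>) \<phi> x = integral {a..x} ?q + frac_integral (1 - \<alpha>) \<phi> a" if x: "x \<in> {a<..<b}" for x
    proof -
      have cq: "continuous_on {a..x} ?q"
        using qc ab x by (intro continuous_at_imp_continuous_on) auto
      have "integral {a..x} ?q = (\<integral>t. indicator {a..x} t * ?q t \<partial>lborel)"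
        using set_borel_integral_eq_integral(2)[OF borel_integrable_atLeastAtMost'[OF cq]]
        by (simp add: set_lebesgue_integral_def)
      also have "\<dots> = (\<integral>t. frac_kernel 1 (x - t) * (indicator {0<..} t * ?q t) - frac_kernel 1 (a - t) * (indicator {0<..} t * ?q t) \<partial>lborel)"
        using AE_lborel_singleton[of a] AE_lborel_singleton[of x] ab x
        by (intro integral_cong_AE) (auto simp: frac_kernel_1 indicator_def elim!: eventually_elim2)
      also have "\<dots> = frac_integral (1 - \<alpha>) \<phi> x - frac_integral (1 - \<alpha>) \<phi> a"
        using ab x by (subst Bochner_Integration.integral_diff[OF qi qi]) (simp add: prim I)
      finally show ?thesis by simp
    qed
    then have "(frac_integral (1 - \<alpha>) \<phi> has_real_derivative ?q s) (at s)"
      using has_field_derivative_transform_within_open[OF d, of "{a<..<b}"] ab by auto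
    then show ?thesis unfolding RL_deriv_def by (rule DERIV_imp_deriv)
  qed
qed

section \<open>Smooth functions on the slab\<close>

text \<open>Derivatives are taken within the closed slab, hence one-sided at the times \<open>0\<close> and \<open>T\<close>.\<close>

definition slab_deriv :: "real \<Rightarrow> (real \<times> 'a::euclidean_space) \<Rightarrow> (real \<times> 'a \<Rightarrow> real) \<Rightarrow> real \<times> 'a \<Rightarrow> real" where
  "slab_deriv T v G p = frechet_derivative G (at p within {0..T} \<times> UNIV) v"

text \<open>A compact set Z outside of which G vanishes is carried along in place of the support of
  G, because the same Z then serves all derivatives.\<close>

definition slab_smooth :: "real \<Rightarrow> (real \<times> 'a::euclidean_space) set \<Rightarrow> (real \<times> 'a \<Rightarrow> real) \<Rightarrow> bool" where
  "slab_smooth T Z G \<longleftrightarrow> T > 0 \<and> compact Z \<and> Z \<subseteq> {0..T} \<times> UNIV \<and>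
     (\<forall>k. Ck_on k ({0..T} \<times> UNIV) G) \<and> (\<forall>p\<in>{0..T} \<times> UNIV - Z. G p = 0)"

lemma slab_smooth_continuous: "slab_smooth T Z G \<Longrightarrow> continuous_on ({0..T} \<times> UNIV) G"
  using Ck_on.simps(1) unfolding slab_smooth_def by blast

lemma slab_smooth_has_derivative:
  assumes "slab_smooth T Z G" "p \<in> {0..T} \<times> UNIV"
  shows "(G has_derivative (\<lambda>v. slab_deriv T v G p)) (at p within {0..T} \<times> UNIV)"
  unfolding slab_deriv_def
  by (rule Ck_on_derivative[of 0]) (use assms in \<open>auto simp: slab_smooth_def simp del: Ck_on.simps\<close>)

lemma slab_smooth_deriv:
  assumes G: "slab_smooth T Z G"
  shows "slab_smooth T Z (slab_deriv T v G)"
proof -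
  let ?S = "{0..T} \<times> (UNIV :: 'a set)"
  have T: "T > 0" and Z: "compact Z" "Z \<subseteq> ?S" and Ck: "\<And>k. Ck_on (Suc k) ?S G"
    and zero: "\<And>p. p \<in> ?S \<Longrightarrow> p \<notin> Z \<Longrightarrow> G p = 0"
    using G unfolding slab_smooth_def by blast+
  have "Ck_on k ?S (slab_deriv T v G)" for k
    using Ck[of k] unfolding slab_deriv_def[abs_def] Ck_on.simps(2) by blast
  moreover have "slab_deriv T v G p = 0" if p: "p \<in> ?S" "p \<notin> Z" for p
  proof -
    have "open (- Z)" using Z(1) by (simp add: compact_imp_closed open_Compl)
    then obtain d where d: "d > 0" "ball p d \<subseteq> - Z"
      using p(2) by (metis ComplI open_contains_ball)
    have "((\<lambda>_. 0) has_derivative (\<lambda>_. 0)) (at p within ?S)" by simp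
    then have "(G has_derivative (\<lambda>_. 0)) (at p within ?S)"
    proof (rule has_derivative_transform_within[OF _ d(1) p(1)])
      fix q assume "q \<in> ?S" "dist q p < d"
      then show "0 = G q" using d(2) zero[of q] by (auto simp: dist_commute subset_eq)
    qed
    then show ?thesis
      using unique_derivatives_slab[OF T, where 'a = 'a] p(1)
      unfolding slab_deriv_def unique_derivatives_def by (metis (no_types, lifting))
  qed
  ultimately show ?thesis
    using T Z by (auto simp: slab_smooth_def)
qed

lemma slab_smooth_bounded:
  assumes G: "slab_smooth T Z G"
  shows "\<exists>B. \<forall>p\<in>{0..T} \<times> UNIV. \<bar>G p\<bar> \<le> B"
proof -
  have "continuous_on Z G"
    using slab_smooth_continuous[OF G] G continuous_on_subset unfolding slab_smooth_def by blast
  then have "bounded (G ` Z)"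
    using G by (intro compact_imp_bounded compact_continuous_image) (auto simp: slab_smooth_def)
  then obtain B where B: "\<forall>y\<in>G ` Z. norm y \<le> B" unfolding bounded_iff by blast
  have "\<bar>G p\<bar> \<le> max B 0" if "p \<in> {0..T} \<times> UNIV" for p
    using B G that by (cases "p \<in> Z") (auto simp: slab_smooth_def le_max_iff_disj)
  then show ?thesis by blast
qed

lemma slab_smooth_space_derivative:
  assumes G: "slab_smooth T Z G" and s: "s \<in> {0..T}"
  shows "((\<lambda>x. G (s, x)) has_derivative (\<lambda>v. \<Sum>e\<in>Basis. (v \<bullet> e) * slab_deriv T (0, e) G (s, x))) (at x)"
proof -
  let ?S = "{0..T} \<times> (UNIV :: 'a set)"
  have p: "(s, x) \<in> ?S" using s by simp
  note GD = slab_smooth_has_derivative[OF G p]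
  interpret D: bounded_linear "\<lambda>v. slab_deriv T v G (s, x)" using GD by (rule has_derivative_bounded_linear)
  have "((\<lambda>x. (s, x)) has_derivative (\<lambda>v. (0, v))) (at x within UNIV)"
    by (auto intro!: derivative_eq_intros)
  then have D: "((\<lambda>x. G (s, x)) has_derivative (\<lambda>v. slab_deriv T (0, v) G (s, x))) (at x within UNIV)"
    by (rule has_derivative_in_compose) (rule has_derivative_subset[OF GD], use s in auto)
  have "slab_deriv T (0, v) G (s, x) = (\<Sum>e\<in>Basis. (v \<bullet> e) * slab_deriv T (0, e) G (s, x))" for v :: 'a
  proof -
    have "(0 :: real, v) = (\<Sum>e\<in>Basis. (v \<bullet> e) *\<^sub>R (0, e))"
      using euclidean_representation[of v] by (simp add: sum_prod)
    then have "slab_deriv T (0, v) G (s, x) = slab_deriv T (\<Sum>e\<in>Basis. (v \<bullet> e) *\<^sub>R (0, e)) G (s, x)" by simp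
    also have "\<dots> = (\<Sum>e\<in>Basis. (v \<bullet> e) * slab_deriv T (0, e) G (s, x))"
      by (simp add: D.sum D.scaleR del: scaleR_Pair)
    finally show ?thesis .
  qed
  then have "(\<lambda>v. slab_deriv T (0, v) G (s, x)) = (\<lambda>v. \<Sum>e\<in>Basis. (v \<bullet> e) * slab_deriv T (0, e) G (s, x))"
    by (rule ext)
  then show ?thesis using D by (simp only:)
qed

lemma slab_smooth_line_derivative:
  assumes G: "slab_smooth T Z G" and s: "s \<in> {0..T}" and e: "e \<in> Basis"
  shows "((\<lambda>h. G (s, x + h *\<^sub>R e)) has_real_derivative slab_deriv T (0, e) G (s, x + h *\<^sub>R e)) (at h)"
proof -
  have "((\<lambda>h. x + h *\<^sub>R e) has_derivative (\<lambda>k. k *\<^sub>R e)) (at h)"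
    by (auto intro!: derivative_eq_intros)
  from has_derivative_compose[OF this slab_smooth_space_derivative[OF G s]]
  have "((\<lambda>h. G (s, x + h *\<^sub>R e)) has_derivative
      (\<lambda>k. \<Sum>b\<in>Basis. ((k *\<^sub>R e) \<bullet> b) * slab_deriv T (0, b) G (s, x + h *\<^sub>R e))) (at h)" .
  moreover have "(\<Sum>b\<in>Basis. ((k *\<^sub>R e) \<bullet> b) * slab_deriv T (0, b) G (s, x + h *\<^sub>R e)) =
      slab_deriv T (0, e) G (s, x + h *\<^sub>R e) * k" for k
  proof -
    have "(\<Sum>b\<in>Basis. ((k *\<^sub>R e) \<bullet> b) * slab_deriv T (0, b) G (s, x + h *\<^sub>R e)) =
        (\<Sum>b\<in>Basis. if b = e then k * slab_deriv T (0, b) G (s, x + h *\<^sub>R e) else 0)"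
      using e by (intro sum.cong) (auto simp: inner_Basis)
    then show ?thesis using e by (simp add: sum.delta)
  qed
  ultimately show ?thesis by (simp add: has_field_derivative_def)
qed

lemma slab_smooth_time_derivative:
  assumes G: "slab_smooth T Z G" and s: "s \<in> {0..T}"
  shows "((\<lambda>s. G (s, x)) has_vector_derivative slab_deriv T (1, 0) G (s, x)) (at s within {0..T})"
proof -
  let ?S = "{0..T} \<times> (UNIV :: 'a set)"
  have p: "(s, x) \<in> ?S" using s by simp
  note GD = slab_smooth_has_derivative[OF G p]
  interpret D: bounded_linear "\<lambda>v. slab_deriv T v G (s, x)" using GD by (rule has_derivative_bounded_linear)
  have "((\<lambda>s. (s, x)) has_derivative (\<lambda>k. (k, 0))) (at s within {0..T})"
    by (auto intro!: derivative_eq_intros)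
  then have D: "((\<lambda>s. G (s, x)) has_derivative (\<lambda>k. slab_deriv T (k, 0) G (s, x))) (at s within {0..T})"
    by (rule has_derivative_in_compose) (rule has_derivative_subset[OF GD], auto)
  have "slab_deriv T (k, 0) G (s, x) = k *\<^sub>R slab_deriv T (1, 0) G (s, x)" for k
    using D.scaleR[of k "(1, 0)"] by simp
  then have "(\<lambda>k. slab_deriv T (k, 0) G (s, x)) = (\<lambda>k. k *\<^sub>R slab_deriv T (1, 0) G (s, x))"
    by (rule ext)
  then show ?thesis using D unfolding has_vector_derivative_def by (simp only:)
qed

lemma slab_smooth_time_integral:
  assumes G: "slab_smooth T Z G" and s: "s \<in> {0..T}"
  shows "G (s, x) = G (0, x) + integral (cbox 0 s) (\<lambda>r. slab_deriv T (1, 0) G (r, x))"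
proof -
  have "((\<lambda>r. slab_deriv T (1, 0) G (r, x)) has_integral (G (s, x) - G (0, x))) {0..s}"
    using s by (intro fundamental_theorem_of_calculus)
      (auto intro!: has_vector_derivative_within_subset[OF slab_smooth_time_derivative[OF G]])
  then show ?thesis by (simp add: integral_unique)
qed

text \<open>Differentiation under the integral sign takes the place of the symmetry of mixed
  derivatives, and it also covers the boundary times. G and H are kept general so that the lemma can
  be applied a second time to the first derivatives.\<close>

lemma slab_smooth_time_integral_deriv:
  assumes G: "slab_smooth T Z G" and H: "slab_smooth T Z' H" and s: "s \<in> {0..T}" and e: "e \<in> Basis"
    and GH: "\<And>x. G (s, x) = G (0, x) + integral (cbox 0 s) (\<lambda>r. H (r, x))"
  shows "slab_deriv T (0, e) G (s, x) = slab_deriv T (0, e) G (0, x) + integral (cbox 0 s) (\<lambda>r. slab_deriv T (0, e) H (r, x))"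
proof -
  have T: "0 \<in> {0..T}" using s by auto
  have cH: "continuous_on ({0..T} \<times> UNIV) H" "continuous_on ({0..T} \<times> UNIV) (slab_deriv T (0, e) H)"
    using slab_smooth_continuous[OF H] slab_smooth_continuous[OF slab_smooth_deriv[OF H]] by auto
  have "((\<lambda>h. integral (cbox 0 s) (\<lambda>r. H (r, x + h *\<^sub>R e))) has_field_derivative
      integral (cbox 0 s) (\<lambda>r. slab_deriv T (0, e) H (r, x + 0 *\<^sub>R e))) (at 0 within UNIV)"
  proof (rule leibniz_rule_field_derivative[where fx = "\<lambda>h r. slab_deriv T (0, e) H (r, x + h *\<^sub>R e)"])
    show "((\<lambda>h. H (r, x + h *\<^sub>R e)) has_field_derivative slab_deriv T (0, e) H (r, x + h *\<^sub>R e)) (at h within UNIV)"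
      if "r \<in> cbox 0 s" for h r
      using that s by (intro slab_smooth_line_derivative[OF H _ e]) auto
    show "(\<lambda>r. H (r, x + h *\<^sub>R e)) integrable_on cbox 0 s" for h
      using s by (intro integrable_continuous continuous_on_compose2[OF cH(1)] continuous_intros) auto
    show "continuous_on (UNIV \<times> cbox 0 s) (\<lambda>(h, r). slab_deriv T (0, e) H (r, x + h *\<^sub>R e))"
      unfolding case_prod_unfold
      using s by (intro continuous_on_compose2[OF cH(2)] continuous_intros) auto
  qed auto
  then have "((\<lambda>h. G (0, x + h *\<^sub>R e) + integral (cbox 0 s) (\<lambda>r. H (r, x + h *\<^sub>R e))) has_field_derivative
      slab_deriv T (0, e) G (0, x + 0 *\<^sub>R e) + integral (cbox 0 s) (\<lambda>r. slab_deriv T (0, e) H (r, x + 0 *\<^sub>R e))) (at 0)"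
    by (intro DERIV_add slab_smooth_line_derivative[OF G T e]) simp
  then have "((\<lambda>h. G (s, x + h *\<^sub>R e)) has_field_derivative
      slab_deriv T (0, e) G (0, x) + integral (cbox 0 s) (\<lambda>r. slab_deriv T (0, e) H (r, x))) (at 0)"
    unfolding GH[symmetric] by simp
  moreover have "((\<lambda>h. G (s, x + h *\<^sub>R e)) has_real_derivative slab_deriv T (0, e) G (s, x)) (at 0)"
    using slab_smooth_line_derivative[OF G s e, of x 0] by simp
  ultimately show ?thesis by (rule DERIV_unique[rotated])
qed

definition slab_laplacian :: "real \<Rightarrow> (real \<times> 'a::euclidean_space \<Rightarrow> real) \<Rightarrow> real \<times> 'a \<Rightarrow> real" where
  "slab_laplacian T G p = (\<Sum>e\<in>Basis. slab_deriv T (0, e) (slab_deriv T (0, e) G) p)"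

lemma slab_laplacian_eq:
  assumes G: "slab_smooth T Z G" and s: "s \<in> {0..T}"
  shows "laplacian (\<lambda>x. G (s, x)) x = slab_laplacian T G (s, x)"
  unfolding laplacian_def slab_laplacian_def
proof (rule sum.cong[OF refl])
  fix e :: 'a assume e: "e \<in> Basis"
  have 1: "deriv (\<lambda>h. G (s, x + h *\<^sub>R e)) = (\<lambda>h. slab_deriv T (0, e) G (s, x + h *\<^sub>R e))"
    by (intro ext DERIV_imp_deriv slab_smooth_line_derivative[OF G s e])
  show "(deriv ^^ 2) (\<lambda>h. G (s, x + h *\<^sub>R e)) 0 = slab_deriv T (0, e) (slab_deriv T (0, e) G) (s, x)"
    using DERIV_imp_deriv[OF slab_smooth_line_derivative[OF slab_smooth_deriv[OF G, of "(0, e)"] s e, of x 0]]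
    by (simp add: numeral_2_eq_2 1)
qed

lemma slab_laplacian_continuous:
  assumes G: "slab_smooth T Z G"
  shows "continuous_on ({0..T} \<times> UNIV) (slab_laplacian T G)"
  unfolding slab_laplacian_def[abs_def]
  by (intro continuous_on_sum slab_smooth_continuous[OF slab_smooth_deriv[OF slab_smooth_deriv[OF G]]])

lemma slab_laplacian_time_integral:
  assumes G: "slab_smooth T Z G" and s: "s \<in> {0..T}"
  shows "slab_laplacian T G (s, x) = slab_laplacian T G (0, x) +
    integral (cbox 0 s) (\<lambda>r. slab_laplacian T (slab_deriv T (1, 0) G) (r, x))"
proof -
  let ?H = "slab_deriv T (1, 0) G"
  note H = slab_smooth_deriv[OF G, of "(1, 0)"]
  have e1: "slab_deriv T (0, e) G (s, x) = slab_deriv T (0, e) G (0, x) + integral (cbox 0 s) (\<lambda>r. slab_deriv T (0, e) ?H (r, x))"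
    if "e \<in> Basis" for e x
    by (rule slab_smooth_time_integral_deriv[OF G H s that slab_smooth_time_integral[OF G s]])
  have e2: "slab_deriv T (0, e) (slab_deriv T (0, e) G) (s, x) = slab_deriv T (0, e) (slab_deriv T (0, e) G) (0, x) +
      integral (cbox 0 s) (\<lambda>r. slab_deriv T (0, e) (slab_deriv T (0, e) ?H) (r, x))"
    if "e \<in> Basis" for e
    by (rule slab_smooth_time_integral_deriv[OF slab_smooth_deriv[OF G] slab_smooth_deriv[OF H] s that e1[OF that]])
  have int: "(\<lambda>r. slab_deriv T (0, e) (slab_deriv T (0, e) ?H) (r, x)) integrable_on cbox 0 s" for e
    using s by (intro integrable_continuous continuous_on_compose2[OF slab_smooth_continuous[OF slab_smooth_deriv[OF slab_smooth_deriv[OF H]]]]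
        continuous_intros) auto
  show ?thesis
    unfolding slab_laplacian_def by (subst integral_sum[OF finite_Basis int]) (simp add: e2 sum.distrib)
qed

lemma test_function_slab_smooth:
  assumes T: "T > 0" and \<phi>: "test_function T \<phi>"
  obtains Z where "slab_smooth T Z (\<lambda>(t, x). \<phi> t x)"
proof
  define A where "A = {(t, x) \<in> {0..T} \<times> UNIV. \<phi> t x \<noteq> 0}"
  have A: "compact (closure A)" "\<forall>k. Ck_on k ({0..T} \<times> UNIV) (\<lambda>(t, x). \<phi> t x)"
    using \<phi> unfolding test_function_def A_def by blast+
  have "closure A \<subseteq> {0..T} \<times> UNIV"
    by (intro closure_minimal closed_Times) (auto simp: A_def)
  moreover have "\<forall>p\<in>{0..T} \<times> UNIV - closure A. (case p of (t, x) \<Rightarrow> \<phi> t x) = 0"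
  proof (rule ballI, rule ccontr)
    fix p assume p: "p \<in> {0..T} \<times> UNIV - closure A" "(case p of (t, x) \<Rightarrow> \<phi> t x) \<noteq> 0"
    then have "p \<in> A" by (auto simp: A_def)
    then show False using p(1) closure_subset by blast
  qed
  ultimately show "slab_smooth T (closure A) (\<lambda>(t, x). \<phi> t x)"
    unfolding slab_smooth_def by (intro conjI T A)
qed

section \<open>Existence of weak solutions\<close>

lemma slice_convolution:
  fixes w F :: "real \<times> 'a::euclidean_space \<Rightarrow> real"
  assumes w: "integrable lborel (\<lambda>x. w (t, x))" and [measurable]: "w \<in> borel_measurable borel"
    and F [measurable]: "F \<in> borel_measurable borel" and bd: "\<And>r x. \<bar>F (r, x)\<bar> \<le> B * indicator {0<..} r" and \<beta>: "\<beta> > 0"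
  shows "integrable lborel (\<lambda>x. w (t, x) * (\<integral>r. frac_kernel \<beta> (s - r) * F (r, x) \<partial>lborel))"
    and "slice w (\<lambda>x. \<integral>r. frac_kernel \<beta> (s - r) * F (r, x) \<partial>lborel) t =
      (\<integral>r. frac_kernel \<beta> (s - r) * slice w (\<lambda>x. F (r, x)) t \<partial>lborel)"
proof -
  have [measurable]: "w \<in> borel_measurable (borel \<Otimes>\<^sub>M borel)" "F \<in> borel_measurable (borel \<Otimes>\<^sub>M borel)"
    by (simp_all add: borel_prod)
  let ?f = "\<lambda>(r, x). frac_kernel \<beta> (s - r) * (w (t, x) * F (r, x))"
  have fm: "?f \<in> borel_measurable (lborel \<Otimes>\<^sub>M lborel)" by measurable
  have i: "integrable lborel (\<lambda>x. w (t, x) * F (r, x))" and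
    l: "(\<integral>x. \<bar>w (t, x) * F (r, x)\<bar> \<partial>lborel) \<le> (\<integral>x. \<bar>w (t, x)\<bar> \<partial>lborel) * (B * indicator {0<..} r)" for r
    using slice_abs_le(1,2)[OF w, of "\<lambda>x. F (r, x)" "B * indicator {0<..} r"] bd by auto
  have int: "integrable (lborel \<Otimes>\<^sub>M lborel) ?f"
  proof (rule lborel_pair.Fubini_integrable[OF fm])
    show "integrable lborel (\<lambda>r. \<integral>x. norm (?f (r, x)) \<partial>lborel)"
    proof (rule Bochner_Integration.integrable_bound)
      show "integrable lborel (\<lambda>r. ((\<integral>x. \<bar>w (t, x)\<bar> \<partial>lborel) * B) * (indicator {0<..} r * frac_kernel \<beta> (s - r)))"
        by (intro integrable_mult_right integrable.intros[OF frac_kernel_primitive[OF \<beta>]])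
      have "norm (\<integral>x. norm (?f (r, x)) \<partial>lborel) \<le> norm (((\<integral>x. \<bar>w (t, x)\<bar> \<partial>lborel) * B) * (indicator {0<..} r * frac_kernel \<beta> (s - r)))" for r
      proof -
        have "norm (\<integral>x. norm (?f (r, x)) \<partial>lborel) = frac_kernel \<beta> (s - r) * (\<integral>x. \<bar>w (t, x) * F (r, x)\<bar> \<partial>lborel)"
          using frac_kernel_nonneg[OF \<beta>, of "s - r"] by (simp add: abs_mult[of "frac_kernel \<beta> (s - r)"])
        also have "\<dots> \<le> frac_kernel \<beta> (s - r) * ((\<integral>x. \<bar>w (t, x)\<bar> \<partial>lborel) * (B * indicator {0<..} r))"
          by (rule mult_left_mono[OF l frac_kernel_nonneg[OF \<beta>]])
        also have "\<dots> = ((\<integral>x. \<bar>w (t, x)\<bar> \<partial>lborel) * B) * (indicator {0<..} r * frac_kernel \<beta> (s - r))" by simp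
        finally show ?thesis by simp
      qed
      then show "AE r in lborel. norm (\<integral>x. norm (?f (r, x)) \<partial>lborel) \<le>
          norm (((\<integral>x. \<bar>w (t, x)\<bar> \<partial>lborel) * B) * (indicator {0<..} r * frac_kernel \<beta> (s - r)))"
        by (intro AE_I2)
    qed (use fm in measurable)
    show "AE r in lborel. integrable lborel (\<lambda>x. ?f (r, x))" using i by simp
  qed
  have eq: "w (t, x) * (\<integral>r. frac_kernel \<beta> (s - r) * F (r, x) \<partial>lborel) = (\<integral>r. ?f (r, x) \<partial>lborel)" for x
    by (simp add: mult.left_commute[of "frac_kernel _ _"])
  show "integrable lborel (\<lambda>x. w (t, x) * (\<integral>r. frac_kernel \<beta> (s - r) * F (r, x) \<partial>lborel))"
    unfolding eq using lborel_pair.integrable_snd[OF int] by simp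
  have "slice w (\<lambda>x. \<integral>r. frac_kernel \<beta> (s - r) * F (r, x) \<partial>lborel) t = (\<integral>x. (\<integral>r. ?f (r, x) \<partial>lborel) \<partial>lborel)"
    unfolding slice_def eq ..
  also have "\<dots> = (\<integral>r. (\<integral>x. ?f (r, x) \<partial>lborel) \<partial>lborel)"
    by (rule lborel_pair.Fubini_integral) (use int in simp)
  finally show "slice w (\<lambda>x. \<integral>r. frac_kernel \<beta> (s - r) * F (r, x) \<partial>lborel) t =
      (\<integral>r. frac_kernel \<beta> (s - r) * slice w (\<lambda>x. F (r, x)) t \<partial>lborel)"
    by (simp add: slice_def)
qed

lemma integral_slice_convolution:
  fixes w F :: "real \<times> 'a::euclidean_space \<Rightarrow> real"
  assumes w: "L1_slices C w"
    and F [measurable]: "F \<in> borel_measurable borel" and bd: "\<And>r x. \<bar>F (r, x)\<bar> \<le> B * indicator {0<..} r" and \<beta>: "\<beta> > 0"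
  shows "integrable lborel (\<lambda>t. slice w (\<lambda>x. \<integral>r. frac_kernel \<beta> (S - t - r) * F (r, x) \<partial>lborel) t)"
    and "integrable lborel (\<lambda>r. \<integral>t. frac_kernel \<beta> (S - r - t) * slice w (\<lambda>x. F (r, x)) t \<partial>lborel)"
    and "(\<integral>t. slice w (\<lambda>x. \<integral>r. frac_kernel \<beta> (S - t - r) * F (r, x) \<partial>lborel) t \<partial>lborel) =
      (\<integral>r. (\<integral>t. frac_kernel \<beta> (S - r - t) * slice w (\<lambda>x. F (r, x)) t \<partial>lborel) \<partial>lborel)"
proof -
  have wm [measurable]: "w \<in> borel_measurable borel" and C: "C \<ge> 0"
    and ae: "AE t in lborel. integrable lborel (\<lambda>x. w (t, x)) \<and> (\<integral>x. \<bar>w (t, x)\<bar> \<partial>lborel) \<le> C * indicator {0<..} t"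
    using w unfolding L1_slices_def by blast+
  have [measurable]: "w \<in> borel_measurable (borel \<Otimes>\<^sub>M borel)" "F \<in> borel_measurable (borel \<Otimes>\<^sub>M borel)"
    by (simp_all add: borel_prod)
  have B: "B \<ge> 0" using bd[of 1 undefined] by simp
  let ?f = "\<lambda>(t, r). frac_kernel \<beta> (S - t - r) * slice w (\<lambda>x. F (r, x)) t"
  have fm [measurable]: "?f \<in> borel_measurable (lborel \<Otimes>\<^sub>M lborel)"
    unfolding slice_def by measurable
  have fb: "AE t in lborel. \<forall>r. norm (?f (t, r)) \<le> C * B * indicator {0<..} t * (indicator {0<..} r * frac_kernel \<beta> (S - t - r))"
    using ae
  proof eventually_elim
    case (elim t)
    show ?case
    proof
      fix r
      have "\<bar>slice w (\<lambda>x. F (r, x)) t\<bar> \<le> (\<integral>x. \<bar>w (t, x)\<bar> \<partial>lborel) * (B * indicator {0<..} r)"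
        using elim bd by (intro slice_abs_le(3)) auto
      also have "\<dots> \<le> (C * indicator {0<..} t) * (B * indicator {0<..} r)"
        using elim B by (intro mult_right_mono) auto
      finally have "frac_kernel \<beta> (S - t - r) * \<bar>slice w (\<lambda>x. F (r, x)) t\<bar> \<le> frac_kernel \<beta> (S - t - r) * ((C * indicator {0<..} t) * (B * indicator {0<..} r))"
        by (rule mult_left_mono[OF _ frac_kernel_nonneg[OF \<beta>]])
      then show "norm (?f (t, r)) \<le> C * B * indicator {0<..} t * (indicator {0<..} r * frac_kernel \<beta> (S - t - r))"
        using frac_kernel_nonneg[OF \<beta>, of "S - t - r"] by (simp add: abs_mult mult_ac)
    qed
  qed
  have int: "integrable (lborel \<Otimes>\<^sub>M lborel) ?f"
  proof (rule lborel_pair.Fubini_integrable[OF fm])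
    have i: "AE t in lborel. integrable lborel (\<lambda>r. ?f (t, r))"
      using fb
    proof eventually_elim
      case (elim t)
      show ?case
      proof (rule Bochner_Integration.integrable_bound)
        show "integrable lborel (\<lambda>r. C * B * indicator {0<..} t * (indicator {0<..} r * frac_kernel \<beta> (S - t - r)))"
          by (intro integrable_mult_right integrable.intros[OF frac_kernel_primitive[OF \<beta>]])
        show "AE r in lborel. norm (?f (t, r)) \<le> norm (C * B * indicator {0<..} t * (indicator {0<..} r * frac_kernel \<beta> (S - t - r)))"
          by (intro AE_I2 order_trans[OF elim[THEN spec]]) simp
      qed measurable
    qed
    then show "AE t in lborel. integrable lborel (\<lambda>r. ?f (t, r))" .
    show "integrable lborel (\<lambda>t. \<integral>r. norm (?f (t, r)) \<partial>lborel)"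
    proof (rule Bochner_Integration.integrable_bound)
      show "integrable lborel (\<lambda>t. C * B * (indicator {0<..} t * frac_kernel (\<beta> + 1) (S - t)))"
        using \<beta> by (intro integrable_mult_right integrable.intros[OF frac_kernel_primitive]) simp
      show "AE t in lborel. norm (\<integral>r. norm (?f (t, r)) \<partial>lborel) \<le> norm (C * B * (indicator {0<..} t * frac_kernel (\<beta> + 1) (S - t)))"
        using fb i
      proof eventually_elim
        case (elim t)
        have "(\<integral>r. norm (?f (t, r)) \<partial>lborel) \<le> (\<integral>r. C * B * indicator {0<..} t * (indicator {0<..} r * frac_kernel \<beta> (S - t - r)) \<partial>lborel)"
          by (intro integral_mono integrable_norm elim(2) elim(1)[THEN spec] integrable_mult_right integrable.intros[OF frac_kernel_primitive[OF \<beta>]])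
        also have "\<dots> = C * B * indicator {0<..} t * frac_kernel (\<beta> + 1) (S - t)"
          using frac_kernel_primitive[OF \<beta>, of "S - t"] by (simp add: has_bochner_integral_iff)
        finally show ?case
          using integral_nonneg_AE[of "\<lambda>r. norm (?f (t, r))" lborel] by (simp add: mult.assoc)
      qed
    qed measurable
  qed
  have "integrable lborel (\<lambda>t. \<integral>r. ?f (t, r) \<partial>lborel)" by (rule lborel_pair.integrable_fst'[OF int])
  moreover have ae_eq: "AE t in lborel. slice w (\<lambda>x. \<integral>r. frac_kernel \<beta> (S - t - r) * F (r, x) \<partial>lborel) t = (\<integral>r. ?f (t, r) \<partial>lborel)"
    using ae by eventually_elim (simp add: slice_convolution(2)[OF _ wm F bd \<beta>])
  moreover have sm: "(\<lambda>t. slice w (\<lambda>x. \<integral>r. frac_kernel \<beta> (S - t - r) * F (r, x) \<partial>lborel) t) \<in> borel_measurable lborel"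
    unfolding slice_def by measurable
  ultimately show "integrable lborel (\<lambda>t. slice w (\<lambda>x. \<integral>r. frac_kernel \<beta> (S - t - r) * F (r, x) \<partial>lborel) t)"
    by (subst integrable_cong_AE[OF sm _ ae_eq]) auto
  have swap: "S - t - r = S - r - t" for t r :: real by simp
  show "integrable lborel (\<lambda>r. \<integral>t. frac_kernel \<beta> (S - r - t) * slice w (\<lambda>x. F (r, x)) t \<partial>lborel)"
    using lborel_pair.integrable_snd[OF int] by (simp add: swap)
  have "(\<integral>t. slice w (\<lambda>x. \<integral>r. frac_kernel \<beta> (S - t - r) * F (r, x) \<partial>lborel) t \<partial>lborel) = (\<integral>t. (\<integral>r. ?f (t, r) \<partial>lborel) \<partial>lborel)"
    by (rule integral_cong_AE[OF sm _ ae_eq]) measurable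
  also have "\<dots> = (\<integral>r. (\<integral>t. ?f (t, r) \<partial>lborel) \<partial>lborel)"
    by (rule lborel_pair.Fubini_integral[symmetric]) (use int in simp)
  finally show "(\<integral>t. slice w (\<lambda>x. \<integral>r. frac_kernel \<beta> (S - t - r) * F (r, x) \<partial>lborel) t \<partial>lborel) =
      (\<integral>r. (\<integral>t. frac_kernel \<beta> (S - r - t) * slice w (\<lambda>x. F (r, x)) t \<partial>lborel) \<partial>lborel)"
    by (simp add: swap)
qed

text \<open>The increment of the test function over dr is the function F(r, .) of space alone,
  switched on at time r. After Fubini's theorem it sees the equation with final time S - r, which
  \<open>heat_eq\<close> provides for every real value of the final time. The terms with M add up to
  the fractional integral of the test function at the origin.\<close>

lemma fractional_heat_time_dependent:
  fixes w F G :: "real \<times> 'a::euclidean_space \<Rightarrow> real"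
  assumes w: "L1_slices C w" and \<alpha>: "0 < \<alpha>" "\<alpha> < 1"
    and heat_eq: "\<And>S \<psi> L. C2_bounded B \<psi> L \<Longrightarrow>
      (\<integral>t. frac_kernel (1 - \<alpha>) (S - t) * slice w \<psi> t \<partial>lborel) =
      (\<integral>t. frac_kernel 1 (S - t) * slice w L t \<partial>lborel) + M * \<psi> 0 * frac_kernel (2 - \<alpha>) S"
    and f: "C2_bounded B f L"
    and F: "F \<in> borel_measurable borel" "\<And>r x. \<bar>F (r, x)\<bar> \<le> B * indicator {0<..} r"
    and G: "G \<in> borel_measurable borel" "\<And>r x. \<bar>G (r, x)\<bar> \<le> B * indicator {0<..} r"
    and FG: "\<And>r. C2_bounded B (\<lambda>x. F (r, x)) (\<lambda>x. G (r, x))"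
  shows "(\<integral>t. slice w (\<lambda>x. f x * frac_kernel (1 - \<alpha>) (S - t) + (\<integral>r. frac_kernel (1 - \<alpha>) (S - t - r) * F (r, x) \<partial>lborel)) t \<partial>lborel) =
    (\<integral>t. slice w (\<lambda>x. L x * frac_kernel 1 (S - t) + (\<integral>r. frac_kernel 1 (S - t - r) * G (r, x) \<partial>lborel)) t \<partial>lborel) +
    M * (f 0 * frac_kernel (2 - \<alpha>) S + (\<integral>r. frac_kernel (2 - \<alpha>) (S - r) * F (r, 0) \<partial>lborel))"
proof -
  have wm [measurable]: "w \<in> borel_measurable borel" and C: "C \<ge> 0"
    and ae: "AE t in lborel. integrable lborel (\<lambda>x. w (t, x)) \<and> (\<integral>x. \<bar>w (t, x)\<bar> \<partial>lborel) \<le> C * indicator {0<..} t"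
    using w unfolding L1_slices_def by blast+
  have fm: "f \<in> borel_measurable borel" "L \<in> borel_measurable borel"
    using C2_boundedD(1,3)[OF f] by (auto intro: borel_measurable_continuous_onI)
  have split: "(\<integral>t. slice w (\<lambda>x. h x * frac_kernel \<beta> (S - t) + (\<integral>r. frac_kernel \<beta> (S - t - r) * H (r, x) \<partial>lborel)) t \<partial>lborel) =
      (\<integral>t. frac_kernel \<beta> (S - t) * slice w h t \<partial>lborel) +
      (\<integral>r. (\<integral>t. frac_kernel \<beta> (S - r - t) * slice w (\<lambda>x. H (r, x)) t \<partial>lborel) \<partial>lborel)"
    if \<beta>: "\<beta> > 0" and h [measurable]: "h \<in> borel_measurable borel" and hb: "\<And>x. \<bar>h x\<bar> \<le> B"
      and H [measurable]: "H \<in> borel_measurable borel" and Hb: "\<And>r x. \<bar>H (r, x)\<bar> \<le> B * indicator {0<..} r" for h H \<beta>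
  proof -
    have [measurable]: "w \<in> borel_measurable (borel \<Otimes>\<^sub>M borel)" "H \<in> borel_measurable (borel \<Otimes>\<^sub>M borel)"
      by (simp_all add: borel_prod)
    note I = integral_slice_convolution[OF w H Hb \<beta>, where S = S]
    have "AE t in lborel. \<bar>slice w h t\<bar> \<le> C * B * indicator {0<..} t"
      using slice_bound[OF w h hb] by (auto elim: eventually_mono)
    then have i1: "integrable lborel (\<lambda>t. frac_kernel \<beta> (S - t) * slice w h t)"
      by (intro frac_kernel_bounded_integrable[OF \<beta>] slice_measurable wm h)
    have "AE t in lborel. slice w (\<lambda>x. h x * frac_kernel \<beta> (S - t) + (\<integral>r. frac_kernel \<beta> (S - t - r) * H (r, x) \<partial>lborel)) t =
        frac_kernel \<beta> (S - t) * slice w h t + slice w (\<lambda>x. \<integral>r. frac_kernel \<beta> (S - t - r) * H (r, x) \<partial>lborel) t"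
      using ae
    proof eventually_elim
      case (elim t)
      have "slice w (\<lambda>x. h x * frac_kernel \<beta> (S - t) + (\<integral>r. frac_kernel \<beta> (S - t - r) * H (r, x) \<partial>lborel)) t =
          (\<integral>x. frac_kernel \<beta> (S - t) * (w (t, x) * h x) + w (t, x) * (\<integral>r. frac_kernel \<beta> (S - t - r) * H (r, x) \<partial>lborel) \<partial>lborel)"
        unfolding slice_def by (intro Bochner_Integration.integral_cong) (simp_all add: algebra_simps)
      also have "\<dots> = (\<integral>x. frac_kernel \<beta> (S - t) * (w (t, x) * h x) \<partial>lborel) +
          (\<integral>x. w (t, x) * (\<integral>r. frac_kernel \<beta> (S - t - r) * H (r, x) \<partial>lborel) \<partial>lborel)"
        using elim by (intro Bochner_Integration.integral_add integrable_mult_right slice_abs_le(1)[OF _ h hb] slice_convolution(1)[OF _ wm H Hb \<beta>]) auto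
      finally show ?case by (simp add: slice_def)
    qed
    then have "(\<integral>t. slice w (\<lambda>x. h x * frac_kernel \<beta> (S - t) + (\<integral>r. frac_kernel \<beta> (S - t - r) * H (r, x) \<partial>lborel)) t \<partial>lborel) =
        (\<integral>t. frac_kernel \<beta> (S - t) * slice w h t + slice w (\<lambda>x. \<integral>r. frac_kernel \<beta> (S - t - r) * H (r, x) \<partial>lborel) t \<partial>lborel)"
      by (intro integral_cong_AE) (unfold slice_def, measurable)
    also have "\<dots> = (\<integral>t. frac_kernel \<beta> (S - t) * slice w h t \<partial>lborel) +
        (\<integral>t. slice w (\<lambda>x. \<integral>r. frac_kernel \<beta> (S - t - r) * H (r, x) \<partial>lborel) t \<partial>lborel)"
      by (rule Bochner_Integration.integral_add[OF i1 I(1)])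
    finally show ?thesis by (simp only: I(3))
  qed
  have F0: "\<bar>F (r, 0)\<bar> \<le> B * indicator {0<..} r" for r by (rule F(2))
  have [measurable]: "F \<in> borel_measurable (borel \<Otimes>\<^sub>M borel)" using F(1) by (simp add: borel_prod)
  have "integrable lborel (\<lambda>r. frac_kernel (2 - \<alpha>) (S - r) * F (r, 0))"
    using \<alpha> F0 by (intro frac_kernel_bounded_integrable AE_I2) (simp, measurable)
  then have i0: "integrable lborel (\<lambda>r. M * (frac_kernel (2 - \<alpha>) (S - r) * F (r, 0)))"
    by (rule integrable_mult_right)
  have "(\<integral>r. (\<integral>t. frac_kernel (1 - \<alpha>) (S - r - t) * slice w (\<lambda>x. F (r, x)) t \<partial>lborel) \<partial>lborel) =
    (\<integral>r. (\<integral>t. frac_kernel 1 (S - r - t) * slice w (\<lambda>x. G (r, x)) t \<partial>lborel) + M * (frac_kernel (2 - \<alpha>) (S - r) * F (r, 0)) \<partial>lborel)"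
    by (intro Bochner_Integration.integral_cong refl) (subst heat_eq[OF FG], simp add: mult_ac)
  also have "\<dots> = (\<integral>r. (\<integral>t. frac_kernel 1 (S - r - t) * slice w (\<lambda>x. G (r, x)) t \<partial>lborel) \<partial>lborel) +
      (\<integral>r. M * (frac_kernel (2 - \<alpha>) (S - r) * F (r, 0)) \<partial>lborel)"
    by (rule Bochner_Integration.integral_add[OF integral_slice_convolution(2)[OF w G zero_less_one] i0])
  finally have e1: "(\<integral>r. (\<integral>t. frac_kernel (1 - \<alpha>) (S - r - t) * slice w (\<lambda>x. F (r, x)) t \<partial>lborel) \<partial>lborel) =
      (\<integral>r. (\<integral>t. frac_kernel 1 (S - r - t) * slice w (\<lambda>x. G (r, x)) t \<partial>lborel) \<partial>lborel) +
      M * (\<integral>r. frac_kernel (2 - \<alpha>) (S - r) * F (r, 0) \<partial>lborel)"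
    by simp
  have a: "1 - \<alpha> > 0" using \<alpha> by simp
  show ?thesis
    unfolding split[OF a fm(1) C2_boundedD(2)[OF f] F] split[OF zero_less_one fm(2) C2_boundedD(4)[OF f] G] e1 heat_eq[OF f]
    by (simp add: algebra_simps)
qed

text \<open>At r = 0 the true object is the point mass at the origin; the value 0 for r \<le> 0 is a
  default, met only on a null set by \<open>no_atom_at_0\<close>.\<close>

definition heat_kernel :: "real \<Rightarrow> 'a::euclidean_space \<Rightarrow> real" where
  "heat_kernel r x = (if r > 0 then gauss (x /\<^sub>R sqrt r) / sqrt r ^ DIM('a) else 0)"

lemma heat_kernel_nonneg: "heat_kernel r x \<ge> 0"
  by (simp add: heat_kernel_def gauss_nonneg)

lemma heat_kernel_measurable [measurable]:
  assumes [measurable]: "f \<in> borel_measurable N" "g \<in> borel_measurable N"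
  shows "(\<lambda>x. heat_kernel (f x) (g x :: 'a::euclidean_space)) \<in> borel_measurable N"
  unfolding heat_kernel_def by measurable

lemma has_bochner_integral_heat_kernel:
  fixes \<psi> :: "'a::euclidean_space \<Rightarrow> real"
  assumes r: "r > 0" and [measurable]: "\<psi> \<in> borel_measurable borel" and bd: "\<And>x. \<bar>\<psi> x\<bar> \<le> B"
  shows "has_bochner_integral lborel (\<lambda>x. heat_kernel r x * \<psi> x) (heat \<psi> r)"
proof -
  let ?q = "sqrt r"
  have q: "?q > 0" using r by simp
  have "has_bochner_integral lborel (\<lambda>z. gauss z * \<psi> (?q *\<^sub>R z)) (heat \<psi> r)"
    unfolding heat_def by (intro has_bochner_integral_integrable gauss_mult_integrable[of \<psi> B] assms)
  moreover have "gauss z * \<psi> (?q *\<^sub>R z) = \<bar>?q\<bar> ^ DIM('a) *\<^sub>R (heat_kernel r (0 + ?q *\<^sub>R z) * \<psi> (0 + ?q *\<^sub>R z))" for z :: 'a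
    using q r by (simp add: heat_kernel_def field_simps del: real_sqrt_abs2)
  ultimately have "has_bochner_integral lborel (\<lambda>z. \<bar>?q\<bar> ^ DIM('a) *\<^sub>R (heat_kernel r (0 + ?q *\<^sub>R z) * \<psi> (0 + ?q *\<^sub>R z))) (heat \<psi> r)"
    by (simp only:)
  then have "has_bochner_integral (density (distr lborel borel (\<lambda>z::'a. 0 + ?q *\<^sub>R z)) (\<lambda>_. ennreal (\<bar>?q\<bar> ^ DIM('a))))
      (\<lambda>x. heat_kernel r x * \<psi> x) (heat \<psi> r)"
    by (intro has_bochner_integral_density has_bochner_integral_distr) simp_all
  then show ?thesis
    using lborel_affine[of ?q "0::'a"] q by simp
qed

section \<open>The subordinated heat kernel\<close>

context Mittag_Leffler begin

definition subordinated :: "real \<Rightarrow> real \<times> 'a::euclidean_space \<Rightarrow> real" where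
  "subordinated M p = indicator {0<..} (fst p) * (M * (\<integral>s. heat_kernel (fst p powr \<alpha> * s) (snd p) \<partial>\<mu>))"

lemma subordinated_measurable [measurable]: "subordinated M \<in> borel_measurable (borel :: (real \<times> 'a::euclidean_space) measure)"
proof -
  have [measurable_cong]: "sets \<mu> = sets borel" by simp
  show ?thesis
    unfolding subordinated_def[abs_def] borel_prod[symmetric] by measurable
qed

lemma subordinated_nonneg: "M \<ge> 0 \<Longrightarrow> subordinated M p \<ge> 0"
  by (simp add: subordinated_def heat_kernel_nonneg)

text \<open>Fubini's theorem for s and x. The total mass of each heat kernel is 1, so the bound B of
  \<psi> dominates the inner integrals uniformly in s. Where the integral over s fails to exist for
  single x its value is 0 by convention; such x form a null set.\<close>

lemma has_bochner_integral_subordinated: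
  fixes \<psi> :: "'a::euclidean_space \<Rightarrow> real"
  assumes t: "t > 0" and [measurable]: "\<psi> \<in> borel_measurable borel" and bd: "\<And>x. \<bar>\<psi> x\<bar> \<le> B"
  shows "has_bochner_integral lborel (\<lambda>x. subordinated M (t, x) * \<psi> x) (M * (\<integral>s. heat \<psi> (t powr \<alpha> * s) \<partial>\<mu>))"
proof -
  interpret X: pair_sigma_finite \<mu> "lborel :: 'a measure"
    by (simp add: pair_sigma_finite_def sigma_finite_real_distribution[OF rd] sigma_finite_lborel)
  have sm [measurable_cong]: "sets \<mu> = sets borel" by simp
  have pos: "AE s in \<mu>. t powr \<alpha> * s > 0" using no_atom_at_0 t by (auto elim: eventually_mono)
  let ?f = "\<lambda>(s, x). heat_kernel (t powr \<alpha> * s) x * \<psi> x"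
  have fm [measurable]: "?f \<in> borel_measurable (\<mu> \<Otimes>\<^sub>M lborel)" by measurable
  have nrm: "AE s in \<mu>. (\<integral>x. norm (?f (s, x)) \<partial>lborel) \<le> B"
    using pos
  proof eventually_elim
    case (elim s)
    have "has_bochner_integral lborel (\<lambda>x. heat_kernel (t powr \<alpha> * s) x * \<bar>\<psi> x\<bar>) (heat (\<lambda>x. \<bar>\<psi> x\<bar>) (t powr \<alpha> * s))"
      by (rule has_bochner_integral_heat_kernel[OF elim, of _ B]) (use bd in auto)
    then have "(\<integral>x. norm (?f (s, x)) \<partial>lborel) = heat (\<lambda>x. \<bar>\<psi> x\<bar>) (t powr \<alpha> * s)"
      by (simp add: abs_mult heat_kernel_nonneg has_bochner_integral_integral_eq)
    also have "\<dots> \<le> \<bar>heat (\<lambda>x. \<bar>\<psi> x\<bar>) (t powr \<alpha> * s)\<bar>" by simp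
    also have "\<dots> \<le> B" by (rule heat_bounded) (use bd in auto)
    finally show ?case .
  qed
  have int: "integrable (\<mu> \<Otimes>\<^sub>M lborel) ?f"
  proof (rule X.Fubini_integrable[OF fm])
    show "integrable \<mu> (\<lambda>s. \<integral>x. norm (?f (s, x)) \<partial>lborel)"
      by (rule \<mu>.integrable_const_bound[where B = B]) (use nrm in auto)
    show "AE s in \<mu>. integrable lborel (\<lambda>x. ?f (s, x))"
      using pos by eventually_elim
        (use has_bochner_integral_heat_kernel[of _ \<psi> B] bd in \<open>auto simp: has_bochner_integral_iff\<close>)
  qed
  have eq: "subordinated M (t, x) * \<psi> x = M * (\<integral>s. ?f (s, x) \<partial>\<mu>)" for x
    using t by (simp add: subordinated_def)
  have "(\<integral>x. (\<integral>s. ?f (s, x) \<partial>\<mu>) \<partial>lborel) = (\<integral>s. (\<integral>x. ?f (s, x) \<partial>lborel) \<partial>\<mu>)"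
    by (rule X.Fubini_integral) (use int in simp)
  also have "\<dots> = (\<integral>s. heat \<psi> (t powr \<alpha> * s) \<partial>\<mu>)"
  proof (rule integral_cong_AE)
    show "(\<lambda>s. heat \<psi> (t powr \<alpha> * s)) \<in> borel_measurable \<mu>"
      unfolding heat_def by measurable
    show "AE s in \<mu>. (\<integral>x. ?f (s, x) \<partial>lborel) = heat \<psi> (t powr \<alpha> * s)"
      using pos by eventually_elim
        (use has_bochner_integral_heat_kernel[of _ \<psi> B] bd in \<open>auto simp: has_bochner_integral_iff\<close>)
  qed simp
  finally have "has_bochner_integral lborel (\<lambda>x. \<integral>s. ?f (s, x) \<partial>\<mu>) (\<integral>s. heat \<psi> (t powr \<alpha> * s) \<partial>\<mu>)"
    using X.integrable_snd[OF int] by (simp add: has_bochner_integral_iff)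
  then show ?thesis unfolding eq by (rule has_bochner_integral_mult_right)
qed

lemma slice_subordinated:
  fixes \<psi> :: "'a::euclidean_space \<Rightarrow> real"
  assumes "\<psi> \<in> borel_measurable borel" and "\<And>x. \<bar>\<psi> x\<bar> \<le> B"
  shows "slice (subordinated M) \<psi> t = indicator {0<..} t * (M * (\<integral>s. heat \<psi> (t powr \<alpha> * s) \<partial>\<mu>))"
proof (cases "t > 0")
  case True
  then show ?thesis
    using has_bochner_integral_subordinated[OF True assms, of M]
    by (simp add: slice_def has_bochner_integral_iff)
qed (simp add: slice_def subordinated_def)

lemma L1_slices_subordinated:
  assumes M: "M \<ge> 0"
  shows "L1_slices M (subordinated M :: real \<times> 'a::euclidean_space \<Rightarrow> real)"
proof -
  have "integrable lborel (\<lambda>x. subordinated M (t, x :: 'a)) \<and> (\<integral>x. \<bar>subordinated M (t, x :: 'a)\<bar> \<partial>lborel) \<le> M * indicator {0<..} t" for t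
  proof (cases "t > 0")
    case True
    have "has_bochner_integral lborel (\<lambda>x. subordinated M (t, x :: 'a) * 1) (M * (\<integral>s. heat (\<lambda>_::'a. 1) (t powr \<alpha> * s) \<partial>\<mu>))"
      by (rule has_bochner_integral_subordinated[OF True, of _ 1]) auto
    moreover have "heat (\<lambda>_::'a. 1) x = 1" for x by (simp add: heat_def gauss_integral)
    ultimately show ?thesis
      using True by (simp add: abs_of_nonneg[OF subordinated_nonneg[OF M]] has_bochner_integral_iff \<mu>.prob_space[unfolded \<mu>.space_eq_univ])
  qed (simp add: subordinated_def)
  then show ?thesis using M by (auto simp: L1_slices_def)
qed

text \<open>This is \<open>mixture_FTC\<close> for g = \<open>heat \<psi>\<close> and g' =
  \<open>heat L\<close>, multiplied by M. Final times S \<le> 0, where both sides vanish, are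
  included because the superposition in time uses S - r for all r.\<close>

lemma slice_subordinated_fractional_heat:
  fixes \<psi> L :: "'a::euclidean_space \<Rightarrow> real"
  assumes C2: "C2_bounded B \<psi> L"
  shows "(\<integral>t. frac_kernel (1 - \<alpha>) (S - t) * slice (subordinated M) \<psi> t \<partial>lborel) =
    (\<integral>t. frac_kernel 1 (S - t) * slice (subordinated M) L t \<partial>lborel) + M * \<psi> 0 * frac_kernel (2 - \<alpha>) S"
proof (cases "S > 0")
  case True
  note c\<psi> = C2_boundedD(1)[OF C2] and b\<psi> = C2_boundedD(2)[OF C2] and cL = C2_boundedD(3)[OF C2] and bL = C2_boundedD(4)[OF C2]
  have m: "\<psi> \<in> borel_measurable borel" "L \<in> borel_measurable borel"
    using c\<psi> cL by (auto intro: borel_measurable_continuous_onI)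
  have "heat \<psi> \<in> borel_measurable borel" "heat L \<in> borel_measurable borel"
    using heat_continuous[OF c\<psi> b\<psi>] heat_continuous[OF cL bL] by (auto intro: borel_measurable_continuous_onI)
  then have "(\<integral>t. weight (1 - \<alpha>) S t * (\<integral>s. heat \<psi> (t powr \<alpha> * s) \<partial>\<mu>) \<partial>lborel) =
    (\<integral>t. weight 1 S t * (\<integral>s. heat L (t powr \<alpha> * s) \<partial>\<mu>) \<partial>lborel) + heat \<psi> 0 * frac_kernel (2 - \<alpha>) S"
    by (intro mixture_FTC[OF True, where C = B] heat_bounded m b\<psi> bL)
      (simp_all add: heat_0 heat_FTC[OF C2])
  then have "M * (\<integral>t. weight (1 - \<alpha>) S t * (\<integral>s. heat \<psi> (t powr \<alpha> * s) \<partial>\<mu>) \<partial>lborel) =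
    M * (\<integral>t. weight 1 S t * (\<integral>s. heat L (t powr \<alpha> * s) \<partial>\<mu>) \<partial>lborel) + M * \<psi> 0 * frac_kernel (2 - \<alpha>) S"
    by (simp add: heat_0 algebra_simps)
  moreover have "frac_kernel \<beta> (S - t) * (indicator {0<..} t * (M * I)) = M * (weight \<beta> S t * I)" for \<beta> t I
    by (simp add: weight_def)
  ultimately show ?thesis
    by (simp only: slice_subordinated[OF m(1) b\<psi>] slice_subordinated[OF m(2) bL] Bochner_Integration.integral_mult_right_zero)
next
  case False
  have z: "frac_kernel \<beta> (S - t) * slice (subordinated M) g t = 0" for \<beta> t and g :: "'a \<Rightarrow> real"
    using False by (cases "t > 0") (simp_all add: frac_kernel_def slice_def subordinated_def)
  have "frac_kernel (2 - \<alpha>) S = 0" using False by (simp add: frac_kernel_def)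
  then show ?thesis by (simp only: z Bochner_Integration.integral_zero mult_zero_right add_0_right)
qed

end

section \<open>Passage to test functions that depend on time\<close>

lemma integral_eq_frac_kernel_1:
  fixes h :: "real \<Rightarrow> real"
  assumes h: "continuous_on {0..T} h" and s: "0 \<le> s" "s \<le> T"
  shows "integral (cbox 0 s) h = (\<integral>r. frac_kernel 1 (s - r) * (indicator {0<..} r * h (max 0 (min T r))) \<partial>lborel)"
proof -
  \<comment> \<open>Nothing is known about h outside [0,T]; clamping the argument gives a function
    that is continuous on the whole line.\<close>
  have "continuous_on UNIV (\<lambda>r. h (max 0 (min T r)))"
    by (rule continuous_on_compose2[OF h]) (use s in \<open>auto intro!: continuous_intros\<close>)
  then have [measurable]: "(\<lambda>r. h (max 0 (min T r))) \<in> borel_measurable borel" by (rule borel_measurable_continuous_onI)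
  have "set_integrable lborel {0..s} h"
    by (rule borel_integrable_atLeastAtMost') (use h s continuous_on_subset in fastforce)
  then have "integral (cbox 0 s) h = (\<integral>r. indicator {0..s} r *\<^sub>R h r \<partial>lborel)"
    using set_borel_integral_eq_integral(2)[of "{0..s}" h] by (simp add: set_lebesgue_integral_def)
  also have "\<dots> = (\<integral>r. indicator {0..s} r *\<^sub>R h (max 0 (min T r)) \<partial>lborel)"
    using s by (intro Bochner_Integration.integral_cong) (auto simp: indicator_def)
  also have "\<dots> = (\<integral>r. frac_kernel 1 (s - r) * (indicator {0<..} r * h (max 0 (min T r))) \<partial>lborel)"
  proof (rule integral_cong_AE)
    show "AE r in lborel. indicator {0..s} r *\<^sub>R h (max 0 (min T r)) = frac_kernel 1 (s - r) * (indicator {0<..} r * h (max 0 (min T r)))"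
      using AE_lborel_singleton[of 0] AE_lborel_singleton[of s]
      by eventually_elim (auto simp: frac_kernel_1 indicator_def)
  qed measurable
  finally show ?thesis .
qed

lemma slab_smooth_C2_bounded:
  fixes G :: "real \<times> 'a::euclidean_space \<Rightarrow> real"
  assumes G: "slab_smooth T Z G"
  obtains B where "\<And>s b. s \<in> {0..T} \<Longrightarrow> b \<ge> B \<Longrightarrow> C2_bounded b (\<lambda>x. G (s, x)) (\<lambda>x. slab_laplacian T G (s, x))"
proof -
  have "\<exists>B. \<forall>e. \<forall>p\<in>{0..T} \<times> UNIV. e \<in> A \<longrightarrow> \<bar>H e p\<bar> \<le> B"
    if "finite A" and "\<And>e. e \<in> A \<Longrightarrow> slab_smooth T Z (H e)" for A :: "'a set" and H :: "'a \<Rightarrow> real \<times> 'a \<Rightarrow> real"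
    using that
  proof (induction A rule: finite_induct)
    case (insert a A)
    then obtain B where B: "\<forall>e. \<forall>p\<in>{0..T} \<times> UNIV. e \<in> A \<longrightarrow> \<bar>H e p\<bar> \<le> B" by auto
    obtain B' where B': "\<forall>p\<in>{0..T} \<times> UNIV. \<bar>H a p\<bar> \<le> B'"
      using slab_smooth_bounded[of T Z "H a"] insert.prems by auto
    show ?case
      using B B' by (intro exI[of _ "max B B'"]) (auto simp: le_max_iff_disj)
  qed auto
  note bounded_family = this[OF finite_Basis]
  note G1 = slab_smooth_deriv[OF G] and G2 = slab_smooth_deriv[OF slab_smooth_deriv[OF G]]
  obtain B0 where B0: "\<And>p. p \<in> {0..T} \<times> UNIV \<Longrightarrow> \<bar>G p\<bar> \<le> B0" using slab_smooth_bounded[OF G] by blast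
  obtain B1 where B1: "\<And>e p. e \<in> Basis \<Longrightarrow> p \<in> {0..T} \<times> UNIV \<Longrightarrow> \<bar>slab_deriv T (0, e) G p\<bar> \<le> B1"
    using bounded_family[OF G1, of "\<lambda>e. (0, e)"] by blast
  obtain B2 where B2: "\<And>e p. e \<in> Basis \<Longrightarrow> p \<in> {0..T} \<times> UNIV \<Longrightarrow> \<bar>slab_deriv T (0, e) (slab_deriv T (0, e) G) p\<bar> \<le> B2"
    using bounded_family[OF G2, of "\<lambda>e. (0, e)" "\<lambda>e. (0, e)"] by blast
  have B3: "\<bar>slab_laplacian T G p\<bar> \<le> real DIM('a) * B2" if "p \<in> {0..T} \<times> UNIV" for p
    unfolding slab_laplacian_def
    by (rule order_trans[OF sum_abs]) (rule sum_bounded_above, rule B2[OF _ that])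
  have cont: "continuous_on UNIV (\<lambda>x. H (s, x))" if "slab_smooth T Z H" "s \<in> {0..T}" for H :: "real \<times> 'a \<Rightarrow> real" and s
    by (rule continuous_on_compose2[OF slab_smooth_continuous[OF that(1)]]) (use that(2) in \<open>auto intro!: continuous_intros\<close>)
  show thesis
  proof (rule that[of "max (max B0 B1) (max B2 (real DIM('a) * B2))"])
    fix s b assume s: "s \<in> {0..T}" and b: "b \<ge> max (max B0 B1) (max B2 (real DIM('a) * B2))"
    then have p: "(s, x) \<in> {0..T} \<times> UNIV" for x :: 'a by simp
    show "C2_bounded b (\<lambda>x. G (s, x)) (\<lambda>x. slab_laplacian T G (s, x))"
    proof (rule C2_boundedI[where \<psi>' = "\<lambda>e x. slab_deriv T (0, e) G (s, x)"
          and \<psi>'' = "\<lambda>e x. slab_deriv T (0, e) (slab_deriv T (0, e) G) (s, x)"])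
      fix x e :: 'a assume e: "e \<in> Basis"
      show "((\<lambda>h. slab_deriv T (0, e) G (s, x + h *\<^sub>R e)) has_real_derivative slab_deriv T (0, e) (slab_deriv T (0, e) G) (s, x)) (at 0)"
        using slab_smooth_line_derivative[OF G1[of "(0, e)"] s e, of x 0] by simp
      show "\<bar>slab_deriv T (0, e) G (s, x)\<bar> \<le> b" "\<bar>slab_deriv T (0, e) (slab_deriv T (0, e) G) (s, x)\<bar> \<le> b"
        using B1[OF e p, of x] B2[OF e p, of x] b by auto
    next
      fix x :: 'a
      show "\<bar>G (s, x)\<bar> \<le> b" "\<bar>slab_laplacian T G (s, x)\<bar> \<le> b"
        using B0[OF p, of x] B3[OF p, of x] b by auto
    qed (auto intro!: cont G G1 G2 s slab_smooth_space_derivative[OF G s] simp: slab_laplacian_def)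
  qed
qed

lemma weak_solution_if_fractional_heat:
  fixes w :: "real \<times> 'a::euclidean_space \<Rightarrow> real"
  assumes w: "L1_slices C w" and w0: "\<And>t x. t \<le> 0 \<Longrightarrow> w (t, x) = 0" and \<alpha>: "0 < \<alpha>" "\<alpha> < 1"
    and heat_eq: "\<And>B S \<psi> L. C2_bounded B \<psi> L \<Longrightarrow>
      (\<integral>t. frac_kernel (1 - \<alpha>) (S - t) * slice w \<psi> t \<partial>lborel) =
      (\<integral>t. frac_kernel 1 (S - t) * slice w L t \<partial>lborel) + M * \<psi> 0 * frac_kernel (2 - \<alpha>) S"
  shows "weak_solution \<alpha> M (\<lambda>t x. w (t, x))"
  unfolding weak_solution_def
proof (intro conjI allI impI)
  have wm [measurable]: "w \<in> borel_measurable borel" and C: "C \<ge> 0"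
    and ae: "AE t in lborel. integrable lborel (\<lambda>x. w (t, x)) \<and> (\<integral>x. \<bar>w (t, x)\<bar> \<partial>lborel) \<le> C * indicator {0<..} t"
    using w unfolding L1_slices_def by blast+
  have [measurable]: "w \<in> borel_measurable (borel \<Otimes>\<^sub>M borel)" by (simp add: borel_prod)
  have wt [measurable]: "(\<lambda>x. w (t, x)) \<in> borel_measurable borel" for t by measurable
  fix T :: real assume T: "T > 0"
  show "Linf_L1 T (\<lambda>t x. w (t, x))"
    unfolding Linf_L1_def
  proof (intro conjI exI[of _ C])
    show "(\<lambda>(t, x). w (t, x)) \<in> borel_measurable (lebesgue_on ({0<..<T} \<times> UNIV))"
      using wm by (intro measurable_restrict_space1 measurable_completion) simp
    have "AE t in lborel. 0 < t \<and> t < T \<longrightarrow> integrable lebesgue (\<lambda>x. w (t, x)) \<and> (LINT x|lebesgue. \<bar>w (t, x)\<bar>) \<le> C"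
      using ae
    proof eventually_elim
      case (elim t)
      have "integrable lebesgue (\<lambda>x. w (t, x)) \<longleftrightarrow> integrable lborel (\<lambda>x. w (t, x))"
        by (rule lebesgue_integral_AE_borel(2)[OF wt]) simp
      moreover have "(LINT x|lebesgue. \<bar>w (t, x)\<bar>) = (\<integral>x. \<bar>w (t, x)\<bar> \<partial>lborel)"
        by (rule lebesgue_integral_AE_borel(1)) auto
      ultimately show ?case using elim by auto
    qed
    then show "AE t in lebesgue. 0 < t \<and> t < T \<longrightarrow> integrable lebesgue (\<lambda>x. w (t, x)) \<and> (LINT x|lebesgue. \<bar>w (t, x)\<bar>) \<le> C"
      by (rule AE_completion)
  qed
  fix \<phi> :: "real \<Rightarrow> 'a \<Rightarrow> real" assume \<phi>: "test_function T \<phi>"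
  define \<Phi> where "\<Phi> = (\<lambda>(t, x). \<phi> t x)"
  obtain Z where Z: "slab_smooth T Z \<Phi>"
    unfolding \<Phi>_def by (rule test_function_slab_smooth[OF T \<phi>])
  let ?H = "slab_deriv T (1, 0) \<Phi>"
  note H = slab_smooth_deriv[OF Z, of "(1, 0)"]
  obtain B1 where B1: "\<And>s b. s \<in> {0..T} \<Longrightarrow> b \<ge> B1 \<Longrightarrow> C2_bounded b (\<lambda>x. \<Phi> (s, x)) (\<lambda>x. slab_laplacian T \<Phi> (s, x))"
    by (rule slab_smooth_C2_bounded[OF Z]) (rule that)
  obtain B2 where B2: "\<And>s b. s \<in> {0..T} \<Longrightarrow> b \<ge> B2 \<Longrightarrow> C2_bounded b (\<lambda>x. ?H (s, x)) (\<lambda>x. slab_laplacian T ?H (s, x))"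
    by (rule slab_smooth_C2_bounded[OF H]) (rule that)
  define B where "B = max B1 (max B2 0)"
  define cl where "cl = (\<lambda>r. max 0 (min T r))"
  have cl: "cl r \<in> {0..T}" for r using T by (simp add: cl_def)
  have cl_id: "cl r = r" if "r \<in> {0..T}" for r using that by (simp add: cl_def)
  have ccl: "continuous_on UNIV (\<lambda>p :: real \<times> 'a. E (cl (fst p), snd p))"
    if "continuous_on ({0..T} \<times> UNIV) E" for E :: "real \<times> 'a \<Rightarrow> real"
    by (rule continuous_on_compose2[OF that]) (use T in \<open>auto simp: cl_def intro!: continuous_intros\<close>)
  \<comment> \<open>F is the time derivative of the test function and G the Laplacian of F, both
    clamped to [0,T] and set to 0 for r \<le> 0. The clamp keeps them bounded for all positive
    times, as the convolution lemmas require.\<close>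
  define F where "F = (\<lambda>p. indicator {0<..} (fst p) * ?H (cl (fst p), snd p))"
  define G where "G = (\<lambda>p. indicator {0<..} (fst p) * slab_laplacian T ?H (cl (fst p), snd p))"
  have FGm: "F \<in> borel_measurable borel" "G \<in> borel_measurable borel"
    unfolding F_def G_def
    using borel_measurable_continuous_onI[OF ccl[OF slab_smooth_continuous[OF H]]]
      borel_measurable_continuous_onI[OF ccl[OF slab_laplacian_continuous[OF H]]]
    by measurable
  have B: "C2_bounded B (\<lambda>x. \<Phi> (0, x)) (\<lambda>x. slab_laplacian T \<Phi> (0, x))"
    "\<And>r. C2_bounded B (\<lambda>x. ?H (cl r, x)) (\<lambda>x. slab_laplacian T ?H (cl r, x))" and B0: "B \<ge> 0"
    using T by (auto simp: B_def intro!: B1 B2[OF cl])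
  have FGb: "\<bar>F (r, x)\<bar> \<le> B * indicator {0<..} r" "\<bar>G (r, x)\<bar> \<le> B * indicator {0<..} r" for r x
    using C2_boundedD(2,4)[OF B(2), of r x] by (auto simp: F_def G_def indicator_def)
  have FG: "C2_bounded B (\<lambda>x. F (r, x)) (\<lambda>x. G (r, x))" for r
    using B(2)[of r] C2_bounded_zero[OF B0] by (cases "r > 0") (simp_all add: F_def G_def)
  let ?R = "\<lambda>t x. \<Phi> (0, x) * frac_kernel (1 - \<alpha>) (T - t) + (\<integral>r. frac_kernel (1 - \<alpha>) (T - t - r) * F (r, x) \<partial>lborel)"
  let ?L = "\<lambda>t x. slab_laplacian T \<Phi> (0, x) * frac_kernel 1 (T - t) + (\<integral>r. frac_kernel 1 (T - t - r) * G (r, x) \<partial>lborel)"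
  have slab_slice: "continuous_on {0..T} (\<lambda>r. E (r, x))" if "continuous_on ({0..T} \<times> UNIV) E" for E :: "real \<times> 'a \<Rightarrow> real" and x
    by (rule continuous_on_compose2[OF that]) (auto intro!: continuous_intros)
  have \<phi>_eq: "\<phi> s x = \<Phi> (0, x) + (\<integral>r. frac_kernel 1 (s - r) * F (r, x) \<partial>lborel)" if "0 < s" "s \<le> T" for s x
    using slab_smooth_time_integral[OF Z, of s x] that
      integral_eq_frac_kernel_1[OF slab_slice[OF slab_smooth_continuous[OF H]], of s x]
    by (simp add: F_def cl_def \<Phi>_def)
  have Fx: "(\<lambda>r. F (r, x)) \<in> borel_measurable borel" for x
  proof -
    have [measurable]: "F \<in> borel_measurable (borel \<Otimes>\<^sub>M borel)" using FGm(1) by (simp add: borel_prod)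
    show ?thesis by measurable
  qed
  have F_cont: "isCont (\<lambda>r. F (r, x)) r" if "0 < r" "r < T" for r x
  proof -
    have c: "continuous_on {0<..<T} (\<lambda>r. ?H (r, x))"
      by (rule continuous_on_subset[OF slab_slice[OF slab_smooth_continuous[OF H]]]) auto
    have "F (r, x) = ?H (r, x)" if "r \<in> {0<..<T}" for r
      using that by (simp add: F_def cl_def)
    then have "continuous_on {0<..<T} (\<lambda>r. F (r, x))"
      using c by (subst continuous_on_cong[OF refl]) auto
    then show ?thesis using that by (simp add: continuous_on_eq_continuous_at)
  qed
  note RL = RL_deriv_eq[OF \<alpha> Fx FGb(1) F_cont \<phi>_eq]
  have RL_eq: "RL_deriv \<alpha> (\<lambda>s. \<phi> s x) (T - t) = ?R t x" if "0 < t" "t < T" for t x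
    by (rule RL(2)) (use that in auto)
  have I_eq: "frac_integral (1 - \<alpha>) (\<lambda>s. \<phi> s 0) T = \<Phi> (0, 0) * frac_kernel (2 - \<alpha>) T + (\<integral>r. frac_kernel (2 - \<alpha>) (T - r) * F (r, 0) \<partial>lborel)"
    by (rule RL(1)) (use T in auto)
  have L_eq: "laplacian (\<phi> (T - t)) x = ?L t x" if "0 < t" "t < T" for t x
  proof -
    have "laplacian (\<phi> (T - t)) x = slab_laplacian T \<Phi> (T - t, x)"
      using slab_laplacian_eq[OF Z, of "T - t" x] that by (simp add: \<Phi>_def)
    also have "\<dots> = slab_laplacian T \<Phi> (0, x) + integral (cbox 0 (T - t)) (\<lambda>r. slab_laplacian T ?H (r, x))"
      by (rule slab_laplacian_time_integral[OF Z]) (use that in auto)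
    also have "\<dots> = ?L t x"
      using that integral_eq_frac_kernel_1[OF slab_slice[OF slab_laplacian_continuous[OF H]], of "T - t" x]
      by (simp add: G_def cl_def frac_kernel_1)
    finally show ?thesis .
  qed
  have to_slice: "(LINT t:{0<..<T}|lebesgue. LINT x|lebesgue. w (t, x) * E t x) =
      (\<integral>t. slice w (\<lambda>x. h x * frac_kernel \<beta> (T - t) + (\<integral>r. frac_kernel \<beta> (T - t - r) * A (r, x) \<partial>lborel)) t \<partial>lborel)"
    if E: "\<And>t x. 0 < t \<Longrightarrow> t < T \<Longrightarrow> E t x = h x * frac_kernel \<beta> (T - t) + (\<integral>r. frac_kernel \<beta> (T - t - r) * A (r, x) \<partial>lborel)"
      and h [measurable]: "h \<in> borel_measurable borel" and A: "A \<in> borel_measurable borel"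
      and Ab: "\<And>r x. \<bar>A (r, x)\<bar> \<le> B * indicator {0<..} r" for E h A \<beta>
  proof -
    have [measurable]: "A \<in> borel_measurable (borel \<Otimes>\<^sub>M borel)" using A by (simp add: borel_prod)
    let ?E = "\<lambda>t x. h x * frac_kernel \<beta> (T - t) + (\<integral>r. frac_kernel \<beta> (T - t - r) * A (r, x) \<partial>lborel)"
    have "indicator {0<..<T} t *\<^sub>R (LINT x|lebesgue. w (t, x) * E t x) = slice w (?E t) t" for t
    proof (cases "0 < t \<and> t < T")
      case True
      have "(LINT x|lebesgue. w (t, x) * E t x) = (\<integral>x. w (t, x) * ?E t x \<partial>lborel)"
        by (rule lebesgue_integral_AE_borel(1)) (measurable, use True E in auto)
      then show ?thesis using True by (simp add: slice_def)
    next
      case False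
      \<comment> \<open>The weak formulation integrates over (0,T) only. Extending to the whole line
        adds nothing: w vanishes for t \<le> 0, and for t \<ge> T the kernels vanish wherever A does
        not.\<close>
      have w0E: "w (t, x) * ?E t x = 0" for x
      proof (cases "t \<le> 0")
        case False
        with \<open>\<not> (0 < t \<and> t < T)\<close> have t: "T - t \<le> 0" by simp
        have A0: "frac_kernel \<beta> (T - t - r) * A (r, x) = 0" for r
          using t Ab[of r x] by (cases "r > 0") (simp_all add: frac_kernel_def)
        have "frac_kernel \<beta> (T - t) = 0" using t by (simp add: frac_kernel_def)
        then show ?thesis unfolding A0 by simp
      qed (simp add: w0)
      show ?thesis using False unfolding slice_def w0E by simp
    qed
    then show ?thesis
      unfolding set_lebesgue_integral_def
      by (intro lebesgue_integral_AE_borel(1) AE_I2) (unfold slice_def, measurable)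
  qed
  have m: "(\<lambda>x. \<Phi> (0, x)) \<in> borel_measurable borel" "(\<lambda>x. slab_laplacian T \<Phi> (0, x)) \<in> borel_measurable borel"
    using C2_boundedD(1,3)[OF B(1)] by (auto intro: borel_measurable_continuous_onI)
  have e1: "(LINT t:{0<..<T}|lebesgue. LINT x|lebesgue. w (t, x) * RL_deriv \<alpha> (\<lambda>s. \<phi> s x) (T - t)) = (\<integral>t. slice w (?R t) t \<partial>lborel)"
    by (rule to_slice[OF RL_eq m(1) FGm(1) FGb(1)])
  have e2: "(LINT t:{0<..<T}|lebesgue. LINT x|lebesgue. w (t, x) * laplacian (\<phi> (T - t)) x) = (\<integral>t. slice w (?L t) t \<partial>lborel)"
    by (rule to_slice[OF L_eq m(2) FGm(2) FGb(2)])
  show "(LINT t:{0<..<T}|lebesgue. LINT x|lebesgue. w (t, x) * RL_deriv \<alpha> (\<lambda>s. \<phi> s x) (T - t)) =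
      (LINT t:{0<..<T}|lebesgue. LINT x|lebesgue. w (t, x) * laplacian (\<phi> (T - t)) x) + M * frac_integral (1 - \<alpha>) (\<lambda>s. \<phi> s 0) T"
    unfolding I_eq e1 e2
    by (rule fractional_heat_time_dependent[OF w \<alpha> heat_eq B(1) FGm(1) FGb(1) FGm(2) FGb(2) FG])
qed

lemma weak_solution_exists:
  assumes \<alpha>: "0 < \<alpha>" "\<alpha> < 1" and M: "M \<ge> 0"
  shows "\<exists>u :: real \<Rightarrow> 'a::euclidean_space \<Rightarrow> real. weak_solution \<alpha> M u"
proof -
  obtain \<mu> where "real_distribution \<mu>" "AE x in \<mu>. 0 \<le> x" "\<And>k. integrable \<mu> (\<lambda>x. x ^ k)"
    "\<And>k. (\<integral>x. x ^ k \<partial>\<mu>) = fact k / Gamma (1 + \<alpha> * k)"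
    by (rule Mittag_Leffler_distribution_exists[OF \<alpha>]) (rule that)
  then interpret Mittag_Leffler \<alpha> \<mu>
    by (intro Mittag_Leffler.intro \<alpha>)
  have "weak_solution \<alpha> M (\<lambda>t x. subordinated M (t, x :: 'a))"
    by (rule weak_solution_if_fractional_heat[OF L1_slices_subordinated[OF M] _ \<alpha> slice_subordinated_fractional_heat])
      (simp add: subordinated_def)
  then show ?thesis by blast
qed

theorem theorem1p4:
  fixes \<alpha> M :: real
  assumes "0 < \<alpha>" and "\<alpha> < 1" and "M > 0"
  shows "(\<exists>u :: real \<Rightarrow> real ^ 'd \<Rightarrow> real. weak_solution \<alpha> M u \<and>
            (\<forall>v. weak_solution \<alpha> M v \<longrightarrow>
               (AE (t, x) in lebesgue. 0 < t \<longrightarrow> v t x = u t x))) \<and>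
         (\<forall>U V. (\<forall>z>0. U z \<ge> 0) \<and> profile_solution CARD('d) \<alpha> U \<and> has_mass TYPE(real ^ 'd) M U \<and>
                (\<forall>z>0. V z \<ge> 0) \<and> profile_solution CARD('d) \<alpha> V \<and> has_mass TYPE(real ^ 'd) M V \<longrightarrow>
                (\<forall>z>0. U z = V z))"
proof (intro conjI allI impI)
  obtain u :: "real \<Rightarrow> real ^ 'd \<Rightarrow> real" where "weak_solution \<alpha> M u"
    using weak_solution_exists[OF assms(1,2), of M] assms(3) by auto
  then show "\<exists>u :: real \<Rightarrow> real ^ 'd \<Rightarrow> real. weak_solution \<alpha> M u \<and>
      (\<forall>v. weak_solution \<alpha> M v \<longrightarrow> (AE (t, x) in lebesgue. 0 < t \<longrightarrow> v t x = u t x))"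
    using weak_solution_unique[OF assms(1,2)] by blast
next
  fix U V :: "real \<Rightarrow> real" and z :: real
  assume UV: "(\<forall>z>0. U z \<ge> 0) \<and> profile_solution CARD('d) \<alpha> U \<and> has_mass TYPE(real ^ 'd) M U \<and>
    (\<forall>z>0. V z \<ge> 0) \<and> profile_solution CARD('d) \<alpha> V \<and> has_mass TYPE(real ^ 'd) M V" and z: "z > 0"
  let ?I = "\<lambda>W. LINT \<rho>:{0<..}|lebesgue. W \<rho> * \<rho> ^ (CARD('d) - 1)"
  define \<sigma> where "\<sigma> = sphere_measure (sphere (0 :: real ^ 'd) 1)"
  have int: "set_integrable lebesgue {0<..} (\<lambda>\<rho>. W \<rho> * \<rho> ^ (CARD('d) - 1))" and mass: "\<sigma> * ?I W = M"
    if "has_mass TYPE(real ^ 'd) M W" for W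
    using that by (simp_all add: has_mass_def \<sigma>_def)
  have UM: "has_mass TYPE(real ^ 'd) M U" and VM: "has_mass TYPE(real ^ 'd) M V" using UV by blast+
  \<comment> \<open>The mass equation with M > 0 already excludes the value 0, so the surface
    measure of the sphere need not be computed.\<close>
  have \<sigma>: "\<sigma> \<noteq> 0" using mass[OF UM] assms(3) by auto
  have eq: "?I V = ?I U" using mass[OF UM] mass[OF VM] \<sigma> by (metis mult_left_cancel)
  have "?I U \<ge> 0"
    unfolding set_lebesgue_integral_def using UV by (intro integral_nonneg_AE AE_I2) (auto simp: indicator_def)
  then have pos: "?I U > 0" using mass[OF UM] assms(3) by (cases "?I U = 0") auto
  show "U z = V z"
    by (rule profile_solution_unique[OF assms(1,2) _ pos _ _ int[OF UM] refl _ _ int[OF VM] eq z])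
      (use UV in auto)
qed

end
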